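(* Let $\mathfrak g=W(1,1)$ be the Witt algebra over an algebraically closed field $k$ of characteristic $p\ge 5$, and let $\lambda,\mu\in\mathbb F_p$ (all conditions on $\lambda,\mu$ below are read in $\mathbb F_p$). (a) For $p=5$, $$\operatorname{Ext}^1_{u(\mathfrak g)}(Z^+(\mu),Z^+(\lambda))\cong\begin{cases}k & \text{if } \lambda-\mu=2,3 \text{ or } \{\mu,\lambda\}=\{0\},\{4\},\{0,1\},\{0,4\},\{3,4\},\\ 0&\text{otherwise.}\end{cases}$$ (Here $\{\mu,\lambda\}$ is an unordered set, so e.g. $\{\mu,\lambda\}=\{0\}$ means $\mu=\lambda=0$.) (b) For $p\ge 7$, $\operatorname{Ext}^1_{u(\mathfrak g)}(Z^+(\mu),Z^+(\lambda))\cong k$ if (i) $\lambda-\mu=2,3,4$; or (ii) $(\mu,\lambda)=(0,0),(-1,-1),(-1,0),(0,-1),(0,1),(-2,-1),(-5,0)$ or $(-1,4)$; or (iii) $2\lambda^2-10\lambda+3=0$ and $\lambda-\mu=6$. Otherwise $\operatorname{Ext}^1_{u(\mathfrak g)}(Z^+(\mu),Z^+(\lambda))=0$.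
   Context: $W(1,1)$ is the $p$-dimensional restricted Lie algebra over $k$ with basis $\{e_i\mid -1\le i\le p-2\}$, bracket $[e_i,e_j]=(j-i)e_{i+j}$ (with $e_{i+j}:=0$ if $i+j\notin\{-1,\dots,p-2\}$) and $p$-mapping $e_i^{[p]}=\delta_{i0}e_i$. Put $\mathfrak b^+=\operatorname{span}(e_0,\dots,e_{p-2})$, $\mathfrak t=ke_0$, $\mathfrak n^+=\operatorname{span}(e_1,\dots,e_{p-2})$. For a restricted Lie algebra $\mathfrak h$, $u(\mathfrak h)=U(\mathfrak h)/(x^p-x^{[p]}: x\in\mathfrak h)$ is its restricted enveloping algebra. For $\lambda\in\mathbb F_p$, let $\lambda$ also denote the one-dimensional $u(\mathfrak b^+)$-module on which $e_0$ acts by $\lambda$ and $\mathfrak n^+$ acts by $0$; the Verma module is $Z^+(\lambda)=u(\mathfrak g)\otimes_{u(\mathfrak b^+)}\lambda$. It is $p$-dimensional. *)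

theory Defs
  imports "HOL-Computational_Algebra.Polynomial"
    "HOL-Algebra.Free_Abelian_Groups" "HOL-Algebra.Module" "HOL-Algebra.QuotRing"
begin

section \<open>Algebras, modules and quotients\<close>

text \<open>
  The base field is the type \<open>'k\<close>. The record \<^type>\<open>module\<close> (a ring together with a scalar
  multiplication) serves both for \<open>'k\<close>-algebras and for left modules over an arbitrary ring
  \<open>A\<close>; the library locale of the same name is not used, as it needs a commutative ring of
  scalars. In a record that is only a module the ring multiplication and unit are irrelevant.
\<close>

definition factor :: "('a, 'b) module \<Rightarrow> 'b set \<Rightarrow> ('a, 'b set) module" where
  "factor V I = ring.extend (V Quot I) (module.fields (\<lambda>c X. I <+>\<^bsub>V\<^esub> (\<lambda>x. c \<odot>\<^bsub>V\<^esub> x) ` X))"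

definition linear_iso :: "('k, 'v) module \<Rightarrow> ('k, 'w) module \<Rightarrow> bool" where
  "linear_iso V W \<longleftrightarrow> (\<exists>h. bij_betw h (carrier V) (carrier W) \<and>
     (\<forall>x\<in>carrier V. \<forall>y\<in>carrier V. h (x \<oplus>\<^bsub>V\<^esub> y) = h x \<oplus>\<^bsub>W\<^esub> h y) \<and>
     (\<forall>c. \<forall>x\<in>carrier V. h (c \<odot>\<^bsub>V\<^esub> x) = c \<odot>\<^bsub>W\<^esub> h x))"

definition base_field :: "('k::field, 'k) module" where
  "base_field = \<lparr>carrier = UNIV, mult = (*), one = 1, zero = 0, add = (+), smult = (*)\<rparr>"

section \<open>\<open>Ext\<^sup>1\<close> over an algebra\<close>

definition free_module :: "('k, 'a) module \<Rightarrow> 'x set \<Rightarrow> ('a, 'x \<Rightarrow> 'a) module" where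
  "free_module A X =
     \<lparr>carrier = {f. (\<forall>x\<in>X. f x \<in> carrier A) \<and> (\<forall>x. x \<notin> X \<longrightarrow> f x = \<zero>\<^bsub>A\<^esub>) \<and>
                    finite {x. f x \<noteq> \<zero>\<^bsub>A\<^esub>}},
      mult = undefined, one = undefined,
      zero = (\<lambda>_. \<zero>\<^bsub>A\<^esub>), add = (\<lambda>f g x. f x \<oplus>\<^bsub>A\<^esub> g x),
      smult = (\<lambda>a f x. a \<otimes>\<^bsub>A\<^esub> f x)\<rparr>"

text \<open>The \<open>A\<close>-linear map from a free module on a subset of \<open>M\<close> to \<open>M\<close> extending the inclusion.\<close>

definition free_eval :: "('k, 'a) module \<Rightarrow> ('a, 'm) module \<Rightarrow> ('m \<Rightarrow> 'a) \<Rightarrow> 'm" where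
  "free_eval A M f = finsum M (\<lambda>x. f x \<odot>\<^bsub>M\<^esub> x) {x. f x \<noteq> \<zero>\<^bsub>A\<^esub>}"

text \<open>Maps are \<open>undefined\<close> outside \<open>carrier M\<close>; \<open>c \<in> 'k\<close> acts on \<open>N\<close> as \<open>c \<cdot> 1 \<in> A\<close>.\<close>

definition Hom_module ::
  "('k, 'a) module \<Rightarrow> ('a, 'm) module \<Rightarrow> ('a, 'n) module \<Rightarrow> ('k, 'm \<Rightarrow> 'n) module" where
  "Hom_module A M N =
     \<lparr>carrier = {h \<in> carrier M \<rightarrow>\<^sub>E carrier N.
        (\<forall>x\<in>carrier M. \<forall>y\<in>carrier M. h (x \<oplus>\<^bsub>M\<^esub> y) = h x \<oplus>\<^bsub>N\<^esub> h y) \<and>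
        (\<forall>a\<in>carrier A. \<forall>x\<in>carrier M. h (a \<odot>\<^bsub>M\<^esub> x) = a \<odot>\<^bsub>N\<^esub> h x)},
      mult = undefined, one = undefined,
      zero = (\<lambda>x\<in>carrier M. \<zero>\<^bsub>N\<^esub>),
      add = (\<lambda>f g. \<lambda>x\<in>carrier M. f x \<oplus>\<^bsub>N\<^esub> g x),
      smult = (\<lambda>c f. \<lambda>x\<in>carrier M. (c \<odot>\<^bsub>A\<^esub> \<one>\<^bsub>A\<^esub>) \<odot>\<^bsub>N\<^esub> f x)\<rparr>"

text \<open>
  The canonical free resolution of \<open>M\<close> starts with
  \<open>P\<^sub>0 = A\<^bsup>(M)\<^esup>\<close>, \<open>P\<^sub>1 = A\<^bsup>(X\<^sub>1)\<^esup>\<close>, \<open>P\<^sub>2 = A\<^bsup>(X\<^sub>2)\<^esup>\<close>, where \<open>X\<^sub>1\<close> is the kernel of \<open>P\<^sub>0 \<rightarrow> M\<close> and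
  \<open>X\<^sub>2\<close> the kernel of \<open>P\<^sub>1 \<rightarrow> P\<^sub>0\<close>; all maps are \<^const>\<open>free_eval\<close>. \<open>Ext\<^sup>1(M, N)\<close> is the
  cohomology of \<open>Hom(P\<^sub>0, N) \<rightarrow> Hom(P\<^sub>1, N) \<rightarrow> Hom(P\<^sub>2, N)\<close> in the middle.
\<close>

definition Ext1 ::
  "('k, 'a) module \<Rightarrow> ('a, 'm) module \<Rightarrow> ('a, 'n) module
     \<Rightarrow> ('k, ((('m \<Rightarrow> 'a) \<Rightarrow> 'a) \<Rightarrow> 'n) set) module" where
  "Ext1 A M N =
     (let P0 = free_module A (carrier M);
          X1 = {f \<in> carrier P0. free_eval A M f = \<zero>\<^bsub>M\<^esub>};
          P1 = free_module A X1;
          d1 = free_eval A P0;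
          X2 = {f \<in> carrier P1. d1 f = \<zero>\<^bsub>P0\<^esub>};
          P2 = free_module A X2;
          d2 = free_eval A P1;
          Z = {h \<in> carrier (Hom_module A P1 N). \<forall>f\<in>carrier P2. h (d2 f) = \<zero>\<^bsub>N\<^esub>};
          B = (\<lambda>g. compose (carrier P1) g d1) ` carrier (Hom_module A P0 N)
      in factor ((Hom_module A P1 N)\<lparr>carrier := Z\<rparr>) B)"

section \<open>Extension of scalars\<close>

text \<open>
  \<open>A \<otimes>\<^sub>S M\<close> for a homomorphism \<open>\<phi> : S \<rightarrow> A\<close>: the free abelian group on \<open>A \<times> M\<close> modulo the
  biadditive \<open>S\<close>-balanced relations, with \<open>A\<close> acting on the left factor.
\<close>

definition tensor_relations ::
  "('k, 's) module \<Rightarrow> ('k, 'a) module \<Rightarrow> ('s \<Rightarrow> 'a) \<Rightarrow> ('s, 'm) module \<Rightarrow> ('a \<times> 'm \<Rightarrow>\<^sub>0 int) set" where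
  "tensor_relations S A \<phi> M =
     {frag_of (a \<oplus>\<^bsub>A\<^esub> b, m) - frag_of (a, m) - frag_of (b, m) | a b m.
        a \<in> carrier A \<and> b \<in> carrier A \<and> m \<in> carrier M} \<union>
     {frag_of (a, m \<oplus>\<^bsub>M\<^esub> n) - frag_of (a, m) - frag_of (a, n) | a m n.
        a \<in> carrier A \<and> m \<in> carrier M \<and> n \<in> carrier M} \<union>
     {frag_of (a \<otimes>\<^bsub>A\<^esub> \<phi> s, m) - frag_of (a, s \<odot>\<^bsub>M\<^esub> m) | a s m.
        a \<in> carrier A \<and> s \<in> carrier S \<and> m \<in> carrier M}"

definition extend_scalars ::
  "('k, 's) module \<Rightarrow> ('k, 'a) module \<Rightarrow> ('s \<Rightarrow> 'a) \<Rightarrow> ('s, 'm) module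
     \<Rightarrow> ('a, ('a \<times> 'm \<Rightarrow>\<^sub>0 int) set) module" where
  "extend_scalars S A \<phi> M =
     (let F = free_Abelian_group (carrier A \<times> carrier M)
      in factor
           \<lparr>carrier = carrier F, mult = undefined, one = undefined, zero = 0, add = (+),
            smult = (\<lambda>a. frag_extend (\<lambda>(b, m). frag_of (a \<otimes>\<^bsub>A\<^esub> b, m)))\<rparr>
           (generate F (tensor_relations S A \<phi> M)))"

section \<open>Restricted Lie algebras\<close>

text \<open>
  The carrier is a subspace of an ambient vector space on the type \<open>'g\<close>, so that a subalgebra
  is obtained by changing the carrier only.
\<close>

record ('k, 'g) restricted_lie = "'g partial_object" +
  lie_scale :: "'k \<Rightarrow> 'g \<Rightarrow> 'g"
  bracket :: "'g \<Rightarrow> 'g \<Rightarrow> 'g"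
  p_map :: "'g \<Rightarrow> 'g"

text \<open>The coefficient of \<open>T\<^sup>j\<close> in \<open>(ad (T x + y))\<^sup>n (x)\<close>, for an indeterminate \<open>T\<close>.\<close>

primrec ad_coeff ::
  "('k, 'g::ab_group_add) restricted_lie \<Rightarrow> 'g \<Rightarrow> 'g \<Rightarrow> nat \<Rightarrow> nat \<Rightarrow> 'g" where
  "ad_coeff L x y 0 = (\<lambda>j. if j = 0 then x else 0)"
| "ad_coeff L x y (Suc n) = (\<lambda>j. (if j = 0 then 0 else bracket L x (ad_coeff L x y n (j - 1)))
                                  + bracket L y (ad_coeff L x y n j))"

text \<open>Jacobson's \<open>s\<^sub>i(x, y)\<close>: \<open>i s\<^sub>i(x, y)\<close> is the coefficient of \<open>T\<^bsup>i-1\<^esup>\<close> in \<open>(ad (T x + y))\<^bsup>p-1\<^esup> (x)\<close>.\<close>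

definition jacobson_s ::
  "('k::field, 'g::ab_group_add) restricted_lie \<Rightarrow> nat \<Rightarrow> 'g \<Rightarrow> 'g \<Rightarrow> 'g" where
  "jacobson_s L i x y =
     lie_scale L (inverse (of_nat i)) (ad_coeff L x y (CHAR('k) - 1) (i - 1))"

locale restricted_lie_algebra =
  fixes L :: "('k::field, 'g::ab_group_add) restricted_lie"
  assumes pos_char: "CHAR('k) > 0"
    and vector_space: "vector_space (lie_scale L)"
    and subspace: "module.subspace (lie_scale L) (carrier L)"
    and bracket_closed: "\<lbrakk>x \<in> carrier L; y \<in> carrier L\<rbrakk> \<Longrightarrow> bracket L x y \<in> carrier L"
    and bracket_add_left: "\<lbrakk>x \<in> carrier L; y \<in> carrier L; z \<in> carrier L\<rbrakk>
      \<Longrightarrow> bracket L (x + y) z = bracket L x z + bracket L y z"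
    and bracket_add_right: "\<lbrakk>x \<in> carrier L; y \<in> carrier L; z \<in> carrier L\<rbrakk>
      \<Longrightarrow> bracket L x (y + z) = bracket L x y + bracket L x z"
    and bracket_scale_left: "\<lbrakk>x \<in> carrier L; y \<in> carrier L\<rbrakk>
      \<Longrightarrow> bracket L (lie_scale L c x) y = lie_scale L c (bracket L x y)"
    and bracket_scale_right: "\<lbrakk>x \<in> carrier L; y \<in> carrier L\<rbrakk>
      \<Longrightarrow> bracket L x (lie_scale L c y) = lie_scale L c (bracket L x y)"
    and bracket_self: "x \<in> carrier L \<Longrightarrow> bracket L x x = 0"
    and jacobi: "\<lbrakk>x \<in> carrier L; y \<in> carrier L; z \<in> carrier L\<rbrakk>
      \<Longrightarrow> bracket L x (bracket L y z) + bracket L y (bracket L z x) + bracket L z (bracket L x y) = 0"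
    and p_map_closed: "x \<in> carrier L \<Longrightarrow> p_map L x \<in> carrier L"
    and ad_p_map: "\<lbrakk>x \<in> carrier L; y \<in> carrier L\<rbrakk>
      \<Longrightarrow> bracket L (p_map L x) y = (bracket L x ^^ CHAR('k)) y"
    and p_map_scale: "x \<in> carrier L
      \<Longrightarrow> p_map L (lie_scale L c x) = lie_scale L (c ^ CHAR('k)) (p_map L x)"
    and p_map_add: "\<lbrakk>x \<in> carrier L; y \<in> carrier L\<rbrakk>
      \<Longrightarrow> p_map L (x + y) = p_map L x + p_map L y + (\<Sum>i = 1..<CHAR('k). jacobson_s L i x y)"

section \<open>Restricted enveloping algebras\<close>

text \<open>The free associative algebra on a set \<open>X\<close>: finitely supported functions on words over \<open>X\<close>.\<close>

definition free_algebra :: "'x set \<Rightarrow> ('k::field, 'x list \<Rightarrow> 'k) module" where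
  "free_algebra X =
     \<lparr>carrier = {f. finite {w. f w \<noteq> 0} \<and> (\<forall>w. f w \<noteq> 0 \<longrightarrow> set w \<subseteq> X)},
      mult = (\<lambda>f g w. \<Sum>i\<le>length w. f (take i w) * g (drop i w)),
      one = (\<lambda>w. if w = [] then 1 else 0),
      zero = (\<lambda>_. 0), add = (\<lambda>f g w. f w + g w), smult = (\<lambda>c f w. c * f w)\<rparr>"

definition gen :: "'x \<Rightarrow> 'x list \<Rightarrow> 'k::field" where
  "gen x = (\<lambda>w. if w = [x] then 1 else 0)"

definition U_ideal :: "('k::field, 'g::ab_group_add) restricted_lie \<Rightarrow> ('g list \<Rightarrow> 'k) set" where
  "U_ideal L =
     (let T = free_algebra (carrier L)
      in Idl\<^bsub>T\<^esub>
          ({gen (x + y) \<ominus>\<^bsub>T\<^esub> (gen x \<oplus>\<^bsub>T\<^esub> gen y) | x y. x \<in> carrier L \<and> y \<in> carrier L} \<union>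
           {gen (lie_scale L c x) \<ominus>\<^bsub>T\<^esub> c \<odot>\<^bsub>T\<^esub> gen x | c x. x \<in> carrier L} \<union>
           {(gen x \<otimes>\<^bsub>T\<^esub> gen y \<ominus>\<^bsub>T\<^esub> gen y \<otimes>\<^bsub>T\<^esub> gen x) \<ominus>\<^bsub>T\<^esub> gen (bracket L x y) | x y.
              x \<in> carrier L \<and> y \<in> carrier L}))"

definition U_alg :: "('k::field, 'g::ab_group_add) restricted_lie \<Rightarrow> ('k, ('g list \<Rightarrow> 'k) set) module" where
  "U_alg L = factor (free_algebra (carrier L)) (U_ideal L)"

definition U_gen :: "('k::field, 'g::ab_group_add) restricted_lie \<Rightarrow> 'g \<Rightarrow> ('g list \<Rightarrow> 'k) set" where
  "U_gen L x = U_ideal L +>\<^bsub>free_algebra (carrier L)\<^esub> gen x"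

definition u_ideal :: "('k::field, 'g::ab_group_add) restricted_lie \<Rightarrow> ('g list \<Rightarrow> 'k) set set" where
  "u_ideal L = Idl\<^bsub>U_alg L\<^esub>
     {U_gen L x [^]\<^bsub>U_alg L\<^esub> CHAR('k) \<ominus>\<^bsub>U_alg L\<^esub> U_gen L (p_map L x) | x. x \<in> carrier L}"

definition u_alg ::
  "('k::field, 'g::ab_group_add) restricted_lie \<Rightarrow> ('k, ('g list \<Rightarrow> 'k) set set) module" where
  "u_alg L = factor (U_alg L) (u_ideal L)"

text \<open>
  The homomorphism \<open>u(H) \<rightarrow> u(L)\<close> for a restricted subalgebra \<open>H\<close> of \<open>L\<close>, induced by the
  inclusion: a coset \<open>X\<close> of \<open>U_ideal H\<close> is sent to the coset of \<open>U_ideal L\<close> containing it, and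
  likewise in the second quotient.
\<close>

definition u_incl ::
  "('k::field, 'g::ab_group_add) restricted_lie \<Rightarrow> ('g list \<Rightarrow> 'k) set set \<Rightarrow> ('g list \<Rightarrow> 'k) set set" where
  "u_incl L Y =
     u_ideal L <+>\<^bsub>U_alg L\<^esub> (\<lambda>X. U_ideal L <+>\<^bsub>free_algebra (carrier L)\<^esub> X) ` Y"

text \<open>
  The one-dimensional \<open>u(L)\<close>-module \<open>'k\<close> on which each \<open>x\<close> acts by the scalar \<open>\<chi> x\<close>, for a
  character \<open>\<chi>\<close> with \<open>(\<chi> x)\<^sup>p = \<chi> (x\<^bsup>[p]\<^esup>)\<close>. An element of \<open>u(L)\<close> is a set of sets of elements
  of the free algebra, and acts by the common value of \<^term>\<open>word_eval \<chi>\<close> on them.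
\<close>

definition word_eval :: "('x \<Rightarrow> 'k::field) \<Rightarrow> ('x list \<Rightarrow> 'k) \<Rightarrow> 'k" where
  "word_eval \<chi> f = (\<Sum>w | f w \<noteq> 0. f w * prod_list (map \<chi> w))"

definition character_module :: "('g \<Rightarrow> 'k::field) \<Rightarrow> (('g list \<Rightarrow> 'k) set set, 'k) module" where
  "character_module \<chi> =
     \<lparr>carrier = UNIV, mult = (*), one = 1, zero = 0, add = (+),
      smult = (\<lambda>Y v. the_elem (word_eval \<chi> ` \<Union>Y) * v)\<rparr>"

section \<open>The Witt algebra \<open>W(1,1)\<close> and its Verma modules\<close>

definition witt_range :: "'k::field itself \<Rightarrow> int set" where
  "witt_range _ = {-1..int CHAR('k) - 2}"

text \<open>The basis vector \<open>e\<^sub>i\<close>; an element \<open>x\<close> has \<open>e\<^sub>i\<close>-coordinate \<^term>\<open>Poly_Mapping.lookup x i\<close>.\<close>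

definition witt_e :: "int \<Rightarrow> (int \<Rightarrow>\<^sub>0 'k::field)" where
  "witt_e i = Poly_Mapping.single i 1"

definition witt_bracket :: "(int \<Rightarrow>\<^sub>0 'k::field) \<Rightarrow> (int \<Rightarrow>\<^sub>0 'k) \<Rightarrow> (int \<Rightarrow>\<^sub>0 'k)" where
  "witt_bracket x y =
     (\<Sum>i\<in>witt_range TYPE('k). \<Sum>j\<in>witt_range TYPE('k).
        if i + j \<in> witt_range TYPE('k)
        then Poly_Mapping.single (i + j)
               (of_int (j - i) * (Poly_Mapping.lookup x i * Poly_Mapping.lookup y j))
        else 0)"

definition witt :: "((int \<Rightarrow>\<^sub>0 'k::field) \<Rightarrow> (int \<Rightarrow>\<^sub>0 'k)) \<Rightarrow> ('k, int \<Rightarrow>\<^sub>0 'k) restricted_lie" where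
  "witt pm =
     \<lparr>carrier = {x. Poly_Mapping.keys x \<subseteq> witt_range TYPE('k)},
      lie_scale = (\<lambda>c. Poly_Mapping.map ((*) c)),
      bracket = witt_bracket,
      p_map = pm\<rparr>"

text \<open>
  By Jacobson's theorem, and since the centre of \<open>W(1,1)\<close> is trivial, there is exactly one
  \<open>p\<close>-mapping on \<open>W(1,1)\<close> with the prescribed values on the basis.
\<close>

definition is_witt_p_map :: "((int \<Rightarrow>\<^sub>0 'k::field) \<Rightarrow> (int \<Rightarrow>\<^sub>0 'k)) \<Rightarrow> bool" where
  "is_witt_p_map pm \<longleftrightarrow> restricted_lie_algebra (witt pm) \<and>
     (\<forall>i\<in>witt_range TYPE('k). pm (witt_e i) = (if i = 0 then witt_e i else 0))"

definition witt_borel :: "((int \<Rightarrow>\<^sub>0 'k::field) \<Rightarrow> (int \<Rightarrow>\<^sub>0 'k)) \<Rightarrow> ('k, int \<Rightarrow>\<^sub>0 'k) restricted_lie" where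
  "witt_borel pm =
     (witt pm)\<lparr>carrier := {x. Poly_Mapping.keys x \<subseteq> {0..int CHAR('k) - 2}}\<rparr>"

text \<open>
  The weight \<open>l\<close> is an element of the prime field inside \<open>'k\<close>, which is the image \<open>\<int>\<close> of the integers.
\<close>

definition verma ::
  "((int \<Rightarrow>\<^sub>0 'k::field) \<Rightarrow> (int \<Rightarrow>\<^sub>0 'k)) \<Rightarrow> 'k \<Rightarrow>
   (((int \<Rightarrow>\<^sub>0 'k) list \<Rightarrow> 'k) set set,
    (((int \<Rightarrow>\<^sub>0 'k) list \<Rightarrow> 'k) set set \<times> 'k \<Rightarrow>\<^sub>0 int) set) module" where
  "verma pm l =
     extend_scalars (u_alg (witt_borel pm)) (u_alg (witt pm)) (u_incl (witt pm))
       (character_module (\<lambda>x. l * Poly_Mapping.lookup x 0))"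

end

theory Submission
  imports Defs "HOL-Computational_Algebra.Formal_Power_Series" "HOL-Library.Function_Algebras"
begin

text \<open>
  The Verma module \<open>Z\<^sup>+(\<mu>)\<close> is generated by one vector \<open>v\<close>. For every
  cyclic module \<open>A v\<close> the group \<open>Ext\<^sup>1(A v, N)\<close> is the space of \<open>A\<close>-linear maps from the annihilator
  of \<open>v\<close> to \<open>N\<close>, modulo the inner maps \<open>a \<mapsto> a n\<close> (\<open>Ext1_trivial\<close>, \<open>Ext1_one_dimensional\<close>).

  The Verma module \<open>Z\<^sup>+(\<lambda>)\<close> is isomorphic to the module of densities with basis
  \<open>u\<^sub>0, \<dots>, u\<^sub>p\<^sub>-\<^sub>1\<close> and action \<open>e\<^sub>j u\<^sub>n = (n + (j + 1) s) u\<^sub>n\<^sub>+\<^sub>j\<close>, where \<open>s = \<lambda> + 1\<close>; the top vector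
  \<open>u\<^sub>p\<^sub>-\<^sub>1\<close> is the highest weight vector. The comparison map exists by the universal property of the
  Verma module. It is bijective because modulo the annihilator of \<open>v\<close> every element of \<open>u(W)\<close> is a
  polynomial of degree less than \<open>p\<close> in \<open>e\<^sub>-\<^sub>1\<close>, and the powers of \<open>e\<^sub>-\<^sub>1\<close> lower \<open>u\<^sub>p\<^sub>-\<^sub>1\<close> through the
  whole basis (\<open>span_modulo_left_ideal\<close>, \<open>lowering_top\<close>).

  The annihilator of \<open>v\<close> is generated by \<open>e\<^sub>0 - \<mu>\<close> and the \<open>e\<^sub>j\<close> with \<open>j \<ge> 1\<close>. Subtracting
  an inner map makes a homomorphism vanish on \<open>e\<^sub>0 - \<mu>\<close>; then it sends \<open>e\<^sub>j\<close> to a vector of weight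
  \<open>\<mu> + j\<close>, that is, to a multiple \<open>c\<^sub>j\<close> of one basis vector. Let \<open>m < p\<close> represent \<open>\<lambda> - \<mu>\<close>. The
  brackets \<open>[e\<^sub>i, e\<^sub>j]\<close> become linear equations for \<open>c\<close> with coefficients in \<open>m\<close> and \<open>s\<close>
  (\<open>cocycle\<close>), and the inner maps that remain form an explicit line or zero (\<open>inner_iff\<close>).
  Conversely, a solution defines a module structure on the sum of the two density modules
  (\<open>extension_setup\<close>). The relations \<open>e\<^sub>j\<^sup>p = 0\<close> add a condition only for \<open>j = 1\<close> and \<open>m = 0\<close>
  (\<open>raising_product_zero\<close>, \<open>cocycle_realized\<close>).

  Since \<open>e\<^sub>1\<close> and \<open>e\<^sub>2\<close> generate, \<open>c\<^sub>1\<close> and \<open>c\<^sub>2\<close> determine \<open>c\<close>. For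
  \<open>m \<ge> 2\<close> all \<open>c\<^sub>n\<close> with \<open>n > m\<close> vanish, so only the equations of degree at most \<open>m\<close> matter. Those of
  degree at most four merely define \<open>c\<^sub>3\<close> and \<open>c\<^sub>4\<close>; in degree five the two expressions for
  \<open>c\<^sub>5\<close> agree, for a solution that is not inner, only if \<open>m\<^sup>2 - 4 m s - m + 4 s\<^sup>2 - 4 s = 0\<close>. This produces
  \<open>\<lambda> - \<mu> = 2, 3, 4\<close>, the two exceptions for \<open>m = 5\<close> and the quadratic condition for \<open>m = 6\<close>; in
  degree seven a second such condition contradicts the first one. The remaining exceptions come
  from \<open>m = 0\<close>, \<open>m = 1\<close> and \<open>m = p - 1\<close>, where the shape of the equations changes, and from the
  truncation \<open>c\<^sub>n = 0\<close> for \<open>n \<ge> p - 1\<close>. The outcome is \<open>classification\<close>.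
\<close>

section \<open>Powers of commutators in characteristic \<open>p\<close>\<close>

text \<open>Left and right multiplication by \<open>u\<close> commute, so powers of their difference expand by the
  binomial theorem.\<close>

lemma commutator_power_expansion:
  fixes u z :: "'r::ring_1"
  shows "((\<lambda>z. u * z - z * u) ^^ n) z
    = (\<Sum>a\<le>n. of_int ((-1) ^ (n + a) * int (n choose a)) * (u ^ a * z * u ^ (n - a)))"
proof (induction n)
  case 0
  show ?case by simp
next
  case (Suc n)
  define t where "t a = u ^ a * z * u ^ (Suc n - a)" for a
  define k where "k n a = (of_int ((-1) ^ (n + a) * int (n choose a)) :: 'r)" for n a
  have comm: "u * (k n a * x) = k n a * (u * x)" for a x
    unfolding k_def by (metis mult.assoc mult_of_int_commute)
  have k_Suc: "k (Suc n) (Suc a) = k n a - k n (Suc a)" for a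
    by (simp add: k_def algebra_simps flip: of_int_diff)
  have "((\<lambda>z. u * z - z * u) ^^ Suc n) z
      = (\<Sum>a\<le>n. k n a * t (Suc a)) - (\<Sum>a\<le>n. k n a * t a)"
  proof -
    have "u * (\<Sum>a\<le>n. k n a * (u ^ a * z * u ^ (n - a))) = (\<Sum>a\<le>n. k n a * t (Suc a))"
      unfolding sum_distrib_left comm t_def by (simp add: mult.assoc)
    moreover have "(\<Sum>a\<le>n. k n a * (u ^ a * z * u ^ (n - a))) * u = (\<Sum>a\<le>n. k n a * t a)"
      unfolding sum_distrib_right t_def
      by (intro sum.cong refl) (simp add: mult.assoc Suc_diff_le power_commutes)
    ultimately show ?thesis using Suc unfolding k_def by simp
  qed
  also have "(\<Sum>a\<le>n. k n a * t a) = (\<Sum>a\<le>Suc n. k n a * t a)"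
    by (simp add: k_def binomial_eq_0)
  also have "\<dots> = k n 0 * t 0 + (\<Sum>a\<le>n. k n (Suc a) * t (Suc a))"
    by (rule sum.atMost_Suc_shift)
  also have "(\<Sum>a\<le>n. k n a * t (Suc a)) - \<dots> = k (Suc n) 0 * t 0 + (\<Sum>a\<le>n. k (Suc n) (Suc a) * t (Suc a))"
    by (simp add: k_Suc left_diff_distrib sum_subtractf) (simp add: k_def algebra_simps)
  also have "\<dots> = (\<Sum>a\<le>Suc n. k (Suc n) a * t a)"
    by (rule sum.atMost_Suc_shift[symmetric])
  finally show ?case by (simp add: k_def t_def)
qed

lemma commutator_power_prime:
  fixes u z :: "'r::ring_1"
  assumes p: "prime p" and char: "of_nat p = (0 :: 'r)"
  shows "((\<lambda>z. u * z - z * u) ^^ p) z = u ^ p * z - z * u ^ p"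
proof -
  have zero: "of_int ((-1) ^ (p + a) * int (p choose a)) = (0 :: 'r)" if "0 < a" "a < p" for a
  proof -
    from that p have "p dvd (p choose a)" by (intro dvd_choose_prime) auto
    then obtain q where "p choose a = p * q" ..
    with char show ?thesis by simp
  qed
  have "((\<lambda>z. u * z - z * u) ^^ p) z
      = (\<Sum>a\<in>{0, p}. of_int ((-1) ^ (p + a) * int (p choose a)) * (u ^ a * z * u ^ (p - a)))"
    unfolding commutator_power_expansion using zero
    by (intro sum.mono_neutral_right) (auto simp: le_less)
  also have "\<dots> = of_int ((-1) ^ p) * (z * u ^ p) + u ^ p * z"
    using prime_gt_0_nat[OF p] by simp
  also have "of_int ((-1) ^ p) = (- 1 :: 'r)"
  proof (cases "p = 2")
    case True
    with char have "(1 :: 'r) + 1 = 0" by simp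
    with True show ?thesis by (simp add: eq_neg_iff_add_eq_0)
  next
    case False
    with p have "odd p" using primes_dvd_imp_eq two_is_prime_nat by blast
    then show ?thesis by simp
  qed
  finally show ?thesis by simp
qed

text \<open>Modulo \<open>p\<close> the binomial coefficients of \<open>p - 1\<close> are \<open>\<plusminus>1\<close>, and the signs cancel those of
  the expansion. The right-hand side is the noncommutative derivative of \<open>u\<^sup>p\<close> in direction \<open>z\<close>.\<close>

lemma commutator_power_prime_pred:
  fixes u z :: "'r::ring_1"
  assumes p: "prime p" and char: "of_nat p = (0 :: 'r)"
  shows "((\<lambda>z. u * z - z * u) ^^ (p - 1)) z = (\<Sum>a<p. u ^ a * z * u ^ (p - 1 - a))"
proof -
  obtain q where q: "p = Suc q" using prime_gt_0_nat[OF p] gr0_implies_Suc by blast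
  define k where "k a = (of_int ((-1) ^ (q + a) * int (q choose a)) :: 'r)" for a
  have "k a = 1" if "a \<le> q" for a
    using that
  proof (induction "q - a" arbitrary: a)
    case 0
    then show ?case by (simp add: k_def)
  next
    case (Suc d)
    have "p dvd (p choose Suc a)" using Suc q p by (intro dvd_choose_prime) auto
    then obtain r where "p choose Suc a = p * r" ..
    with char have "of_nat (p choose Suc a) = (0 :: 'r)" by simp
    then have "of_nat (q choose a) = - (of_nat (q choose Suc a) :: 'r)"
      by (simp add: q eq_neg_iff_add_eq_0)
    then have "k a = k (Suc a)" by (simp add: k_def)
    with Suc show ?case by simp
  qed
  then show ?thesis
    unfolding commutator_power_expansion q lessThan_Suc_atMost
    by (intro sum.cong) (auto simp: k_def)
qed

lemma fps_deriv_power_noncommuting: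
  fixes u :: "'r::ring_1 fps"
  shows "fps_deriv (u ^ n) = (\<Sum>a<n. u ^ a * fps_deriv u * u ^ (n - 1 - a))"
proof (induction n)
  case 0
  show ?case by simp
next
  case (Suc n)
  have "fps_deriv (u ^ Suc n) = u ^ n * fps_deriv u + fps_deriv (u ^ n) * u"
    by (simp only: power_Suc2 fps_deriv_mult)
  also have "fps_deriv (u ^ n) * u = (\<Sum>a<n. u ^ a * fps_deriv u * u ^ (n - a))"
    unfolding Suc sum_distrib_right
  proof (intro sum.cong refl)
    fix a assume "a \<in> {..<n}"
    then have "n - a = Suc (n - 1 - a)" by auto
    then show "u ^ a * fps_deriv u * u ^ (n - 1 - a) * u = u ^ a * fps_deriv u * u ^ (n - a)"
      by (simp only: mult.assoc power_Suc2)
  qed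
  finally show ?case by (simp add: add.commute)
qed

section \<open>Representations and the \<open>p\<close>-map\<close>

text \<open>Makes a type-class ring an algebra over the field, so that operator rings and the field itself
  can serve as targets of representations.\<close>

locale algebra_map =
  fixes \<kappa> :: "'k::field \<Rightarrow> 'r::ring_1"
  assumes map_one: "\<kappa> 1 = 1"
    and map_add: "\<kappa> (c + d) = \<kappa> c + \<kappa> d"
    and map_mult: "\<kappa> (c * d) = \<kappa> c * \<kappa> d"
    and central: "\<kappa> c * r = r * \<kappa> c"
begin

lemma map_zero: "\<kappa> 0 = 0"
  using map_add[of 0 0] by simp

lemma map_of_nat: "\<kappa> (of_nat n) = of_nat n"
  by (induction n) (simp_all add: map_zero map_one map_add)

lemma power_scale: "(\<kappa> c * r) ^ n = \<kappa> (c ^ n) * r ^ n"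
proof (induction n)
  case 0
  show ?case by (simp add: map_one)
next
  case (Suc n)
  have "(\<kappa> c * r) ^ Suc n = \<kappa> c * (r * \<kappa> (c ^ n)) * r ^ n"
    by (simp add: Suc mult.assoc)
  also have "r * \<kappa> (c ^ n) = \<kappa> (c ^ n) * r" by (rule central[symmetric])
  finally show ?case by (simp add: map_mult mult.assoc)
qed

lemma of_nat_CHAR_zero: "of_nat CHAR('k) = (0 :: 'r)"
  using map_of_nat[of "CHAR('k)"] by (simp add: map_zero)

end

text \<open>The subspace \<open>B\<close> need not be closed under the \<open>p\<close>-map: closure is a consequence of being closed on a
  basis, and is obtained together with the compatibility of \<open>\<rho>\<close>.\<close>

locale subalgebra_rep = restricted_lie_algebra L + algebra_map \<kappa>
  for L :: "('k::field, 'g::ab_group_add) restricted_lie" and \<kappa> :: "'k \<Rightarrow> 'r::ring_1" +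
  fixes B :: "'g set" and \<rho> :: "'g \<Rightarrow> 'r"
  assumes sub: "B \<subseteq> carrier L"
    and zero_in: "0 \<in> B"
    and add_in: "\<lbrakk>x \<in> B; y \<in> B\<rbrakk> \<Longrightarrow> x + y \<in> B"
    and scale_in: "x \<in> B \<Longrightarrow> lie_scale L c x \<in> B"
    and bracket_in: "\<lbrakk>x \<in> B; y \<in> B\<rbrakk> \<Longrightarrow> bracket L x y \<in> B"
    and rep_add: "\<lbrakk>x \<in> B; y \<in> B\<rbrakk> \<Longrightarrow> \<rho> (x + y) = \<rho> x + \<rho> y"
    and rep_scale: "x \<in> B \<Longrightarrow> \<rho> (lie_scale L c x) = \<kappa> c * \<rho> x"
    and rep_bracket: "\<lbrakk>x \<in> B; y \<in> B\<rbrakk> \<Longrightarrow> \<rho> (bracket L x y) = \<rho> x * \<rho> y - \<rho> y * \<rho> x"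
begin

definition p_compatible :: "'g \<Rightarrow> bool" where
  "p_compatible x \<longleftrightarrow> x \<in> B \<and> p_map L x \<in> B \<and> \<rho> x ^ CHAR('k) = \<rho> (p_map L x)"

lemma rep_zero: "\<rho> 0 = 0"
  using rep_add[OF zero_in zero_in] by simp

lemma prime_char: "prime CHAR('k)"
  using pos_char by (simp add: prime_CHAR_semidom)

lemma ad_coeff_in: "\<lbrakk>x \<in> B; y \<in> B\<rbrakk> \<Longrightarrow> ad_coeff L x y n j \<in> B"
  by (induction n arbitrary: j) (auto simp: zero_in intro!: add_in bracket_in)

lemma jacobson_s_in: "\<lbrakk>x \<in> B; y \<in> B\<rbrakk> \<Longrightarrow> jacobson_s L i x y \<in> B"
  by (simp add: jacobson_s_def scale_in ad_coeff_in)

lemma sum_in: "(\<And>i. i \<in> I \<Longrightarrow> f i \<in> B) \<Longrightarrow> sum f I \<in> B"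
  by (induction I rule: infinite_finite_induct) (auto simp: zero_in add_in)

lemma rep_sum: "(\<And>i. i \<in> I \<Longrightarrow> f i \<in> B) \<Longrightarrow> \<rho> (sum f I) = (\<Sum>i\<in>I. \<rho> (f i))"
  by (induction I rule: infinite_finite_induct) (auto simp: rep_zero rep_add sum_in)

text \<open>Jacobson's formula for \<open>\<rho>\<close>: the \<open>p\<close>-th power of \<open>\<rho> y + T \<rho> x\<close> is a polynomial in the
  indeterminate \<open>T\<close>; its outer coefficients are the two pure powers and its inner ones are the
  images of \<open>s\<^sub>i\<close>, as one sees by differentiating. Evaluation at \<open>T = 1\<close> gives the formula.\<close>

lemma rep_jacobson:
  includes fps_syntax
  assumes x: "x \<in> B" and y: "y \<in> B"
  shows "(\<rho> x + \<rho> y) ^ CHAR('k)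
    = \<rho> x ^ CHAR('k) + \<rho> y ^ CHAR('k) + (\<Sum>i = 1..<CHAR('k). \<rho> (jacobson_s L i x y))"
proof -
  let ?p = "CHAR('k)"
  define u :: "'r fps" where "u = fps_const (\<rho> y) + fps_X * fps_const (\<rho> x)"
  have char: "of_nat ?p = (0 :: 'r fps)"
    using of_nat_CHAR_zero by (metis fps_const_0_eq_0 fps_of_nat)
  have left: "(u * z) $ j = \<rho> y * z $ j + (if j = 0 then 0 else \<rho> x * z $ (j - 1))" for z j
    by (simp add: u_def distrib_right mult.assoc)
  have right: "(z * u) $ j = z $ j * \<rho> y + (if j = 0 then 0 else z $ (j - 1) * \<rho> x)" for z j
  proof -
    have "z * u = z * fps_const (\<rho> y) + fps_X * (z * fps_const (\<rho> x))"
      by (simp add: u_def distrib_left flip: mult.assoc) (simp add: fps_mult_fps_X_commute)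
    then show ?thesis by simp
  qed
  have ad: "((\<lambda>z. u * z - z * u) ^^ n) (fps_const (\<rho> x)) $ j = \<rho> (ad_coeff L x y n j)" for n j
  proof (induction n arbitrary: j)
    case 0
    show ?case by (simp add: rep_zero)
  next
    case (Suc n)
    then show ?case
      by (simp add: left right rep_add rep_bracket rep_zero zero_in bracket_in ad_coeff_in x y
          algebra_simps)
  qed
  \<comment> \<open>Differentiating in the indeterminate turns powers into iterated commutators.\<close>
  have deriv: "of_nat (Suc i) * (u ^ ?p) $ Suc i = \<rho> (ad_coeff L x y (?p - 1) i)" for i
  proof -
    have "fps_deriv u = fps_const (\<rho> x)" by (simp add: u_def)
    then have "fps_deriv (u ^ ?p) = ((\<lambda>z. u * z - z * u) ^^ (?p - 1)) (fps_const (\<rho> x))"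
      by (simp only: fps_deriv_power_noncommuting commutator_power_prime_pred[OF prime_char char])
    then show ?thesis using ad[of "?p - 1" i] by (metis fps_deriv_nth Suc_eq_plus1)
  qed
  have mid: "(u ^ ?p) $ i = \<rho> (jacobson_s L i x y)" if i: "i \<in> {1..<?p}" for i
  proof -
    have nz: "of_nat i \<noteq> (0 :: 'k)"
      using i by (auto simp: of_nat_eq_0_iff_char_dvd dest: dvd_imp_le)
    have "\<kappa> (inverse (of_nat i)) * (of_nat i * (u ^ ?p) $ i) = \<rho> (jacobson_s L i x y)"
      using deriv[of "i - 1"] i by (simp add: jacobson_s_def rep_scale ad_coeff_in x y del: of_nat_Suc)
    moreover have "\<kappa> (inverse (of_nat i)) * of_nat i = \<kappa> (inverse (of_nat i) * of_nat i)"
      by (simp add: map_mult map_of_nat)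
    ultimately show ?thesis using nz by (simp add: map_one flip: mult.assoc)
  qed
  have bounds: "(u ^ n) $ 0 = \<rho> y ^ n \<and> (u ^ n) $ n = \<rho> x ^ n \<and> (\<forall>i>n. (u ^ n) $ i = 0)
      \<and> (\<Sum>i\<le>n. (u ^ n) $ i) = (\<rho> x + \<rho> y) ^ n" for n
  proof (induction n)
    case 0
    show ?case by simp
  next
    case (Suc n)
    have "(\<Sum>i\<le>Suc n. (u ^ Suc n) $ i)
        = (\<Sum>i\<le>Suc n. \<rho> y * (u ^ n) $ i) + (\<Sum>i\<le>Suc n. if i = 0 then 0 else \<rho> x * (u ^ n) $ (i - 1))"
      by (simp only: power_Suc left sum.distrib)
    also have "(\<Sum>i\<le>Suc n. if i = 0 then 0 else \<rho> x * (u ^ n) $ (i - 1)) = (\<Sum>i\<le>n. \<rho> x * (u ^ n) $ i)"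
      by (subst sum.atMost_Suc_shift) simp
    also have "(\<Sum>i\<le>Suc n. \<rho> y * (u ^ n) $ i) = (\<Sum>i\<le>n. \<rho> y * (u ^ n) $ i)"
      using Suc by simp
    finally have "(\<Sum>i\<le>Suc n. (u ^ Suc n) $ i) = (\<rho> x + \<rho> y) ^ Suc n"
      using Suc by (simp add: algebra_simps flip: sum_distrib_left)
    moreover have "u $ 0 = \<rho> y" by (simp add: u_def)
    ultimately show ?case using Suc by (auto simp: left)
  qed
  have "{..?p} = insert 0 (insert ?p {1..<?p})" using pos_char by auto
  then have "(\<Sum>i\<le>?p. (u ^ ?p) $ i) = \<rho> y ^ ?p + (\<rho> x ^ ?p + (\<Sum>i = 1..<?p. (u ^ ?p) $ i))"
    using bounds[of ?p] pos_char by simp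
  also have "(\<Sum>i = 1..<?p. (u ^ ?p) $ i) = (\<Sum>i = 1..<?p. \<rho> (jacobson_s L i x y))"
    using mid by (intro sum.cong) auto
  finally show ?thesis using bounds[of ?p] by (simp add: algebra_simps)
qed

lemma p_compatible_add:
  assumes "p_compatible x" "p_compatible y"
  shows "p_compatible (x + y)"
proof -
  have x: "x \<in> B" "p_map L x \<in> B" and y: "y \<in> B" "p_map L y \<in> B"
    using assms by (auto simp: p_compatible_def)
  have eq: "p_map L (x + y) = p_map L x + p_map L y + (\<Sum>i = 1..<CHAR('k). jacobson_s L i x y)"
    using p_map_add x y sub by blast
  have s: "(\<Sum>i = 1..<CHAR('k). jacobson_s L i x y) \<in> B"
    using x y by (intro sum_in jacobson_s_in)
  have "\<rho> (x + y) ^ CHAR('k) = \<rho> (p_map L (x + y))"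
    unfolding eq using assms x y s
    by (simp add: rep_add add_in rep_sum jacobson_s_in rep_jacobson p_compatible_def)
  with x y s show ?thesis by (simp add: p_compatible_def eq add_in)
qed

lemma p_compatible_scale:
  assumes "p_compatible x"
  shows "p_compatible (lie_scale L c x)"
proof -
  have x: "x \<in> B" "p_map L x \<in> B" "\<rho> x ^ CHAR('k) = \<rho> (p_map L x)"
    using assms by (auto simp: p_compatible_def)
  then have "p_map L (lie_scale L c x) = lie_scale L (c ^ CHAR('k)) (p_map L x)"
    using p_map_scale sub by blast
  with x show ?thesis by (simp add: p_compatible_def scale_in rep_scale power_scale)
qed

lemma p_compatible_zero: "p_compatible 0"
proof -
  interpret V: vector_space "lie_scale L" by (rule vector_space)
  have "p_map L (lie_scale L 0 0) = lie_scale L (0 ^ CHAR('k)) (p_map L 0)"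
    using p_map_scale zero_in sub by blast
  then have "p_map L 0 = 0"
    using pos_char by (simp add: power_0_left)
  then show ?thesis using pos_char by (simp add: p_compatible_def zero_in rep_zero power_0_left)
qed

end

section \<open>Algebras and their quotients\<close>

lemma ring_cong:
  assumes "ring R" "carrier S = carrier R" "mult S = mult R" "one S = one R"
    "zero S = zero R" "add S = add R"
  shows "ring S"
proof -
  interpret R: ring R by fact
  have "abelian_group S"
    by (rule abelian_groupI) (use R.a_assoc R.a_comm R.add.l_inv_ex assms in auto)
  moreover have "monoid S"
    by (rule monoidI) (use assms R.m_assoc in auto)
  ultimately show ?thesis
    by (rule ringI) (use assms R.l_distr R.r_distr in auto)
qed

lemma abelian_group_cong:
  assumes "abelian_group R" "carrier S = carrier R" "zero S = zero R" "add S = add R"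
  shows "abelian_group S"
proof -
  interpret R: abelian_group R by fact
  show ?thesis
    by (rule abelian_groupI) (use R.a_assoc R.a_comm R.add.l_inv_ex assms in auto)
qed

lemma factor_simps [simp]:
  "carrier (factor V I) = a_rcosets\<^bsub>V\<^esub> I"
  "add (factor V I) = (<+>\<^bsub>V\<^esub>)"
  "zero (factor V I) = I"
  "one (factor V I) = I +>\<^bsub>V\<^esub> \<one>\<^bsub>V\<^esub>"
  "mult (factor V I) = rcoset_mult V I"
  "smult (factor V I) = (\<lambda>c X. I <+>\<^bsub>V\<^esub> (\<lambda>x. c \<odot>\<^bsub>V\<^esub> x) ` X)"
  by (simp_all add: factor_def FactRing_def ring.extend_def module.fields_def set_add_def fun_eq_iff)

locale kalgebra = ring A for A :: "('k::field, 'a) module" (structure) +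
  assumes smult_closed [simp]: "x \<in> carrier A \<Longrightarrow> c \<odot> x \<in> carrier A"
    and smult_add_right: "\<lbrakk>x \<in> carrier A; y \<in> carrier A\<rbrakk> \<Longrightarrow> c \<odot> (x \<oplus> y) = c \<odot> x \<oplus> c \<odot> y"
    and smult_add_left: "x \<in> carrier A \<Longrightarrow> (c + d) \<odot> x = c \<odot> x \<oplus> d \<odot> x"
    and smult_smult: "x \<in> carrier A \<Longrightarrow> (c * d) \<odot> x = c \<odot> (d \<odot> x)"
    and smult_one [simp]: "x \<in> carrier A \<Longrightarrow> 1 \<odot> x = x"
    and smult_mult_left: "\<lbrakk>x \<in> carrier A; y \<in> carrier A\<rbrakk> \<Longrightarrow> (c \<odot> x) \<otimes> y = c \<odot> (x \<otimes> y)"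
    and smult_mult_right: "\<lbrakk>x \<in> carrier A; y \<in> carrier A\<rbrakk> \<Longrightarrow> x \<otimes> (c \<odot> y) = c \<odot> (x \<otimes> y)"
begin

lemma smult_zero [simp]: "x \<in> carrier A \<Longrightarrow> 0 \<odot> x = \<zero>"
  using smult_add_left[of x 0 0] by (metis add.r_cancel_one add_0 smult_closed)

lemma smult_eq_mult: "x \<in> carrier A \<Longrightarrow> c \<odot> x = (c \<odot> \<one>) \<otimes> x"
  by (simp add: smult_mult_left)

lemma smult_one_central: "x \<in> carrier A \<Longrightarrow> x \<otimes> (c \<odot> \<one>) = (c \<odot> \<one>) \<otimes> x"
  by (simp add: smult_mult_left smult_mult_right)

lemma ideal_smult:
  assumes "ideal I A" "x \<in> I"
  shows "c \<odot> x \<in> I"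
proof -
  interpret ideal I A by fact
  show ?thesis using assms by (subst smult_eq_mult) (auto intro: I_l_closed)
qed

lemma factor_smult:
  assumes I: "ideal I A" and x: "x \<in> carrier A"
  shows "c \<odot>\<^bsub>factor A I\<^esub> (I +> x) = I +> (c \<odot> x)"
proof -
  interpret ideal I A by fact
  have sub: "i \<in> carrier A" if "i \<in> I" for i using that a_subset by blast
  have "I <+> (\<lambda>y. c \<odot> y) ` (I +> x) = I +> (c \<odot> x)" (is "?L = ?R")
  proof
    show "?L \<subseteq> ?R"
    proof
      fix z assume "z \<in> ?L"
      then obtain i j where "i \<in> I" "j \<in> I" "z = i \<oplus> c \<odot> (j \<oplus> x)"
        by (auto simp: set_add_def' a_r_coset_def')
      then have "z = (i \<oplus> c \<odot> j) \<oplus> c \<odot> x"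
        using x by (simp add: smult_add_right sub a_assoc)
      with \<open>i \<in> I\<close> \<open>j \<in> I\<close> show "z \<in> ?R"
        using ideal_smult[OF I] by (auto simp: a_r_coset_def' intro!: bexI[of _ "i \<oplus> c \<odot> j"])
    qed
    show "?R \<subseteq> ?L"
    proof
      fix z assume "z \<in> ?R"
      then obtain i where "i \<in> I" "z = i \<oplus> c \<odot> (\<zero> \<oplus> x)"
        using x by (auto simp: a_r_coset_def')
      moreover have "\<zero> \<in> I" using zero_closed by blast
      ultimately show "z \<in> ?L"
        unfolding set_add_def' a_r_coset_def' by blast
    qed
  qed
  then show ?thesis by simp
qed

lemma factor_kalgebra:
  assumes I: "ideal I A"
  shows "kalgebra (factor A I)"
proof -
  interpret I: ideal I A by fact
  have ring: "ring (factor A I)"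
    by (rule ring_cong[OF I.quotient_is_ring]) (simp_all add: FactRing_def fun_eq_iff)
  have car: "\<exists>x\<in>carrier A. X = I +> x" if "X \<in> carrier (factor A I)" for X
    using that by (auto simp: A_RCOSETS_def')
  have mem: "I +> x \<in> carrier (factor A I)" if "x \<in> carrier A" for x
    using that by (auto simp: A_RCOSETS_def')
  note s = factor_smult[OF I]
  show ?thesis
  proof (intro kalgebra.intro ring kalgebra_axioms.intro)
    fix c and X assume "X \<in> carrier (factor A I)"
    then show "c \<odot>\<^bsub>factor A I\<^esub> X \<in> carrier (factor A I)" using car s mem smult_closed by metis
  next
    fix c X Y assume "X \<in> carrier (factor A I)" "Y \<in> carrier (factor A I)"
    then obtain x y where xy: "x \<in> carrier A" "y \<in> carrier A" "X = I +> x" "Y = I +> y"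
      using car by metis
    then show "c \<odot>\<^bsub>factor A I\<^esub> (X \<oplus>\<^bsub>factor A I\<^esub> Y) = c \<odot>\<^bsub>factor A I\<^esub> X \<oplus>\<^bsub>factor A I\<^esub> c \<odot>\<^bsub>factor A I\<^esub> Y"
      using s[of "x \<oplus> y" c] s[of x c] s[of y c]
      by (simp add: I.a_rcos_sum smult_add_right del: factor_simps(6))
    show "(c \<odot>\<^bsub>factor A I\<^esub> X) \<otimes>\<^bsub>factor A I\<^esub> Y = c \<odot>\<^bsub>factor A I\<^esub> (X \<otimes>\<^bsub>factor A I\<^esub> Y)"
      using s[of "x \<otimes> y" c] s[of x c] xy
      by (simp add: I.rcoset_mult_add smult_mult_left del: factor_simps(6))
    show "X \<otimes>\<^bsub>factor A I\<^esub> (c \<odot>\<^bsub>factor A I\<^esub> Y) = c \<odot>\<^bsub>factor A I\<^esub> (X \<otimes>\<^bsub>factor A I\<^esub> Y)"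
      using s[of "x \<otimes> y" c] s[of y c] xy
      by (simp add: I.rcoset_mult_add smult_mult_right del: factor_simps(6))
  next
    fix c d X assume "X \<in> carrier (factor A I)"
    then obtain x where x: "x \<in> carrier A" "X = I +> x" using car by metis
    show "(c + d) \<odot>\<^bsub>factor A I\<^esub> X = c \<odot>\<^bsub>factor A I\<^esub> X \<oplus>\<^bsub>factor A I\<^esub> d \<odot>\<^bsub>factor A I\<^esub> X"
      using s[of x] x by (simp add: I.a_rcos_sum smult_add_left del: factor_simps(6))
    show "(c * d) \<odot>\<^bsub>factor A I\<^esub> X = c \<odot>\<^bsub>factor A I\<^esub> (d \<odot>\<^bsub>factor A I\<^esub> X)"
      using s x by (simp add: smult_smult del: factor_simps(6))
    show "1 \<odot>\<^bsub>factor A I\<^esub> X = X" using s x by (simp del: factor_simps(6))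
  qed
qed

end

section \<open>The free algebra\<close>

lemma free_algebra_simps [simp]:
  "carrier (free_algebra X) = {f. finite {w. f w \<noteq> 0} \<and> (\<forall>w. f w \<noteq> 0 \<longrightarrow> set w \<subseteq> X)}"
  "f \<otimes>\<^bsub>free_algebra X\<^esub> g = (\<lambda>w. \<Sum>i\<le>length w. f (take i w) * g (drop i w))"
  "\<one>\<^bsub>free_algebra X\<^esub> = (\<lambda>w. if w = [] then 1 else 0)"
  "\<zero>\<^bsub>free_algebra X\<^esub> = (\<lambda>_. 0)"
  "f \<oplus>\<^bsub>free_algebra X\<^esub> g = (\<lambda>w. f w + g w)"
  "c \<odot>\<^bsub>free_algebra X\<^esub> f = (\<lambda>w. c * f w)"
  by (simp_all add: free_algebra_def)

lemma convolution_assoc: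
  fixes f g h :: "'x list \<Rightarrow> 'k::field"
  shows "(\<Sum>i\<le>length w. (\<Sum>j\<le>length (take i w). f (take j (take i w)) * g (drop j (take i w))) * h (drop i w))
    = (\<Sum>i\<le>length w. f (take i w) * (\<Sum>j\<le>length (drop i w). g (take j (drop i w)) * h (drop j (drop i w))))"
proof -
  define F where "F a b c = f (take a w) * g (take b (drop a w)) * h (drop (a + b) w)" for a b c :: nat
  have "(\<Sum>i\<le>length w. (\<Sum>j\<le>length (take i w). f (take j (take i w)) * g (drop j (take i w))) * h (drop i w))
      = (\<Sum>i = 0..length w. \<Sum>j = 0..i. F j (i - j) (length w - i))"
    unfolding F_def sum_distrib_right atLeast0AtMost
    by (intro sum.cong) (auto simp: drop_take min_def)
  also have "\<dots> = (\<Sum>i = 0..length w. \<Sum>j = 0..length w - i. F i j (length w - i - j))"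
    by (rule fps_mult_assoc_lemma)
  also have "\<dots> = (\<Sum>i\<le>length w. f (take i w) * (\<Sum>j\<le>length (drop i w). g (take j (drop i w)) * h (drop j (drop i w))))"
    unfolding F_def sum_distrib_left atLeast0AtMost
    by (intro sum.cong) (auto simp: add.commute mult.assoc)
  finally show ?thesis .
qed

lemma convolution_support:
  fixes f g :: "'x list \<Rightarrow> 'k::field"
  shows "{w. (\<Sum>i\<le>length w. f (take i w) * g (drop i w)) \<noteq> 0}
    \<subseteq> (\<lambda>(u, v). u @ v) ` ({w. f w \<noteq> 0} \<times> {w. g w \<noteq> 0})"
proof
  fix w assume "w \<in> {w. (\<Sum>i\<le>length w. f (take i w) * g (drop i w)) \<noteq> 0}"
  then obtain i where "f (take i w) * g (drop i w) \<noteq> 0"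
    by (auto elim: sum.not_neutral_contains_not_neutral)
  then show "w \<in> (\<lambda>(u, v). u @ v) ` ({w. f w \<noteq> 0} \<times> {w. g w \<noteq> 0})"
    by (intro image_eqI[where x = "(take i w, drop i w)"]) auto
qed

lemma kalgebra_free_algebra: "kalgebra (free_algebra X :: ('k::field, 'x list \<Rightarrow> 'k) module)"
proof -
  let ?T = "free_algebra X :: ('k, 'x list \<Rightarrow> 'k) module"
  have add: "f \<oplus>\<^bsub>?T\<^esub> g \<in> carrier ?T" if "f \<in> carrier ?T" "g \<in> carrier ?T" for f g
  proof -
    have "{w. f w + g w \<noteq> 0} \<subseteq> {w. f w \<noteq> 0} \<union> {w. g w \<noteq> 0}" by auto
    with that show ?thesis by (auto intro: finite_subset)
  qed
  have neg: "(\<lambda>w. - f w) \<in> carrier ?T" if "f \<in> carrier ?T" for f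
    using that by simp
  have mult: "f \<otimes>\<^bsub>?T\<^esub> g \<in> carrier ?T" if "f \<in> carrier ?T" "g \<in> carrier ?T" for f g
  proof -
    define h where "h = (\<lambda>w. \<Sum>i\<le>length w. f (take i w) * g (drop i w))"
    have sub: "{w. h w \<noteq> 0} \<subseteq> (\<lambda>(u, v). u @ v) ` ({w. f w \<noteq> 0} \<times> {w. g w \<noteq> 0})"
      unfolding h_def by (rule convolution_support)
    then have "finite {w. h w \<noteq> 0}" by (rule finite_subset) (use that in auto)
    moreover have "set w \<subseteq> X" if "h w \<noteq> 0" for w
      using sub that \<open>f \<in> carrier ?T\<close> \<open>g \<in> carrier ?T\<close> by fastforce
    ultimately show ?thesis by (simp add: h_def)
  qed
  have "abelian_group ?T"
  proof (rule abelian_groupI)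
    fix f assume "f \<in> carrier ?T"
    then show "\<exists>g\<in>carrier ?T. g \<oplus>\<^bsub>?T\<^esub> f = \<zero>\<^bsub>?T\<^esub>"
      using neg by (intro bexI[of _ "\<lambda>w. - f w"]) auto
  qed ((rule add; assumption) | simp add: fun_eq_iff add.assoc add.commute)+
  have "monoid ?T"
  proof (rule monoidI)
    show "\<one>\<^bsub>?T\<^esub> \<in> carrier ?T" by auto
  next
    fix f g h
    show "f \<otimes>\<^bsub>?T\<^esub> g \<otimes>\<^bsub>?T\<^esub> h = f \<otimes>\<^bsub>?T\<^esub> (g \<otimes>\<^bsub>?T\<^esub> h)"
      unfolding free_algebra_simps fun_eq_iff using convolution_assoc by blast
  next
    fix f :: "'x list \<Rightarrow> 'k"
    show "\<one>\<^bsub>?T\<^esub> \<otimes>\<^bsub>?T\<^esub> f = f"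
    proof
      fix w :: "'x list"
      have "(\<Sum>i\<le>length w. (if take i w = [] then 1 else 0) * f (drop i w)) = (\<Sum>i\<in>{0}. f (drop i w))"
        by (rule sum.mono_neutral_cong_right) auto
      then show "(\<one>\<^bsub>?T\<^esub> \<otimes>\<^bsub>?T\<^esub> f) w = f w" by simp
    qed
    show "f \<otimes>\<^bsub>?T\<^esub> \<one>\<^bsub>?T\<^esub> = f"
    proof
      fix w :: "'x list"
      have "(\<Sum>i\<le>length w. f (take i w) * (if drop i w = [] then 1 else 0)) = (\<Sum>i\<in>{length w}. f (take i w))"
        by (rule sum.mono_neutral_cong_right) auto
      then show "(f \<otimes>\<^bsub>?T\<^esub> \<one>\<^bsub>?T\<^esub>) w = f w" by simp
    qed
  qed (rule mult)
  have "ring ?T"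
    by (rule ringI) (fact | simp add: algebra_simps sum.distrib fun_eq_iff)+
  then show ?thesis
  proof (intro kalgebra.intro kalgebra_axioms.intro)
    fix f c assume "f \<in> carrier ?T"
    then show "c \<odot>\<^bsub>?T\<^esub> f \<in> carrier ?T"
      by (auto intro: finite_subset[of _ "{w. f w \<noteq> 0}"])
  qed (simp_all add: fun_eq_iff algebra_simps sum_distrib_left)
qed

section \<open>Evaluating noncommutative polynomials\<close>

definition free_lift :: "('k::field \<Rightarrow> 'r::ring_1) \<Rightarrow> ('x \<Rightarrow> 'r) \<Rightarrow> ('x list \<Rightarrow> 'k) \<Rightarrow> 'r" where
  "free_lift \<kappa> \<rho> f = (\<Sum>w | f w \<noteq> 0. \<kappa> (f w) * prod_list (map \<rho> w))"

text \<open>Additive and multiplicative maps from a carrier-based ring to a type-class ring.\<close>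

definition ring_map :: "('a, 'm) ring_scheme \<Rightarrow> ('a \<Rightarrow> 'r::ring_1) \<Rightarrow> bool" where
  "ring_map R h \<longleftrightarrow> (\<forall>x\<in>carrier R. \<forall>y\<in>carrier R.
     h (x \<oplus>\<^bsub>R\<^esub> y) = h x + h y \<and> h (x \<otimes>\<^bsub>R\<^esub> y) = h x * h y)"

context algebra_map
begin

lemma free_lift_superset:
  assumes "finite S" "{w. f w \<noteq> 0} \<subseteq> S"
  shows "free_lift \<kappa> \<rho> f = (\<Sum>w\<in>S. \<kappa> (f w) * prod_list (map \<rho> w))"
  unfolding free_lift_def using assms by (intro sum.mono_neutral_left) (auto simp: map_zero)

lemma free_lift_add:
  assumes "finite {w. f w \<noteq> 0}" "finite {w. g w \<noteq> 0}"
  shows "free_lift \<kappa> \<rho> (\<lambda>w. f w + g w) = free_lift \<kappa> \<rho> f + free_lift \<kappa> \<rho> g"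
proof -
  let ?S = "{w. f w \<noteq> 0} \<union> {w. g w \<noteq> 0}"
  have "finite ?S" using assms by simp
  moreover have "{w. f w + g w \<noteq> 0} \<subseteq> ?S" by auto
  ultimately show ?thesis
    using free_lift_superset[of ?S f] free_lift_superset[of ?S g] free_lift_superset[of ?S "\<lambda>w. f w + g w"]
    by (simp add: map_add algebra_simps sum.distrib)
qed

lemma free_lift_scale: "free_lift \<kappa> \<rho> (\<lambda>w. c * f w) = \<kappa> c * free_lift \<kappa> \<rho> f"
proof (cases "c = 0")
  case True
  then show ?thesis by (simp add: free_lift_def map_zero)
next
  case False
  then show ?thesis
    by (simp add: free_lift_def map_mult sum_distrib_left mult.assoc)
qed

lemma free_lift_one: "free_lift \<kappa> \<rho> (\<lambda>w. if w = [] then 1 else 0) = 1"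
proof -
  have "{w::'x list. (if w = [] then 1 else (0::'k)) \<noteq> 0} = {[]}" by auto
  then show ?thesis by (simp add: free_lift_def map_one)
qed

lemma free_lift_gen: "free_lift \<kappa> \<rho> (gen x) = \<rho> x"
proof -
  have "{w. gen x w \<noteq> (0::'k)} = {[x]}" by (auto simp: gen_def)
  then show ?thesis by (simp add: free_lift_def gen_def map_one)
qed

lemma map_sum: "\<kappa> (sum h I) = (\<Sum>i\<in>I. \<kappa> (h i))"
  by (induction I rule: infinite_finite_induct) (simp_all add: map_zero map_add)

lemma free_lift_mult:
  fixes f g :: "'x list \<Rightarrow> 'k"
  assumes f: "finite {w. f w \<noteq> 0}" and g: "finite {w. g w \<noteq> 0}"
  shows "free_lift \<kappa> \<rho> (\<lambda>w. \<Sum>i\<le>length w. f (take i w) * g (drop i w))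
    = free_lift \<kappa> \<rho> f * free_lift \<kappa> \<rho> g"
proof -
  let ?F = "{w. f w \<noteq> 0}" and ?G = "{w. g w \<noteq> 0}"
  define W where "W = (\<lambda>(u, v). u @ v) ` (?F \<times> ?G)"
  define \<pi> where "\<pi> w = prod_list (map \<rho> w)" for w
  have W: "finite W" using f g by (simp add: W_def)
  have "free_lift \<kappa> \<rho> (\<lambda>w. \<Sum>i\<le>length w. f (take i w) * g (drop i w))
      = (\<Sum>w\<in>W. \<kappa> (\<Sum>i\<le>length w. f (take i w) * g (drop i w)) * \<pi> w)"
    unfolding \<pi>_def W_def using W[unfolded W_def] convolution_support by (rule free_lift_superset)
  also have "\<dots> = (\<Sum>w\<in>W. \<Sum>i\<le>length w. \<kappa> (f (take i w)) * \<kappa> (g (drop i w)) * \<pi> w)"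
    by (simp add: map_sum map_mult sum_distrib_right)
  also have "\<dots> = (\<Sum>(w, i)\<in>(SIGMA w:W. {..length w}). \<kappa> (f (take i w)) * \<kappa> (g (drop i w)) * \<pi> w)"
    using W by (simp add: sum.Sigma)
  also have "\<dots> = (\<Sum>(u, v)\<in>?F \<times> ?G. \<kappa> (f u) * \<kappa> (g v) * \<pi> (u @ v))"
  proof -
    define \<phi> where "\<phi> = (\<lambda>(u :: 'x list, v :: 'x list). (u @ v, length u))"
    have "(\<Sum>(w, i)\<in>(SIGMA w:W. {..length w}). \<kappa> (f (take i w)) * \<kappa> (g (drop i w)) * \<pi> w)
        = (\<Sum>(w, i)\<in>\<phi> ` (?F \<times> ?G). \<kappa> (f (take i w)) * \<kappa> (g (drop i w)) * \<pi> w)"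
    proof (rule sum.mono_neutral_right)
      show "finite (SIGMA w:W. {..length w})" using W by simp
      show "\<phi> ` (?F \<times> ?G) \<subseteq> (SIGMA w:W. {..length w})" by (auto simp: \<phi>_def W_def)
      have "(case wi of (w, i) \<Rightarrow> \<kappa> (f (take i w)) * \<kappa> (g (drop i w)) * \<pi> w) = 0"
        if "wi \<in> (SIGMA w:W. {..length w}) - \<phi> ` (?F \<times> ?G)" for wi
      proof -
        obtain w i where wi: "wi = (w, i)" by (cases wi)
        with that have "i \<le> length w" and not: "(w, i) \<notin> \<phi> ` (?F \<times> ?G)" by auto
        then have "\<phi> (take i w, drop i w) = (w, i)" by (simp add: \<phi>_def)
        with not have "(take i w, drop i w) \<notin> ?F \<times> ?G" by (metis image_eqI)
        then show ?thesis by (auto simp: map_zero wi)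
      qed
      then show "\<forall>wi\<in>(SIGMA w:W. {..length w}) - \<phi> ` (?F \<times> ?G).
          (case wi of (w, i) \<Rightarrow> \<kappa> (f (take i w)) * \<kappa> (g (drop i w)) * \<pi> w) = 0" by blast
    qed
    also have "\<dots> = (\<Sum>(u, v)\<in>?F \<times> ?G. \<kappa> (f u) * \<kappa> (g v) * \<pi> (u @ v))"
      by (subst sum.reindex) (auto simp: inj_on_def \<phi>_def intro!: sum.cong)
    finally show ?thesis .
  qed
  also have "\<dots> = (\<Sum>(u, v)\<in>?F \<times> ?G. (\<kappa> (f u) * \<pi> u) * (\<kappa> (g v) * \<pi> v))"
  proof (intro sum.cong refl, clarify)
    fix u v
    have "\<kappa> (g v) * \<pi> u = \<pi> u * \<kappa> (g v)" by (rule central)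
    then have "\<kappa> (g v) * (\<pi> u * \<pi> v) = \<pi> u * (\<kappa> (g v) * \<pi> v)" by (metis mult.assoc)
    then show "\<kappa> (f u) * \<kappa> (g v) * \<pi> (u @ v) = \<kappa> (f u) * \<pi> u * (\<kappa> (g v) * \<pi> v)"
      by (simp add: \<pi>_def mult.assoc)
  qed
  also have "\<dots> = free_lift \<kappa> \<rho> f * free_lift \<kappa> \<rho> g"
    by (simp add: free_lift_def \<pi>_def sum_product sum.cartesian_product)
  finally show ?thesis .
qed

lemma ring_map_free_lift: "ring_map (free_algebra X) (free_lift \<kappa> \<rho>)"
  unfolding ring_map_def by (simp add: free_lift_add free_lift_mult)

end

lemma word_eval_eq_free_lift: "word_eval \<chi> = free_lift (\<lambda>c. c) \<chi>"
  by (simp add: word_eval_def free_lift_def fun_eq_iff)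

context ring
begin

lemma ring_map_zero: "ring_map R h \<Longrightarrow> h \<zero> = 0"
  unfolding ring_map_def by (metis add_cancel_right_right l_zero zero_closed)

lemma ring_map_neg:
  assumes "ring_map R h" "x \<in> carrier R"
  shows "h (\<ominus> x) = - h x"
proof -
  have "h x + h (\<ominus> x) = 0"
    using assms ring_map_zero[OF assms(1)] r_neg[OF assms(2)] a_inv_closed unfolding ring_map_def by metis
  then show ?thesis by (simp add: eq_neg_iff_add_eq_0 add.commute)
qed

lemma ring_map_minus:
  "\<lbrakk>ring_map R h; x \<in> carrier R; y \<in> carrier R\<rbrakk> \<Longrightarrow> h (x \<ominus> y) = h x - h y"
  using ring_map_neg[of h y] unfolding ring_map_def minus_eq by simp

lemma ring_map_kernel_ideal:
  assumes h: "ring_map R h"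
  shows "ideal {x \<in> carrier R. h x = 0} R"
proof (rule idealI[OF ring_axioms])
  have "subgroup {x \<in> carrier R. h x = 0} (add_monoid R)"
    by (rule subgroup.intro)
      (use h ring_map_zero[OF h] ring_map_neg[OF h] in \<open>auto simp: ring_map_def a_inv_def[symmetric]\<close>)
  then show "subgroup {x \<in> carrier R. h x = 0} (add_monoid R)" .
qed (use h in \<open>auto simp: ring_map_def\<close>)

lemma genideal_kernel:
  assumes "ring_map R h" "S \<subseteq> carrier R" "\<And>x. x \<in> S \<Longrightarrow> h x = 0" "x \<in> Idl S"
  shows "h x = 0"
  using genideal_minimal[OF ring_map_kernel_ideal[OF assms(1)], of S] assms by blast

lemma ring_map_coset:
  assumes h: "ring_map R h" and I: "ideal I R" and ker: "\<And>x. x \<in> I \<Longrightarrow> h x = 0" and x: "x \<in> carrier R"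
  shows "h ` (I +> x) = {h x}"
proof -
  interpret I: ideal I R by fact
  have "h (i \<oplus> x) = h x" if "i \<in> I" for i
    using that h x ker I.a_subset unfolding ring_map_def by (metis add_0 subsetD)
  moreover have "x \<in> I +> x" by (rule I.a_rcos_self[OF x])
  ultimately show ?thesis by (auto simp: a_r_coset_def')
qed

end

lemma (in kalgebra) ring_map_factor:
  assumes h: "ring_map A h" and I: "ideal I A" and ker: "\<And>x. x \<in> I \<Longrightarrow> h x = 0"
  shows "ring_map (factor A I) (\<lambda>X. the_elem (h ` X))"
  unfolding ring_map_def
proof (intro ballI)
  interpret I: ideal I A by fact
  fix X Y assume "X \<in> carrier (factor A I)" "Y \<in> carrier (factor A I)"
  then obtain x y where xy: "x \<in> carrier A" "y \<in> carrier A" "X = I +> x" "Y = I +> y"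
    by (auto simp: A_RCOSETS_def')
  have "the_elem (h ` (I +> z)) = h z" if "z \<in> carrier A" for z
    by (simp add: ring_map_coset[OF h I ker that])
  with xy h show "the_elem (h ` (X \<oplus>\<^bsub>factor A I\<^esub> Y)) = the_elem (h ` X) + the_elem (h ` Y) \<and>
      the_elem (h ` (X \<otimes>\<^bsub>factor A I\<^esub> Y)) = the_elem (h ` X) * the_elem (h ` Y)"
    by (simp add: I.a_rcos_sum I.rcoset_mult_add ring_map_def)
qed

section \<open>Restricted enveloping algebras\<close>

text \<open>The image in \<open>u(L)\<close> of an element of the free algebra.\<close>

definition u_class :: "('k::field, 'g::ab_group_add) restricted_lie \<Rightarrow> ('g list \<Rightarrow> 'k) \<Rightarrow> ('g list \<Rightarrow> 'k) set set" where
  "u_class L f = u_ideal L +>\<^bsub>U_alg L\<^esub> (U_ideal L +>\<^bsub>free_algebra (carrier L)\<^esub> f)"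

definition u_gen :: "('k::field, 'g::ab_group_add) restricted_lie \<Rightarrow> 'g \<Rightarrow> ('g list \<Rightarrow> 'k) set set" where
  "u_gen L x = u_class L (gen x)"

text \<open>Closure under the operations, so that the Borel subalgebra is an instance as soon as the
  \<open>p\<close>-map is known to preserve it.\<close>

locale envelope =
  fixes L :: "('k::field, 'g::ab_group_add) restricted_lie"
  assumes add_closed: "\<lbrakk>x \<in> carrier L; y \<in> carrier L\<rbrakk> \<Longrightarrow> x + y \<in> carrier L"
    and scale_closed: "x \<in> carrier L \<Longrightarrow> lie_scale L c x \<in> carrier L"
    and brack_closed: "\<lbrakk>x \<in> carrier L; y \<in> carrier L\<rbrakk> \<Longrightarrow> bracket L x y \<in> carrier L"
    and p_closed: "x \<in> carrier L \<Longrightarrow> p_map L x \<in> carrier L"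
begin

abbreviation T where "T \<equiv> free_algebra (carrier L) :: ('k, 'g list \<Rightarrow> 'k) module"

definition U_rels :: "('g list \<Rightarrow> 'k) set" where
  "U_rels = {gen (x + y) \<ominus>\<^bsub>T\<^esub> (gen x \<oplus>\<^bsub>T\<^esub> gen y) | x y. x \<in> carrier L \<and> y \<in> carrier L} \<union>
           {gen (lie_scale L c x) \<ominus>\<^bsub>T\<^esub> c \<odot>\<^bsub>T\<^esub> gen x | c x. x \<in> carrier L} \<union>
           {(gen x \<otimes>\<^bsub>T\<^esub> gen y \<ominus>\<^bsub>T\<^esub> gen y \<otimes>\<^bsub>T\<^esub> gen x) \<ominus>\<^bsub>T\<^esub> gen (bracket L x y) | x y.
              x \<in> carrier L \<and> y \<in> carrier L}"

definition u_rels :: "('g list \<Rightarrow> 'k) set set" where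
  "u_rels = {U_gen L x [^]\<^bsub>U_alg L\<^esub> CHAR('k) \<ominus>\<^bsub>U_alg L\<^esub> U_gen L (p_map L x) | x. x \<in> carrier L}"

lemma U_ideal_eq: "U_ideal L = Idl\<^bsub>T\<^esub> U_rels"
  by (simp only: U_ideal_def U_rels_def Let_def)

lemma u_ideal_eq: "u_ideal L = Idl\<^bsub>U_alg L\<^esub> u_rels"
  by (simp only: u_ideal_def u_rels_def)

sublocale T: kalgebra T by (rule kalgebra_free_algebra)

lemma gen_in [simp, intro]: "x \<in> carrier L \<Longrightarrow> gen x \<in> carrier T"
proof -
  assume "x \<in> carrier L"
  moreover have "{w. gen x w \<noteq> (0::'k)} \<subseteq> {[x]}" by (auto simp: gen_def)
  ultimately show ?thesis by (auto simp: gen_def intro: finite_subset)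
qed

declare free_algebra_simps [simp del]

lemma U_rels_sub: "U_rels \<subseteq> carrier T"
  unfolding U_rels_def by (auto intro!: T.minus_closed simp: add_closed scale_closed brack_closed)

lemma U_ideal: "ideal (U_ideal L) T"
  unfolding U_ideal_eq by (rule T.genideal_ideal[OF U_rels_sub])

sublocale U: kalgebra "U_alg L"
  unfolding U_alg_def by (rule T.factor_kalgebra[OF U_ideal])

lemma carrier_U: "carrier (U_alg L) = (\<lambda>f. U_ideal L +>\<^bsub>T\<^esub> f) ` carrier T"
  by (auto simp: U_alg_def A_RCOSETS_def')

lemma U_gen_in: "x \<in> carrier L \<Longrightarrow> U_gen L x \<in> carrier (U_alg L)"
  by (simp add: U_gen_def carrier_U)

lemma u_rels_sub: "u_rels \<subseteq> carrier (U_alg L)"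
  unfolding u_rels_def by (auto intro!: U.minus_closed U_gen_in p_closed)

lemma u_ideal: "ideal (u_ideal L) (U_alg L)"
  unfolding u_ideal_eq by (rule U.genideal_ideal[OF u_rels_sub])

sublocale u: kalgebra "u_alg L"
  unfolding u_alg_def by (rule U.factor_kalgebra[OF u_ideal])

lemma U_coset_hom:
  assumes "f \<in> carrier T" "g \<in> carrier T"
  shows "U_ideal L +>\<^bsub>T\<^esub> (f \<oplus>\<^bsub>T\<^esub> g) = (U_ideal L +>\<^bsub>T\<^esub> f) \<oplus>\<^bsub>U_alg L\<^esub> (U_ideal L +>\<^bsub>T\<^esub> g)"
    and "U_ideal L +>\<^bsub>T\<^esub> (f \<otimes>\<^bsub>T\<^esub> g) = (U_ideal L +>\<^bsub>T\<^esub> f) \<otimes>\<^bsub>U_alg L\<^esub> (U_ideal L +>\<^bsub>T\<^esub> g)"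
  using assms ideal.a_rcos_sum[OF U_ideal]
    ideal.rcoset_mult_add[OF U_ideal]
  by (simp_all add: U_alg_def del: factor_simps(6))

lemma u_coset_hom:
  assumes "X \<in> carrier (U_alg L)" "Y \<in> carrier (U_alg L)"
  shows "u_ideal L +>\<^bsub>U_alg L\<^esub> (X \<oplus>\<^bsub>U_alg L\<^esub> Y) = (u_ideal L +>\<^bsub>U_alg L\<^esub> X) \<oplus>\<^bsub>u_alg L\<^esub> (u_ideal L +>\<^bsub>U_alg L\<^esub> Y)"
    and "u_ideal L +>\<^bsub>U_alg L\<^esub> (X \<otimes>\<^bsub>U_alg L\<^esub> Y) = (u_ideal L +>\<^bsub>U_alg L\<^esub> X) \<otimes>\<^bsub>u_alg L\<^esub> (u_ideal L +>\<^bsub>U_alg L\<^esub> Y)"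
  using assms ideal.a_rcos_sum[OF u_ideal]
    ideal.rcoset_mult_add[OF u_ideal]
  by (simp_all add: u_alg_def del: factor_simps(6))

lemma coset_smult:
  shows "f \<in> carrier T \<Longrightarrow> U_ideal L +>\<^bsub>T\<^esub> (c \<odot>\<^bsub>T\<^esub> f) = c \<odot>\<^bsub>U_alg L\<^esub> (U_ideal L +>\<^bsub>T\<^esub> f)"
    and "X \<in> carrier (U_alg L) \<Longrightarrow>
      u_ideal L +>\<^bsub>U_alg L\<^esub> (c \<odot>\<^bsub>U_alg L\<^esub> X) = c \<odot>\<^bsub>u_alg L\<^esub> (u_ideal L +>\<^bsub>U_alg L\<^esub> X)"
  using T.factor_smult[OF U_ideal] U.factor_smult[OF u_ideal] by (simp_all only: U_alg_def u_alg_def)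

lemma coset_one:
  shows "U_ideal L +>\<^bsub>T\<^esub> \<one>\<^bsub>T\<^esub> = \<one>\<^bsub>U_alg L\<^esub>"
    and "u_ideal L +>\<^bsub>U_alg L\<^esub> \<one>\<^bsub>U_alg L\<^esub> = \<one>\<^bsub>u_alg L\<^esub>"
  by (simp_all add: U_alg_def u_alg_def)

lemma carrier_u: "carrier (u_alg L) = u_class L ` carrier T"
  by (auto simp: u_alg_def A_RCOSETS_def' carrier_U u_class_def)

lemma u_class_hom:
  assumes "f \<in> carrier T" "g \<in> carrier T"
  shows u_class_add: "u_class L (f \<oplus>\<^bsub>T\<^esub> g) = u_class L f \<oplus>\<^bsub>u_alg L\<^esub> u_class L g"
    and u_class_mult: "u_class L (f \<otimes>\<^bsub>T\<^esub> g) = u_class L f \<otimes>\<^bsub>u_alg L\<^esub> u_class L g"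
  using assms by (simp_all add: u_class_def U_coset_hom u_coset_hom carrier_U)

lemma u_class_smult: "f \<in> carrier T \<Longrightarrow> u_class L (c \<odot>\<^bsub>T\<^esub> f) = c \<odot>\<^bsub>u_alg L\<^esub> u_class L f"
  by (simp add: u_class_def coset_smult carrier_U)

lemma u_class_one: "u_class L \<one>\<^bsub>T\<^esub> = \<one>\<^bsub>u_alg L\<^esub>"
  by (simp add: u_class_def coset_one)

lemma u_class_in [simp, intro]: "f \<in> carrier T \<Longrightarrow> u_class L f \<in> carrier (u_alg L)"
  by (simp add: carrier_u)

lemma u_gen_in [simp, intro]: "x \<in> carrier L \<Longrightarrow> u_gen L x \<in> carrier (u_alg L)"
  by (simp add: u_gen_def)

lemma u_class_eqI:
  assumes "f \<ominus>\<^bsub>T\<^esub> g \<in> U_rels" "f \<in> carrier T" "g \<in> carrier T"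
  shows "u_class L f = u_class L g"
proof -
  have "f \<ominus>\<^bsub>T\<^esub> g \<in> U_ideal L"
    using T.genideal_self[OF U_rels_sub] assms(1) by (auto simp: U_ideal_eq)
  then show ?thesis
    using T.quotient_eq_iff_same_a_r_cos[OF U_ideal assms(2,3)] by (simp add: u_class_def)
qed

lemma u_gen_add:
  assumes "x \<in> carrier L" "y \<in> carrier L"
  shows "u_gen L (x + y) = u_gen L x \<oplus>\<^bsub>u_alg L\<^esub> u_gen L y"
proof -
  have "u_class L (gen (x + y)) = u_class L (gen x \<oplus>\<^bsub>T\<^esub> gen y)"
  proof (rule u_class_eqI)
    show "gen (x + y) \<ominus>\<^bsub>T\<^esub> (gen x \<oplus>\<^bsub>T\<^esub> gen y) \<in> U_rels"
      unfolding U_rels_def using assms by blast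
  qed (use assms add_closed in simp_all)
  then show ?thesis using assms by (simp add: u_gen_def u_class_add)
qed

lemma u_gen_scale:
  assumes "x \<in> carrier L"
  shows "u_gen L (lie_scale L c x) = c \<odot>\<^bsub>u_alg L\<^esub> u_gen L x"
proof -
  have "u_class L (gen (lie_scale L c x)) = u_class L (c \<odot>\<^bsub>T\<^esub> gen x)"
  proof (rule u_class_eqI)
    show "gen (lie_scale L c x) \<ominus>\<^bsub>T\<^esub> c \<odot>\<^bsub>T\<^esub> gen x \<in> U_rels"
      unfolding U_rels_def using assms by blast
  qed (use assms scale_closed in simp_all)
  then show ?thesis using assms by (simp add: u_gen_def u_class_smult)
qed

lemma u_gen_bracket:
  assumes "x \<in> carrier L" "y \<in> carrier L"
  shows "u_gen L x \<otimes>\<^bsub>u_alg L\<^esub> u_gen L y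
    = u_gen L (bracket L x y) \<oplus>\<^bsub>u_alg L\<^esub> u_gen L y \<otimes>\<^bsub>u_alg L\<^esub> u_gen L x"
proof -
  let ?a = "gen x \<otimes>\<^bsub>T\<^esub> gen y" and ?b = "gen y \<otimes>\<^bsub>T\<^esub> gen x"
  have in_T: "?a \<in> carrier T" "?b \<in> carrier T" "?a \<ominus>\<^bsub>T\<^esub> ?b \<in> carrier T" using assms by auto
  have "u_class L (?a \<ominus>\<^bsub>T\<^esub> ?b) = u_class L (gen (bracket L x y))"
  proof (rule u_class_eqI)
    show "(?a \<ominus>\<^bsub>T\<^esub> ?b) \<ominus>\<^bsub>T\<^esub> gen (bracket L x y) \<in> U_rels"
      unfolding U_rels_def using assms by blast
  qed (use assms brack_closed in simp_all)
  moreover have "?a = (?a \<ominus>\<^bsub>T\<^esub> ?b) \<oplus>\<^bsub>T\<^esub> ?b"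
    using in_T by (simp add: T.minus_eq T.a_assoc T.l_neg)
  ultimately have "u_class L ?a = u_class L (gen (bracket L x y)) \<oplus>\<^bsub>u_alg L\<^esub> u_class L ?b"
    using in_T by (metis u_class_add)
  then show ?thesis using assms by (simp add: u_gen_def u_class_mult)
qed

lemma u_gen_power:
  assumes "x \<in> carrier L"
  shows "u_gen L x [^]\<^bsub>u_alg L\<^esub> CHAR('k) = u_gen L (p_map L x)"
proof -
  have in_U: "U_gen L x [^]\<^bsub>U_alg L\<^esub> n \<in> carrier (U_alg L)" for n :: nat
    using assms U_gen_in by auto
  have pow: "u_ideal L +>\<^bsub>U_alg L\<^esub> (U_gen L x [^]\<^bsub>U_alg L\<^esub> n) = u_gen L x [^]\<^bsub>u_alg L\<^esub> n" for n :: nat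
    by (induction n) (simp_all add: u_coset_hom coset_one in_U U_gen_in assms u_gen_def u_class_def flip: U_gen_def)
  have "U_gen L x [^]\<^bsub>U_alg L\<^esub> CHAR('k) \<ominus>\<^bsub>U_alg L\<^esub> U_gen L (p_map L x) \<in> u_ideal L"
    using U.genideal_self[OF u_rels_sub] assms by (auto simp: u_ideal_eq u_rels_def)
  then have "u_ideal L +>\<^bsub>U_alg L\<^esub> (U_gen L x [^]\<^bsub>U_alg L\<^esub> CHAR('k)) = u_ideal L +>\<^bsub>U_alg L\<^esub> U_gen L (p_map L x)"
    using U.quotient_eq_iff_same_a_r_cos[OF u_ideal in_U U_gen_in[OF p_closed[OF assms]]] by blast
  then show ?thesis by (simp add: pow) (simp add: u_gen_def u_class_def U_gen_def)
qed

text \<open>As \<open>u(L)\<close> is spanned by products of generators, left multiplication by generators reaches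
  everything from the unit.\<close>

lemma u_induct [consumes 1, case_names zero one add smult gen]:
  assumes a: "a \<in> carrier (u_alg L)"
    and zero: "P \<zero>\<^bsub>u_alg L\<^esub>" and one: "P \<one>\<^bsub>u_alg L\<^esub>"
    and add: "\<And>a b. \<lbrakk>a \<in> carrier (u_alg L); b \<in> carrier (u_alg L); P a; P b\<rbrakk> \<Longrightarrow> P (a \<oplus>\<^bsub>u_alg L\<^esub> b)"
    and smult: "\<And>c a. \<lbrakk>a \<in> carrier (u_alg L); P a\<rbrakk> \<Longrightarrow> P (c \<odot>\<^bsub>u_alg L\<^esub> a)"
    and gen: "\<And>x a. \<lbrakk>x \<in> carrier L; a \<in> carrier (u_alg L); P a\<rbrakk> \<Longrightarrow> P (u_gen L x \<otimes>\<^bsub>u_alg L\<^esub> a)"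
  shows "P a"
proof -
  define wd :: "'g list \<Rightarrow> 'g list \<Rightarrow> 'k" where "wd w = (\<lambda>v. if v = w then 1 else 0)" for w
  have wd_in: "wd w \<in> carrier T" if "set w \<subseteq> carrier L" for w
    using that by (auto simp: wd_def free_algebra_simps)
  have wd_Cons: "wd (x # w) = gen x \<otimes>\<^bsub>T\<^esub> wd w" for x w
  proof
    fix v :: "'g list"
    show "wd (x # w) v = (gen x \<otimes>\<^bsub>T\<^esub> wd w) v"
    proof (cases "v = x # w")
      case True
      have "(\<Sum>i\<le>length v. gen x (take i v) * wd w (drop i v)) = (\<Sum>i\<in>{1 :: nat}. (1 :: 'k))"
        by (rule sum.mono_neutral_cong_right) (use True in \<open>auto simp: wd_def gen_def take_Cons' split: if_splits\<close>)
      then show ?thesis using True by (simp add: wd_def free_algebra_simps)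
    next
      case False
      have "gen x (take i v) * wd w (drop i v) = (0 :: 'k)" for i
      proof (rule ccontr)
        assume "gen x (take i v) * wd w (drop i v) \<noteq> (0 :: 'k)"
        then have "take i v = [x]" "drop i v = w" by (auto simp: gen_def wd_def split: if_splits)
        then have "v = x # w" by (metis append_Cons append_Nil append_take_drop_id)
        with False show False by simp
      qed
      then have "(\<Sum>i\<le>length v. gen x (take i v) * wd w (drop i v)) = (0 :: 'k)"
        by (simp only: sum.neutral_const)
      then show ?thesis using False by (simp add: wd_def free_algebra_simps)
    qed
  qed
  have Pwd: "P (u_class L (wd w))" if "set w \<subseteq> carrier L" for w
    using that
  proof (induction w)
    case Nil
    have "wd [] = \<one>\<^bsub>T\<^esub>" by (simp add: wd_def free_algebra_simps)
    then show ?case using one by (simp add: u_class_one)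
  next
    case (Cons x w)
    then show ?case
      using gen[of x "u_class L (wd w)"] wd_in[of w] by (simp add: wd_Cons u_class_mult u_gen_def)
  qed
  have "P (u_class L f)" if "finite S" "{w. f w \<noteq> 0} \<subseteq> S" "S \<subseteq> lists (carrier L)" for f S
    using that
  proof (induction S arbitrary: f rule: finite_induct)
    case empty
    then have "f = 0 \<odot>\<^bsub>T\<^esub> \<one>\<^bsub>T\<^esub>" by (auto simp: free_algebra_simps)
    then show ?case using smult[OF _ one, of 0] u_class_smult[of "\<one>\<^bsub>T\<^esub>" 0] by (simp add: u_class_one)
  next
    case (insert v S)
    let ?g = "f(v := 0)"
    have v: "set v \<subseteq> carrier L" using insert.prems by (auto simp: lists_eq_set)
    have g: "P (u_class L ?g)" using insert.prems by (intro insert.IH) auto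
    have "{w. ?g w \<noteq> 0} \<subseteq> S" using insert.prems by auto
    then have g_in: "?g \<in> carrier T"
      using insert.prems insert.hyps(1) by (auto simp: free_algebra_simps lists_eq_set intro: finite_subset split: if_splits)
    have "f = ?g \<oplus>\<^bsub>T\<^esub> f v \<odot>\<^bsub>T\<^esub> wd v"
      by (auto simp: free_algebra_simps wd_def)
    then have "u_class L f = u_class L ?g \<oplus>\<^bsub>u_alg L\<^esub> f v \<odot>\<^bsub>u_alg L\<^esub> u_class L (wd v)"
      using g_in wd_in[OF v] by (metis u_class_add u_class_smult T.smult_closed)
    then show ?case using add[OF _ _ g smult[OF _ Pwd[OF v], of "f v"]] g_in wd_in[OF v] by auto
  qed
  moreover obtain f where "f \<in> carrier T" "a = u_class L f" using a carrier_u by auto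
  ultimately show ?thesis
    by (simp add: free_algebra_simps lists_eq_set) (metis (mono_tags, lifting) mem_Collect_eq subsetI subset_refl)
qed

end

text \<open>The universal property: \<open>\<rho>\<close> extends to \<open>u(L)\<close>. An element of \<open>u(L)\<close> is a set of sets of
  polynomials, and all of these have the same value; this is also how the scalar action in
  \<open>character_module\<close> reads off its factor.\<close>

locale envelope_map = envelope L + algebra_map \<kappa>
  for L :: "('k::field, 'g::ab_group_add) restricted_lie" and \<kappa> :: "'k \<Rightarrow> 'r::ring_1" +
  fixes \<rho> :: "'g \<Rightarrow> 'r"
  assumes rho_add: "\<lbrakk>x \<in> carrier L; y \<in> carrier L\<rbrakk> \<Longrightarrow> \<rho> (x + y) = \<rho> x + \<rho> y"
    and rho_scale: "x \<in> carrier L \<Longrightarrow> \<rho> (lie_scale L c x) = \<kappa> c * \<rho> x"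
    and rho_bracket: "\<lbrakk>x \<in> carrier L; y \<in> carrier L\<rbrakk> \<Longrightarrow> \<rho> (bracket L x y) = \<rho> x * \<rho> y - \<rho> y * \<rho> x"
    and rho_p_map: "x \<in> carrier L \<Longrightarrow> \<rho> x ^ CHAR('k) = \<rho> (p_map L x)"
begin

abbreviation "lift \<equiv> free_lift \<kappa> \<rho>"

lemma lift_hom: "ring_map T lift"
  by (rule ring_map_free_lift)

lemma lift_U_ideal: "f \<in> U_ideal L \<Longrightarrow> lift f = 0"
proof (rule T.genideal_kernel[OF lift_hom U_rels_sub])
  have smult: "lift (c \<odot>\<^bsub>T\<^esub> f) = \<kappa> c * lift f" for c f
    by (simp add: free_algebra_simps free_lift_scale)
  have add: "lift (f \<oplus>\<^bsub>T\<^esub> g) = lift f + lift g" "lift (f \<otimes>\<^bsub>T\<^esub> g) = lift f * lift g"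
    if "f \<in> carrier T" "g \<in> carrier T" for f g
    using lift_hom that by (auto simp: ring_map_def)
  fix r assume "r \<in> U_rels"
  then show "lift r = 0"
    unfolding U_rels_def
    by (auto simp: T.ring_map_minus[OF lift_hom] add smult free_lift_gen rho_add rho_scale rho_bracket
        add_closed scale_closed brack_closed)
qed (simp add: U_ideal_eq)

definition U_lift :: "('g list \<Rightarrow> 'k) set \<Rightarrow> 'r" where
  "U_lift X = the_elem (lift ` X)"

lemma U_lift_hom: "ring_map (U_alg L) U_lift"
  unfolding U_alg_def U_lift_def
  by (rule T.ring_map_factor[OF lift_hom U_ideal lift_U_ideal])

lemma lift_coset: "f \<in> carrier T \<Longrightarrow> lift ` (U_ideal L +>\<^bsub>T\<^esub> f) = {lift f}"
  by (rule T.ring_map_coset[OF lift_hom U_ideal lift_U_ideal])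

lemma U_lift_coset: "f \<in> carrier T \<Longrightarrow> U_lift (U_ideal L +>\<^bsub>T\<^esub> f) = lift f"
  by (simp add: U_lift_def lift_coset)

lemma lift_one: "lift \<one>\<^bsub>T\<^esub> = 1"
  by (simp add: free_algebra_simps free_lift_one)

lemma U_lift_one: "U_lift \<one>\<^bsub>U_alg L\<^esub> = 1"
  using U_lift_coset[OF T.one_closed] by (simp add: coset_one lift_one)

lemma lift_image_U: "X \<in> carrier (U_alg L) \<Longrightarrow> lift ` X = {U_lift X}"
proof -
  assume "X \<in> carrier (U_alg L)"
  then obtain f where f: "f \<in> carrier T" and X: "X = U_ideal L +>\<^bsub>T\<^esub> f"
    unfolding carrier_U by (rule imageE)
  show ?thesis by (simp only: X lift_coset[OF f] U_lift_coset[OF f])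
qed

lemma U_lift_u_ideal: "X \<in> u_ideal L \<Longrightarrow> U_lift X = 0"
proof (rule U.genideal_kernel[OF U_lift_hom u_rels_sub])
  fix r assume "r \<in> u_rels"
  then obtain x where x: "x \<in> carrier L"
    and r: "r = U_gen L x [^]\<^bsub>U_alg L\<^esub> CHAR('k) \<ominus>\<^bsub>U_alg L\<^esub> U_gen L (p_map L x)"
    unfolding u_rels_def by auto
  have g: "U_lift (U_gen L y) = \<rho> y" if "y \<in> carrier L" for y
    using that by (simp add: U_gen_def U_lift_coset free_lift_gen)
  have "U_lift (U_gen L x [^]\<^bsub>U_alg L\<^esub> n) = \<rho> x ^ n" for n :: nat
    using U_lift_hom x U_gen_in[OF x]
    by (induction n) (simp_all add: U_lift_one ring_map_def g power_Suc2 del: power_Suc)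
  then show "U_lift r = 0"
    using x by (simp add: r U.ring_map_minus[OF U_lift_hom] U_gen_in p_closed g rho_p_map)
qed (simp add: u_ideal_eq)

definition u_lift :: "('g list \<Rightarrow> 'k) set set \<Rightarrow> 'r" where
  "u_lift Y = the_elem (lift ` \<Union>Y)"

lemma lift_Union_class:
  assumes "f \<in> carrier T"
  shows "lift ` \<Union>(u_class L f) = {lift f}"
proof -
  let ?X = "U_ideal L +>\<^bsub>T\<^esub> f"
  have X: "?X \<in> carrier (U_alg L)" using assms by (simp add: carrier_U)
  have "U_lift ` (u_class L f) = {lift f}"
    using U.ring_map_coset[OF U_lift_hom u_ideal U_lift_u_ideal X]
    by (simp only: U_lift_coset assms u_class_def)
  moreover have "u_class L f \<subseteq> carrier (U_alg L)"
    unfolding u_class_def by (rule U.a_r_coset_subset_G[OF _ X]) (rule additive_subgroup.a_subset[OF ideal.axioms(1)[OF u_ideal]])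
  ultimately have Y: "lift ` Y = {lift f}" if "Y \<in> u_class L f" for Y
  proof -
    have "U_lift Y = lift f"
      using \<open>U_lift ` (u_class L f) = {lift f}\<close> that by (metis imageI singletonD)
    moreover have "Y \<in> carrier (U_alg L)"
      using \<open>u_class L f \<subseteq> carrier (U_alg L)\<close> that by (rule subsetD)
    ultimately show ?thesis using lift_image_U by simp
  qed
  have "u_class L f \<noteq> {}"
    using \<open>U_lift ` (u_class L f) = {lift f}\<close> by (metis image_empty insert_not_empty)
  moreover have "lift ` \<Union>(u_class L f) = (\<Union>Y\<in>u_class L f. {lift f})"
    unfolding image_Union by (rule SUP_cong[OF refl Y])
  ultimately show ?thesis by simp
qed

lemma u_lift_class: "f \<in> carrier T \<Longrightarrow> u_lift (u_class L f) = lift f"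
  by (simp add: u_lift_def lift_Union_class)

lemma u_lift_hom:
  assumes "a \<in> carrier (u_alg L)" "b \<in> carrier (u_alg L)"
  shows u_lift_add: "u_lift (a \<oplus>\<^bsub>u_alg L\<^esub> b) = u_lift a + u_lift b"
    and u_lift_mult: "u_lift (a \<otimes>\<^bsub>u_alg L\<^esub> b) = u_lift a * u_lift b"
    and u_lift_smult: "u_lift (c \<odot>\<^bsub>u_alg L\<^esub> a) = \<kappa> c * u_lift a"
proof -
  obtain f g where fg: "f \<in> carrier T" "g \<in> carrier T" "a = u_class L f" "b = u_class L g"
    using assms carrier_u by auto
  have sum: "lift (f \<oplus>\<^bsub>T\<^esub> g) = lift f + lift g" and prod: "lift (f \<otimes>\<^bsub>T\<^esub> g) = lift f * lift g"
    using lift_hom fg(1,2) unfolding ring_map_def by blast+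
  have scale: "lift (c \<odot>\<^bsub>T\<^esub> f) = \<kappa> c * lift f"
    by (simp add: free_algebra_simps free_lift_scale)
  show "u_lift (a \<oplus>\<^bsub>u_alg L\<^esub> b) = u_lift a + u_lift b"
    using u_lift_class[of "f \<oplus>\<^bsub>T\<^esub> g"] fg(1,2)
    by (simp only: fg(3,4) u_class_add[OF fg(1,2), symmetric] u_lift_class sum T.a_closed)
  show "u_lift (a \<otimes>\<^bsub>u_alg L\<^esub> b) = u_lift a * u_lift b"
    using u_lift_class[of "f \<otimes>\<^bsub>T\<^esub> g"] fg(1,2)
    by (simp only: fg(3,4) u_class_mult[OF fg(1,2), symmetric] u_lift_class prod T.m_closed)
  show "u_lift (c \<odot>\<^bsub>u_alg L\<^esub> a) = \<kappa> c * u_lift a"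
    using u_lift_class[of "c \<odot>\<^bsub>T\<^esub> f"] fg(1)
    by (simp only: fg(3) u_class_smult[OF fg(1), symmetric] u_lift_class scale T.smult_closed)
qed

lemma u_lift_one: "u_lift \<one>\<^bsub>u_alg L\<^esub> = 1"
  using u_lift_class[OF T.one_closed] by (simp add: u_class_one lift_one)

lemma u_lift_zero: "u_lift \<zero>\<^bsub>u_alg L\<^esub> = 0"
  using u_lift_add[of "\<zero>\<^bsub>u_alg L\<^esub>" "\<zero>\<^bsub>u_alg L\<^esub>"] by simp

lemma u_lift_gen: "x \<in> carrier L \<Longrightarrow> u_lift (u_gen L x) = \<rho> x"
  by (simp add: u_gen_def u_lift_class free_lift_gen)

end

section \<open>Quotients of vector spaces by the kernel of a functional\<close>

lemma base_field_simps [simp]: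
  "carrier base_field = UNIV" "add base_field = (+)" "smult base_field = (*)"
  by (simp_all add: base_field_def)

lemma factor_whole:
  assumes "abelian_group V"
  shows "carrier (factor V (carrier V)) = {\<zero>\<^bsub>factor V (carrier V)\<^esub>}"
proof -
  interpret V: abelian_group V by fact
  have "carrier V +>\<^bsub>V\<^esub> x = carrier V" if x: "x \<in> carrier V" for x
  proof
    show "carrier V +>\<^bsub>V\<^esub> x \<subseteq> carrier V" using x by (auto simp: a_r_coset_def')
    show "carrier V \<subseteq> carrier V +>\<^bsub>V\<^esub> x"
    proof
      fix y assume y: "y \<in> carrier V"
      then have "y = (y \<ominus>\<^bsub>V\<^esub> x) \<oplus>\<^bsub>V\<^esub> x"
        using x by (simp add: V.minus_eq V.a_assoc V.l_neg)
      with x y show "y \<in> carrier V +>\<^bsub>V\<^esub> x" unfolding a_r_coset_def' by blast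
    qed
  qed
  then show ?thesis using V.zero_closed by (auto simp: A_RCOSETS_def')
qed

text \<open>A nonzero linear functional identifies the quotient by its kernel with the field.\<close>

lemma factor_kernel_linear_iso:
  fixes V :: "('k::field, 'v) module" and \<phi> :: "'v \<Rightarrow> 'k"
  assumes V: "abelian_group V"
    and smult: "\<And>c x. x \<in> carrier V \<Longrightarrow> c \<odot>\<^bsub>V\<^esub> x \<in> carrier V"
    and add: "\<And>x y. \<lbrakk>x \<in> carrier V; y \<in> carrier V\<rbrakk> \<Longrightarrow> \<phi> (x \<oplus>\<^bsub>V\<^esub> y) = \<phi> x + \<phi> y"
    and scale: "\<And>c x. x \<in> carrier V \<Longrightarrow> \<phi> (c \<odot>\<^bsub>V\<^esub> x) = c * \<phi> x"
    and nz: "\<exists>x\<in>carrier V. \<phi> x \<noteq> 0"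
  shows "linear_iso (factor V {x \<in> carrier V. \<phi> x = 0}) base_field"
proof -
  interpret V: abelian_group V by fact
  define K where "K = {x \<in> carrier V. \<phi> x = 0}"
  define fib where "fib t = {x \<in> carrier V. \<phi> x = t}" for t
  have zero: "\<phi> \<zero>\<^bsub>V\<^esub> = 0"
    using add[OF V.zero_closed V.zero_closed] by (metis V.l_zero V.zero_closed add_cancel_right_left)
  have diff: "\<phi> (x \<ominus>\<^bsub>V\<^esub> y) = \<phi> x - \<phi> y" if "x \<in> carrier V" "y \<in> carrier V" for x y
  proof -
    have "\<phi> y + \<phi> (\<ominus>\<^bsub>V\<^esub> y) = 0" using add[of y "\<ominus>\<^bsub>V\<^esub> y"] that by (simp add: V.r_neg zero)
    then show ?thesis using add[of x "\<ominus>\<^bsub>V\<^esub> y"] that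
      by (simp add: V.minus_eq eq_neg_iff_add_eq_0 add.commute)
  qed
  have split: "y = (y \<ominus>\<^bsub>V\<^esub> x) \<oplus>\<^bsub>V\<^esub> x" if "x \<in> carrier V" "y \<in> carrier V" for x y
    using that by (simp add: V.minus_eq V.a_assoc V.l_neg)
  have coset: "K +>\<^bsub>V\<^esub> x = fib (\<phi> x)" if x: "x \<in> carrier V" for x
  proof
    show "K +>\<^bsub>V\<^esub> x \<subseteq> fib (\<phi> x)" using x add by (auto simp: a_r_coset_def' K_def fib_def)
    show "fib (\<phi> x) \<subseteq> K +>\<^bsub>V\<^esub> x"
    proof
      fix y assume y: "y \<in> fib (\<phi> x)"
      then have "y \<ominus>\<^bsub>V\<^esub> x \<in> K" using x diff by (auto simp: K_def fib_def)
      with split[of x y] x y show "y \<in> K +>\<^bsub>V\<^esub> x" unfolding a_r_coset_def' fib_def by blast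
    qed
  qed
  have ex: "\<exists>x\<in>carrier V. \<phi> x = t" for t
  proof -
    obtain x where "x \<in> carrier V" "\<phi> x \<noteq> 0" using nz by blast
    then show ?thesis using smult scale by (intro bexI[of _ "(t / \<phi> x) \<odot>\<^bsub>V\<^esub> x"]) auto
  qed
  have car: "carrier (factor V K) = range fib"
  proof -
    have "carrier (factor V K) = (\<lambda>x. fib (\<phi> x)) ` carrier V"
      using coset by (auto simp: A_RCOSETS_def')
    also have "\<dots> = range fib" using ex by (auto simp: image_iff) metis
    finally show ?thesis .
  qed
  have img: "\<phi> ` fib t = {t}" for t using ex[of t] by (auto simp: fib_def)
  have sum: "fib s \<oplus>\<^bsub>factor V K\<^esub> fib t = fib (s + t)" for s t
  proof -
    obtain x y where xy: "x \<in> carrier V" "\<phi> x = s" "y \<in> carrier V" "\<phi> y = t" using ex by blast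
    have "fib s <+>\<^bsub>V\<^esub> fib t = fib (s + t)"
    proof
      show "fib s <+>\<^bsub>V\<^esub> fib t \<subseteq> fib (s + t)" using add by (auto simp: set_add_def' fib_def)
      show "fib (s + t) \<subseteq> fib s <+>\<^bsub>V\<^esub> fib t"
      proof
        fix z assume z: "z \<in> fib (s + t)"
        then have "z \<ominus>\<^bsub>V\<^esub> y \<in> fib s" using xy diff by (auto simp: fib_def)
        moreover have "y \<in> fib t" using xy by (simp add: fib_def)
        moreover have "z = (z \<ominus>\<^bsub>V\<^esub> y) \<oplus>\<^bsub>V\<^esub> y" using split xy z by (auto simp: fib_def)
        ultimately show "z \<in> fib s <+>\<^bsub>V\<^esub> fib t" unfolding set_add_def' by blast
      qed
    qed
    then show ?thesis by simp
  qed
  have scl: "c \<odot>\<^bsub>factor V K\<^esub> fib t = fib (c * t)" for c t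
  proof -
    obtain x where x: "x \<in> carrier V" "\<phi> x = t" using ex by blast
    have "K <+>\<^bsub>V\<^esub> (\<lambda>x. c \<odot>\<^bsub>V\<^esub> x) ` fib t = fib (c * t)"
    proof
      show "K <+>\<^bsub>V\<^esub> (\<lambda>x. c \<odot>\<^bsub>V\<^esub> x) ` fib t \<subseteq> fib (c * t)"
        using add smult scale by (auto simp: set_add_def' fib_def K_def)
      show "fib (c * t) \<subseteq> K <+>\<^bsub>V\<^esub> (\<lambda>x. c \<odot>\<^bsub>V\<^esub> x) ` fib t"
      proof
        fix z assume z: "z \<in> fib (c * t)"
        have "z \<ominus>\<^bsub>V\<^esub> c \<odot>\<^bsub>V\<^esub> x \<in> K" using z x diff smult scale by (auto simp: fib_def K_def)
        moreover have "c \<odot>\<^bsub>V\<^esub> x \<in> (\<lambda>x. c \<odot>\<^bsub>V\<^esub> x) ` fib t" using x by (simp add: fib_def)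
        moreover have "z = (z \<ominus>\<^bsub>V\<^esub> c \<odot>\<^bsub>V\<^esub> x) \<oplus>\<^bsub>V\<^esub> c \<odot>\<^bsub>V\<^esub> x" using split x z smult by (auto simp: fib_def)
        ultimately show "z \<in> K <+>\<^bsub>V\<^esub> (\<lambda>x. c \<odot>\<^bsub>V\<^esub> x) ` fib t" unfolding set_add_def' by blast
      qed
    qed
    then show ?thesis by simp
  qed
  have "linear_iso (factor V K) base_field"
    unfolding linear_iso_def
  proof (intro exI[of _ "\<lambda>X. the_elem (\<phi> ` X)"] conjI ballI allI)
    show "bij_betw (\<lambda>X. the_elem (\<phi> ` X)) (carrier (factor V K)) (carrier base_field)"
      unfolding car by (rule bij_betwI[where g = fib]) (auto simp: img)
  qed (auto simp: car sum scl img simp del: factor_simps)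
  then show ?thesis by (simp only: K_def)
qed

section \<open>Left modules and free modules\<close>

locale left_module = A: ring A + M: abelian_group M
  for A :: "('k, 'a) module" and M :: "('a, 'm) module" +
  assumes act_closed [simp]: "\<lbrakk>a \<in> carrier A; x \<in> carrier M\<rbrakk> \<Longrightarrow> a \<odot>\<^bsub>M\<^esub> x \<in> carrier M"
    and act_add_left: "\<lbrakk>a \<in> carrier A; b \<in> carrier A; x \<in> carrier M\<rbrakk>
      \<Longrightarrow> (a \<oplus>\<^bsub>A\<^esub> b) \<odot>\<^bsub>M\<^esub> x = a \<odot>\<^bsub>M\<^esub> x \<oplus>\<^bsub>M\<^esub> b \<odot>\<^bsub>M\<^esub> x"
    and act_add_right: "\<lbrakk>a \<in> carrier A; x \<in> carrier M; y \<in> carrier M\<rbrakk>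
      \<Longrightarrow> a \<odot>\<^bsub>M\<^esub> (x \<oplus>\<^bsub>M\<^esub> y) = a \<odot>\<^bsub>M\<^esub> x \<oplus>\<^bsub>M\<^esub> a \<odot>\<^bsub>M\<^esub> y"
    and act_mult: "\<lbrakk>a \<in> carrier A; b \<in> carrier A; x \<in> carrier M\<rbrakk>
      \<Longrightarrow> (a \<otimes>\<^bsub>A\<^esub> b) \<odot>\<^bsub>M\<^esub> x = a \<odot>\<^bsub>M\<^esub> (b \<odot>\<^bsub>M\<^esub> x)"
    and act_one [simp]: "x \<in> carrier M \<Longrightarrow> \<one>\<^bsub>A\<^esub> \<odot>\<^bsub>M\<^esub> x = x"
begin

lemma act_zero_left [simp]: "x \<in> carrier M \<Longrightarrow> \<zero>\<^bsub>A\<^esub> \<odot>\<^bsub>M\<^esub> x = \<zero>\<^bsub>M\<^esub>"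
  using act_add_left[of "\<zero>\<^bsub>A\<^esub>" "\<zero>\<^bsub>A\<^esub>" x] by (metis A.l_zero A.zero_closed M.add.r_cancel_one act_closed)

lemma act_zero_right [simp]: "a \<in> carrier A \<Longrightarrow> a \<odot>\<^bsub>M\<^esub> \<zero>\<^bsub>M\<^esub> = \<zero>\<^bsub>M\<^esub>"
  using act_add_right[of a "\<zero>\<^bsub>M\<^esub>" "\<zero>\<^bsub>M\<^esub>"] by (metis M.l_zero M.zero_closed M.add.r_cancel_one act_closed)

end

definition lin_map :: "('k, 'a) module \<Rightarrow> ('a, 'm) module \<Rightarrow> ('a, 'n) module \<Rightarrow> ('m \<Rightarrow> 'n) \<Rightarrow> bool" where
  "lin_map A M N h \<longleftrightarrow> h \<in> carrier M \<rightarrow> carrier N \<and>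
     (\<forall>x\<in>carrier M. \<forall>y\<in>carrier M. h (x \<oplus>\<^bsub>M\<^esub> y) = h x \<oplus>\<^bsub>N\<^esub> h y) \<and>
     (\<forall>a\<in>carrier A. \<forall>x\<in>carrier M. h (a \<odot>\<^bsub>M\<^esub> x) = a \<odot>\<^bsub>N\<^esub> h x)"

lemma lin_mapD:
  assumes "lin_map A M N h"
  shows "x \<in> carrier M \<Longrightarrow> h x \<in> carrier N"
    and "\<lbrakk>x \<in> carrier M; y \<in> carrier M\<rbrakk> \<Longrightarrow> h (x \<oplus>\<^bsub>M\<^esub> y) = h x \<oplus>\<^bsub>N\<^esub> h y"
    and "\<lbrakk>a \<in> carrier A; x \<in> carrier M\<rbrakk> \<Longrightarrow> h (a \<odot>\<^bsub>M\<^esub> x) = a \<odot>\<^bsub>N\<^esub> h x"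
  using assms by (auto simp: lin_map_def)

lemma lin_map_zero:
  assumes "left_module A M" "left_module A N" "lin_map A M N h"
  shows "h \<zero>\<^bsub>M\<^esub> = \<zero>\<^bsub>N\<^esub>"
proof -
  interpret M: left_module A M by fact
  interpret N: left_module A N by fact
  have "h (\<zero>\<^bsub>A\<^esub> \<odot>\<^bsub>M\<^esub> \<zero>\<^bsub>M\<^esub>) = \<zero>\<^bsub>A\<^esub> \<odot>\<^bsub>N\<^esub> h \<zero>\<^bsub>M\<^esub>"
    by (rule lin_mapD(3)[OF assms(3)]) simp_all
  then show ?thesis using lin_mapD(1)[OF assms(3), of "\<zero>\<^bsub>M\<^esub>"] by simp
qed

lemma lin_map_minus:
  assumes "left_module A M" "left_module A N" "lin_map A M N h" "x \<in> carrier M" "y \<in> carrier M"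
  shows "h (x \<ominus>\<^bsub>M\<^esub> y) = h x \<ominus>\<^bsub>N\<^esub> h y"
proof -
  interpret M: left_module A M by fact
  interpret N: left_module A N by fact
  note h = lin_mapD[OF assms(3)]
  have "h (x \<ominus>\<^bsub>M\<^esub> y) \<oplus>\<^bsub>N\<^esub> h y = h x"
    using h(2)[of "x \<ominus>\<^bsub>M\<^esub> y" y] assms(4,5) by (simp add: M.M.minus_eq M.M.a_assoc M.M.l_neg)
  then show ?thesis using h(1) assms(4,5)
    by (metis M.M.minus_closed N.M.add.inv_solve_right N.M.minus_eq a_inv_def)
qed

lemma lin_map_comp:
  "\<lbrakk>lin_map A M N h; lin_map A N Q g\<rbrakk> \<Longrightarrow> lin_map A M Q (\<lambda>x. g (h x))"
  unfolding lin_map_def Pi_iff by (intro conjI ballI) (simp_all)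

lemma free_module_simps [simp]:
  "carrier (free_module A X) = {f. (\<forall>x\<in>X. f x \<in> carrier A) \<and> (\<forall>x. x \<notin> X \<longrightarrow> f x = \<zero>\<^bsub>A\<^esub>) \<and> finite {x. f x \<noteq> \<zero>\<^bsub>A\<^esub>}}"
  "zero (free_module A X) = (\<lambda>_. \<zero>\<^bsub>A\<^esub>)"
  "f \<oplus>\<^bsub>free_module A X\<^esub> g = (\<lambda>x. f x \<oplus>\<^bsub>A\<^esub> g x)"
  "a \<odot>\<^bsub>free_module A X\<^esub> f = (\<lambda>x. a \<otimes>\<^bsub>A\<^esub> f x)"
  by (simp_all add: free_module_def)

definition basis_at :: "('k, 'a) module \<Rightarrow> 'x \<Rightarrow> 'a \<Rightarrow> 'x \<Rightarrow> 'a" where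
  "basis_at A x a = (\<lambda>y. if y = x then a else \<zero>\<^bsub>A\<^esub>)"

definition lin_ext :: "('k, 'a) module \<Rightarrow> ('a, 'n) module \<Rightarrow> ('x \<Rightarrow> 'n) \<Rightarrow> ('x \<Rightarrow> 'a) \<Rightarrow> 'n" where
  "lin_ext A N t f = finsum N (\<lambda>x. f x \<odot>\<^bsub>N\<^esub> t x) {x. f x \<noteq> \<zero>\<^bsub>A\<^esub>}"

lemma free_eval_eq_lin_ext: "free_eval A M = lin_ext A M (\<lambda>x. x)"
  by (simp add: free_eval_def lin_ext_def fun_eq_iff)


context
  fixes A :: "('k, 'a) module"
  assumes A: "ring A"
begin

interpretation A: ring A by (rule A)

lemma free_module_carrier_val: "f \<in> carrier (free_module A X) \<Longrightarrow> f x \<in> carrier A"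
  by (cases "x \<in> X") auto

lemma left_module_free_module: "left_module A (free_module A X)"
proof -
  let ?F = "free_module A X"
  note val = free_module_carrier_val[of _ X]
  have fin: "finite {x. f x \<oplus>\<^bsub>A\<^esub> g x \<noteq> \<zero>\<^bsub>A\<^esub>}"
    if "finite {x. f x \<noteq> \<zero>\<^bsub>A\<^esub>}" "finite {x. g x \<noteq> \<zero>\<^bsub>A\<^esub>}" for f g :: "'b \<Rightarrow> 'a"
    by (rule finite_subset[of _ "{x. f x \<noteq> \<zero>\<^bsub>A\<^esub>} \<union> {x. g x \<noteq> \<zero>\<^bsub>A\<^esub>}"]) (use that in auto)
  have add: "f \<oplus>\<^bsub>?F\<^esub> g \<in> carrier ?F" if "f \<in> carrier ?F" "g \<in> carrier ?F" for f g
    using that fin by auto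
  have smult: "a \<odot>\<^bsub>?F\<^esub> f \<in> carrier ?F" if "a \<in> carrier A" "f \<in> carrier ?F" for a f
    using that by (auto intro: finite_subset[of _ "{x. f x \<noteq> \<zero>\<^bsub>A\<^esub>}"])
  have "abelian_group ?F"
  proof (rule abelian_groupI)
    fix f g h assume "f \<in> carrier ?F" "g \<in> carrier ?F" "h \<in> carrier ?F"
    then have "f x \<in> carrier A" "g x \<in> carrier A" "h x \<in> carrier A" for x
      by (auto simp del: free_module_simps intro: val)
    then show "f \<oplus>\<^bsub>?F\<^esub> g \<oplus>\<^bsub>?F\<^esub> h = f \<oplus>\<^bsub>?F\<^esub> (g \<oplus>\<^bsub>?F\<^esub> h)" by (simp add: A.a_assoc)
  next
    fix f g assume "f \<in> carrier ?F" "g \<in> carrier ?F"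
    then have "f x \<in> carrier A" "g x \<in> carrier A" for x by (auto simp del: free_module_simps intro: val)
    then show "f \<oplus>\<^bsub>?F\<^esub> g = g \<oplus>\<^bsub>?F\<^esub> f" by (simp add: A.a_comm)
  next
    fix f assume f: "f \<in> carrier ?F"
    then have fx: "f x \<in> carrier A" for x by (rule val)
    then show "\<zero>\<^bsub>?F\<^esub> \<oplus>\<^bsub>?F\<^esub> f = f" by simp
    have "(\<lambda>x. \<ominus>\<^bsub>A\<^esub> f x) \<in> carrier ?F"
      using f by (auto intro: finite_subset[of _ "{x. f x \<noteq> \<zero>\<^bsub>A\<^esub>}"])
    moreover have "(\<lambda>x. \<ominus>\<^bsub>A\<^esub> f x) \<oplus>\<^bsub>?F\<^esub> f = \<zero>\<^bsub>?F\<^esub>" using fx by (simp add: A.l_neg)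
    ultimately show "\<exists>g\<in>carrier ?F. g \<oplus>\<^bsub>?F\<^esub> f = \<zero>\<^bsub>?F\<^esub>" by blast
  next
    show "\<zero>\<^bsub>?F\<^esub> \<in> carrier ?F" by simp
  qed (rule add)
  then show ?thesis
  proof (intro left_module.intro left_module_axioms.intro A)
    fix a b f assume "a \<in> carrier A" "b \<in> carrier A" "f \<in> carrier ?F"
    moreover from this have "f x \<in> carrier A" for x by (auto simp del: free_module_simps intro: val)
    ultimately show "(a \<oplus>\<^bsub>A\<^esub> b) \<odot>\<^bsub>?F\<^esub> f = a \<odot>\<^bsub>?F\<^esub> f \<oplus>\<^bsub>?F\<^esub> b \<odot>\<^bsub>?F\<^esub> f"
      "(a \<otimes>\<^bsub>A\<^esub> b) \<odot>\<^bsub>?F\<^esub> f = a \<odot>\<^bsub>?F\<^esub> (b \<odot>\<^bsub>?F\<^esub> f)"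
      by (simp_all add: A.l_distr A.m_assoc)
  next
    fix a f g assume "a \<in> carrier A" "f \<in> carrier ?F" "g \<in> carrier ?F"
    moreover from this have "f x \<in> carrier A" "g x \<in> carrier A" for x by (auto simp del: free_module_simps intro: val)
    ultimately show "a \<odot>\<^bsub>?F\<^esub> (f \<oplus>\<^bsub>?F\<^esub> g) = a \<odot>\<^bsub>?F\<^esub> f \<oplus>\<^bsub>?F\<^esub> a \<odot>\<^bsub>?F\<^esub> g"
      by (simp add: A.r_distr)
  next
    fix f assume "f \<in> carrier ?F"
    then have "f x \<in> carrier A" for x by (rule val)
    then show "\<one>\<^bsub>A\<^esub> \<odot>\<^bsub>?F\<^esub> f = f" by simp
  qed (assumption | rule smult; assumption)+
qed

lemma basis_at_in: "\<lbrakk>x \<in> X; a \<in> carrier A\<rbrakk> \<Longrightarrow> basis_at A x a \<in> carrier (free_module A X)"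
  by (auto simp: basis_at_def intro: finite_subset[of _ "{x}"])

lemma basis_at_hom:
  assumes "a \<in> carrier A" "b \<in> carrier A"
  shows "basis_at A x (a \<oplus>\<^bsub>A\<^esub> b) = basis_at A x a \<oplus>\<^bsub>free_module A X\<^esub> basis_at A x b"
    and "basis_at A x (a \<otimes>\<^bsub>A\<^esub> b) = a \<odot>\<^bsub>free_module A X\<^esub> basis_at A x b"
  using assms by (auto simp: basis_at_def)

text \<open>Linear maps on a free module agree if they agree on the basis, by induction on the support.\<close>

lemma lin_map_unique:
  assumes N: "left_module A N"
    and g: "lin_map A (free_module A X) N g" and h: "lin_map A (free_module A X) N h"
    and eq: "\<And>x. x \<in> X \<Longrightarrow> g (basis_at A x \<one>\<^bsub>A\<^esub>) = h (basis_at A x \<one>\<^bsub>A\<^esub>)"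
    and f: "f \<in> carrier (free_module A X)"
  shows "g f = h f"
proof -
  let ?F = "free_module A X"
  have "g f = h f" if "finite S" "{x. f x \<noteq> \<zero>\<^bsub>A\<^esub>} \<subseteq> S" "f \<in> carrier ?F" for S f
    using that
  proof (induction S arbitrary: f rule: finite_induct)
    case empty
    then have "f = \<zero>\<^bsub>?F\<^esub>" by auto
    then show ?case
      using lin_map_zero[OF left_module_free_module N g] lin_map_zero[OF left_module_free_module N h] by simp
  next
    case (insert x S)
    show ?case
    proof (cases "f x = \<zero>\<^bsub>A\<^esub>")
      case True
      then show ?thesis using insert.prems by (intro insert.IH) auto
    next
      case False
      let ?f = "f(x := \<zero>\<^bsub>A\<^esub>)"
      have x: "x \<in> X" "f x \<in> carrier A" using False insert.prems(2) by auto
      have f': "?f \<in> carrier ?F"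
        using insert.prems(2) by (auto intro: finite_subset[of _ "{x. f x \<noteq> \<zero>\<^bsub>A\<^esub>}"])
      have b: "basis_at A x \<one>\<^bsub>A\<^esub> \<in> carrier ?F" using x by (intro basis_at_in) auto
      have vals: "f y \<in> carrier A" for y by (rule free_module_carrier_val[OF insert.prems(2)])
      have dec: "f = ?f \<oplus>\<^bsub>?F\<^esub> f x \<odot>\<^bsub>?F\<^esub> basis_at A x \<one>\<^bsub>A\<^esub>"
        using x vals by (auto simp: basis_at_def fun_eq_iff)
      have sm: "f x \<odot>\<^bsub>?F\<^esub> basis_at A x \<one>\<^bsub>A\<^esub> \<in> carrier ?F"
        using left_module.act_closed[OF left_module_free_module x(2) b] .
      have "g ?f = h ?f" using insert.prems f' by (intro insert.IH) auto
      then have "g (?f \<oplus>\<^bsub>?F\<^esub> f x \<odot>\<^bsub>?F\<^esub> basis_at A x \<one>\<^bsub>A\<^esub>) = h (?f \<oplus>\<^bsub>?F\<^esub> f x \<odot>\<^bsub>?F\<^esub> basis_at A x \<one>\<^bsub>A\<^esub>)"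
        by (simp only: lin_mapD(2)[OF g f' sm] lin_mapD(2)[OF h f' sm] lin_mapD(3)[OF g x(2) b]
            lin_mapD(3)[OF h x(2) b] eq[OF x(1)])
      then show ?thesis using dec by metis
    qed
  qed
  then show ?thesis using f by auto
qed

context
  fixes N :: "('a, 'n) module" and t :: "'x \<Rightarrow> 'n" and X :: "'x set"
  assumes N: "left_module A N" and t: "t \<in> X \<rightarrow> carrier N"
begin

interpretation N: left_module A N by (rule N)

lemma lin_ext_superset:
  assumes f: "f \<in> carrier (free_module A X)" and S: "finite S" "{x. f x \<noteq> \<zero>\<^bsub>A\<^esub>} \<subseteq> S" "S \<subseteq> X"
  shows "lin_ext A N t f = (\<Oplus>\<^bsub>N\<^esub>x\<in>S. f x \<odot>\<^bsub>N\<^esub> t x)"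
  unfolding lin_ext_def
proof (rule N.M.add.finprod_mono_neutral_cong_left)
  show "f i \<odot>\<^bsub>N\<^esub> t i = \<zero>\<^bsub>N\<^esub>" if "i \<in> S - {x. f x \<noteq> \<zero>\<^bsub>A\<^esub>}" for i
    using that S t by (auto intro!: N.act_zero_left)
  show "(\<lambda>x. f x \<odot>\<^bsub>N\<^esub> t x) \<in> S \<rightarrow> carrier N"
    using f S t by (auto intro!: N.act_closed)
qed (use S in auto)

lemma lin_map_lin_ext: "lin_map A (free_module A X) N (lin_ext A N t)"
proof -
  let ?F = "free_module A X"
  have supp: "finite {x. f x \<noteq> \<zero>\<^bsub>A\<^esub>}" "{x. f x \<noteq> \<zero>\<^bsub>A\<^esub>} \<subseteq> X" if "f \<in> carrier ?F" for f
    using that by auto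
  have tm: "(\<lambda>x. f x \<odot>\<^bsub>N\<^esub> t x) \<in> S \<rightarrow> carrier N" if "f \<in> carrier ?F" "S \<subseteq> X" for f S
    using that t by (auto intro!: N.act_closed)
  have "lin_ext A N t f \<in> carrier N" if "f \<in> carrier ?F" for f
    using lin_ext_superset[OF that supp(1)[OF that] subset_refl supp(2)[OF that]] tm[OF that supp(2)[OF that]]
    by (simp add: N.M.finsum_closed)
  moreover have "lin_ext A N t (f \<oplus>\<^bsub>?F\<^esub> g) = lin_ext A N t f \<oplus>\<^bsub>N\<^esub> lin_ext A N t g"
    if f: "f \<in> carrier ?F" and g: "g \<in> carrier ?F" for f g
  proof -
    let ?S = "{x. f x \<noteq> \<zero>\<^bsub>A\<^esub>} \<union> {x. g x \<noteq> \<zero>\<^bsub>A\<^esub>}"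
    have S: "finite ?S" "?S \<subseteq> X" using supp f g by auto
    have fg: "f \<oplus>\<^bsub>?F\<^esub> g \<in> carrier ?F"
      using left_module_free_module[of X] f g by (meson abelian_group.axioms(1) abelian_monoid.a_closed left_module.axioms(2))
    have "lin_ext A N t (f \<oplus>\<^bsub>?F\<^esub> g) = (\<Oplus>\<^bsub>N\<^esub>x\<in>?S. (f \<oplus>\<^bsub>?F\<^esub> g) x \<odot>\<^bsub>N\<^esub> t x)"
      by (rule lin_ext_superset[OF fg S(1) _ S(2)]) auto
    also have "\<dots> = (\<Oplus>\<^bsub>N\<^esub>x\<in>?S. f x \<odot>\<^bsub>N\<^esub> t x \<oplus>\<^bsub>N\<^esub> g x \<odot>\<^bsub>N\<^esub> t x)"
    proof (rule N.M.finsum_cong')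
      show "(\<lambda>x. f x \<odot>\<^bsub>N\<^esub> t x \<oplus>\<^bsub>N\<^esub> g x \<odot>\<^bsub>N\<^esub> t x) \<in> ?S \<rightarrow> carrier N"
        using tm[OF f S(2)] tm[OF g S(2)] by (auto simp: Pi_iff)
      fix x assume "x \<in> ?S"
      then have "x \<in> X" using S(2) by blast
      with t have "t x \<in> carrier N" by blast
      then show "(f \<oplus>\<^bsub>?F\<^esub> g) x \<odot>\<^bsub>N\<^esub> t x = f x \<odot>\<^bsub>N\<^esub> t x \<oplus>\<^bsub>N\<^esub> g x \<odot>\<^bsub>N\<^esub> t x"
        using free_module_carrier_val[OF f, of x] free_module_carrier_val[OF g, of x] by (simp add: N.act_add_left)
    qed simp
    also have "\<dots> = (\<Oplus>\<^bsub>N\<^esub>x\<in>?S. f x \<odot>\<^bsub>N\<^esub> t x) \<oplus>\<^bsub>N\<^esub> (\<Oplus>\<^bsub>N\<^esub>x\<in>?S. g x \<odot>\<^bsub>N\<^esub> t x)"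
      by (rule N.M.finsum_addf[OF tm[OF f S(2)] tm[OF g S(2)]])
    also have "(\<Oplus>\<^bsub>N\<^esub>x\<in>?S. f x \<odot>\<^bsub>N\<^esub> t x) = lin_ext A N t f"
      by (rule lin_ext_superset[OF f S(1) _ S(2), symmetric]) auto
    also have "(\<Oplus>\<^bsub>N\<^esub>x\<in>?S. g x \<odot>\<^bsub>N\<^esub> t x) = lin_ext A N t g"
      by (rule lin_ext_superset[OF g S(1) _ S(2), symmetric]) auto
    finally show ?thesis .
  qed
  moreover have "lin_ext A N t (a \<odot>\<^bsub>?F\<^esub> f) = a \<odot>\<^bsub>N\<^esub> lin_ext A N t f"
    if a: "a \<in> carrier A" and f: "f \<in> carrier ?F" for a f
  proof -
    let ?S = "{x. f x \<noteq> \<zero>\<^bsub>A\<^esub>}"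
    have af: "a \<odot>\<^bsub>?F\<^esub> f \<in> carrier ?F"
      using left_module.act_closed[OF left_module_free_module a f] .
    have fin_act: "a \<odot>\<^bsub>N\<^esub> (\<Oplus>\<^bsub>N\<^esub>x\<in>S. h x) = (\<Oplus>\<^bsub>N\<^esub>x\<in>S. a \<odot>\<^bsub>N\<^esub> h x)"
      if "finite S" "h \<in> S \<rightarrow> carrier N" for S and h :: "'x \<Rightarrow> 'n"
      using that
    proof (induction S rule: finite_induct)
      case empty
      then show ?case using a by simp
    next
      case (insert x S)
      then have "h \<in> S \<rightarrow> carrier N" "h x \<in> carrier N" "(\<lambda>x. a \<odot>\<^bsub>N\<^esub> h x) \<in> S \<rightarrow> carrier N"
        using a by (auto intro!: N.act_closed)
      with insert a show ?case by (simp add: N.M.finsum_insert N.act_add_right N.M.finsum_closed)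
    qed
    have "lin_ext A N t (a \<odot>\<^bsub>?F\<^esub> f) = (\<Oplus>\<^bsub>N\<^esub>x\<in>?S. (a \<odot>\<^bsub>?F\<^esub> f) x \<odot>\<^bsub>N\<^esub> t x)"
      by (rule lin_ext_superset[OF af supp(1)[OF f] _ supp(2)[OF f]]) (use a in auto)
    also have "\<dots> = (\<Oplus>\<^bsub>N\<^esub>x\<in>?S. a \<odot>\<^bsub>N\<^esub> (f x \<odot>\<^bsub>N\<^esub> t x))"
    proof (rule N.M.finsum_cong')
      show "(\<lambda>x. a \<odot>\<^bsub>N\<^esub> (f x \<odot>\<^bsub>N\<^esub> t x)) \<in> ?S \<rightarrow> carrier N"
        using tm[OF f supp(2)[OF f]] a by (auto simp: Pi_iff)
      fix x assume "x \<in> ?S"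
      then have "t x \<in> carrier N" using supp(2)[OF f] t by blast
      then show "(a \<odot>\<^bsub>?F\<^esub> f) x \<odot>\<^bsub>N\<^esub> t x = a \<odot>\<^bsub>N\<^esub> (f x \<odot>\<^bsub>N\<^esub> t x)"
        using free_module_carrier_val[OF f, of x] a by (simp add: N.act_mult)
    qed simp
    also have "\<dots> = a \<odot>\<^bsub>N\<^esub> lin_ext A N t f"
      using fin_act[OF supp(1)[OF f] tm[OF f supp(2)[OF f]]] by (simp add: lin_ext_def)
    finally show ?thesis .
  qed
  ultimately show ?thesis unfolding lin_map_def by blast
qed

lemma lin_ext_basis:
  assumes "x \<in> X" "a \<in> carrier A"
  shows "lin_ext A N t (basis_at A x a) = a \<odot>\<^bsub>N\<^esub> t x"
proof -
  have tx: "t x \<in> carrier N" using assms t by blast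
  have "lin_ext A N t (basis_at A x a) = (\<Oplus>\<^bsub>N\<^esub>y\<in>{x}. basis_at A x a y \<odot>\<^bsub>N\<^esub> t y)"
    by (rule lin_ext_superset[OF basis_at_in[OF assms]]) (use assms in \<open>auto simp: basis_at_def\<close>)
  also have "\<dots> = a \<odot>\<^bsub>N\<^esub> t x"
    using tx assms by (simp add: basis_at_def)
  finally show ?thesis .
qed

end

end

section \<open>Extensions of a cyclic module\<close>

definition regular_module :: "('k, 'a) module \<Rightarrow> ('a, 'a) module" where
  "regular_module A = \<lparr>carrier = carrier A, mult = undefined, one = undefined,
     zero = \<zero>\<^bsub>A\<^esub>, add = add A, smult = mult A\<rparr>"

lemma regular_module_simps [simp]:
  "carrier (regular_module A) = carrier A" "zero (regular_module A) = \<zero>\<^bsub>A\<^esub>"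
  "add (regular_module A) = add A" "smult (regular_module A) = mult A"
  by (simp_all add: regular_module_def)

lemma left_module_regular:
  assumes "ring A"
  shows "left_module A (regular_module A)"
proof -
  interpret A: ring A by fact
  have "abelian_group (regular_module A)"
    by (rule abelian_group_cong[OF A.abelian_group_axioms]) simp_all
  then show ?thesis
    by (intro left_module.intro left_module_axioms.intro assms)
      (simp_all add: A.l_distr A.r_distr A.m_assoc)
qed

text \<open>For a cyclic module \<open>M = A v\<close> with annihilator \<open>J\<close> of \<open>v\<close>, the sequence \<open>J \<rightarrow> A \<rightarrow> M\<close> computes
  \<open>Ext\<^sup>1(M, N)\<close> as the cokernel of \<open>N \<rightarrow> Hom(J, N)\<close>. The locale transports this description to the
  canonical free resolution.\<close>

locale cyclic_ext = A: kalgebra A + M: left_module A M + N: left_module A N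
  for A :: "('k::field, 'a) module" and M :: "('a, 'm) module" and N :: "('a, 'n) module" +
  fixes v :: 'm
  assumes v: "v \<in> carrier M"
    and cyclic: "m \<in> carrier M \<Longrightarrow> \<exists>a\<in>carrier A. m = a \<odot>\<^bsub>M\<^esub> v"
begin

definition ann :: "'a set" where
  "ann = {a \<in> carrier A. a \<odot>\<^bsub>M\<^esub> v = \<zero>\<^bsub>M\<^esub>}"

definition ann_hom :: "('a \<Rightarrow> 'n) \<Rightarrow> bool" where
  "ann_hom f \<longleftrightarrow> (\<forall>a\<in>ann. f a \<in> carrier N) \<and> (\<forall>a\<in>ann. \<forall>b\<in>ann. f (a \<oplus>\<^bsub>A\<^esub> b) = f a \<oplus>\<^bsub>N\<^esub> f b) \<and>
     (\<forall>a\<in>carrier A. \<forall>b\<in>ann. f (a \<otimes>\<^bsub>A\<^esub> b) = a \<odot>\<^bsub>N\<^esub> f b)"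

definition inner :: "('a \<Rightarrow> 'n) \<Rightarrow> bool" where
  "inner f \<longleftrightarrow> (\<exists>n\<in>carrier N. \<forall>a\<in>ann. f a = a \<odot>\<^bsub>N\<^esub> n)"

definition "P0 = free_module A (carrier M)"
definition "X1 = {f \<in> carrier P0. free_eval A M f = \<zero>\<^bsub>M\<^esub>}"
definition "P1 = free_module A X1"
definition "d1 = free_eval A P0"
definition "X2 = {f \<in> carrier P1. d1 f = \<zero>\<^bsub>P0\<^esub>}"
definition "P2 = free_module A X2"
definition "d2 = free_eval A P1"
definition "Z = {h \<in> carrier (Hom_module A P1 N). \<forall>f\<in>carrier P2. h (d2 f) = \<zero>\<^bsub>N\<^esub>}"
definition "B = (\<lambda>g. compose (carrier P1) g d1) ` carrier (Hom_module A P0 N)"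
definition "HZ = (Hom_module A P1 N)\<lparr>carrier := Z\<rparr>"

lemma Ext1_eq: "Ext1 A M N = factor HZ B"
  unfolding Ext1_def Let_def HZ_def Z_def B_def d2_def P2_def X2_def d1_def P1_def X1_def P0_def ..

lemma P0_mod: "left_module A P0" and P1_mod: "left_module A P1" and P2_mod: "left_module A P2"
  unfolding P0_def P1_def P2_def by (intro left_module_free_module A.ring_axioms)+

sublocale P0: left_module A P0 by (rule P0_mod)
sublocale P1: left_module A P1 by (rule P1_mod)
sublocale P2: left_module A P2 by (rule P2_mod)

lemma eval_lin: "lin_map A P0 M (free_eval A M)"
  unfolding P0_def free_eval_eq_lin_ext by (rule lin_map_lin_ext[OF A.ring_axioms M.left_module_axioms]) auto

lemma d1_lin: "lin_map A P1 P0 d1"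
  unfolding P1_def d1_def free_eval_eq_lin_ext
  by (rule lin_map_lin_ext[OF A.ring_axioms P0_mod]) (auto simp: X1_def)

lemma d2_lin: "lin_map A P2 P1 d2"
  unfolding P2_def d2_def free_eval_eq_lin_ext
  by (rule lin_map_lin_ext[OF A.ring_axioms P1_mod]) (auto simp: X2_def)

lemma eval_basis: "\<lbrakk>m \<in> carrier M; a \<in> carrier A\<rbrakk> \<Longrightarrow> free_eval A M (basis_at A m a) = a \<odot>\<^bsub>M\<^esub> m"
  unfolding free_eval_eq_lin_ext
  by (rule lin_ext_basis[OF A.ring_axioms M.left_module_axioms, where X = "carrier M" and t = "\<lambda>x. x"]) auto

lemma d1_basis: "\<lbrakk>x \<in> X1; a \<in> carrier A\<rbrakk> \<Longrightarrow> d1 (basis_at A x a) = a \<odot>\<^bsub>P0\<^esub> x"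
  unfolding d1_def free_eval_eq_lin_ext
  by (rule lin_ext_basis[OF A.ring_axioms P0_mod, where X = X1 and t = "\<lambda>x. x"]) (auto simp: X1_def)

lemma d2_basis: "\<lbrakk>x \<in> X2; a \<in> carrier A\<rbrakk> \<Longrightarrow> d2 (basis_at A x a) = a \<odot>\<^bsub>P1\<^esub> x"
  unfolding d2_def free_eval_eq_lin_ext
  by (rule lin_ext_basis[OF A.ring_axioms P1_mod, where X = X2 and t = "\<lambda>x. x"]) (auto simp: X2_def)

lemma basis_P0: "\<lbrakk>m \<in> carrier M; a \<in> carrier A\<rbrakk> \<Longrightarrow> basis_at A m a \<in> carrier P0"
  unfolding P0_def by (rule basis_at_in[OF A.ring_axioms])

lemma basis_P1: "\<lbrakk>x \<in> X1; a \<in> carrier A\<rbrakk> \<Longrightarrow> basis_at A x a \<in> carrier P1"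
  unfolding P1_def by (rule basis_at_in[OF A.ring_axioms])

lemma basis_P2: "\<lbrakk>x \<in> X2; a \<in> carrier A\<rbrakk> \<Longrightarrow> basis_at A x a \<in> carrier P2"
  unfolding P2_def by (rule basis_at_in[OF A.ring_axioms])

lemma zero_lin: "left_module A Q \<Longrightarrow> left_module A R \<Longrightarrow> lin_map A Q R (\<lambda>_. \<zero>\<^bsub>R\<^esub>)"
proof -
  assume "left_module A Q" "left_module A R"
  then interpret Q: left_module A Q + R: left_module A R by auto
  show ?thesis by (simp add: lin_map_def)
qed

lemma X1_sub: "x \<in> X1 \<Longrightarrow> x \<in> carrier P0"
  by (simp add: X1_def)

lemma d1_in: "u \<in> carrier P1 \<Longrightarrow> d1 u \<in> X1"
proof -
  assume u: "u \<in> carrier P1"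
  have "free_eval A M (d1 u) = \<zero>\<^bsub>M\<^esub>"
  proof (rule lin_map_unique[OF A.ring_axioms M.left_module_axioms, where X = X1
        and g = "\<lambda>u. free_eval A M (d1 u)" and h = "\<lambda>_. \<zero>\<^bsub>M\<^esub>" and f = u])
    show "lin_map A (free_module A X1) M (\<lambda>u. free_eval A M (d1 u))"
      using lin_map_comp[OF d1_lin eval_lin] by (simp only: P1_def)
    show "lin_map A (free_module A X1) M (\<lambda>_. \<zero>\<^bsub>M\<^esub>)"
      using zero_lin[OF P1_mod M.left_module_axioms] by (simp only: P1_def)
    show "u \<in> carrier (free_module A X1)" using u by (simp only: P1_def)
    fix x assume x: "x \<in> X1"
    then have "d1 (basis_at A x \<one>\<^bsub>A\<^esub>) = x" by (simp add: d1_basis X1_sub)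
    with x show "free_eval A M (d1 (basis_at A x \<one>\<^bsub>A\<^esub>)) = \<zero>\<^bsub>M\<^esub>" by (simp add: X1_def)
  qed
  then show ?thesis using lin_mapD(1)[OF d1_lin u] by (simp add: X1_def)
qed

lemma d1_d2: "f \<in> carrier P2 \<Longrightarrow> d1 (d2 f) = \<zero>\<^bsub>P0\<^esub>"
proof (rule lin_map_unique[OF A.ring_axioms P0_mod, where X = X2
      and g = "\<lambda>u. d1 (d2 u)" and h = "\<lambda>_. \<zero>\<^bsub>P0\<^esub>" and f = f])
  show "lin_map A (free_module A X2) P0 (\<lambda>u. d1 (d2 u))"
    using lin_map_comp[OF d2_lin d1_lin] by (simp only: P2_def)
  show "lin_map A (free_module A X2) P0 (\<lambda>_. \<zero>\<^bsub>P0\<^esub>)"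
    using zero_lin[OF P2_mod P0_mod] by (simp only: P2_def)
  fix x assume x: "x \<in> X2"
  then have "d2 (basis_at A x \<one>\<^bsub>A\<^esub>) = x" by (simp add: d2_basis X2_def)
  with x show "d1 (d2 (basis_at A x \<one>\<^bsub>A\<^esub>)) = \<zero>\<^bsub>P0\<^esub>" by (simp add: X2_def)
qed (simp only: P2_def)

lemma X1_act: "\<lbrakk>a \<in> carrier A; x \<in> X1\<rbrakk> \<Longrightarrow> a \<odot>\<^bsub>P0\<^esub> x \<in> X1"
  using lin_mapD(3)[OF eval_lin] by (simp add: X1_def)

text \<open>\<open>coef\<close> below lifts the evaluation \<open>P\<^sub>0 \<rightarrow> M\<close> to a map \<open>P\<^sub>0 \<rightarrow> A\<close>. Choosing \<open>sec v = 1\<close> makes it split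
  the inclusion of \<open>A\<close> at the basis vector \<open>v\<close>.\<close>

definition sec :: "'m \<Rightarrow> 'a" where
  "sec m = (if m = v then \<one>\<^bsub>A\<^esub> else SOME a. a \<in> carrier A \<and> m = a \<odot>\<^bsub>M\<^esub> v)"

lemma sec: assumes "m \<in> carrier M" shows "sec m \<in> carrier A" "sec m \<odot>\<^bsub>M\<^esub> v = m"
proof -
  have "\<exists>a. a \<in> carrier A \<and> m = a \<odot>\<^bsub>M\<^esub> v" using cyclic[OF assms] by blast
  then have "(SOME a. a \<in> carrier A \<and> m = a \<odot>\<^bsub>M\<^esub> v) \<in> carrier A \<and>
      m = (SOME a. a \<in> carrier A \<and> m = a \<odot>\<^bsub>M\<^esub> v) \<odot>\<^bsub>M\<^esub> v" by (rule someI_ex)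
  then show "sec m \<in> carrier A" "sec m \<odot>\<^bsub>M\<^esub> v = m" using v by (auto simp: sec_def)
qed

definition coef :: "('m \<Rightarrow> 'a) \<Rightarrow> 'a" where
  "coef = lin_ext A (regular_module A) sec"

lemma coef_lin: "lin_map A P0 (regular_module A) coef"
  unfolding P0_def coef_def
  by (rule lin_map_lin_ext[OF A.ring_axioms left_module_regular[OF A.ring_axioms]]) (auto intro: sec)

lemma coef_basis: "\<lbrakk>m \<in> carrier M; a \<in> carrier A\<rbrakk> \<Longrightarrow> coef (basis_at A m a) = a \<otimes>\<^bsub>A\<^esub> sec m"
  unfolding coef_def
  using lin_ext_basis[OF A.ring_axioms left_module_regular[OF A.ring_axioms], of sec "carrier M" m a] sec by auto

lemma coef_in: "x \<in> carrier P0 \<Longrightarrow> coef x \<in> carrier A"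
  using lin_mapD(1)[OF coef_lin] by simp

lemma eval_eq: "x \<in> carrier P0 \<Longrightarrow> free_eval A M x = coef x \<odot>\<^bsub>M\<^esub> v"
proof (rule lin_map_unique[OF A.ring_axioms M.left_module_axioms, where X = "carrier M"
      and g = "free_eval A M" and h = "\<lambda>x. coef x \<odot>\<^bsub>M\<^esub> v" and f = x])
  show "lin_map A (free_module A (carrier M)) M (free_eval A M)"
    using eval_lin by (simp only: P0_def)
  have "lin_map A (regular_module A) M (\<lambda>a. a \<odot>\<^bsub>M\<^esub> v)"
    using v by (simp add: lin_map_def M.act_add_left M.act_mult)
  from lin_map_comp[OF coef_lin this]
  show "lin_map A (free_module A (carrier M)) M (\<lambda>x. coef x \<odot>\<^bsub>M\<^esub> v)" by (simp only: P0_def)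
qed (simp_all only: P0_def eval_basis coef_basis A.one_closed A.l_one M.act_one sec)

lemma coef_ann: "x \<in> X1 \<Longrightarrow> coef x \<in> ann"
  using eval_eq[of x] coef_in[of x] by (simp add: X1_def ann_def)

abbreviation "sv \<equiv> basis_at A v"

lemma sv_in: "a \<in> carrier A \<Longrightarrow> sv a \<in> carrier P0"
  using v by (rule basis_P0)

lemma sv_ann: "a \<in> ann \<Longrightarrow> sv a \<in> X1"
  using v by (simp add: X1_def ann_def sv_in eval_basis)

lemma sv_hom:
  assumes "a \<in> carrier A" "b \<in> carrier A"
  shows "sv (a \<oplus>\<^bsub>A\<^esub> b) = sv a \<oplus>\<^bsub>P0\<^esub> sv b" and "sv (a \<otimes>\<^bsub>A\<^esub> b) = a \<odot>\<^bsub>P0\<^esub> sv b"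
  using basis_at_hom[OF A.ring_axioms assms] by (simp_all only: P0_def)

lemma coef_sv: "a \<in> carrier A \<Longrightarrow> coef (sv a) = a"
  using v by (simp add: coef_basis sec_def)

definition rem :: "('m \<Rightarrow> 'a) \<Rightarrow> 'm \<Rightarrow> 'a" where
  "rem x = x \<ominus>\<^bsub>P0\<^esub> sv (coef x)"

lemma rem_in: "x \<in> carrier P0 \<Longrightarrow> rem x \<in> X1"
proof -
  assume x: "x \<in> carrier P0"
  then have s: "sv (coef x) \<in> carrier P0" by (simp add: coef_in sv_in)
  have "free_eval A M (rem x) = free_eval A M x \<ominus>\<^bsub>M\<^esub> free_eval A M (sv (coef x))"
    unfolding rem_def by (rule lin_map_minus[OF P0_mod M.left_module_axioms eval_lin x s])
  also have "\<dots> = \<zero>\<^bsub>M\<^esub>"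
    using x v by (simp add: eval_eq sv_in coef_in coef_sv M.M.minus_eq M.M.r_neg)
  finally show ?thesis using x s by (simp add: X1_def rem_def)
qed

text \<open>\<open>P\<^sub>0 = rem(P\<^sub>0) \<oplus> A\<close>, and \<open>rem(P\<^sub>0)\<close> lies in the kernel of the evaluation, so that kernel is
  \<open>rem(P\<^sub>0) \<oplus> J\<close>. Maps on the kernel therefore matter only through their restriction to \<open>J\<close>.\<close>

lemma rem_split: "x \<in> carrier P0 \<Longrightarrow> x = rem x \<oplus>\<^bsub>P0\<^esub> sv (coef x)"
  using sv_in[OF coef_in] by (simp add: rem_def P0.M.minus_eq P0.M.a_assoc P0.M.l_neg)

lemma rem_hom:
  assumes "x \<in> carrier P0" "y \<in> carrier P0"
  shows "rem (x \<oplus>\<^bsub>P0\<^esub> y) = rem x \<oplus>\<^bsub>P0\<^esub> rem y"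
proof -
  have s: "sv (coef x) \<in> carrier P0" "sv (coef y) \<in> carrier P0"
    using assms by (simp_all add: coef_in sv_in)
  have "coef (x \<oplus>\<^bsub>P0\<^esub> y) = coef x \<oplus>\<^bsub>A\<^esub> coef y" using lin_mapD(2)[OF coef_lin assms] by simp
  then show ?thesis
    using assms s by (simp add: rem_def sv_hom coef_in P0.M.minus_eq P0.M.minus_add P0.M.a_ac)
qed

lemma rem_act:
  assumes "a \<in> carrier A" "x \<in> carrier P0"
  shows "rem (a \<odot>\<^bsub>P0\<^esub> x) = a \<odot>\<^bsub>P0\<^esub> rem x"
proof -
  have s: "sv (coef x) \<in> carrier P0" using assms by (simp add: coef_in sv_in)
  have c: "coef (a \<odot>\<^bsub>P0\<^esub> x) = a \<otimes>\<^bsub>A\<^esub> coef x" using lin_mapD(3)[OF coef_lin assms] by simp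
  have eq: "a \<odot>\<^bsub>P0\<^esub> x = a \<odot>\<^bsub>P0\<^esub> rem x \<oplus>\<^bsub>P0\<^esub> a \<odot>\<^bsub>P0\<^esub> sv (coef x)"
    using P0.act_add_right[OF assms(1) X1_sub[OF rem_in[OF assms(2)]] s] rem_split[OF assms(2)] by simp
  have "rem (a \<odot>\<^bsub>P0\<^esub> x) = a \<odot>\<^bsub>P0\<^esub> x \<ominus>\<^bsub>P0\<^esub> a \<odot>\<^bsub>P0\<^esub> sv (coef x)"
    using assms by (simp add: rem_def c sv_hom coef_in)
  also have "\<dots> = a \<odot>\<^bsub>P0\<^esub> rem x"
    unfolding eq using assms s X1_sub[OF rem_in[OF assms(2)]]
    by (simp add: P0.M.minus_eq P0.M.a_assoc P0.M.r_neg)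
  finally show ?thesis .
qed

lemma Hom_simps [simp]:
  "\<And>Q. zero (Hom_module A Q N) = (\<lambda>x\<in>carrier Q. \<zero>\<^bsub>N\<^esub>)"
  "\<And>Q f g. f \<oplus>\<^bsub>Hom_module A Q N\<^esub> g = (\<lambda>x\<in>carrier Q. f x \<oplus>\<^bsub>N\<^esub> g x)"
  "\<And>Q c f. c \<odot>\<^bsub>Hom_module A Q N\<^esub> f = (\<lambda>x\<in>carrier Q. (c \<odot>\<^bsub>A\<^esub> \<one>\<^bsub>A\<^esub>) \<odot>\<^bsub>N\<^esub> f x)"
  by (simp_all add: Hom_module_def)

lemma Hom_carrier: "h \<in> carrier (Hom_module A Q N) \<longleftrightarrow> lin_map A Q N h \<and> h \<in> extensional (carrier Q)"
  by (auto simp: Hom_module_def lin_map_def PiE_def)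

lemma Hom_carrierI:
  assumes "left_module A Q" "lin_map A Q N h"
  shows "restrict h (carrier Q) \<in> carrier (Hom_module A Q N)"
proof -
  interpret Q: left_module A Q by fact
  show ?thesis using assms(2) by (simp add: Hom_carrier lin_map_def Pi_iff)
qed

lemma Z_iff: "h \<in> Z \<longleftrightarrow> lin_map A P1 N h \<and> h \<in> extensional (carrier P1) \<and> (\<forall>f\<in>carrier P2. h (d2 f) = \<zero>\<^bsub>N\<^esub>)"
  by (auto simp: Z_def Hom_carrier)

lemma HZ_simps [simp]:
  "carrier HZ = Z" "zero HZ = (\<lambda>x\<in>carrier P1. \<zero>\<^bsub>N\<^esub>)"
  "f \<oplus>\<^bsub>HZ\<^esub> g = (\<lambda>x\<in>carrier P1. f x \<oplus>\<^bsub>N\<^esub> g x)"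
  "c \<odot>\<^bsub>HZ\<^esub> f = (\<lambda>x\<in>carrier P1. (c \<odot>\<^bsub>A\<^esub> \<one>\<^bsub>A\<^esub>) \<odot>\<^bsub>N\<^esub> f x)"
  by (simp_all add: HZ_def)

lemma scalar_act_comm:
  assumes "a \<in> carrier A" "n \<in> carrier N"
  shows "(c \<odot>\<^bsub>A\<^esub> \<one>\<^bsub>A\<^esub>) \<odot>\<^bsub>N\<^esub> (a \<odot>\<^bsub>N\<^esub> n) = a \<odot>\<^bsub>N\<^esub> ((c \<odot>\<^bsub>A\<^esub> \<one>\<^bsub>A\<^esub>) \<odot>\<^bsub>N\<^esub> n)"
  using assms A.smult_one_central[of a c] by (simp flip: N.act_mult)

lemma d2_in: "f \<in> carrier P2 \<Longrightarrow> d2 f \<in> carrier P1"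
  by (rule lin_mapD(1)[OF d2_lin])

lemma Z_add: "\<lbrakk>f \<in> Z; g \<in> Z\<rbrakk> \<Longrightarrow> f \<oplus>\<^bsub>HZ\<^esub> g \<in> Z"
  by (simp add: Z_iff lin_map_def Pi_iff N.act_add_right d2_in N.M.a_ac)

lemma Z_smult: "f \<in> Z \<Longrightarrow> c \<odot>\<^bsub>HZ\<^esub> f \<in> Z"
  by (simp add: Z_iff lin_map_def Pi_iff N.act_add_right d2_in scalar_act_comm)

lemma Z_val: "\<lbrakk>f \<in> Z; u \<in> carrier P1\<rbrakk> \<Longrightarrow> f u \<in> carrier N"
  by (auto simp: Z_iff lin_map_def)

lemma HZ_group: "abelian_group HZ"
proof (rule abelian_groupI)
  fix f g h assume fgh: "f \<in> carrier HZ" "g \<in> carrier HZ" "h \<in> carrier HZ"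
  then show "f \<oplus>\<^bsub>HZ\<^esub> g \<oplus>\<^bsub>HZ\<^esub> h = f \<oplus>\<^bsub>HZ\<^esub> (g \<oplus>\<^bsub>HZ\<^esub> h)"
    by (auto simp: restrict_def fun_eq_iff N.M.a_assoc Z_val)
next
  fix f g assume "f \<in> carrier HZ" "g \<in> carrier HZ"
  then show "f \<oplus>\<^bsub>HZ\<^esub> g \<in> carrier HZ" using Z_add by simp
  show "f \<oplus>\<^bsub>HZ\<^esub> g = g \<oplus>\<^bsub>HZ\<^esub> f"
    using \<open>f \<in> carrier HZ\<close> \<open>g \<in> carrier HZ\<close> by (auto simp: restrict_def fun_eq_iff N.M.a_comm Z_val)
next
  show "\<zero>\<^bsub>HZ\<^esub> \<in> carrier HZ" by (simp add: Z_iff lin_map_def d2_in)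
next
  fix f assume f: "f \<in> carrier HZ"
  then show "\<zero>\<^bsub>HZ\<^esub> \<oplus>\<^bsub>HZ\<^esub> f = f"
    by (auto simp: restrict_def fun_eq_iff Z_val Z_iff extensional_def)
  have "(\<lambda>x\<in>carrier P1. \<ominus>\<^bsub>N\<^esub> f x) \<in> Z"
  proof -
    have "a \<odot>\<^bsub>N\<^esub> (\<ominus>\<^bsub>N\<^esub> n) = \<ominus>\<^bsub>N\<^esub> (a \<odot>\<^bsub>N\<^esub> n)" if "a \<in> carrier A" "n \<in> carrier N" for a n
      using that N.act_add_right[of a "\<ominus>\<^bsub>N\<^esub> n" n]
      by (metis N.M.a_inv_closed N.M.l_neg N.M.minus_equality N.act_closed N.act_zero_right)
    then show ?thesis
      using f by (simp add: Z_iff lin_map_def Pi_iff d2_in N.M.minus_add)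
  qed
  moreover have "(\<lambda>x\<in>carrier P1. \<ominus>\<^bsub>N\<^esub> f x) \<oplus>\<^bsub>HZ\<^esub> f = \<zero>\<^bsub>HZ\<^esub>"
    using f by (auto simp: restrict_def fun_eq_iff N.M.l_neg Z_val)
  ultimately show "\<exists>g\<in>carrier HZ. g \<oplus>\<^bsub>HZ\<^esub> f = \<zero>\<^bsub>HZ\<^esub>" by (auto simp del: HZ_simps(2,3))
qed

text \<open>A cocycle \<open>h\<close> factors through \<open>d\<^sub>1\<close>, so it is a linear map on the kernel \<open>X\<^sub>1\<close> of \<open>P\<^sub>0 \<rightarrow> M\<close>; its value
  at \<open>x\<close> is the value of \<open>h\<close> at the basis vector \<open>x\<close> of \<open>P\<^sub>1\<close>.\<close>

definition on_kernel :: "((('m \<Rightarrow> 'a) \<Rightarrow> 'a) \<Rightarrow> 'n) \<Rightarrow> ('m \<Rightarrow> 'a) \<Rightarrow> 'n" where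
  "on_kernel h x = h (basis_at A x \<one>\<^bsub>A\<^esub>)"

definition on_ann :: "((('m \<Rightarrow> 'a) \<Rightarrow> 'a) \<Rightarrow> 'n) \<Rightarrow> 'a \<Rightarrow> 'n" where
  "on_ann h a = on_kernel h (sv a)"

text \<open>If \<open>d\<^sub>1 u = x\<close> then \<open>u\<close> minus the basis vector \<open>x\<close> is a boundary, on which \<open>h\<close> vanishes.\<close>

lemma Z_d1:
  assumes h: "h \<in> Z" and u: "u \<in> carrier P1"
  shows "h u = on_kernel h (d1 u)"
proof -
  have lin: "lin_map A P1 N h" using h by (simp add: Z_iff)
  let ?u = "basis_at A (d1 u) \<one>\<^bsub>A\<^esub>"
  have u': "?u \<in> carrier P1" using d1_in[OF u] by (simp add: basis_P1)
  have "d1 ?u = d1 u" using d1_in[OF u] by (simp add: d1_basis X1_sub)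
  then have "d1 (u \<ominus>\<^bsub>P1\<^esub> ?u) = \<zero>\<^bsub>P0\<^esub>"
    using lin_map_minus[OF P1_mod P0_mod d1_lin u u'] X1_sub[OF d1_in[OF u]] by (simp add: P0.M.minus_eq P0.M.r_neg)
  then have x2: "u \<ominus>\<^bsub>P1\<^esub> ?u \<in> X2" using u u' by (simp add: X2_def)
  have "d2 (basis_at A (u \<ominus>\<^bsub>P1\<^esub> ?u) \<one>\<^bsub>A\<^esub>) = u \<ominus>\<^bsub>P1\<^esub> ?u"
    using x2 u u' by (simp add: d2_basis)
  then have "h (u \<ominus>\<^bsub>P1\<^esub> ?u) = \<zero>\<^bsub>N\<^esub>"
    using h basis_P2[OF x2 A.one_closed] unfolding Z_iff by metis
  then have "h u \<ominus>\<^bsub>N\<^esub> h ?u = \<zero>\<^bsub>N\<^esub>"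
    using lin_map_minus[OF P1_mod N.left_module_axioms lin u u'] by simp
  moreover have "h u = (h u \<ominus>\<^bsub>N\<^esub> h ?u) \<oplus>\<^bsub>N\<^esub> h ?u"
    using Z_val[OF h u] Z_val[OF h u'] by (simp add: N.M.minus_eq N.M.a_assoc N.M.l_neg)
  ultimately show ?thesis
    using Z_val[OF h u'] by (simp add: on_kernel_def)
qed

lemma on_kernel_hom:
  assumes h: "h \<in> Z"
  shows on_kernel_in: "x \<in> X1 \<Longrightarrow> on_kernel h x \<in> carrier N"
    and on_kernel_add: "\<lbrakk>x \<in> X1; y \<in> X1\<rbrakk> \<Longrightarrow> on_kernel h (x \<oplus>\<^bsub>P0\<^esub> y) = on_kernel h x \<oplus>\<^bsub>N\<^esub> on_kernel h y"
    and on_kernel_act: "\<lbrakk>a \<in> carrier A; x \<in> X1\<rbrakk> \<Longrightarrow> on_kernel h (a \<odot>\<^bsub>P0\<^esub> x) = a \<odot>\<^bsub>N\<^esub> on_kernel h x"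
proof -
  have lin: "lin_map A P1 N h" using h by (simp add: Z_iff)
  have b: "basis_at A x \<one>\<^bsub>A\<^esub> \<in> carrier P1" if "x \<in> X1" for x
    using that by (simp add: basis_P1)
  have d: "d1 (basis_at A x \<one>\<^bsub>A\<^esub>) = x" if "x \<in> X1" for x
    using that by (simp add: d1_basis X1_sub)
  show "on_kernel h x \<in> carrier N" if "x \<in> X1" using Z_val[OF h b[OF that]] by (simp add: on_kernel_def)
  show "on_kernel h (x \<oplus>\<^bsub>P0\<^esub> y) = on_kernel h x \<oplus>\<^bsub>N\<^esub> on_kernel h y" if x: "x \<in> X1" and y: "y \<in> X1"
  proof -
    let ?u = "basis_at A x \<one>\<^bsub>A\<^esub> \<oplus>\<^bsub>P1\<^esub> basis_at A y \<one>\<^bsub>A\<^esub>"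
    have "d1 ?u = x \<oplus>\<^bsub>P0\<^esub> y" using lin_mapD(2)[OF d1_lin b[OF x] b[OF y]] d x y by simp
    moreover have "?u \<in> carrier P1" using b x y by simp
    ultimately show ?thesis
      using Z_d1[OF h, of ?u] lin_mapD(2)[OF lin b[OF x] b[OF y]] by (simp add: on_kernel_def)
  qed
  show "on_kernel h (a \<odot>\<^bsub>P0\<^esub> x) = a \<odot>\<^bsub>N\<^esub> on_kernel h x" if a: "a \<in> carrier A" and x: "x \<in> X1"
  proof -
    let ?u = "a \<odot>\<^bsub>P1\<^esub> basis_at A x \<one>\<^bsub>A\<^esub>"
    have "d1 ?u = a \<odot>\<^bsub>P0\<^esub> x" using lin_mapD(3)[OF d1_lin a b[OF x]] d x by simp
    moreover have "?u \<in> carrier P1" using b a x by simp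
    ultimately show ?thesis
      using Z_d1[OF h, of ?u] lin_mapD(3)[OF lin a b[OF x]] by (simp add: on_kernel_def)
  qed
qed

lemma on_ann_hom: "h \<in> Z \<Longrightarrow> ann_hom (on_ann h)"
  unfolding ann_hom_def on_ann_def
  using on_kernel_in on_kernel_add on_kernel_act sv_ann sv_hom by (auto simp: ann_def)

lemma Z_from_kernel:
  assumes t: "\<And>x. x \<in> X1 \<Longrightarrow> t x \<in> carrier N"
    "\<And>x y. \<lbrakk>x \<in> X1; y \<in> X1\<rbrakk> \<Longrightarrow> t (x \<oplus>\<^bsub>P0\<^esub> y) = t x \<oplus>\<^bsub>N\<^esub> t y"
    "\<And>a x. \<lbrakk>a \<in> carrier A; x \<in> X1\<rbrakk> \<Longrightarrow> t (a \<odot>\<^bsub>P0\<^esub> x) = a \<odot>\<^bsub>N\<^esub> t x"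
  shows "(\<lambda>u\<in>carrier P1. t (d1 u)) \<in> Z"
    and "x \<in> X1 \<Longrightarrow> on_kernel (\<lambda>u\<in>carrier P1. t (d1 u)) x = t x"
proof -
  have zero: "\<zero>\<^bsub>P0\<^esub> \<in> X1" using X1_act[of "\<zero>\<^bsub>A\<^esub>"] d1_in[of "\<zero>\<^bsub>P1\<^esub>"] X1_sub by fastforce
  then have "t \<zero>\<^bsub>P0\<^esub> = \<zero>\<^bsub>N\<^esub>" using t(3)[of "\<zero>\<^bsub>A\<^esub>" "\<zero>\<^bsub>P0\<^esub>"] t(1) by simp
  then show "(\<lambda>u\<in>carrier P1. t (d1 u)) \<in> Z"
    using t d1_in lin_mapD(2,3)[OF d1_lin] by (simp add: Z_iff lin_map_def Pi_iff d2_in d1_d2)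
  show "on_kernel (\<lambda>u\<in>carrier P1. t (d1 u)) x = t x" if "x \<in> X1"
    using that by (simp add: on_kernel_def basis_P1 d1_basis X1_sub)
qed

lemma ex_cocycle:
  assumes f: "ann_hom f"
  shows "\<exists>h\<in>Z. \<forall>a\<in>ann. on_ann h a = f a"
proof -
  let ?t = "\<lambda>x. f (coef x)"
  have t: "?t x \<in> carrier N" if "x \<in> X1" for x
    using f coef_ann[OF that] by (simp add: ann_hom_def)
  have t2: "?t (x \<oplus>\<^bsub>P0\<^esub> y) = ?t x \<oplus>\<^bsub>N\<^esub> ?t y" if "x \<in> X1" "y \<in> X1" for x y
    using f coef_ann that lin_mapD(2)[OF coef_lin, of x y] X1_sub by (simp add: ann_hom_def)
  have t3: "?t (a \<odot>\<^bsub>P0\<^esub> x) = a \<odot>\<^bsub>N\<^esub> ?t x" if "a \<in> carrier A" "x \<in> X1" for a x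
    using f coef_ann that lin_mapD(3)[OF coef_lin, of a x] X1_sub by (simp add: ann_hom_def)
  have z: "(\<lambda>u\<in>carrier P1. ?t (d1 u)) \<in> Z"
    by (rule Z_from_kernel) (rule t t2 t3; assumption)+
  have k: "on_kernel (\<lambda>u\<in>carrier P1. ?t (d1 u)) x = ?t x" if "x \<in> X1" for x
    by (rule Z_from_kernel[where t = ?t]) (rule t t2 t3 that; assumption?)+
  have "on_ann (\<lambda>u\<in>carrier P1. ?t (d1 u)) a = f a" if "a \<in> ann" for a
    using k[OF sv_ann[OF that]] that coef_sv[of a] by (simp add: on_ann_def ann_def)
  then show ?thesis using z by blast
qed

text \<open>A coboundary restricts to an inner map, evaluated at the image of \<open>v\<close>. Conversely, if the
  restriction of \<open>h\<close> is inner with vector \<open>n\<close>, then \<open>h\<close> on the kernel extends to \<open>P\<^sub>0\<close> along the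
  splitting, with the value \<open>n\<close> on the summand \<open>A\<close>.\<close>

lemma B_iff: "h \<in> B \<longleftrightarrow> h \<in> Z \<and> inner (on_ann h)"
proof
  assume "h \<in> B"
  then obtain g where g: "lin_map A P0 N g" and h: "h = compose (carrier P1) g d1"
    by (auto simp: B_def Hom_carrier)
  have "(\<lambda>u\<in>carrier P1. g (d1 u)) \<in> Z"
    using lin_mapD[OF g] X1_sub by (intro Z_from_kernel) auto
  moreover have h': "h = (\<lambda>u\<in>carrier P1. g (d1 u))" by (simp add: h compose_def)
  moreover have "on_ann h a = a \<odot>\<^bsub>N\<^esub> g (sv \<one>\<^bsub>A\<^esub>)" if a: "a \<in> ann" for a
  proof -
    have a': "a \<in> carrier A" using a by (simp add: ann_def)
    have "on_ann h a = g (sv a)"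
      using sv_ann[OF a] by (simp add: h' on_ann_def on_kernel_def basis_P1 d1_basis X1_sub)
    also have "\<dots> = g (a \<odot>\<^bsub>P0\<^esub> sv \<one>\<^bsub>A\<^esub>)"
      using sv_hom(2)[OF a' A.one_closed] a' by simp
    also have "\<dots> = a \<odot>\<^bsub>N\<^esub> g (sv \<one>\<^bsub>A\<^esub>)"
      by (rule lin_mapD(3)[OF g a' sv_in]) simp
    finally show ?thesis .
  qed
  ultimately show "h \<in> Z \<and> inner (on_ann h)"
    using lin_mapD(1)[OF g sv_in[OF A.one_closed]] by (auto simp: inner_def)
next
  assume hZ: "h \<in> Z \<and> inner (on_ann h)"
  then have h: "h \<in> Z" by simp
  obtain n where n: "n \<in> carrier N" "\<And>a. a \<in> ann \<Longrightarrow> on_ann h a = a \<odot>\<^bsub>N\<^esub> n"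
    using hZ by (auto simp: inner_def)
  define g where "g x = on_kernel h (rem x) \<oplus>\<^bsub>N\<^esub> coef x \<odot>\<^bsub>N\<^esub> n" for x
  note k = on_kernel_in[OF h] on_kernel_add[OF h] on_kernel_act[OF h]
  have "lin_map A P0 N g"
    unfolding lin_map_def
  proof (intro conjI ballI)
    show "g \<in> carrier P0 \<rightarrow> carrier N"
      using n by (auto simp: g_def k rem_in coef_in)
    fix x y assume xy: "x \<in> carrier P0" "y \<in> carrier P0"
    have "coef (x \<oplus>\<^bsub>P0\<^esub> y) = coef x \<oplus>\<^bsub>A\<^esub> coef y" using lin_mapD(2)[OF coef_lin xy] by simp
    then show "g (x \<oplus>\<^bsub>P0\<^esub> y) = g x \<oplus>\<^bsub>N\<^esub> g y"
      using xy n by (simp add: g_def k rem_hom rem_in coef_in N.act_add_left N.M.a_ac)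
  next
    fix a x assume ax: "a \<in> carrier A" "x \<in> carrier P0"
    have "coef (a \<odot>\<^bsub>P0\<^esub> x) = a \<otimes>\<^bsub>A\<^esub> coef x" using lin_mapD(3)[OF coef_lin ax] by simp
    then show "g (a \<odot>\<^bsub>P0\<^esub> x) = a \<odot>\<^bsub>N\<^esub> g x"
      using ax n by (simp add: g_def k rem_act rem_in coef_in N.act_add_right N.act_mult)
  qed
  then have "restrict g (carrier P0) \<in> carrier (Hom_module A P0 N)"
    by (rule Hom_carrierI[OF P0_mod])
  moreover have "h = compose (carrier P1) (restrict g (carrier P0)) d1"
  proof
    fix u
    show "h u = compose (carrier P1) (restrict g (carrier P0)) d1 u"
    proof (cases "u \<in> carrier P1")
      case False
      then show ?thesis using h by (simp add: Z_iff extensional_def compose_def)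
    next
      case True
      then have x: "d1 u \<in> X1" by (rule d1_in)
      have "on_kernel h (d1 u) = on_kernel h (rem (d1 u)) \<oplus>\<^bsub>N\<^esub> on_kernel h (sv (coef (d1 u)))"
        using rem_split[OF X1_sub[OF x]] k(2)[OF rem_in[OF X1_sub[OF x]] sv_ann[OF coef_ann[OF x]]] by simp
      also have "on_kernel h (sv (coef (d1 u))) = coef (d1 u) \<odot>\<^bsub>N\<^esub> n"
        using n(2)[OF coef_ann[OF x]] by (simp add: on_ann_def)
      finally show ?thesis
        using True x Z_d1[OF h True] by (simp add: compose_def g_def X1_sub)
    qed
  qed
  ultimately show "h \<in> B" unfolding B_def by blast
qed

theorem Ext1_trivial:
  assumes "\<And>f. ann_hom f \<Longrightarrow> inner f"
  shows "carrier (Ext1 A M N) = {\<zero>\<^bsub>Ext1 A M N\<^esub>}"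
proof -
  have "B = carrier HZ" using B_iff assms on_ann_hom by auto
  then show ?thesis unfolding Ext1_eq using factor_whole[OF HZ_group] by simp
qed

theorem Ext1_one_dimensional:
  fixes \<theta> :: "('a \<Rightarrow> 'n) \<Rightarrow> 'k"
  assumes cong: "\<And>f g. (\<And>a. a \<in> ann \<Longrightarrow> f a = g a) \<Longrightarrow> \<theta> f = \<theta> g"
    and add: "\<And>f g. \<lbrakk>ann_hom f; ann_hom g\<rbrakk> \<Longrightarrow> \<theta> (\<lambda>a. f a \<oplus>\<^bsub>N\<^esub> g a) = \<theta> f + \<theta> g"
    and scale: "\<And>c f. ann_hom f \<Longrightarrow> \<theta> (\<lambda>a. (c \<odot>\<^bsub>A\<^esub> \<one>\<^bsub>A\<^esub>) \<odot>\<^bsub>N\<^esub> f a) = c * \<theta> f"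
    and ker: "\<And>f. ann_hom f \<Longrightarrow> \<theta> f = 0 \<longleftrightarrow> inner f"
    and ex: "\<exists>f. ann_hom f \<and> \<theta> f \<noteq> 0"
  shows "linear_iso (Ext1 A M N) base_field"
proof -
  define \<phi> where "\<phi> h = \<theta> (on_ann h)" for h
  have b: "basis_at A (sv a) \<one>\<^bsub>A\<^esub> \<in> carrier P1" if "a \<in> ann" for a
    using that by (simp add: sv_ann basis_P1)
  have "linear_iso (factor HZ {h \<in> carrier HZ. \<phi> h = 0}) base_field"
  proof (rule factor_kernel_linear_iso[OF HZ_group])
    fix c f assume f: "f \<in> carrier HZ"
    then show "c \<odot>\<^bsub>HZ\<^esub> f \<in> carrier HZ" using Z_smult by simp
    have "\<phi> (c \<odot>\<^bsub>HZ\<^esub> f) = \<theta> (\<lambda>a. (c \<odot>\<^bsub>A\<^esub> \<one>\<^bsub>A\<^esub>) \<odot>\<^bsub>N\<^esub> on_ann f a)"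
      unfolding \<phi>_def by (rule cong) (simp add: on_ann_def on_kernel_def b)
    then show "\<phi> (c \<odot>\<^bsub>HZ\<^esub> f) = c * \<phi> f" using f scale[OF on_ann_hom] by (simp add: \<phi>_def)
  next
    fix f g assume fg: "f \<in> carrier HZ" "g \<in> carrier HZ"
    have "\<phi> (f \<oplus>\<^bsub>HZ\<^esub> g) = \<theta> (\<lambda>a. on_ann f a \<oplus>\<^bsub>N\<^esub> on_ann g a)"
      unfolding \<phi>_def by (rule cong) (simp add: on_ann_def on_kernel_def b)
    then show "\<phi> (f \<oplus>\<^bsub>HZ\<^esub> g) = \<phi> f + \<phi> g" using fg add[OF on_ann_hom on_ann_hom] by (simp add: \<phi>_def)
  next
    obtain f where f: "ann_hom f" "\<theta> f \<noteq> 0" using ex by blast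
    then obtain h where "h \<in> Z" "\<forall>a\<in>ann. on_ann h a = f a" using ex_cocycle by blast
    then have "\<phi> h \<noteq> 0" using f cong[of "on_ann h" f] by (simp add: \<phi>_def)
    with \<open>h \<in> Z\<close> show "\<exists>h\<in>carrier HZ. \<phi> h \<noteq> 0" by auto
  qed
  moreover have "{h \<in> carrier HZ. \<phi> h = 0} = B"
    using B_iff ker[OF on_ann_hom] by (auto simp: \<phi>_def)
  ultimately show ?thesis by (simp add: Ext1_eq)
qed

end

section \<open>Linear endomorphisms of a space of functions\<close>

text \<open>A type is needed here, because the targets of representations are type-class rings. The index
  type is left open: it is \<open>int\<close> for a density module and \<open>int + int\<close> for an extension of two of them.\<close>

typedef (overloaded) ('i, 'k::field) endo =
  "{f :: ('i \<Rightarrow> 'k) \<Rightarrow> ('i \<Rightarrow> 'k). (\<forall>x y. f (x + y) = f x + f y) \<and> (\<forall>c x. f (\<lambda>i. c * x i) = (\<lambda>i. c * f x i))}"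
  morphisms app Endo
  by (rule exI[of _ "\<lambda>x. x"]) simp

lemma app_add: "app a (x + y) = app a x + app a y"
  and app_scale: "app a (\<lambda>i. c * x i) = (\<lambda>i. c * app a x i)"
  using app[of a] by auto

lemma app_zero: "app a 0 = 0"
  using app_add[of a 0 0] by simp

lemma app_Endo:
  assumes "\<And>x y. f (x + y) = f x + f y" "\<And>c x. f (\<lambda>i. c * x i) = (\<lambda>i. c * f x i)"
  shows "app (Endo f) = f"
  using assms by (intro Endo_inverse) auto

lemma endo_eqI: "(\<And>x. app a x = app b x) \<Longrightarrow> a = b"
  by (metis app_inject ext)

instantiation endo :: (type, field) ring_1
begin

definition "0 = Endo (\<lambda>x. 0)"
definition "1 = Endo (\<lambda>x. x)"
definition "a + b = Endo (\<lambda>x. app a x + app b x)"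
definition "a - b = Endo (\<lambda>x. app a x - app b x)"
definition "- a = Endo (\<lambda>x. - app a x)"
definition "a * b = Endo (\<lambda>x. app a (app b x))"

lemma app_simps0:
  "app (0 :: ('a, 'b) endo) x = 0" "app (1 :: ('a, 'b) endo) x = x"
  "app (a + b) x = app a x + app b x" "app (a - b) x = app a x - app b x"
  "app (- a) x = - app a x" "app (a * b) x = app a (app b x)"
  for a b :: "('a, 'b) endo"
proof -
  show "app (0 :: ('a, 'b) endo) x = 0"
    unfolding zero_endo_def by (subst app_Endo) (auto simp: fun_eq_iff)
  show "app (1 :: ('a, 'b) endo) x = x"
    unfolding one_endo_def by (subst app_Endo) (auto simp: fun_eq_iff)
  show "app (a + b) x = app a x + app b x"
    unfolding plus_endo_def by (subst app_Endo) (auto simp: fun_eq_iff app_add app_scale algebra_simps)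
  show "app (a - b) x = app a x - app b x"
    unfolding minus_endo_def by (subst app_Endo) (auto simp: fun_eq_iff app_add app_scale algebra_simps)
  show "app (- a) x = - app a x"
    unfolding uminus_endo_def by (subst app_Endo) (auto simp: fun_eq_iff app_add app_scale)
  show "app (a * b) x = app a (app b x)"
    unfolding times_endo_def by (subst app_Endo) (auto simp: fun_eq_iff app_add app_scale)
qed

instance
proof
  show "(0 :: ('a, 'b) endo) \<noteq> 1"
  proof
    assume "(0 :: ('a, 'b) endo) = 1"
    then have "app (0 :: ('a, 'b) endo) (\<lambda>_. 1) = app 1 (\<lambda>_. 1)" by simp
    then show False by (simp add: app_simps0 fun_eq_iff)
  qed
qed (rule endo_eqI; simp add: app_simps0 app_add fun_eq_iff algebra_simps)+

end

lemmas app_simps = app_simps0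

definition scalar :: "'k::field \<Rightarrow> ('i, 'k) endo" where
  "scalar c = Endo (\<lambda>x i. c * x i)"

lemma app_scalar: "app (scalar c) x = (\<lambda>i. c * x i)"
  unfolding scalar_def by (subst app_Endo) (auto simp: fun_eq_iff algebra_simps)

lemma algebra_map_scalar: "algebra_map (scalar :: 'k::field \<Rightarrow> ('i, 'k) endo)"
proof
  fix c d :: 'k and r :: "('i, 'k) endo"
  show "scalar 1 = (1 :: ('i, 'k) endo)" by (rule endo_eqI) (simp add: app_simps app_scalar)
  show "scalar (c + d) = (scalar c + scalar d :: ('i, 'k) endo)"
    by (rule endo_eqI) (simp add: app_simps app_scalar fun_eq_iff algebra_simps)
  show "scalar (c * d) = (scalar c * scalar d :: ('i, 'k) endo)"
    by (rule endo_eqI) (simp add: app_simps app_scalar fun_eq_iff algebra_simps)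
  show "scalar c * r = r * scalar c"
    by (rule endo_eqI) (simp add: app_simps app_scalar app_scale)
qed

lemma algebra_map_id: "algebra_map (\<lambda>c::'k::field. c)"
  by unfold_locales (simp_all add: algebra_simps)

section \<open>Representations of the Witt algebra and of its Borel subalgebra\<close>

lemma lookup_scale: "Poly_Mapping.lookup (Poly_Mapping.map ((*) c) x) i = c * Poly_Mapping.lookup (x :: 'a \<Rightarrow>\<^sub>0 'k::field) i"
  by (simp add: Poly_Mapping.map.rep_eq when_def)

lemma lookup_sum: "Poly_Mapping.lookup (sum f S) i = (\<Sum>x\<in>S. Poly_Mapping.lookup (f x) i)"
  by (induction S rule: infinite_finite_induct) (simp_all add: lookup_add)

definition witt_sub :: "((int \<Rightarrow>\<^sub>0 'k::field) \<Rightarrow> (int \<Rightarrow>\<^sub>0 'k)) \<Rightarrow> int set \<Rightarrow> ('k, int \<Rightarrow>\<^sub>0 'k) restricted_lie" where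
  "witt_sub pm I = (witt pm)\<lparr>carrier := {x. Poly_Mapping.keys x \<subseteq> I}\<rparr>"

lemma witt_eq_witt_sub: "witt (pm :: (int \<Rightarrow>\<^sub>0 'k::field) \<Rightarrow> _) = witt_sub pm (witt_range TYPE('k))"
  by (simp add: witt_def witt_sub_def)

lemma witt_borel_eq_witt_sub: "witt_borel (pm :: (int \<Rightarrow>\<^sub>0 'k::field) \<Rightarrow> _) = witt_sub pm {0..int CHAR('k) - 2}"
  by (simp add: witt_borel_def witt_sub_def)

lemma witt_sub_simps [simp]:
  "carrier (witt_sub pm I) = {x. Poly_Mapping.keys x \<subseteq> I}"
  "lie_scale (witt_sub pm I) c = Poly_Mapping.map ((*) c)"
  "bracket (witt_sub pm I) = witt_bracket"
  "p_map (witt_sub pm I) = pm"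
  by (simp_all add: witt_sub_def witt_def)

lemma in_keys_subset_iff: "Poly_Mapping.keys x \<subseteq> I \<longleftrightarrow> (\<forall>i. i \<notin> I \<longrightarrow> Poly_Mapping.lookup x i = 0)"
  by (auto simp: in_keys_iff)

lemma lookup_witt_e: "Poly_Mapping.lookup (witt_e i) j = (if i = j then 1 else 0)"
  by (simp add: witt_e_def lookup_single when_def)

lemma finite_witt_range: "finite (witt_range TYPE('k::field))"
  by (simp add: witt_range_def)

lemma lookup_witt_bracket:
  fixes x y :: "int \<Rightarrow>\<^sub>0 'k::field"
  shows "Poly_Mapping.lookup (witt_bracket x y) n
    = (\<Sum>i\<in>witt_range TYPE('k). \<Sum>j\<in>witt_range TYPE('k).
        if i + j = n \<and> n \<in> witt_range TYPE('k)
        then of_int (j - i) * (Poly_Mapping.lookup x i * Poly_Mapping.lookup y j) else 0)"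
  unfolding witt_bracket_def lookup_sum
  by (intro sum.cong refl) (auto simp: lookup_single when_def)

lemma witt_sub_decomposition:
  fixes x :: "int \<Rightarrow>\<^sub>0 'k::field"
  assumes "Poly_Mapping.keys x \<subseteq> I" "finite I"
  shows "x = (\<Sum>i\<in>I. Poly_Mapping.map ((*) (Poly_Mapping.lookup x i)) (witt_e i))"
proof (rule poly_mapping_eqI)
  fix k
  have "(\<Sum>i\<in>I. Poly_Mapping.lookup x i * (if i = k then 1 else 0)) = Poly_Mapping.lookup x k"
    using assms by (cases "k \<in> I") (auto simp: in_keys_subset_iff if_distrib cong: if_cong)
  then show "Poly_Mapping.lookup x k
      = Poly_Mapping.lookup (\<Sum>i\<in>I. Poly_Mapping.map ((*) (Poly_Mapping.lookup x i)) (witt_e i)) k"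
    by (simp add: lookup_sum lookup_scale lookup_witt_e)
qed

text \<open>The two index sets for which representations are needed, that of \<open>W(1,1)\<close> and that of the Borel
  subalgebra, share all proofs.\<close>

definition witt_index :: "'k::field itself \<Rightarrow> int set \<Rightarrow> bool" where
  "witt_index k I \<longleftrightarrow> I = witt_range k \<or> I = {0..int CHAR('k) - 2}"

text \<open>A representation is specified by the operators of the basis vectors; the relations between them
  and their \<open>p\<close>-th powers suffice, since Jacobson's formula extends the compatibility with the
  \<open>p\<close>-map from the basis to all elements.\<close>

locale witt_rep = algebra_map \<kappa> for \<kappa> :: "'k::field \<Rightarrow> 'r::ring_1" +
  fixes pm :: "(int \<Rightarrow>\<^sub>0 'k) \<Rightarrow> (int \<Rightarrow>\<^sub>0 'k)" and I :: "int set" and r :: "int \<Rightarrow> 'r"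
  assumes char5: "CHAR('k) \<ge> 5"
    and pm: "is_witt_p_map pm"
    and index: "witt_index TYPE('k) I"
    and r_comm: "\<lbrakk>i \<in> I; j \<in> I\<rbrakk> \<Longrightarrow> r i * r j - r j * r i =
      (if i + j \<in> witt_range TYPE('k) then \<kappa> (of_int (j - i)) * r (i + j) else 0)"
    and r_power: "i \<in> I \<Longrightarrow> r i ^ CHAR('k) = (if i = 0 then r 0 else 0)"
begin

definition rep :: "(int \<Rightarrow>\<^sub>0 'k) \<Rightarrow> 'r" where
  "rep x = (\<Sum>i\<in>I. \<kappa> (Poly_Mapping.lookup x i) * r i)"

lemma finite_I: "finite I"
  using index by (auto simp: witt_index_def witt_range_def)

lemma I_sub: "I \<subseteq> witt_range TYPE('k)"
  using index by (auto simp: witt_index_def witt_range_def)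

lemma I_add: "\<lbrakk>i \<in> I; j \<in> I; i + j \<in> witt_range TYPE('k)\<rbrakk> \<Longrightarrow> i + j \<in> I"
  using index by (auto simp: witt_index_def witt_range_def)

lemma zero_in_I: "0 \<in> I"
  using index char5 by (auto simp: witt_index_def witt_range_def)

lemma rep_e: "i \<in> I \<Longrightarrow> rep (witt_e i) = r i"
proof -
  assume i: "i \<in> I"
  have "rep (witt_e i) = (\<Sum>j\<in>I. if i = j then r j else 0)"
    unfolding rep_def by (intro sum.cong refl) (simp add: lookup_witt_e map_one map_zero)
  then show ?thesis using i finite_I by simp
qed

lemma bracket_closed_I:
  fixes x y :: "int \<Rightarrow>\<^sub>0 'k"
  assumes "Poly_Mapping.keys x \<subseteq> I" "Poly_Mapping.keys y \<subseteq> I"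
  shows "Poly_Mapping.keys (witt_bracket x y) \<subseteq> I"
  unfolding in_keys_subset_iff
proof (intro allI impI)
  fix n assume n: "n \<notin> I"
  have "i + j \<noteq> n \<or> n \<notin> witt_range TYPE('k) \<or> Poly_Mapping.lookup x i * Poly_Mapping.lookup y j = 0" for i j
    using assms I_add n unfolding in_keys_subset_iff by (metis mult_zero_left mult_zero_right)
  then show "Poly_Mapping.lookup (witt_bracket x y) n = 0"
    unfolding lookup_witt_bracket by (intro sum.neutral ballI) auto
qed

lemma rep_bracket_I:
  fixes x y :: "int \<Rightarrow>\<^sub>0 'k"
  assumes x: "Poly_Mapping.keys x \<subseteq> I" and y: "Poly_Mapping.keys y \<subseteq> I"
  shows "rep (witt_bracket x y) = rep x * rep y - rep y * rep x"
proof -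
  let ?R = "witt_range TYPE('k)"
  let ?x = "Poly_Mapping.lookup x" and ?y = "Poly_Mapping.lookup y"
  have fin: "finite ?R" by (rule finite_witt_range)
  have "rep (witt_bracket x y)
      = (\<Sum>n\<in>I. \<Sum>i\<in>?R. \<Sum>j\<in>?R. if i + j = n \<and> n \<in> ?R then \<kappa> (of_int (j - i) * (?x i * ?y j)) * r n else 0)"
    unfolding rep_def lookup_witt_bracket map_sum sum_distrib_right
    by (intro sum.cong refl) (simp add: map_zero)
  also have "\<dots> = (\<Sum>i\<in>?R. \<Sum>n\<in>I. \<Sum>j\<in>?R. if i + j = n \<and> n \<in> ?R then \<kappa> (of_int (j - i) * (?x i * ?y j)) * r n else 0)"
    by (rule sum.swap)
  also have "\<dots> = (\<Sum>i\<in>?R. \<Sum>j\<in>?R. \<Sum>n\<in>I. if i + j = n \<and> n \<in> ?R then \<kappa> (of_int (j - i) * (?x i * ?y j)) * r n else 0)"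
    by (intro sum.cong refl sum.swap)
  also have "\<dots> = (\<Sum>i\<in>?R. \<Sum>j\<in>?R. if i + j \<in> I then \<kappa> (of_int (j - i) * (?x i * ?y j)) * r (i + j) else 0)"
  proof (intro sum.cong refl)
    fix i j
    have "(\<Sum>n\<in>I. if i + j = n \<and> n \<in> ?R then \<kappa> (of_int (j - i) * (?x i * ?y j)) * r n else 0)
        = (\<Sum>n\<in>I. if i + j = n then \<kappa> (of_int (j - i) * (?x i * ?y j)) * r n else 0)"
      using I_sub by (intro sum.cong) auto
    then show "(\<Sum>n\<in>I. if i + j = n \<and> n \<in> ?R then \<kappa> (of_int (j - i) * (?x i * ?y j)) * r n else 0)
        = (if i + j \<in> I then \<kappa> (of_int (j - i) * (?x i * ?y j)) * r (i + j) else 0)"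
      using finite_I by simp
  qed
  also have "\<dots> = (\<Sum>i\<in>I. \<Sum>j\<in>I. if i + j \<in> I then \<kappa> (of_int (j - i) * (?x i * ?y j)) * r (i + j) else 0)"
  proof -
    have inner: "(\<Sum>j\<in>?R. if i + j \<in> I then \<kappa> (of_int (j - i) * (?x i * ?y j)) * r (i + j) else 0)
      = (\<Sum>j\<in>I. if i + j \<in> I then \<kappa> (of_int (j - i) * (?x i * ?y j)) * r (i + j) else 0)" for i
      using y I_sub fin by (intro sum.mono_neutral_right) (auto simp: in_keys_subset_iff map_zero)
    show ?thesis
      unfolding inner using x I_sub fin
      by (intro sum.mono_neutral_right) (auto simp: in_keys_subset_iff map_zero intro!: sum.neutral)
  qed
  also have "\<dots> = (\<Sum>i\<in>I. \<Sum>j\<in>I. \<kappa> (?x i * ?y j) * (r i * r j - r j * r i))"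
  proof (intro sum.cong refl)
    fix i j assume ij: "i \<in> I" "j \<in> I"
    show "(if i + j \<in> I then \<kappa> (of_int (j - i) * (?x i * ?y j)) * r (i + j) else 0)
        = \<kappa> (?x i * ?y j) * (r i * r j - r j * r i)"
    proof (cases "i + j \<in> I")
      case True
      then have "r i * r j - r j * r i = \<kappa> (of_int (j - i)) * r (i + j)"
        using r_comm[OF ij] I_sub by auto
      moreover have "\<kappa> (of_int (j - i) * (?x i * ?y j)) * r (i + j) = \<kappa> (?x i * ?y j) * (\<kappa> (of_int (j - i)) * r (i + j))"
        by (simp only: mult.commute[of "of_int (j - i)" "?x i * ?y j"] map_mult mult.assoc)
      ultimately show ?thesis using True by (simp only: if_True)
    next
      case False
      then show ?thesis using r_comm[OF ij] I_add[OF ij] by auto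
    qed
  qed
  also have "\<dots> = (\<Sum>i\<in>I. \<Sum>j\<in>I. (\<kappa> (?x i) * r i) * (\<kappa> (?y j) * r j)) - (\<Sum>i\<in>I. \<Sum>j\<in>I. (\<kappa> (?y j) * r j) * (\<kappa> (?x i) * r i))"
  proof -
    have e: "\<kappa> (a * b) * (s * t) = (\<kappa> a * s) * (\<kappa> b * t)" for a b s t
    proof -
      have "(\<kappa> a * s) * (\<kappa> b * t) = \<kappa> a * (s * \<kappa> b) * t" by (simp only: mult.assoc)
      also have "s * \<kappa> b = \<kappa> b * s" by (rule central[symmetric])
      finally show ?thesis by (simp only: map_mult mult.assoc)
    qed
    have e1: "\<kappa> (?x i * ?y j) * (r i * r j) = (\<kappa> (?x i) * r i) * (\<kappa> (?y j) * r j)" for i j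
      by (rule e)
    have e2: "\<kappa> (?x i * ?y j) * (r j * r i) = (\<kappa> (?y j) * r j) * (\<kappa> (?x i) * r i)" for i j
      by (subst mult.commute[of "?x i"]) (rule e)
    show ?thesis by (simp add: right_diff_distrib sum_subtractf e1 e2)
  qed
  also have "(\<Sum>i\<in>I. \<Sum>j\<in>I. (\<kappa> (?y j) * r j) * (\<kappa> (?x i) * r i)) = rep y * rep x"
    unfolding rep_def sum_product by (rule sum.swap)
  finally show ?thesis by (simp add: rep_def sum_product)
qed

lemma rep_add_I: "rep (x + y) = rep x + rep y"
  by (simp add: rep_def lookup_add map_add distrib_right sum.distrib)

lemma rep_scale_I: "rep (Poly_Mapping.map ((*) c) x) = \<kappa> c * rep x"
  by (simp add: rep_def lookup_scale map_mult mult.assoc sum_distrib_left)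

lemma restricted: "restricted_lie_algebra (witt_sub pm (witt_range TYPE('k)))"
  using pm by (simp add: is_witt_p_map_def witt_eq_witt_sub)

lemma keys_plus: "\<lbrakk>Poly_Mapping.keys x \<subseteq> I; Poly_Mapping.keys y \<subseteq> I\<rbrakk> \<Longrightarrow> Poly_Mapping.keys (x + y) \<subseteq> I"
  by (simp add: in_keys_subset_iff lookup_add)

lemma keys_scale: "Poly_Mapping.keys (x :: int \<Rightarrow>\<^sub>0 'k) \<subseteq> I \<Longrightarrow> Poly_Mapping.keys (Poly_Mapping.map ((*) c) x) \<subseteq> I"
  by (simp add: in_keys_subset_iff lookup_scale)

sublocale sub: subalgebra_rep "witt_sub pm (witt_range TYPE('k))" \<kappa> "{x. Poly_Mapping.keys x \<subseteq> I}" rep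
proof (intro subalgebra_rep.intro restricted algebra_map_axioms subalgebra_rep_axioms.intro)
  show "{x. Poly_Mapping.keys x \<subseteq> I} \<subseteq> carrier (witt_sub pm (witt_range TYPE('k)))" using I_sub by auto
qed (simp_all add: keys_plus keys_scale bracket_closed_I rep_add_I rep_scale_I rep_bracket_I)

text \<open>The compatible elements are closed under sums and scalar multiples and contain the basis. This
  also shows that the \<open>p\<close>-map, of which only the values on the basis are known, preserves the Borel
  subalgebra.\<close>

lemma p_compatible_all: "Poly_Mapping.keys x \<subseteq> I \<Longrightarrow> sub.p_compatible x"
proof -
  assume x: "Poly_Mapping.keys x \<subseteq> I"
  have e: "sub.p_compatible (witt_e i)" if i: "i \<in> I" for i
  proof -
    have "pm (witt_e i) = (if i = 0 then witt_e i else 0)"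
      using pm i I_sub by (auto simp: is_witt_p_map_def)
    then show ?thesis
      using i r_power[OF i] rep_e[OF i] sub.rep_zero
      by (auto simp: sub.p_compatible_def witt_e_def)
  qed
  have "sub.p_compatible (\<Sum>i\<in>S. Poly_Mapping.map ((*) (Poly_Mapping.lookup x i)) (witt_e i))" if "S \<subseteq> I" for S
    using finite_subset[OF that finite_I] that
  proof (induction S rule: finite_induct)
    case empty
    then show ?case using sub.p_compatible_zero by simp
  next
    case (insert i S)
    then show ?case
      using sub.p_compatible_add sub.p_compatible_scale[OF e[of i], of "Poly_Mapping.lookup x i"] by simp
  qed
  from this[OF subset_refl] show ?thesis using witt_sub_decomposition[OF x finite_I] by simp
qed

lemma pm_closed: "Poly_Mapping.keys x \<subseteq> I \<Longrightarrow> Poly_Mapping.keys (pm x) \<subseteq> I"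
  and rep_pm: "Poly_Mapping.keys x \<subseteq> I \<Longrightarrow> rep x ^ CHAR('k) = rep (pm x)"
  using p_compatible_all[of x] by (auto simp: sub.p_compatible_def)

lemma envelope_I: "envelope (witt_sub pm I)"
  by (rule envelope.intro) (simp_all add: keys_plus keys_scale bracket_closed_I pm_closed)

sublocale env: envelope_map "witt_sub pm I" \<kappa> rep
  by (intro envelope_map.intro envelope_I algebra_map_axioms envelope_map_axioms.intro)
    (simp_all add: rep_add_I rep_scale_I rep_bracket_I rep_pm)

end

section \<open>The inclusion of a restricted subalgebra\<close>

lemma free_algebra_neg:
  assumes "f \<in> carrier (free_algebra X :: ('k::field, 'x list \<Rightarrow> 'k) module)"
  shows "\<ominus>\<^bsub>free_algebra X\<^esub> f = (\<lambda>w. - f w)"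
proof -
  interpret T: kalgebra "free_algebra X :: ('k, 'x list \<Rightarrow> 'k) module" by (rule kalgebra_free_algebra)
  show ?thesis by (rule T.minus_equality) (use assms in auto)
qed

lemma free_algebra_minus:
  assumes "g \<in> carrier (free_algebra X :: ('k::field, 'x list \<Rightarrow> 'k) module)"
  shows "f \<ominus>\<^bsub>free_algebra X\<^esub> g = (\<lambda>w. f w - g w)"
  using free_algebra_neg[OF assms] by (simp add: a_minus_def)

lemma preimage_ideal:
  assumes R: "ring R" and J: "ideal J S"
    and closed: "\<And>x. x \<in> carrier R \<Longrightarrow> h x \<in> carrier S"
    and add: "\<And>x y. \<lbrakk>x \<in> carrier R; y \<in> carrier R\<rbrakk> \<Longrightarrow> h (x \<oplus>\<^bsub>R\<^esub> y) = h x \<oplus>\<^bsub>S\<^esub> h y"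
    and mult: "\<And>x y. \<lbrakk>x \<in> carrier R; y \<in> carrier R\<rbrakk> \<Longrightarrow> h (x \<otimes>\<^bsub>R\<^esub> y) = h x \<otimes>\<^bsub>S\<^esub> h y"
  shows "ideal {x \<in> carrier R. h x \<in> J} R"
proof -
  interpret R: ring R by fact
  interpret J: ideal J S by fact
  have zero: "h \<zero>\<^bsub>R\<^esub> = \<zero>\<^bsub>S\<^esub>"
    using add[OF R.zero_closed R.zero_closed] closed[OF R.zero_closed]
    by (metis J.add.r_cancel_one R.l_zero R.zero_closed)
  have neg: "h (\<ominus>\<^bsub>R\<^esub> x) = \<ominus>\<^bsub>S\<^esub> h x" if "x \<in> carrier R" for x
  proof -
    have "h (\<ominus>\<^bsub>R\<^esub> x) \<oplus>\<^bsub>S\<^esub> h x = \<zero>\<^bsub>S\<^esub>"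
      using add[of "\<ominus>\<^bsub>R\<^esub> x" x] that by (simp add: R.l_neg zero)
    then show ?thesis using that closed by (metis J.minus_equality R.a_inv_closed)
  qed
  show ?thesis
  proof (rule idealI[OF R])
    show "subgroup {x \<in> carrier R. h x \<in> J} (add_monoid R)"
      by (rule subgroup.intro)
        (use add zero neg J.zero_closed J.a_closed in \<open>auto simp: a_inv_def[symmetric]\<close>)
  qed (use mult closed J.I_l_closed J.I_r_closed in auto)
qed

text \<open>The map \<open>u_incl\<close> is given on cosets of cosets. It is enough to know that it sends the class of a
  polynomial to the class of the same polynomial.\<close>

locale sub_envelope = small: envelope S + big: envelope L
  for S L :: "('k::field, 'g::ab_group_add) restricted_lie" +
  assumes sub: "carrier S \<subseteq> carrier L"
    and same: "lie_scale S = lie_scale L" "bracket S = bracket L" "p_map S = p_map L"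
begin

lemma T_sub: "f \<in> carrier small.T \<Longrightarrow> f \<in> carrier big.T"
  using sub by (auto simp: free_algebra_simps)

lemma T_ops:
  "f \<oplus>\<^bsub>small.T\<^esub> g = f \<oplus>\<^bsub>big.T\<^esub> g" "f \<otimes>\<^bsub>small.T\<^esub> g = f \<otimes>\<^bsub>big.T\<^esub> g" "c \<odot>\<^bsub>small.T\<^esub> f = c \<odot>\<^bsub>big.T\<^esub> f"
  "\<one>\<^bsub>small.T\<^esub> = \<one>\<^bsub>big.T\<^esub>"
  by (simp_all add: free_algebra_simps)

lemma T_minus: "g \<in> carrier small.T \<Longrightarrow> f \<ominus>\<^bsub>small.T\<^esub> g = f \<ominus>\<^bsub>big.T\<^esub> g"
  by (simp only: free_algebra_minus T_sub)

lemma U_rels_sub: "small.U_rels \<subseteq> big.U_rels"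
proof
  fix z assume "z \<in> small.U_rels"
  then consider (a) x y where "x \<in> carrier S" "y \<in> carrier S" "z = gen (x + y) \<ominus>\<^bsub>small.T\<^esub> (gen x \<oplus>\<^bsub>small.T\<^esub> gen y)"
    | (s) c x where "x \<in> carrier S" "z = gen (lie_scale S c x) \<ominus>\<^bsub>small.T\<^esub> c \<odot>\<^bsub>small.T\<^esub> gen x"
    | (b) x y where "x \<in> carrier S" "y \<in> carrier S"
        "z = (gen x \<otimes>\<^bsub>small.T\<^esub> gen y \<ominus>\<^bsub>small.T\<^esub> gen y \<otimes>\<^bsub>small.T\<^esub> gen x) \<ominus>\<^bsub>small.T\<^esub> gen (bracket S x y)"
    unfolding small.U_rels_def by blast
  then show "z \<in> big.U_rels"
  proof cases
    case a
    then have "z = gen (x + y) \<ominus>\<^bsub>big.T\<^esub> (gen x \<oplus>\<^bsub>big.T\<^esub> gen y)"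
      using T_minus[OF small.T.a_closed[OF small.gen_in small.gen_in]] by (simp only: T_ops)
    with a sub show ?thesis unfolding big.U_rels_def by blast
  next
    case s
    then have "z = gen (lie_scale L c x) \<ominus>\<^bsub>big.T\<^esub> c \<odot>\<^bsub>big.T\<^esub> gen x"
      using T_minus[OF small.T.smult_closed[OF small.gen_in]] by (simp only: T_ops same)
    with s sub show ?thesis unfolding big.U_rels_def by blast
  next
    case b
    then have "z = (gen x \<otimes>\<^bsub>big.T\<^esub> gen y \<ominus>\<^bsub>big.T\<^esub> gen y \<otimes>\<^bsub>big.T\<^esub> gen x) \<ominus>\<^bsub>big.T\<^esub> gen (bracket L x y)"
      using T_minus[OF small.T.m_closed[OF small.gen_in small.gen_in], of y x]
        T_minus[OF small.gen_in[OF small.brack_closed]]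
      by (simp only: T_ops same)
    with b sub show ?thesis unfolding big.U_rels_def by blast
  qed
qed

text \<open>The preimage of the larger ideal is an ideal of the smaller free algebra that contains all
  relations.\<close>

lemma U_ideal_sub: "U_ideal S \<subseteq> U_ideal L"
proof -
  have "ideal {f \<in> carrier small.T. f \<in> U_ideal L} small.T"
    by (rule preimage_ideal[where h = "\<lambda>f. f", OF small.T.ring_axioms big.U_ideal])
      (simp_all only: T_sub T_ops)
  moreover have "small.U_rels \<subseteq> {f \<in> carrier small.T. f \<in> U_ideal L}"
    using small.U_rels_sub U_rels_sub big.T.genideal_self[OF big.U_rels_sub] unfolding big.U_ideal_eq by blast
  ultimately show ?thesis
    unfolding small.U_ideal_eq using small.T.genideal_minimal by blast
qed

definition U_incl :: "('g list \<Rightarrow> 'k) set \<Rightarrow> ('g list \<Rightarrow> 'k) set" where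
  "U_incl X = U_ideal L <+>\<^bsub>big.T\<^esub> X"

lemma U_incl_coset:
  assumes f: "f \<in> carrier small.T"
  shows "U_incl (U_ideal S +>\<^bsub>small.T\<^esub> f) = U_ideal L +>\<^bsub>big.T\<^esub> f"
proof -
  interpret I: ideal "U_ideal L" big.T by (rule big.U_ideal)
  interpret J: ideal "U_ideal S" small.T by (rule small.U_ideal)
  have f': "f \<in> carrier big.T" by (rule T_sub[OF f])
  show ?thesis
  proof
    show "U_incl (U_ideal S +>\<^bsub>small.T\<^esub> f) \<subseteq> U_ideal L +>\<^bsub>big.T\<^esub> f"
    proof
      fix z assume "z \<in> U_incl (U_ideal S +>\<^bsub>small.T\<^esub> f)"
      then obtain i j where ij: "i \<in> U_ideal L" "j \<in> U_ideal S" "z = i \<oplus>\<^bsub>big.T\<^esub> (j \<oplus>\<^bsub>big.T\<^esub> f)"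
        unfolding U_incl_def set_add_def' a_r_coset_def' T_ops by blast
      then have j: "j \<in> U_ideal L" using U_ideal_sub by blast
      have "z = (i \<oplus>\<^bsub>big.T\<^esub> j) \<oplus>\<^bsub>big.T\<^esub> f"
        using ij(3) I.Icarr[OF ij(1)] I.Icarr[OF j] f' by (simp only: big.T.a_assoc)
      then show "z \<in> U_ideal L +>\<^bsub>big.T\<^esub> f"
        using I.a_closed[OF ij(1) j] unfolding a_r_coset_def' by blast
    qed
    show "U_ideal L +>\<^bsub>big.T\<^esub> f \<subseteq> U_incl (U_ideal S +>\<^bsub>small.T\<^esub> f)"
    proof
      fix z assume "z \<in> U_ideal L +>\<^bsub>big.T\<^esub> f"
      then obtain i where i: "i \<in> U_ideal L" "z = i \<oplus>\<^bsub>big.T\<^esub> f"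
        unfolding a_r_coset_def' by blast
      have "f \<in> U_ideal S +>\<^bsub>small.T\<^esub> f"
        by (rule J.a_rcos_self[OF f])
      with i show "z \<in> U_incl (U_ideal S +>\<^bsub>small.T\<^esub> f)"
        unfolding U_incl_def set_add_def' by blast
    qed
  qed
qed

lemma U_incl_closed: "X \<in> carrier (U_alg S) \<Longrightarrow> U_incl X \<in> carrier (U_alg L)"
  by (auto simp: small.carrier_U big.carrier_U U_incl_coset T_sub)

lemma U_incl_hom:
  assumes "X \<in> carrier (U_alg S)" "Y \<in> carrier (U_alg S)"
  shows "U_incl (X \<oplus>\<^bsub>U_alg S\<^esub> Y) = U_incl X \<oplus>\<^bsub>U_alg L\<^esub> U_incl Y"
    and "U_incl (X \<otimes>\<^bsub>U_alg S\<^esub> Y) = U_incl X \<otimes>\<^bsub>U_alg L\<^esub> U_incl Y"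
proof -
  obtain f g where fg: "f \<in> carrier small.T" "g \<in> carrier small.T"
    and X: "X = U_ideal S +>\<^bsub>small.T\<^esub> f" and Y: "Y = U_ideal S +>\<^bsub>small.T\<^esub> g"
    using assms unfolding small.carrier_U by blast
  note fg' = fg[THEN T_sub]
  have "U_incl (X \<oplus>\<^bsub>U_alg S\<^esub> Y) = U_incl (U_ideal S +>\<^bsub>small.T\<^esub> (f \<oplus>\<^bsub>small.T\<^esub> g))"
    by (simp only: X Y small.U_coset_hom(1)[OF fg])
  also have "\<dots> = U_ideal L +>\<^bsub>big.T\<^esub> (f \<oplus>\<^bsub>small.T\<^esub> g)"
    by (rule U_incl_coset[OF small.T.a_closed[OF fg]])
  also have "\<dots> = U_incl X \<oplus>\<^bsub>U_alg L\<^esub> U_incl Y"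
    by (simp only: X Y T_ops big.U_coset_hom(1)[OF fg'] U_incl_coset[OF fg(1)] U_incl_coset[OF fg(2)])
  finally show "U_incl (X \<oplus>\<^bsub>U_alg S\<^esub> Y) = U_incl X \<oplus>\<^bsub>U_alg L\<^esub> U_incl Y" .
  have "U_incl (X \<otimes>\<^bsub>U_alg S\<^esub> Y) = U_incl (U_ideal S +>\<^bsub>small.T\<^esub> (f \<otimes>\<^bsub>small.T\<^esub> g))"
    by (simp only: X Y small.U_coset_hom(2)[OF fg])
  also have "\<dots> = U_ideal L +>\<^bsub>big.T\<^esub> (f \<otimes>\<^bsub>small.T\<^esub> g)"
    by (rule U_incl_coset[OF small.T.m_closed[OF fg]])
  also have "\<dots> = U_incl X \<otimes>\<^bsub>U_alg L\<^esub> U_incl Y"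
    by (simp only: X Y T_ops big.U_coset_hom(2)[OF fg'] U_incl_coset[OF fg(1)] U_incl_coset[OF fg(2)])
  finally show "U_incl (X \<otimes>\<^bsub>U_alg S\<^esub> Y) = U_incl X \<otimes>\<^bsub>U_alg L\<^esub> U_incl Y" .
qed

lemma U_incl_gen: "x \<in> carrier S \<Longrightarrow> U_incl (U_gen S x) = U_gen L x"
  unfolding U_gen_def by (rule U_incl_coset) simp

lemma U_incl_u_ideal: "X \<in> u_ideal S \<Longrightarrow> U_incl X \<in> u_ideal L"
proof -
  let ?J = "{X \<in> carrier (U_alg S). U_incl X \<in> u_ideal L}"
  have J: "ideal ?J (U_alg S)"
    by (rule preimage_ideal[OF small.U.ring_axioms big.u_ideal]) (simp_all only: U_incl_closed U_incl_hom)
  have "small.u_rels \<subseteq> ?J"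
  proof
    fix z assume "z \<in> small.u_rels"
    then obtain x where x: "x \<in> carrier S"
      and z: "z = U_gen S x [^]\<^bsub>U_alg S\<^esub> CHAR('k) \<ominus>\<^bsub>U_alg S\<^esub> U_gen S (p_map S x)"
      unfolding small.u_rels_def by blast
    let ?g = "U_gen S x [^]\<^bsub>U_alg S\<^esub> CHAR('k)" and ?h = "U_gen S (p_map S x)"
    have g: "U_gen S x [^]\<^bsub>U_alg S\<^esub> n \<in> carrier (U_alg S)" for n :: nat
      using x small.U_gen_in by simp
    have h: "?h \<in> carrier (U_alg S)" using x small.U_gen_in small.p_closed by simp
    have one: "U_incl \<one>\<^bsub>U_alg S\<^esub> = \<one>\<^bsub>U_alg L\<^esub>"
    proof -
      have "U_incl \<one>\<^bsub>U_alg S\<^esub> = U_incl (U_ideal S +>\<^bsub>small.T\<^esub> \<one>\<^bsub>small.T\<^esub>)"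
        by (simp only: small.coset_one)
      also have "\<dots> = U_ideal L +>\<^bsub>big.T\<^esub> \<one>\<^bsub>small.T\<^esub>"
        by (rule U_incl_coset[OF small.T.one_closed])
      finally show ?thesis by (simp only: T_ops big.coset_one)
    qed
    have pow: "U_incl (U_gen S x [^]\<^bsub>U_alg S\<^esub> n) = U_gen L x [^]\<^bsub>U_alg L\<^esub> n" for n :: nat
      by (induction n) (use x g in \<open>simp_all add: one U_incl_hom small.U_gen_in U_incl_gen\<close>)
    have z_in: "z \<in> carrier (U_alg S)" unfolding z using g h by simp
    have "z \<oplus>\<^bsub>U_alg S\<^esub> ?h = ?g"
      unfolding z using g h by (simp add: small.U.minus_eq small.U.a_assoc small.U.l_neg)
    then have "U_incl z \<oplus>\<^bsub>U_alg L\<^esub> U_incl ?h = U_incl ?g"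
      using U_incl_hom(1)[OF z_in h] by simp
    then have eq: "U_incl z \<oplus>\<^bsub>U_alg L\<^esub> U_gen L (p_map L x) = U_gen L x [^]\<^bsub>U_alg L\<^esub> CHAR('k)"
      using x small.p_closed by (simp add: pow U_incl_gen flip: same)
    have xL: "x \<in> carrier L" using x sub by blast
    have h': "U_gen L (p_map L x) \<in> carrier (U_alg L)" using xL big.U_gen_in big.p_closed by simp
    have "U_incl z = U_gen L x [^]\<^bsub>U_alg L\<^esub> CHAR('k) \<ominus>\<^bsub>U_alg L\<^esub> U_gen L (p_map L x)"
      unfolding eq[symmetric] using U_incl_closed[OF z_in] h'
      by (simp add: big.U.minus_eq big.U.a_assoc big.U.r_neg)
    then have "U_incl z \<in> big.u_rels" unfolding big.u_rels_def using xL by blast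
    then show "z \<in> ?J"
      using z_in big.U.genideal_self[OF big.u_rels_sub] unfolding big.u_ideal_eq by blast
  qed
  then have "u_ideal S \<subseteq> ?J" unfolding small.u_ideal_eq using small.U.genideal_minimal[OF J] by blast
  then show "X \<in> u_ideal S \<Longrightarrow> U_incl X \<in> u_ideal L" by blast
qed

lemma u_incl_class:
  assumes f: "f \<in> carrier small.T"
  shows "u_incl L (u_class S f) = u_class L f"
proof -
  interpret I: ideal "u_ideal L" "U_alg L" by (rule big.u_ideal)
  interpret J: ideal "u_ideal S" "U_alg S" by (rule small.u_ideal)
  define Xs where "Xs = U_ideal S +>\<^bsub>small.T\<^esub> f"
  define Xb where "Xb = U_ideal L +>\<^bsub>big.T\<^esub> f"
  have X: "Xs \<in> carrier (U_alg S)" using f by (simp add: small.carrier_U Xs_def)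
  have X': "Xb \<in> carrier (U_alg L)" using T_sub[OF f] by (simp add: big.carrier_U Xb_def)
  have XX: "U_incl Xs = Xb" unfolding Xs_def Xb_def by (rule U_incl_coset[OF f])
  have "u_ideal L <+>\<^bsub>U_alg L\<^esub> U_incl ` (u_ideal S +>\<^bsub>U_alg S\<^esub> Xs) = u_ideal L +>\<^bsub>U_alg L\<^esub> Xb"
  proof
    show "u_ideal L <+>\<^bsub>U_alg L\<^esub> U_incl ` (u_ideal S +>\<^bsub>U_alg S\<^esub> Xs) \<subseteq> u_ideal L +>\<^bsub>U_alg L\<^esub> Xb"
    proof
      fix z assume "z \<in> u_ideal L <+>\<^bsub>U_alg L\<^esub> U_incl ` (u_ideal S +>\<^bsub>U_alg S\<^esub> Xs)"
      then obtain i j where ij: "i \<in> u_ideal L" "j \<in> u_ideal S" "z = i \<oplus>\<^bsub>U_alg L\<^esub> U_incl (j \<oplus>\<^bsub>U_alg S\<^esub> Xs)"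
        unfolding set_add_def' a_r_coset_def' by blast
      have j: "U_incl j \<in> u_ideal L" by (rule U_incl_u_ideal[OF ij(2)])
      have "z = (i \<oplus>\<^bsub>U_alg L\<^esub> U_incl j) \<oplus>\<^bsub>U_alg L\<^esub> Xb"
        using ij(3) U_incl_hom(1)[OF J.Icarr[OF ij(2)] X] big.U.a_assoc[OF I.Icarr[OF ij(1)] I.Icarr[OF j] X']
        by (simp only: XX)
      then show "z \<in> u_ideal L +>\<^bsub>U_alg L\<^esub> Xb"
        using I.a_closed[OF ij(1) j] unfolding a_r_coset_def' by blast
    qed
    show "u_ideal L +>\<^bsub>U_alg L\<^esub> Xb \<subseteq> u_ideal L <+>\<^bsub>U_alg L\<^esub> U_incl ` (u_ideal S +>\<^bsub>U_alg S\<^esub> Xs)"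
    proof
      fix z assume "z \<in> u_ideal L +>\<^bsub>U_alg L\<^esub> Xb"
      then obtain i where i: "i \<in> u_ideal L" "z = i \<oplus>\<^bsub>U_alg L\<^esub> U_incl Xs"
        unfolding a_r_coset_def' XX by blast
      have "Xs \<in> u_ideal S +>\<^bsub>U_alg S\<^esub> Xs" by (rule J.a_rcos_self[OF X])
      with i show "z \<in> u_ideal L <+>\<^bsub>U_alg L\<^esub> U_incl ` (u_ideal S +>\<^bsub>U_alg S\<^esub> Xs)"
        unfolding set_add_def' by blast
    qed
  qed
  then show ?thesis unfolding u_incl_def u_class_def U_incl_def Xs_def Xb_def .
qed

end

section \<open>Extension of scalars\<close>

text \<open>The extension of \<open>t\<close> to the free abelian group, with values in a space of functions.\<close>

definition frag_lift :: "('x \<Rightarrow> 'i \<Rightarrow> 'k::field) \<Rightarrow> ('x \<Rightarrow>\<^sub>0 int) \<Rightarrow> 'i \<Rightarrow> 'k" where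
  "frag_lift t x = (\<lambda>i. \<Sum>k\<in>Poly_Mapping.keys x. of_int (Poly_Mapping.lookup x k) * t k i)"

lemma frag_lift_superset:
  assumes "finite S" "Poly_Mapping.keys x \<subseteq> S"
  shows "frag_lift t x = (\<lambda>i. \<Sum>k\<in>S. of_int (Poly_Mapping.lookup x k) * t k i)"
  unfolding frag_lift_def fun_eq_iff using assms
  by (intro allI sum.mono_neutral_left) (auto simp: in_keys_iff)

lemma frag_lift_add: "frag_lift t (x + y) = frag_lift t x + frag_lift t y"
proof -
  let ?S = "Poly_Mapping.keys x \<union> Poly_Mapping.keys y"
  have "frag_lift t z = (\<lambda>i. \<Sum>k\<in>?S. of_int (Poly_Mapping.lookup z k) * t k i)" if "z \<in> {x, y, x + y}" for z
    using that keys_add[of x y] by (intro frag_lift_superset) auto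
  then show ?thesis by (simp add: lookup_add fun_eq_iff algebra_simps sum.distrib)
qed

lemma frag_lift_zero: "frag_lift t 0 = 0"
  by (simp add: frag_lift_def fun_eq_iff)

lemma frag_lift_neg: "frag_lift t (- x) = - frag_lift t x"
  using frag_lift_add[of t x "- x"] by (simp add: frag_lift_zero eq_neg_iff_add_eq_0 add.commute)

lemma frag_lift_diff: "frag_lift t (x - y) = frag_lift t x - frag_lift t y"
  using frag_lift_add[of t x "- y"] by (simp add: frag_lift_neg)

lemma frag_lift_of: "frag_lift t (frag_of k) = t k"
  by (simp add: frag_lift_def)

locale scalar_extension = A: ring A
  for A :: "('k, 'a) module" and S :: "('k, 's) module" and \<phi> :: "'s \<Rightarrow> 'a" and M :: "('s, 'm) module" +
  assumes phi_closed: "s \<in> carrier S \<Longrightarrow> \<phi> s \<in> carrier A"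
    and M_add: "\<lbrakk>m \<in> carrier M; n \<in> carrier M\<rbrakk> \<Longrightarrow> m \<oplus>\<^bsub>M\<^esub> n \<in> carrier M"
    and M_act: "\<lbrakk>s \<in> carrier S; m \<in> carrier M\<rbrakk> \<Longrightarrow> s \<odot>\<^bsub>M\<^esub> m \<in> carrier M"
begin

definition "FG = free_Abelian_group (carrier A \<times> carrier M)"
definition "Rl = generate FG (tensor_relations S A \<phi> M)"
definition "act a = frag_extend (\<lambda>(b, m). frag_of (a \<otimes>\<^bsub>A\<^esub> b, m :: 'm))"
definition FM :: "('a, ('a \<times> 'm) \<Rightarrow>\<^sub>0 int) module" where
  "FM = \<lparr>carrier = carrier FG, mult = undefined, one = undefined, zero = 0, add = (+), smult = act\<rparr>"

lemma ext_eq: "extend_scalars S A \<phi> M = factor FM Rl"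
  unfolding extend_scalars_def Let_def FM_def Rl_def FG_def act_def ..

lemma FM_simps [simp]: "carrier FM = {x. Poly_Mapping.keys x \<subseteq> carrier A \<times> carrier M}" "zero FM = 0"
  "add FM = (+)" "smult FM = act"
  by (auto simp: FM_def FG_def)

lemma rel_sub: "tensor_relations S A \<phi> M \<subseteq> carrier FG"
  unfolding tensor_relations_def FG_def
  by (auto simp: keys_frag_of M_add M_act phi_closed dest!: subsetD[OF keys_diff])

lemma Rl_subgroup: "subgroup Rl FG"
  unfolding Rl_def using rel_sub by (intro group.generate_is_subgroup) (simp_all add: FG_def)

lemma Rl_closed: "0 \<in> Rl" "\<lbrakk>x \<in> Rl; y \<in> Rl\<rbrakk> \<Longrightarrow> x + y \<in> Rl" "x \<in> Rl \<Longrightarrow> - x \<in> Rl"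
  and Rl_sub: "x \<in> Rl \<Longrightarrow> x \<in> carrier FM"
proof -
  show sub: "x \<in> carrier FM" if "x \<in> Rl" for x
  proof -
    have "x \<in> carrier FG" using subgroup.subset[OF Rl_subgroup] that by (rule subsetD)
    then show ?thesis by (simp add: FG_def)
  qed
  show "0 \<in> Rl" using subgroup.one_closed[OF Rl_subgroup] by (simp add: FG_def)
  show "\<lbrakk>x \<in> Rl; y \<in> Rl\<rbrakk> \<Longrightarrow> x + y \<in> Rl" using subgroup.m_closed[OF Rl_subgroup] by (simp add: FG_def)
  show "- x \<in> Rl" if "x \<in> Rl" using subgroup.m_inv_closed[OF Rl_subgroup that] sub[OF that] by (simp add: FG_def)
qed

lemma Rl_diff: "\<lbrakk>x \<in> Rl; y \<in> Rl\<rbrakk> \<Longrightarrow> x - y \<in> Rl"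
  using Rl_closed(2)[of x "- y"] Rl_closed(3)[of y] by simp

lemma rel_in: "r \<in> tensor_relations S A \<phi> M \<Longrightarrow> r \<in> Rl"
  unfolding Rl_def by (rule generate.incl)

lemma rel1: "\<lbrakk>a \<in> carrier A; b \<in> carrier A; m \<in> carrier M\<rbrakk> \<Longrightarrow> frag_of (a \<oplus>\<^bsub>A\<^esub> b, m) - frag_of (a, m) - frag_of (b, m) \<in> Rl"
  and rel2: "\<lbrakk>a \<in> carrier A; m \<in> carrier M; n \<in> carrier M\<rbrakk> \<Longrightarrow> frag_of (a, m \<oplus>\<^bsub>M\<^esub> n) - frag_of (a, m) - frag_of (a, n) \<in> Rl"
  and rel3: "\<lbrakk>a \<in> carrier A; s \<in> carrier S; m \<in> carrier M\<rbrakk> \<Longrightarrow> frag_of (a \<otimes>\<^bsub>A\<^esub> \<phi> s, m) - frag_of (a, s \<odot>\<^bsub>M\<^esub> m) \<in> Rl"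
  by (rule rel_in, unfold tensor_relations_def, blast)+

lemma act_simps:
  "act a (x + y) = act a x + act a y" "act a (x - y) = act a x - act a y" "act a (- x) = - act a x"
  "act a 0 = 0" "act a (frag_of (b, m)) = frag_of (a \<otimes>\<^bsub>A\<^esub> b, m)"
  by (simp_all add: act_def frag_extend_add frag_extend_diff frag_extend_minus)

lemma act_carrier: "\<lbrakk>a \<in> carrier A; x \<in> carrier FM\<rbrakk> \<Longrightarrow> act a x \<in> carrier FM"
proof -
  assume a: "a \<in> carrier A" and x: "x \<in> carrier FM"
  have "Poly_Mapping.keys (act a x) \<subseteq> (\<Union>k\<in>Poly_Mapping.keys x. Poly_Mapping.keys (case k of (b, m) \<Rightarrow> frag_of (a \<otimes>\<^bsub>A\<^esub> b, m :: 'm)))"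
    unfolding act_def by (rule keys_frag_extend)
  then show ?thesis using a x by (fastforce simp: keys_frag_of split: prod.splits)
qed

lemma act_Rl:
  assumes a: "a \<in> carrier A" and x: "x \<in> Rl"
  shows "act a x \<in> Rl"
proof -
  have rel: "act a r \<in> Rl" if "r \<in> tensor_relations S A \<phi> M" for r
    using that unfolding tensor_relations_def
    by (auto simp: act_simps a A.r_distr A.m_assoc[symmetric] phi_closed intro!: rel1 rel2 rel3)
  have "x \<in> generate FG (tensor_relations S A \<phi> M)" using x by (simp add: Rl_def)
  then show ?thesis
  proof induction
    case one
    then show ?case by (simp add: FG_def act_simps Rl_closed)
  next
    case (incl h)
    then show ?case by (rule rel)
  next
    case (inv h)
    then have "inv\<^bsub>FG\<^esub> h = - h" using rel_sub by (auto simp: FG_def)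
    then show ?case using rel[OF inv] by (simp add: act_simps Rl_closed)
  next
    case (eng h1 h2)
    then show ?case by (simp add: FG_def act_simps Rl_closed)
  qed
qed

definition cos :: "('a \<times> 'm \<Rightarrow>\<^sub>0 int) \<Rightarrow> ('a \<times> 'm \<Rightarrow>\<^sub>0 int) set" where
  "cos x = Rl +>\<^bsub>FM\<^esub> x"

lemma cos_def': "cos x = (\<lambda>r. r + x) ` Rl"
  by (auto simp: cos_def a_r_coset_def')

lemma cos_eq_iff: "cos x = cos y \<longleftrightarrow> x - y \<in> Rl"
proof
  assume "cos x = cos y"
  moreover have "x \<in> cos x" using Rl_closed(1) by (force simp: cos_def')
  ultimately show "x - y \<in> Rl" by (auto simp: cos_def')
next
  assume d: "x - y \<in> Rl"
  have "r + x \<in> cos y" if "r \<in> Rl" for r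
    using Rl_closed(2)[OF that d] by (auto simp: cos_def' intro!: image_eqI[of _ _ "r + (x - y)"])
  moreover have "r + y \<in> cos x" if "r \<in> Rl" for r
    using Rl_diff[OF that d] by (auto simp: cos_def' intro!: image_eqI[of _ _ "r - (x - y)"])
  ultimately show "cos x = cos y" by (auto simp: cos_def')
qed

lemma ext_carrier: "carrier (extend_scalars S A \<phi> M) = cos ` carrier FM"
  by (auto simp: ext_eq A_RCOSETS_def' cos_def)

lemma ext_add: "cos x \<oplus>\<^bsub>extend_scalars S A \<phi> M\<^esub> cos y = cos (x + y)"
proof -
  have "cos x <+>\<^bsub>FM\<^esub> cos y = cos (x + y)"
  proof
    show "cos x <+>\<^bsub>FM\<^esub> cos y \<subseteq> cos (x + y)"
    proof
      fix z assume "z \<in> cos x <+>\<^bsub>FM\<^esub> cos y"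
      then obtain r q where "r \<in> Rl" "q \<in> Rl" "z = (r + x) + (q + y)" by (auto simp: set_add_def' cos_def')
      then show "z \<in> cos (x + y)" using Rl_closed(2)[of r q] by (auto simp: cos_def' algebra_simps intro!: image_eqI[of _ _ "r + q"])
    qed
    show "cos (x + y) \<subseteq> cos x <+>\<^bsub>FM\<^esub> cos y"
    proof
      fix z assume "z \<in> cos (x + y)"
      then obtain r where r: "r \<in> Rl" "z = (r + x) + (0 + y)" by (auto simp: cos_def' algebra_simps)
      have "r + x \<in> cos x" "0 + y \<in> cos y" using r(1) Rl_closed(1) unfolding cos_def' by blast+
      then show "z \<in> cos x <+>\<^bsub>FM\<^esub> cos y" unfolding set_add_def' r(2) FM_simps by blast
    qed
  qed
  then show ?thesis by (simp add: ext_eq)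
qed

lemma ext_zero: "\<zero>\<^bsub>extend_scalars S A \<phi> M\<^esub> = cos 0"
  by (simp add: ext_eq cos_def')

lemma ext_act:
  assumes a: "a \<in> carrier A"
  shows "a \<odot>\<^bsub>extend_scalars S A \<phi> M\<^esub> cos x = cos (act a x)"
proof -
  have "Rl <+>\<^bsub>FM\<^esub> act a ` cos x = cos (act a x)"
  proof
    show "Rl <+>\<^bsub>FM\<^esub> act a ` cos x \<subseteq> cos (act a x)"
    proof
      fix z assume "z \<in> Rl <+>\<^bsub>FM\<^esub> act a ` cos x"
      then obtain r q where r: "r \<in> Rl" and q: "q \<in> Rl" and z: "z = r + act a (q + x)"
        by (auto simp: set_add_def' cos_def')
      have "r + act a q \<in> Rl" using r act_Rl[OF a q] by (rule Rl_closed(2))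
      moreover have "z = (r + act a q) + act a x" by (simp add: z act_simps algebra_simps)
      ultimately show "z \<in> cos (act a x)" unfolding cos_def' by blast
    qed
    show "cos (act a x) \<subseteq> Rl <+>\<^bsub>FM\<^esub> act a ` cos x"
    proof
      fix z assume "z \<in> cos (act a x)"
      then obtain r where r: "r \<in> Rl" "z = r + act a (0 + x)" by (auto simp: cos_def')
      have "0 + x \<in> cos x" using Rl_closed(1) unfolding cos_def' by blast
      then show "z \<in> Rl <+>\<^bsub>FM\<^esub> act a ` cos x" unfolding set_add_def' r(2) FM_simps using r(1) by blast
    qed
  qed
  then show ?thesis by (simp add: ext_eq)
qed

lemma ext_left_module: "left_module A (extend_scalars S A \<phi> M)"
proof -
  let ?E = "extend_scalars S A \<phi> M"
  have "abelian_group ?E"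
  proof (rule abelian_groupI)
    fix X assume "X \<in> carrier ?E"
    then obtain x where x: "x \<in> carrier FM" "X = cos x" by (auto simp: ext_carrier)
    have "cos (- x) \<in> carrier ?E" using x by (simp add: ext_carrier)
    moreover have "cos (- x) \<oplus>\<^bsub>?E\<^esub> X = \<zero>\<^bsub>?E\<^esub>" by (simp add: x ext_add ext_zero)
    ultimately show "\<exists>Y\<in>carrier ?E. Y \<oplus>\<^bsub>?E\<^esub> X = \<zero>\<^bsub>?E\<^esub>" by blast
  next
    fix X Y assume "X \<in> carrier ?E" "Y \<in> carrier ?E"
    then obtain x y where xy: "x \<in> carrier FM" "y \<in> carrier FM" "X = cos x" "Y = cos y" by (auto simp: ext_carrier)
    have "x + y \<in> carrier FM" using xy(1,2) keys_add[of x y] by auto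
    then show "X \<oplus>\<^bsub>?E\<^esub> Y \<in> carrier ?E" by (simp add: xy(3,4) ext_add ext_carrier)
  qed (auto simp: ext_carrier ext_add ext_zero add_ac simp del: FM_simps(2-4))
  then show ?thesis
  proof (intro left_module.intro left_module_axioms.intro A.ring_axioms)
    fix a X assume "a \<in> carrier A" "X \<in> carrier ?E"
    then show "a \<odot>\<^bsub>?E\<^esub> X \<in> carrier ?E" using act_carrier by (auto simp: ext_carrier ext_act simp del: FM_simps)
  next
    fix a X Y assume "a \<in> carrier A" "X \<in> carrier ?E" "Y \<in> carrier ?E"
    then show "a \<odot>\<^bsub>?E\<^esub> (X \<oplus>\<^bsub>?E\<^esub> Y) = a \<odot>\<^bsub>?E\<^esub> X \<oplus>\<^bsub>?E\<^esub> a \<odot>\<^bsub>?E\<^esub> Y"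
      by (auto simp: ext_carrier ext_act ext_add act_simps)
  next
    fix a b X assume ab: "a \<in> carrier A" "b \<in> carrier A" and "X \<in> carrier ?E"
    then obtain x where x: "x \<in> carrier FM" "X = cos x" by (auto simp: ext_carrier)
    have sup: "Poly_Mapping.keys x \<subseteq> carrier A \<times> carrier M" using x by simp
    have "act (a \<oplus>\<^bsub>A\<^esub> b) x - (act a x + act b x) \<in> Rl"
      using sup
    proof (induction x rule: frag_induction)
      case (one k)
      then obtain c m where k: "k = (c, m)" "c \<in> carrier A" "m \<in> carrier M" by auto
      then show ?case
        using rel1[of "a \<otimes>\<^bsub>A\<^esub> c" "b \<otimes>\<^bsub>A\<^esub> c" m] ab by (simp add: act_simps A.l_distr diff_diff_eq)
    next
      case (diff x y)
      have "act (a \<oplus>\<^bsub>A\<^esub> b) (x - y) - (act a (x - y) + act b (x - y))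
          = (act (a \<oplus>\<^bsub>A\<^esub> b) x - (act a x + act b x)) - (act (a \<oplus>\<^bsub>A\<^esub> b) y - (act a y + act b y))"
        by (simp add: act_simps algebra_simps)
      then show ?case using Rl_diff[OF diff] by simp
    qed (simp add: act_simps Rl_closed)
    then show "(a \<oplus>\<^bsub>A\<^esub> b) \<odot>\<^bsub>?E\<^esub> X = a \<odot>\<^bsub>?E\<^esub> X \<oplus>\<^bsub>?E\<^esub> b \<odot>\<^bsub>?E\<^esub> X"
      using ab by (simp add: x ext_act ext_add cos_eq_iff)
    have "act (a \<otimes>\<^bsub>A\<^esub> b) x = act a (act b x)"
      using sup by (induction x rule: frag_induction) (use ab in \<open>auto simp: act_simps A.m_assoc\<close>)
    then show "(a \<otimes>\<^bsub>A\<^esub> b) \<odot>\<^bsub>?E\<^esub> X = a \<odot>\<^bsub>?E\<^esub> (b \<odot>\<^bsub>?E\<^esub> X)"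
      using ab by (simp add: x ext_act)
  next
    fix X assume "X \<in> carrier ?E"
    then obtain x where x: "x \<in> carrier FM" "X = cos x" by (auto simp: ext_carrier)
    have sup: "Poly_Mapping.keys x \<subseteq> carrier A \<times> carrier M" using x by simp
    have "act \<one>\<^bsub>A\<^esub> x = x"
      using sup by (induction x rule: frag_induction) (auto simp: act_simps)
    then show "\<one>\<^bsub>A\<^esub> \<odot>\<^bsub>?E\<^esub> X = X" by (simp add: x ext_act)
  qed
qed

definition tens :: "'a \<Rightarrow> 'm \<Rightarrow> ('a \<times> 'm \<Rightarrow>\<^sub>0 int) set" where
  "tens a m = cos (frag_of (a, m))"

lemma tens_in: "\<lbrakk>a \<in> carrier A; m \<in> carrier M\<rbrakk> \<Longrightarrow> tens a m \<in> carrier (extend_scalars S A \<phi> M)"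
  by (simp add: tens_def ext_carrier keys_frag_of)

lemma tens_act: "a \<in> carrier A \<Longrightarrow> a \<odot>\<^bsub>extend_scalars S A \<phi> M\<^esub> tens b m = tens (a \<otimes>\<^bsub>A\<^esub> b) m"
  by (simp add: tens_def ext_act act_simps)

lemma tens_balanced: "\<lbrakk>a \<in> carrier A; s \<in> carrier S; m \<in> carrier M\<rbrakk> \<Longrightarrow> tens (a \<otimes>\<^bsub>A\<^esub> \<phi> s) m = tens a (s \<odot>\<^bsub>M\<^esub> m)"
  by (simp add: tens_def cos_eq_iff rel3)

lemma ext_cyclic:
  assumes v: "v \<in> carrier M" and gen: "\<And>m. m \<in> carrier M \<Longrightarrow> \<exists>s\<in>carrier S. m = s \<odot>\<^bsub>M\<^esub> v"
    and X: "X \<in> carrier (extend_scalars S A \<phi> M)"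
  shows "\<exists>a\<in>carrier A. X = a \<odot>\<^bsub>extend_scalars S A \<phi> M\<^esub> tens \<one>\<^bsub>A\<^esub> v"
proof -
  let ?E = "extend_scalars S A \<phi> M"
  interpret E: left_module A ?E by (rule ext_left_module)
  obtain x where x: "x \<in> carrier FM" "X = cos x" using X by (auto simp: ext_carrier)
  have sup: "Poly_Mapping.keys x \<subseteq> carrier A \<times> carrier M" using x by simp
  have w: "tens \<one>\<^bsub>A\<^esub> v \<in> carrier ?E" using v by (simp add: tens_in)
  have "\<exists>a\<in>carrier A. cos x = a \<odot>\<^bsub>?E\<^esub> tens \<one>\<^bsub>A\<^esub> v"
    using sup
  proof (induction x rule: frag_induction)
    case zero
    show ?case using E.act_zero_left[OF w] by (intro bexI[of _ "\<zero>\<^bsub>A\<^esub>"]) (simp_all add: ext_zero)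
  next
    case (one k)
    then obtain a m where k: "k = (a, m)" "a \<in> carrier A" "m \<in> carrier M" by auto
    obtain s where s: "s \<in> carrier S" "m = s \<odot>\<^bsub>M\<^esub> v" using gen k by blast
    have "cos (frag_of k) = (a \<otimes>\<^bsub>A\<^esub> \<phi> s) \<odot>\<^bsub>?E\<^esub> tens \<one>\<^bsub>A\<^esub> v"
      using k s v tens_balanced[of a s v] by (simp add: tens_act phi_closed) (simp add: tens_def)
    then show ?case using k s phi_closed by blast
  next
    case (diff x y)
    then obtain a b where ab: "a \<in> carrier A" "cos x = a \<odot>\<^bsub>?E\<^esub> tens \<one>\<^bsub>A\<^esub> v"
      "b \<in> carrier A" "cos y = b \<odot>\<^bsub>?E\<^esub> tens \<one>\<^bsub>A\<^esub> v" by blast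
    have neg: "cos (- y) = (\<ominus>\<^bsub>A\<^esub> b) \<odot>\<^bsub>?E\<^esub> tens \<one>\<^bsub>A\<^esub> v"
    proof -
      have "(\<ominus>\<^bsub>A\<^esub> b) \<odot>\<^bsub>?E\<^esub> tens \<one>\<^bsub>A\<^esub> v \<oplus>\<^bsub>?E\<^esub> cos y = cos 0"
        using E.act_add_left[of "\<ominus>\<^bsub>A\<^esub> b" b] w ab by (simp add: A.l_neg ext_zero)
      moreover obtain z where z: "(\<ominus>\<^bsub>A\<^esub> b) \<odot>\<^bsub>?E\<^esub> tens \<one>\<^bsub>A\<^esub> v = cos z"
        using ab w E.act_closed[of "\<ominus>\<^bsub>A\<^esub> b" "tens \<one>\<^bsub>A\<^esub> v"] by (auto simp: ext_carrier)
      ultimately have "z + y \<in> Rl" by (simp add: ext_add cos_eq_iff)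
      then have "- y - z \<in> Rl" using Rl_closed(3)[of "z + y"] by (simp add: algebra_simps)
      then show ?thesis by (simp add: z cos_eq_iff)
    qed
    have "cos (x - y) = cos x \<oplus>\<^bsub>?E\<^esub> cos (- y)" by (simp add: ext_add)
    also have "\<dots> = (a \<oplus>\<^bsub>A\<^esub> \<ominus>\<^bsub>A\<^esub> b) \<odot>\<^bsub>?E\<^esub> tens \<one>\<^bsub>A\<^esub> v"
      using ab w by (simp add: neg E.act_add_left)
    finally show ?case using ab by blast
  qed
  then show ?thesis using x by simp
qed

text \<open>The universal property of \<open>A \<otimes>\<^sub>S M\<close> for balanced maps into a space of functions.\<close>

lemma ext_lift:
  fixes t :: "'a \<Rightarrow> 'm \<Rightarrow> 'i \<Rightarrow> 'f::field" and op :: "'a \<Rightarrow> ('i \<Rightarrow> 'f) \<Rightarrow> ('i \<Rightarrow> 'f)"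
  assumes t1: "\<And>a b m. \<lbrakk>a \<in> carrier A; b \<in> carrier A; m \<in> carrier M\<rbrakk> \<Longrightarrow> t (a \<oplus>\<^bsub>A\<^esub> b) m = t a m + t b m"
    and t2: "\<And>a m n. \<lbrakk>a \<in> carrier A; m \<in> carrier M; n \<in> carrier M\<rbrakk> \<Longrightarrow> t a (m \<oplus>\<^bsub>M\<^esub> n) = t a m + t a n"
    and t3: "\<And>a s m. \<lbrakk>a \<in> carrier A; s \<in> carrier S; m \<in> carrier M\<rbrakk> \<Longrightarrow> t (a \<otimes>\<^bsub>A\<^esub> \<phi> s) m = t a (s \<odot>\<^bsub>M\<^esub> m)"
    and op: "\<And>a x y. op a (x - y) = op a x - op a y" "\<And>a. op a 0 = 0"
    and t4: "\<And>a b m. \<lbrakk>a \<in> carrier A; b \<in> carrier A; m \<in> carrier M\<rbrakk> \<Longrightarrow> t (a \<otimes>\<^bsub>A\<^esub> b) m = op a (t b m)"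
  shows "\<exists>\<Theta>. (\<forall>X\<in>carrier (extend_scalars S A \<phi> M). \<forall>Y\<in>carrier (extend_scalars S A \<phi> M).
        \<Theta> (X \<oplus>\<^bsub>extend_scalars S A \<phi> M\<^esub> Y) = \<Theta> X + \<Theta> Y) \<and>
      (\<forall>a\<in>carrier A. \<forall>X\<in>carrier (extend_scalars S A \<phi> M). \<Theta> (a \<odot>\<^bsub>extend_scalars S A \<phi> M\<^esub> X) = op a (\<Theta> X)) \<and>
      (\<forall>a\<in>carrier A. \<forall>m\<in>carrier M. \<Theta> (tens a m) = t a m)"
proof -
  define l where "l = frag_lift (\<lambda>(a, m). t a m)"
  note l_simps = frag_lift_add frag_lift_diff frag_lift_neg frag_lift_zero frag_lift_of
  have rel: "l r = 0" if "r \<in> tensor_relations S A \<phi> M" for r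
    using that unfolding tensor_relations_def l_def by (auto simp: l_simps t1 t2 t3)
  have ker: "l r = 0" if "r \<in> Rl" for r
  proof -
    have "r \<in> generate FG (tensor_relations S A \<phi> M)" using that by (simp add: Rl_def)
    then show ?thesis
    proof induction
      case (inv h)
      then have "inv\<^bsub>FG\<^esub> h = - h" using rel_sub by (auto simp: FG_def)
      then show ?case using rel[OF inv] by (simp add: l_def l_simps)
    qed (simp_all add: FG_def rel, simp_all add: l_def l_simps)
  qed
  define \<Theta> where "\<Theta> X = the_elem (l ` X)" for X
  have \<Theta>: "\<Theta> (cos x) = l x" for x
  proof -
    have "l ` cos x = {l x}"
      using Rl_closed(1) ker by (auto simp: cos_def' l_def l_simps image_image)
    then show ?thesis by (simp add: \<Theta>_def)
  qed
  have act: "l (act a x) = op a (l x)" if "a \<in> carrier A" "x \<in> carrier FM" for a x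
  proof -
    have "Poly_Mapping.keys x \<subseteq> carrier A \<times> carrier M" using that by simp
    then show ?thesis
    proof (induction x rule: frag_induction)
      case zero
      show ?case by (simp only: act_simps l_def frag_lift_zero op)
    next
      case (one k)
      then show ?case using that(1) by (cases k) (simp add: act_simps l_def frag_lift_of t4)
    next
      case (diff x y)
      then show ?case by (simp only: act_simps l_def frag_lift_diff op)
    qed
  qed
  show ?thesis
    by (rule exI[of _ \<Theta>])
      (auto simp: ext_carrier ext_add ext_act \<Theta> act tens_def simp del: FM_simps, simp_all add: l_def l_simps)
qed

end

section \<open>The restricted enveloping algebra of the Witt algebra\<close>

lemma witt_bracket_e:
  assumes ij: "i \<in> witt_range TYPE('k::field)" "j \<in> witt_range TYPE('k)"
  shows "witt_bracket (witt_e i) (witt_e j :: int \<Rightarrow>\<^sub>0 'k)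
    = (if i + j \<in> witt_range TYPE('k) then Poly_Mapping.map ((*) (of_int (j - i))) (witt_e (i + j)) else 0)"
proof (rule poly_mapping_eqI)
  fix n
  have fin: "finite (witt_range TYPE('k))" by (rule finite_witt_range)
  have "(\<Sum>i'\<in> witt_range TYPE('k). \<Sum>j'\<in> witt_range TYPE('k).
        if i' + j' = n \<and> n \<in> witt_range TYPE('k)
        then of_int (j' - i') * (Poly_Mapping.lookup (witt_e i) i' * Poly_Mapping.lookup (witt_e j :: int \<Rightarrow>\<^sub>0 'k) j') else 0)
      = (\<Sum>i'\<in> witt_range TYPE('k). \<Sum>j'\<in> witt_range TYPE('k).
          if j' = j then (if i' = i then (if i + j = n \<and> n \<in> witt_range TYPE('k) then of_int (j - i) else 0) else 0) else 0)"
    by (intro sum.cong refl) (auto simp: lookup_witt_e)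
  also have "\<dots> = (if i + j = n \<and> n \<in> witt_range TYPE('k) then of_int (j - i) else 0)"
    using fin ij by simp
  finally show "Poly_Mapping.lookup (witt_bracket (witt_e i) (witt_e j :: int \<Rightarrow>\<^sub>0 'k)) n = Poly_Mapping.lookup
      (if i + j \<in> witt_range TYPE('k) then Poly_Mapping.map ((*) (of_int (j - i))) (witt_e (i + j)) else 0) n"
    by (auto simp: lookup_witt_bracket lookup_scale lookup_witt_e)
qed

locale witt_setup =
  fixes pm :: "(int \<Rightarrow>\<^sub>0 'k::field) \<Rightarrow> (int \<Rightarrow>\<^sub>0 'k)"
  assumes char5: "CHAR('k) \<ge> 5" and pm: "is_witt_p_map pm"
begin

abbreviation "A \<equiv> u_alg (witt pm)"

text \<open>That the \<open>p\<close>-map preserves the Borel subalgebra is proved within \<open>witt_rep\<close>; the zero representation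
  makes it available.\<close>

lemma trivial_rep: "witt_index TYPE('k) I \<Longrightarrow> witt_rep (\<lambda>c::'k. c) pm I (\<lambda>_. 0)"
  using char5 by (intro witt_rep.intro algebra_map_id witt_rep_axioms.intro pm) (auto simp: power_0_left)

lemma envelope_witt: "envelope (witt pm)"
  unfolding witt_eq_witt_sub by (rule witt_rep.envelope_I[OF trivial_rep]) (simp add: witt_index_def)

lemma envelope_borel: "envelope (witt_borel pm)"
  unfolding witt_borel_eq_witt_sub by (rule witt_rep.envelope_I[OF trivial_rep]) (simp add: witt_index_def)

sublocale A: envelope "witt pm" by (rule envelope_witt)

sublocale incl: sub_envelope "witt_borel pm" "witt pm"
proof (intro sub_envelope.intro envelope_borel envelope_witt sub_envelope_axioms.intro)
qed (auto simp: witt_eq_witt_sub witt_borel_eq_witt_sub witt_range_def)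

lemma carrier_witt: "carrier (witt pm) = {x. Poly_Mapping.keys x \<subseteq> witt_range TYPE('k)}"
  by (simp add: witt_eq_witt_sub)

lemma carrier_borel: "carrier (witt_borel pm) = {x. Poly_Mapping.keys x \<subseteq> {0..int CHAR('k) - 2}}"
  by (simp add: witt_borel_eq_witt_sub)

definition e :: "int \<Rightarrow> ((int \<Rightarrow>\<^sub>0 'k) list \<Rightarrow> 'k) set set" where
  "e i = u_gen (witt pm) (witt_e i)"

lemma keys_witt_e: "i \<in> I \<Longrightarrow> Poly_Mapping.keys (witt_e i :: int \<Rightarrow>\<^sub>0 'k) \<subseteq> I"
  by (auto simp: in_keys_subset_iff lookup_witt_e)

lemma witt_e_in: "i \<in> witt_range TYPE('k) \<Longrightarrow> witt_e i \<in> carrier (witt pm)"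
  by (simp add: carrier_witt keys_witt_e)

lemma e_in [simp]: "i \<in> witt_range TYPE('k) \<Longrightarrow> e i \<in> carrier A"
  unfolding e_def by (rule A.u_gen_in[OF witt_e_in])

lemma zero_in_witt: "0 \<in> carrier (witt pm)"
  by (simp add: carrier_witt)

lemma u_gen_zero: "u_gen (witt pm) 0 = \<zero>\<^bsub>A\<^esub>"
proof -
  have "lie_scale (witt pm) 0 0 = 0"
    by (simp add: witt_eq_witt_sub, rule poly_mapping_eqI, simp add: lookup_scale)
  then show ?thesis
    using A.u_gen_scale[OF zero_in_witt, of 0] A.u_gen_in[OF zero_in_witt] by simp
qed

lemma e_comm:
  assumes "i \<in> witt_range TYPE('k)" "j \<in> witt_range TYPE('k)"
  shows "e i \<otimes>\<^bsub>A\<^esub> e j = (if i + j \<in> witt_range TYPE('k) then of_int (j - i) \<odot>\<^bsub>A\<^esub> e (i + j) else \<zero>\<^bsub>A\<^esub>) \<oplus>\<^bsub>A\<^esub> e j \<otimes>\<^bsub>A\<^esub> e i"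
proof -
  have b: "bracket (witt pm) (witt_e i) (witt_e j)
      = (if i + j \<in> witt_range TYPE('k) then lie_scale (witt pm) (of_int (j - i)) (witt_e (i + j)) else 0)"
    using witt_bracket_e[OF assms] by (simp add: witt_eq_witt_sub)
  have "u_gen (witt pm) (bracket (witt pm) (witt_e i) (witt_e j))
      = (if i + j \<in> witt_range TYPE('k) then of_int (j - i) \<odot>\<^bsub>A\<^esub> e (i + j) else \<zero>\<^bsub>A\<^esub>)"
    unfolding b using A.u_gen_scale[OF witt_e_in] by (simp add: u_gen_zero e_def)
  then show ?thesis
    using A.u_gen_bracket[OF witt_e_in[OF assms(1)] witt_e_in[OF assms(2)]] by (simp add: e_def)
qed

lemma e_power:
  assumes "i \<in> witt_range TYPE('k)"
  shows "e i [^]\<^bsub>A\<^esub> CHAR('k) = (if i = 0 then e 0 else \<zero>\<^bsub>A\<^esub>)"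
proof -
  have "p_map (witt pm) (witt_e i) = (if i = 0 then witt_e i else 0)"
    using pm assms by (simp add: is_witt_p_map_def witt_eq_witt_sub)
  then show ?thesis
    using A.u_gen_power[OF witt_e_in[OF assms]] by (auto simp: e_def u_gen_zero)
qed

lemma A_induct [consumes 1, case_names zero one add smult gen]:
  assumes a: "a \<in> carrier A"
    and zero: "P \<zero>\<^bsub>A\<^esub>" and one: "P \<one>\<^bsub>A\<^esub>"
    and add: "\<And>a b. \<lbrakk>a \<in> carrier A; b \<in> carrier A; P a; P b\<rbrakk> \<Longrightarrow> P (a \<oplus>\<^bsub>A\<^esub> b)"
    and smult: "\<And>c a. \<lbrakk>a \<in> carrier A; P a\<rbrakk> \<Longrightarrow> P (c \<odot>\<^bsub>A\<^esub> a)"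
    and gen: "\<And>i a. \<lbrakk>i \<in> witt_range TYPE('k); a \<in> carrier A; P a\<rbrakk> \<Longrightarrow> P (e i \<otimes>\<^bsub>A\<^esub> a)"
  shows "P a"
  using a
proof (induction a rule: A.u_induct)
  case (gen x a)
  let ?x = "Poly_Mapping.lookup x"
  have "(\<Sum>i\<in>S. Poly_Mapping.map ((*) (?x i)) (witt_e i)) \<in> carrier (witt pm) \<and>
      P (u_gen (witt pm) (\<Sum>i\<in>S. Poly_Mapping.map ((*) (?x i)) (witt_e i)) \<otimes>\<^bsub>A\<^esub> a)" if "S \<subseteq> witt_range TYPE('k)" for S
    using finite_subset[OF that finite_witt_range] that
  proof (induction S rule: finite_induct)
    case empty
    then show ?case using gen(2) zero by (simp add: u_gen_zero zero_in_witt)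
  next
    case (insert i S)
    then have i: "i \<in> witt_range TYPE('k)" by simp
    have IH: "(\<Sum>i\<in>S. Poly_Mapping.map ((*) (?x i)) (witt_e i)) \<in> carrier (witt pm)"
      "P (u_gen (witt pm) (\<Sum>i\<in>S. Poly_Mapping.map ((*) (?x i)) (witt_e i)) \<otimes>\<^bsub>A\<^esub> a)" using insert by auto
    have sc: "Poly_Mapping.map ((*) (?x i)) (witt_e i) = lie_scale (witt pm) (?x i) (witt_e i)"
      by (simp add: witt_eq_witt_sub)
    have sc_in: "Poly_Mapping.map ((*) (?x i)) (witt_e i) \<in> carrier (witt pm)"
      unfolding sc by (rule A.scale_closed[OF witt_e_in[OF i]])
    have "u_gen (witt pm) (Poly_Mapping.map ((*) (?x i)) (witt_e i)) = ?x i \<odot>\<^bsub>A\<^esub> e i"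
      unfolding sc by (simp add: A.u_gen_scale witt_e_in i e_def)
    then have P1: "P (u_gen (witt pm) (Poly_Mapping.map ((*) (?x i)) (witt_e i)) \<otimes>\<^bsub>A\<^esub> a)"
      using smult[OF _ assms(6)[OF i gen(2,3)], of "?x i"] i gen(2) by (simp add: A.u.smult_mult_left)
    have "u_gen (witt pm) (Poly_Mapping.map ((*) (?x i)) (witt_e i) + (\<Sum>i\<in>S. Poly_Mapping.map ((*) (?x i)) (witt_e i))) \<otimes>\<^bsub>A\<^esub> a
        = u_gen (witt pm) (Poly_Mapping.map ((*) (?x i)) (witt_e i)) \<otimes>\<^bsub>A\<^esub> a
          \<oplus>\<^bsub>A\<^esub> u_gen (witt pm) (\<Sum>i\<in>S. Poly_Mapping.map ((*) (?x i)) (witt_e i)) \<otimes>\<^bsub>A\<^esub> a"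
      using sc_in IH(1) gen(2) by (simp only: A.u_gen_add A.u.l_distr A.u_gen_in)
    then show ?case
      using insert(1,2) sc_in IH P1 gen(2) A.add_closed[OF sc_in IH(1)]
        add[OF A.u.m_closed[OF A.u_gen_in[OF sc_in] gen(2)] A.u.m_closed[OF A.u_gen_in[OF IH(1)] gen(2)] P1 IH(2)]
      by simp
  qed
  moreover have "x = (\<Sum>i\<in>witt_range TYPE('k). Poly_Mapping.map ((*) (?x i)) (witt_e i))"
    using gen(1) by (intro witt_sub_decomposition) (simp_all add: carrier_witt finite_witt_range)
  ultimately show ?case by (metis subset_refl)
qed (use zero one add smult in auto)

end

section \<open>Verma modules\<close>

locale verma_setup = witt_setup pm for pm :: "(int \<Rightarrow>\<^sub>0 'k::field) \<Rightarrow> (int \<Rightarrow>\<^sub>0 'k)" +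
  fixes l :: 'k
  assumes l: "l ^ CHAR('k) = l"
begin

definition wt :: "(int \<Rightarrow>\<^sub>0 'k) \<Rightarrow> 'k" where
  "wt x = l * Poly_Mapping.lookup x 0"

abbreviation "S \<equiv> u_alg (witt_borel pm)"
abbreviation "V \<equiv> verma pm l"

lemma wt_rep: "witt_rep (\<lambda>c::'k. c) pm {0..int CHAR('k) - 2} (\<lambda>i. if i = 0 then l else 0)"
  using char5 l by (intro witt_rep.intro algebra_map_id witt_rep_axioms.intro pm) (auto simp: power_0_left witt_index_def add_nonneg_eq_0_iff)

lemma wt_eq: "witt_rep.rep (\<lambda>c::'k. c) {0..int CHAR('k) - 2} (\<lambda>i. if i = 0 then l else 0) = wt"
proof
  fix x :: "int \<Rightarrow>\<^sub>0 'k"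
  have "(\<Sum>i\<in>{0..int CHAR('k) - 2}. Poly_Mapping.lookup x i * (if i = 0 then l else 0))
      = (\<Sum>i\<in>{0..int CHAR('k) - 2}. if i = 0 then Poly_Mapping.lookup x 0 * l else 0)"
    by (intro sum.cong) auto
  then show "witt_rep.rep (\<lambda>c::'k. c) {0..int CHAR('k) - 2} (\<lambda>i. if i = 0 then l else 0) x = wt x"
    using char5 by (simp add: witt_rep.rep_def[OF wt_rep] wt_def mult.commute)
qed

lemma wt_map: "envelope_map (witt_borel pm) (\<lambda>c::'k. c) wt"
proof -
  interpret chi: witt_rep "\<lambda>c::'k. c" pm "{0..int CHAR('k) - 2}" "\<lambda>i. if i = 0 then l else 0" by (rule wt_rep)
  show ?thesis using chi.env.envelope_map_axioms unfolding wt_eq witt_borel_eq_witt_sub .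
qed

sublocale chi: envelope_map "witt_borel pm" "\<lambda>c::'k. c" wt by (rule wt_map)

abbreviation "K \<equiv> character_module wt"

lemma K_simps [simp]:
  "carrier K = UNIV" "x \<oplus>\<^bsub>K\<^esub> y = x + y" "Y \<odot>\<^bsub>K\<^esub> x = chi.u_lift Y * x"
  by (simp_all add: character_module_def chi.u_lift_def word_eval_eq_free_lift)

lemma u_incl_in: "s \<in> carrier S \<Longrightarrow> u_incl (witt pm) s \<in> carrier A"
  by (auto simp: incl.small.carrier_u incl.u_incl_class incl.T_sub)

sublocale ext: scalar_extension A S "u_incl (witt pm)" K
  by (intro scalar_extension.intro A.u.ring_axioms scalar_extension_axioms.intro) (simp_all add: u_incl_in)

lemma V_eq: "V = extend_scalars S A (u_incl (witt pm)) K"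
  by (simp add: verma_def wt_def[abs_def])

lemma V_module: "left_module A V"
  unfolding V_eq by (rule ext.ext_left_module)

sublocale V: left_module A V by (rule V_module)

definition hw :: "(((int \<Rightarrow>\<^sub>0 'k) list \<Rightarrow> 'k) set set \<times> 'k \<Rightarrow>\<^sub>0 int) set" where
  "hw = ext.tens \<one>\<^bsub>A\<^esub> 1"

lemma hw_in [simp]: "hw \<in> carrier V"
  unfolding hw_def V_eq by (rule ext.tens_in) simp_all

lemma scalar_in_S: "c \<odot>\<^bsub>S\<^esub> \<one>\<^bsub>S\<^esub> \<in> carrier S"
  by simp

lemma chi_scalar: "chi.u_lift (c \<odot>\<^bsub>S\<^esub> \<one>\<^bsub>S\<^esub>) = c"
  using chi.u_lift_smult[OF incl.small.u.one_closed incl.small.u.one_closed, of c] by (simp add: chi.u_lift_one)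

lemma incl_scalar: "u_incl (witt pm) (c \<odot>\<^bsub>S\<^esub> \<one>\<^bsub>S\<^esub>) = c \<odot>\<^bsub>A\<^esub> \<one>\<^bsub>A\<^esub>"
proof -
  let ?f = "c \<odot>\<^bsub>incl.small.T\<^esub> \<one>\<^bsub>incl.small.T\<^esub>"
  have "c \<odot>\<^bsub>S\<^esub> \<one>\<^bsub>S\<^esub> = u_class (witt_borel pm) ?f"
    by (simp only: incl.small.u_class_smult[OF incl.small.T.one_closed] incl.small.u_class_one)
  also have "u_incl (witt pm) \<dots> = u_class (witt pm) ?f"
    by (rule incl.u_incl_class[OF incl.small.T.smult_closed[OF incl.small.T.one_closed]])
  also have "\<dots> = c \<odot>\<^bsub>A\<^esub> \<one>\<^bsub>A\<^esub>"
    by (simp only: incl.T_ops A.u_class_smult[OF A.T.one_closed] A.u_class_one)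
  finally show ?thesis .
qed

lemma tens_scalar: "ext.tens \<one>\<^bsub>A\<^esub> c = (c \<odot>\<^bsub>A\<^esub> \<one>\<^bsub>A\<^esub>) \<odot>\<^bsub>V\<^esub> hw"
proof -
  have "(c \<odot>\<^bsub>A\<^esub> \<one>\<^bsub>A\<^esub>) \<odot>\<^bsub>V\<^esub> hw = ext.tens ((c \<odot>\<^bsub>A\<^esub> \<one>\<^bsub>A\<^esub>) \<otimes>\<^bsub>A\<^esub> \<one>\<^bsub>A\<^esub>) 1"
    unfolding hw_def V_eq by (rule ext.tens_act) simp
  also have "(c \<odot>\<^bsub>A\<^esub> \<one>\<^bsub>A\<^esub>) \<otimes>\<^bsub>A\<^esub> \<one>\<^bsub>A\<^esub> = \<one>\<^bsub>A\<^esub> \<otimes>\<^bsub>A\<^esub> u_incl (witt pm) (c \<odot>\<^bsub>S\<^esub> \<one>\<^bsub>S\<^esub>)"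
    by (simp add: incl_scalar)
  also have "ext.tens \<dots> 1 = ext.tens \<one>\<^bsub>A\<^esub> ((c \<odot>\<^bsub>S\<^esub> \<one>\<^bsub>S\<^esub>) \<odot>\<^bsub>K\<^esub> 1)"
    by (rule ext.tens_balanced) simp_all
  finally show ?thesis by (simp add: chi_scalar)
qed

lemma V_cyclic: "X \<in> carrier V \<Longrightarrow> \<exists>a\<in>carrier A. X = a \<odot>\<^bsub>V\<^esub> hw"
  unfolding V_eq hw_def
proof (rule ext.ext_cyclic)
  fix m :: 'k
  show "\<exists>s\<in>carrier S. m = s \<odot>\<^bsub>K\<^esub> 1"
    using scalar_in_S[of m] by (intro bexI[of _ "m \<odot>\<^bsub>S\<^esub> \<one>\<^bsub>S\<^esub>"]) (simp_all add: chi_scalar)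
qed simp_all

lemma e_hw:
  assumes i: "i \<in> {0..int CHAR('k) - 2}"
  shows "e i \<odot>\<^bsub>V\<^esub> hw = ((if i = 0 then l else 0) \<odot>\<^bsub>A\<^esub> \<one>\<^bsub>A\<^esub>) \<odot>\<^bsub>V\<^esub> hw"
proof -
  have iR: "i \<in> witt_range TYPE('k)" using i by (simp add: witt_range_def)
  have b: "witt_e i \<in> carrier (witt_borel pm)" using i by (simp only: carrier_borel keys_witt_e mem_Collect_eq)
  let ?s = "u_gen (witt_borel pm) (witt_e i)"
  have "u_incl (witt pm) ?s = e i"
    unfolding u_gen_def e_def by (rule incl.u_incl_class[OF incl.small.gen_in[OF b]])
  then have "e i \<odot>\<^bsub>V\<^esub> hw = ext.tens (\<one>\<^bsub>A\<^esub> \<otimes>\<^bsub>A\<^esub> u_incl (witt pm) ?s) 1"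
    unfolding hw_def V_eq using ext.tens_act[OF e_in[OF iR], of "\<one>\<^bsub>A\<^esub>" 1] iR by simp
  also have "\<dots> = ext.tens \<one>\<^bsub>A\<^esub> (?s \<odot>\<^bsub>K\<^esub> 1)"
    by (rule ext.tens_balanced) (use b in simp_all)
  also have "?s \<odot>\<^bsub>K\<^esub> 1 = (if i = 0 then l else 0)"
    using chi.u_lift_gen[OF b] by (simp add: wt_def lookup_witt_e)
  finally show ?thesis by (simp only: tens_scalar)
qed

text \<open>Frobenius reciprocity: a vector \<open>w\<close> of weight \<open>l\<close> that is killed by all \<open>e\<^sub>j\<close> with \<open>j \<ge> 1\<close> spans a
  copy of the character module, so the highest weight vector can be sent to it.\<close>

lemma verma_map:
  fixes r :: "int \<Rightarrow> ('i, 'k) endo" and w :: "'i \<Rightarrow> 'k"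
  assumes rep: "witt_rep scalar pm (witt_range TYPE('k)) r"
    and w0: "app (r 0) w = (\<lambda>i. l * w i)"
    and w1: "\<And>j. j \<in> {1..int CHAR('k) - 2} \<Longrightarrow> app (r j) w = 0"
  defines "lift \<equiv> envelope_map.u_lift scalar (witt_rep.rep scalar (witt_range TYPE('k)) r)"
  shows "\<exists>\<Theta>. (\<forall>X\<in>carrier V. \<forall>Y\<in>carrier V. \<Theta> (X \<oplus>\<^bsub>V\<^esub> Y) = \<Theta> X + \<Theta> Y) \<and>
      (\<forall>a\<in>carrier A. \<forall>X\<in>carrier V. \<Theta> (a \<odot>\<^bsub>V\<^esub> X) = app (lift a) (\<Theta> X)) \<and> \<Theta> hw = w"
proof -
  interpret W: witt_rep scalar pm "witt_range TYPE('k)" r by (rule rep)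
  have env: "envelope_map (witt pm) scalar W.rep"
    using W.env.envelope_map_axioms by (simp only: witt_eq_witt_sub)
  interpret E: envelope_map "witt pm" scalar W.rep by (rule env)
  have lift: "lift = E.u_lift" by (simp only: lift_def)
  have rep_w: "app (W.rep x) (\<lambda>i. c * w i) = (\<lambda>i. wt x * (c * w i))" if "x \<in> carrier (witt_borel pm)" for x c
  proof -
    have x: "Poly_Mapping.lookup x (-1) = 0" using that by (simp add: carrier_borel in_keys_subset_iff)
    have app_sum: "app (sum h T) y = (\<lambda>i. \<Sum>j\<in>T. app (h j) y i)" for h :: "int \<Rightarrow> ('i, 'k) endo" and T y
      by (induction T rule: infinite_finite_induct) (simp_all add: app_simps fun_eq_iff)
    have tm: "app (scalar (Poly_Mapping.lookup x j) * r j) (\<lambda>i. c * w i) = (\<lambda>i. if j = 0 then wt x * (c * w i) else 0)"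
      if "j \<in> witt_range TYPE('k)" for j
    proof -
      have "j = -1 \<or> j = 0 \<or> j \<in> {1..int CHAR('k) - 2}"
        using that unfolding witt_range_def atLeastAtMost_iff by linarith
      then show ?thesis
        by (elim disjE) (simp_all add: app_simps app_scalar app_scale x w0 w1 wt_def fun_eq_iff algebra_simps)
    qed
    have "app (W.rep x) (\<lambda>i. c * w i) = (\<lambda>i. \<Sum>j\<in>witt_range TYPE('k). app (scalar (Poly_Mapping.lookup x j) * r j) (\<lambda>i. c * w i) i)"
      unfolding W.rep_def by (rule app_sum)
    also have "\<dots> = (\<lambda>i. \<Sum>j\<in>witt_range TYPE('k). if j = 0 then wt x * (c * w i) else 0)"
      using tm by (intro HOL.ext sum.cong) simp_all
    also have "\<dots> = (\<lambda>i. wt x * (c * w i))"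
      using W.zero_in_I W.finite_I by simp
    finally show ?thesis .
  qed
  have words: "app (prod_list (map W.rep ws)) (\<lambda>i. c * w i) = (\<lambda>i. prod_list (map wt ws) * (c * w i))"
    if "set ws \<subseteq> carrier (witt_borel pm)" for ws c
    using that
  proof (induction ws)
    case Nil
    then show ?case by (simp add: app_simps)
  next
    case (Cons x ws)
    then show ?case using rep_w[of x "prod_list (map wt ws) * c"] by (simp add: app_simps mult.assoc)
  qed
  have incl: "app (E.u_lift (u_incl (witt pm) s)) (\<lambda>i. c * w i) = (\<lambda>i. chi.u_lift s * (c * w i))"
    if s: "s \<in> carrier S" for s c
  proof -
    obtain f where f: "f \<in> carrier incl.small.T" "s = u_class (witt_borel pm) f"
      using s unfolding incl.small.carrier_u by blast
    have f': "f \<in> carrier A.T" by (rule incl.T_sub[OF f(1)])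
    have ws: "set v \<subseteq> carrier (witt_borel pm)" if "f v \<noteq> 0" for v
      using f(1) that by (simp add: free_algebra_simps)
    have app_sum: "app (sum h T) y = (\<lambda>i. \<Sum>j\<in>T. app (h j) y i)" for h :: "(int \<Rightarrow>\<^sub>0 'k) list \<Rightarrow> ('i, 'k) endo" and T y
      by (induction T rule: infinite_finite_induct) (simp_all add: app_simps fun_eq_iff)
    have "app (E.u_lift (u_incl (witt pm) s)) (\<lambda>i. c * w i) = app (free_lift scalar W.rep f) (\<lambda>i. c * w i)"
      by (simp only: f(2) incl.u_incl_class[OF f(1)] E.u_lift_class[OF f'])
    also have "\<dots> = (\<lambda>i. \<Sum>v | f v \<noteq> 0. (f v * prod_list (map wt v)) * (c * w i))"
      unfolding free_lift_def app_sum
      by (intro HOL.ext sum.cong refl) (simp add: app_simps app_scalar words[OF ws] mult.assoc)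
    also have "\<dots> = (\<lambda>i. free_lift (\<lambda>c. c) wt f * (c * w i))"
      by (simp add: free_lift_def sum_distrib_right)
    finally show ?thesis by (simp only: f(2) chi.u_lift_class[OF f(1)])
  qed
  define t where "t a m = app (E.u_lift a) (\<lambda>i. m * w i)" for a m
  have sc: "(\<lambda>i. (m + n) * w i) = (\<lambda>i. m * w i) + (\<lambda>i. n * w i)" for m n
    by (simp add: fun_eq_iff algebra_simps)
  have "\<exists>\<Theta>. (\<forall>X\<in>carrier V. \<forall>Y\<in>carrier V. \<Theta> (X \<oplus>\<^bsub>V\<^esub> Y) = \<Theta> X + \<Theta> Y) \<and>
      (\<forall>a\<in>carrier A. \<forall>X\<in>carrier V. \<Theta> (a \<odot>\<^bsub>V\<^esub> X) = app (E.u_lift a) (\<Theta> X)) \<and>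
      (\<forall>a\<in>carrier A. \<forall>m\<in>carrier K. \<Theta> (ext.tens a m) = t a m)"
    unfolding V_eq
  proof (rule ext.ext_lift)
    fix a s m assume a: "a \<in> carrier A" and s: "s \<in> carrier S"
    show "t (a \<otimes>\<^bsub>A\<^esub> u_incl (witt pm) s) m = t a (s \<odot>\<^bsub>K\<^esub> m)"
      using incl[OF s, of m] E.u_lift_mult[OF a u_incl_in[OF s]] by (simp add: t_def app_simps mult.assoc)
  next
    fix a x y
    have "app (E.u_lift a) (x - y) + app (E.u_lift a) y = app (E.u_lift a) x"
      using app_add[of "E.u_lift a" "x - y" y] by simp
    then show "app (E.u_lift a) (x - y) = app (E.u_lift a) x - app (E.u_lift a) y"
      by (simp add: eq_diff_eq)
    show "app (E.u_lift a) 0 = 0" by (rule app_zero)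
  next
    fix a b m assume ab: "a \<in> carrier A" "b \<in> carrier A"
    show "t (a \<oplus>\<^bsub>A\<^esub> b) m = t a m + t b m" by (simp only: t_def E.u_lift_add[OF ab] app_simps)
    show "t (a \<otimes>\<^bsub>A\<^esub> b) m = app (E.u_lift a) (t b m)" by (simp only: t_def E.u_lift_mult[OF ab] app_simps)
  next
    fix a m n
    show "t a (m \<oplus>\<^bsub>K\<^esub> n) = t a m + t a n" by (simp only: t_def K_simps sc app_add)
  qed
  then obtain \<Theta> where T: "\<forall>X\<in>carrier V. \<forall>Y\<in>carrier V. \<Theta> (X \<oplus>\<^bsub>V\<^esub> Y) = \<Theta> X + \<Theta> Y"
    "\<forall>a\<in>carrier A. \<forall>X\<in>carrier V. \<Theta> (a \<odot>\<^bsub>V\<^esub> X) = app (E.u_lift a) (\<Theta> X)"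
    "\<forall>a\<in>carrier A. \<forall>m\<in>carrier K. \<Theta> (ext.tens a m) = t a m" by blast
  have "\<Theta> hw = w"
    using T(3) by (simp add: hw_def t_def E.u_lift_one app_simps)
  with T(1,2) show ?thesis unfolding lift by blast
qed

end

section \<open>Density modules\<close>

lemma app_power: "app (a ^ n) x = (app a ^^ n) x"
  by (induction n arbitrary: x) (simp_all add: app_simps)

lemma app_minus_arg: "app a (x - y) = app a x - app a y"
  using app_add[of a "x - y" y] by (simp add: eq_diff_eq)

text \<open>\<open>e\<^sub>j\<close> acts on the density \<open>t\<^sup>n (dt)\<^sup>s\<close> by \<open>(n + (j + 1) s) t\<^sup>n\<^sup>+\<^sup>j (dt)\<^sup>s\<close>; exponents outside
  \<open>0, \<dots>, p - 1\<close> are cut off.\<close>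

definition vop :: "'k::field \<Rightarrow> int \<Rightarrow> (int \<Rightarrow> 'k) \<Rightarrow> int \<Rightarrow> 'k" where
  "vop s j f n = (if n \<in> {0..<int CHAR('k)} \<and> n - j \<in> {0..<int CHAR('k)}
     then (of_int (n - j) + of_int (j + 1) * s) * f (n - j) else 0)"

definition dens :: "'k::field \<Rightarrow> int \<Rightarrow> (int, 'k) endo" where
  "dens s j = Endo (vop s j)"

lemma app_dens: "app (dens s j) = vop s j"
  unfolding dens_def by (rule app_Endo) (auto simp: vop_def fun_eq_iff algebra_simps)

lemma vop_add: "vop s j (f + g) = vop s j f + vop s j g"
  and vop_scale: "vop s j (\<lambda>n. c * f n) = (\<lambda>n. c * vop s j f n)"
  and vop_zero: "vop s j 0 = 0"
  using app_add[of "dens s j"] app_scale[of "dens s j"] app_zero[of "dens s j"] by (simp_all add: app_dens)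

lemma app_zero_fun [simp]: "app a (\<lambda>_. 0) = (\<lambda>_. 0)"
  using app_zero[of a] by (simp add: zero_fun_def)

lemma vop_zero_fun [simp]: "vop s j (\<lambda>_. 0) = (\<lambda>_. 0)"
  using vop_zero[of s j] by (simp add: zero_fun_def)

lemma vop_add_fun: "vop s j (\<lambda>i. f i + g i) n = vop s j f n + vop s j g n"
  using vop_add[of s j f g] by (simp add: plus_fun_def)

lemma vop_support: "n \<notin> {0..<int CHAR('k)} \<Longrightarrow> vop (s :: 'k::field) j f n = 0"
  by (auto simp: vop_def)

context witt_setup
begin

lemma prime_p: "prime CHAR('k)"
  using char5 by (simp add: prime_CHAR_semidom)

lemma odd_p: "odd CHAR('k)"
  using prime_odd_nat[OF prime_p] char5 by simp

lemma of_int_mod_p: "of_nat (nat (n mod int CHAR('k))) = (of_int n :: 'k)"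
proof -
  have "(of_int n :: 'k) = of_int (int CHAR('k)) * of_int (n div int CHAR('k)) + of_int (n mod int CHAR('k))"
    by (simp only: of_int_mult[symmetric] of_int_add[symmetric] mult_div_mod_eq)
  moreover have "of_nat (nat (n mod int CHAR('k))) = (of_int (n mod int CHAR('k)) :: 'k)"
    using char5 by (simp add: of_nat_nat)
  ultimately show ?thesis by simp
qed

lemma of_int_eq_0: "of_int n = (0 :: 'k) \<longleftrightarrow> int CHAR('k) dvd n"
proof
  assume n: "of_int n = (0 :: 'k)"
  then have "CHAR('k) dvd nat (n mod int CHAR('k))"
    using of_int_mod_p[of n] by (simp flip: of_nat_eq_0_iff_char_dvd)
  moreover have "nat (n mod int CHAR('k)) < CHAR('k)" using char5 by (simp add: nat_less_iff)
  ultimately have "nat (n mod int CHAR('k)) = 0" by (meson dvd_imp_le linorder_not_less neq0_conv)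
  moreover have "0 \<le> n mod int CHAR('k)" using char5 by simp
  ultimately show "int CHAR('k) dvd n" by auto
next
  assume "int CHAR('k) dvd n"
  then obtain q where "n = int CHAR('k) * q" ..
  then show "of_int n = (0 :: 'k)" by simp
qed

lemma of_int_neq_0: "\<lbrakk>n \<noteq> 0; \<bar>n\<bar> < int CHAR('k)\<rbrakk> \<Longrightarrow> of_int n \<noteq> (0 :: 'k)"
  using dvd_imp_le_int[of n "int CHAR('k)"] by (auto simp: of_int_eq_0)

lemma ints_power_p: "x \<in> \<int> \<Longrightarrow> x ^ CHAR('k) = (x :: 'k)"
proof -
  assume "x \<in> \<int>"
  then obtain n where n: "x = of_int n" by (auto elim: Ints_cases)
  have "of_nat m ^ CHAR('k) = (of_nat m :: 'k)" for m
  proof (induction m)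
    case 0
    show ?case using char5 by (simp add: power_0_left)
  next
    case (Suc m)
    have "(of_nat m + 1 :: 'k) ^ CHAR('k) = of_nat m ^ CHAR('k) + 1 ^ CHAR('k)"
      by (rule freshmans_dream[OF prime_p refl])
    then show ?case using Suc by (simp add: add.commute)
  qed
  moreover have "x = of_nat (nat (n mod int CHAR('k)))" using of_int_mod_p[of n] n by simp
  ultimately show ?thesis by metis
qed

text \<open>The cut-off is harmless: a product can leave the range and return only through a step with \<open>e\<^sub>-\<^sub>1\<close>
  from \<open>p\<close> or \<open>0\<close>, whose coefficient vanishes modulo \<open>p\<close>.\<close>

lemma vop_vop:
  assumes "-1 \<le> i" "-1 \<le> j"
  shows "vop (s :: 'k) i (vop s j f) n = (if n \<in> {0..<int CHAR('k)} \<and> n - i - j \<in> {0..<int CHAR('k)}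
    then (of_int (n - i - j) + of_int (j + 1) * s) * (of_int (n - i) + of_int (i + 1) * s) * f (n - i - j) else 0)"
proof (cases "n \<in> {0..<int CHAR('k)} \<and> n - i - j \<in> {0..<int CHAR('k)}")
  case True
  show ?thesis
  proof (cases "n - i \<in> {0..<int CHAR('k)}")
    case in_range: True
    with True show ?thesis by (simp add: vop_def)
  next
    case False
    with True assms consider "i = -1" "n - i = int CHAR('k)" | "j = -1" "n - i - j = 0" by force
    then show ?thesis
    proof cases
      case 1
      then have "of_int (n - i) + of_int (i + 1) * s = 0" by simp
      with False True show ?thesis by (simp add: vop_def)
    next
      case 2
      then have "of_int (n - i - j) + of_int (j + 1) * s = 0" by simp
      with False True show ?thesis by (simp add: vop_def)
    qed
  qed
next
  case False
  then show ?thesis by (auto simp: vop_def)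
qed

lemma dens_comm:
  assumes "-1 \<le> i" "-1 \<le> j"
  shows "dens s i * dens s j - dens s j * dens s i = scalar (of_int (j - i)) * dens (s :: 'k) (i + j)"
proof (rule endo_eqI, rule ext)
  fix f n
  have e: "n - j - i = n - i - j" "n - (i + j) = n - i - j" by simp_all
  have "vop s i (vop s j f) n - vop s j (vop s i f) n = of_int (j - i) * vop s (i + j) f n"
  proof (cases "n \<in> {0..<int CHAR('k)} \<and> n - i - j \<in> {0..<int CHAR('k)}")
    case True
    have "(of_int (n - i - j) + of_int (j + 1) * s) * (of_int (n - i) + of_int (i + 1) * s) * z
        - (of_int (n - i - j) + of_int (i + 1) * s) * (of_int (n - j) + of_int (j + 1) * s) * z
        = of_int (j - i) * ((of_int (n - i - j) + of_int (i + j + 1) * s) * z)" for z :: 'k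
      by (simp add: algebra_simps)
    then show ?thesis
      unfolding vop_vop[OF assms] vop_vop[OF assms(2,1)] vop_def[of s "i + j"] e using True by simp
  next
    case False
    then show ?thesis
      unfolding vop_vop[OF assms] vop_vop[OF assms(2,1)] vop_def[of s "i + j"] e by (simp only: if_False) simp
  qed
  then show "app (dens s i * dens s j - dens s j * dens s i) f n = app (scalar (of_int (j - i)) * dens s (i + j)) f n"
    by (simp add: app_simps app_dens app_scalar)
qed

lemma vop_large: "j \<ge> int CHAR('k) - 1 \<Longrightarrow> vop (s :: 'k) j f = 0"
proof
  fix n assume j: "j \<ge> int CHAR('k) - 1"
  show "vop s j f n = 0 n"
  proof (cases "n \<in> {0..<int CHAR('k)} \<and> n - j \<in> {0..<int CHAR('k)}")
    case True
    with j have "n - j = 0" "j + 1 = int CHAR('k)" by auto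
    then show ?thesis by (simp add: vop_def)
  next
    case False
    then show ?thesis by (auto simp: vop_def)
  qed
qed

lemma dens_large: "j \<ge> int CHAR('k) - 1 \<Longrightarrow> dens (s :: 'k) j = 0"
  by (rule endo_eqI) (simp add: app_simps app_dens vop_large)

lemma vop_power_vanish:
  assumes "-1 \<le> j" "j \<noteq> 0"
  shows "(vop (s :: 'k) j ^^ CHAR('k)) f = 0"
proof
  fix n
  show "(vop s j ^^ CHAR('k)) f n = 0 n"
  proof (cases "j = -1")
    case True
    have "(vop s j ^^ k) f n = 0" if "n \<notin> {0..<int CHAR('k)} \<or> n > int CHAR('k) - 1 - int k" "k > 0" for k n
      using that
    proof (induction k arbitrary: n)
      case (Suc k)
      then show ?case by (cases "k = 0") (auto simp: vop_def True)
    qed simp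
    then show ?thesis using char5 by (cases "n \<ge> 0") auto
  next
    case False
    then have j: "j \<ge> 1" using assms by auto
    have "(vop s j ^^ k) f n = 0" if "n \<notin> {0..<int CHAR('k)} \<or> n < int k" "k > 0" for k n
      using that
    proof (induction k arbitrary: n)
      case (Suc k)
      then show ?case using j by (cases "k = 0") (auto simp: vop_def)
    qed simp
    then show ?thesis using char5 by (cases "n < int CHAR('k)") auto
  qed
qed

lemma dens_power:
  assumes s: "s ^ CHAR('k) = (s :: 'k)" and j: "-1 \<le> j"
  shows "dens s j ^ CHAR('k) = (if j = 0 then dens s 0 else 0)"
proof (rule endo_eqI)
  fix f
  show "app (dens s j ^ CHAR('k)) f = app (if j = 0 then dens s 0 else 0) f"
  proof (cases "j = 0")
    case False
    then show ?thesis using vop_power_vanish[OF j False] by (simp add: app_power app_dens app_simps)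
  next
    case True
    have diag: "(vop s 0 ^^ k) f n = (if n \<in> {0..<int CHAR('k)} then (of_int n + s) ^ k * f n else 0)" if "k > 0" for k n
      using that
    proof (induction k arbitrary: n)
      case (Suc k)
      then show ?case by (cases "k = 0") (auto simp: vop_def)
    qed simp
    have "(of_int n + s) ^ CHAR('k) = of_int n + s" for n
      using freshmans_dream[OF prime_p refl, of "of_int n" s] s ints_power_p[of "of_int n"] by simp
    then have "(vop s 0 ^^ CHAR('k)) f = vop s 0 f"
      using diag[of "CHAR('k)"] char5 by (auto simp: vop_def)
    then show ?thesis using True by (simp add: app_power app_dens)
  qed
qed

lemma dens_rep:
  assumes s: "s ^ CHAR('k) = (s :: 'k)"
  shows "witt_rep scalar pm (witt_range TYPE('k)) (dens s)"
proof (intro witt_rep.intro algebra_map_scalar witt_rep_axioms.intro char5 pm)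
  show "witt_index TYPE('k) (witt_range TYPE('k))" by (simp add: witt_index_def)
next
  fix i j assume ij: "i \<in> witt_range TYPE('k)" "j \<in> witt_range TYPE('k)"
  then have b: "-1 \<le> i" "-1 \<le> j" by (auto simp: witt_range_def)
  show "dens s i * dens s j - dens s j * dens s i =
      (if i + j \<in> witt_range TYPE('k) then scalar (of_int (j - i)) * dens s (i + j) else 0)"
  proof (cases "i + j \<in> witt_range TYPE('k)")
    case False
    then have "i + j \<ge> int CHAR('k) - 1 \<or> j = i" using ij by (auto simp: witt_range_def)
    moreover have "scalar (of_int 0) = (0 :: (int, 'k) endo)"
      by (rule endo_eqI) (simp add: app_scalar app_simps fun_eq_iff)
    ultimately show ?thesis using False dens_comm[OF b, of s] dens_large[of "i + j" s] by auto
  qed (simp add: dens_comm[OF b])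
next
  fix i assume "i \<in> witt_range TYPE('k)"
  then show "dens s i ^ CHAR('k) = (if i = 0 then dens s 0 else 0)"
    using dens_power[OF s] by (simp add: witt_range_def)
qed

end

section \<open>Modules extending one density module by another\<close>

text \<open>An extension of the density module of \<open>sm\<close> by that of \<open>sl\<close>, where \<open>D j\<close> is the prescribed value of
  \<open>e\<^sub>j\<close> on the highest weight vector of the quotient. The quotient is free over the span of the powers
  of \<open>e\<^sub>-\<^sub>1\<close>, so these values determine all operators.\<close>

locale extension_setup = witt_setup pm for pm :: "(int \<Rightarrow>\<^sub>0 'k::field) \<Rightarrow> (int \<Rightarrow>\<^sub>0 'k)" +
  fixes sl sm :: 'k and D :: "int \<Rightarrow> int \<Rightarrow> 'k"
  assumes sl: "sl ^ CHAR('k) = sl" and sm: "sm ^ CHAR('k) = sm"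
    and D_out: "j \<notin> {1..int CHAR('k) - 2} \<Longrightarrow> D j = 0"
    and D_supp: "n \<notin> {0..<int CHAR('k)} \<Longrightarrow> D j n = 0"
    and D_weight: "vop sl 0 (D j) = (\<lambda>n. (sm - 1 + of_int j) * D j n)"
    and D_cocycle: "\<lbrakk>1 \<le> i; 1 \<le> j\<rbrakk> \<Longrightarrow> vop sl i (D j) - vop sl j (D i) = (\<lambda>n. of_int (j - i) * D (i + j) n)"
    and D_power: "1 \<le> j \<Longrightarrow> (vop sl j ^^ (CHAR('k) - 1)) (D j) = 0"
begin

text \<open>Let \<open>W n\<close> be \<open>e\<^sub>-\<^sub>1\<^sup>n\<close> applied to the lift of the highest weight vector. Then \<open>gam n j\<close> is the component
  of \<open>e\<^sub>j (W n)\<close> in the submodule; the recursion moves \<open>e\<^sub>j\<close> past \<open>e\<^sub>-\<^sub>1\<close> by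
  \<open>e\<^sub>j e\<^sub>-\<^sub>1 = e\<^sub>-\<^sub>1 e\<^sub>j - (j + 1) e\<^sub>j\<^sub>-\<^sub>1\<close>.\<close>

primrec gam :: "nat \<Rightarrow> int \<Rightarrow> int \<Rightarrow> 'k" where
  "gam 0 = D"
| "gam (Suc n) = (\<lambda>j x. vop sl (-1) (gam n j) x - of_int (j + 1) * gam n (j - 1) x)"

definition fall :: "int \<Rightarrow> nat \<Rightarrow> 'k" where
  "fall j k = (\<Prod>i<k. of_int (j + 1 - int i))"

lemma fall_Suc: "fall j (Suc k) = of_int (j + 1) * fall (j - 1) k"
  unfolding fall_def prod.lessThan_Suc_shift by (simp add: algebra_simps)

lemma gam_closed_form:
  "gam n j x = (\<Sum>k\<le>n. of_int ((-1) ^ k * int (n choose k)) * fall j k * (vop sl (-1) ^^ (n - k)) (D (j - int k)) x)"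
proof (induction n arbitrary: j x)
  case 0
  show ?case by (simp add: fall_def)
next
  case (Suc n)
  define t where "t k = fall j k * (vop sl (-1) ^^ (Suc n - k)) (D (j - int k)) x" for k
  define b where "b n k = (of_int ((-1) ^ k * int (n choose k)) :: 'k)" for n k
  have lin: "vop sl (-1) (\<lambda>x. \<Sum>k\<in>K. c k * h k x) = (\<lambda>x. \<Sum>k\<in>K. c k * vop sl (-1) (h k) x)"
    if "finite K" for K :: "nat set" and c :: "nat \<Rightarrow> 'k" and h
    using that
  proof (induction K rule: finite_induct)
    case empty
    then show ?case using vop_zero[of sl "-1"] by (simp add: zero_fun_def)
  next
    case (insert k K)
    have "(\<lambda>x. \<Sum>k\<in>insert k K. c k * h k x) = (\<lambda>x. c k * h k x) + (\<lambda>x. \<Sum>k\<in>K. c k * h k x)"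
      using insert by (simp add: fun_eq_iff)
    then show ?case using insert by (simp only: vop_add vop_scale) (simp add: fun_eq_iff)
  qed
  have b_Suc: "b (Suc n) (Suc k) = b n (Suc k) - b n k" for k
    by (simp add: b_def algebra_simps)
  have "gam n j = (\<lambda>x. \<Sum>k\<le>n. (b n k * fall j k) * (vop sl (-1) ^^ (n - k)) (D (j - int k)) x)"
    by (simp add: Suc b_def fun_eq_iff)
  then have "vop sl (-1) (gam n j) x = (\<Sum>k\<le>n. b n k * fall j k * vop sl (-1) ((vop sl (-1) ^^ (n - k)) (D (j - int k))) x)"
    by (simp only: lin[OF finite_atMost])
  also have "\<dots> = (\<Sum>k\<le>n. b n k * t k)"
    by (intro sum.cong refl) (simp add: t_def Suc_diff_le mult.assoc)
  also have "\<dots> = (\<Sum>k\<le>Suc n. b n k * t k)" by (simp add: b_def binomial_eq_0)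
  also have "\<dots> = b n 0 * t 0 + (\<Sum>k\<le>n. b n (Suc k) * t (Suc k))" by (rule sum.atMost_Suc_shift)
  finally have 1: "vop sl (-1) (gam n j) x = b n 0 * t 0 + (\<Sum>k\<le>n. b n (Suc k) * t (Suc k))" .
  have 2: "of_int (j + 1) * gam n (j - 1) x = (\<Sum>k\<le>n. b n k * t (Suc k))"
    unfolding Suc sum_distrib_left
    by (intro sum.cong refl) (simp add: t_def fall_Suc b_def algebra_simps)
  have "gam (Suc n) j x = b (Suc n) 0 * t 0 + (\<Sum>k\<le>n. b (Suc n) (Suc k) * t (Suc k))"
    unfolding gam.simps 1 2 by (simp add: b_Suc left_diff_distrib sum_subtractf) (simp add: b_def)
  also have "\<dots> = (\<Sum>k\<le>Suc n. b (Suc n) k * t k)" by (rule sum.atMost_Suc_shift[symmetric])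
  finally show ?case by (simp add: b_def t_def mult.assoc)
qed

text \<open>The definition by recursion is consistent with \<open>e\<^sub>-\<^sub>1\<^sup>p = 0\<close>. In the closed form the inner terms vanish
  since \<open>p\<close> divides the binomial coefficients, the first one since \<open>e\<^sub>-\<^sub>1\<^sup>p = 0\<close> on the submodule, and the
  last one since its factor is a product of \<open>p\<close> consecutive integers.\<close>

lemma gam_p: "gam CHAR('k) j = 0"
proof
  fix x
  have "of_int ((-1) ^ k * int (CHAR('k) choose k)) * fall j k * (vop sl (-1) ^^ (CHAR('k) - k)) (D (j - int k)) x = 0" if "k \<le> CHAR('k)" for k
  proof -
    have "k = 0 \<or> (0 < k \<and> k < CHAR('k)) \<or> k = CHAR('k)" using that by linarith
    then show ?thesis
    proof (elim disjE)
      assume 1: "k = 0"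
      then show ?thesis using vop_power_vanish[of "-1" sl "D j"] by simp
    next
      assume 2: "0 < k \<and> k < CHAR('k)"
      then have "CHAR('k) dvd (CHAR('k) choose k)" using prime_p by (intro dvd_choose_prime) auto
      then obtain q where "CHAR('k) choose k = CHAR('k) * q" ..
      then show ?thesis by simp
    next
      assume 3: "k = CHAR('k)"
      show ?thesis
      proof (cases "j - int k \<in> {1..int CHAR('k) - 2}")
        case False
        then show ?thesis using D_out 3 by simp
      next
        case True
        then have "j + 1 - int (nat ((j + 1) mod int CHAR('k))) = (j + 1) div int CHAR('k) * int CHAR('k)"
          using char5 by (simp add: minus_mod_eq_div_mult)
        then have "of_int (j + 1 - int (nat ((j + 1) mod int CHAR('k)))) = (0 :: 'k)"
          by (simp add: of_int_eq_0)
        moreover have "nat ((j + 1) mod int CHAR('k)) < CHAR('k)" using char5 by (simp add: nat_less_iff)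
        ultimately have "\<exists>a\<in>{..<CHAR('k)}. of_int (j + 1 - int a) = (0 :: 'k)" by blast
        then have "fall j CHAR('k) = 0" unfolding fall_def by (rule prod_zero[OF finite_lessThan])
        then show ?thesis using 3 by simp
      qed
    qed
  qed
  then show "gam CHAR('k) j x = 0 x" unfolding gam_closed_form by (simp add: sum.neutral)
qed

lemma gam_neg: "j < 0 \<Longrightarrow> gam n j = (\<lambda>_. 0)"
proof (induction n arbitrary: j)
  case 0
  then show ?case using D_out[of j] by (simp add: zero_fun_def)
next
  case (Suc n)
  have "gam n j = (\<lambda>_. 0)" "gam n (j - 1) = (\<lambda>_. 0)" using Suc by simp_all
  then show ?case by simp
qed

lemma gam_supp: "x \<notin> {0..<int CHAR('k)} \<Longrightarrow> gam n j x = 0"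
proof (induction n arbitrary: j)
  case 0
  then show ?case using D_supp by simp
next
  case (Suc n)
  then show ?case using vop_support[OF Suc.prems] by simp
qed

lemma gam_large: "j \<ge> int CHAR('k) - 1 \<Longrightarrow> gam n j = 0"
proof (induction n arbitrary: j)
  case 0
  then show ?case by (simp add: D_out)
next
  case (Suc n)
  have v: "vop sl (-1) (gam n j) = 0" using Suc.IH[OF Suc.prems] by (simp add: zero_fun_def)
  have "of_int (j + 1) * gam n (j - 1) x = 0" for x
  proof (cases "j = int CHAR('k) - 1")
    case True
    then show ?thesis by simp
  next
    case False
    then show ?thesis using Suc by simp
  qed
  then show ?case using v by (simp add: fun_eq_iff)
qed

text \<open>The factor by which \<open>e\<^sub>-\<^sub>1\<^sup>n\<close> scales the highest weight vector while lowering it.\<close>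

definition fct :: "nat \<Rightarrow> 'k" where
  "fct n = (\<Prod>k<n. of_int (int CHAR('k) - 1 - int k))"

lemma fct_nz: "n < CHAR('k) \<Longrightarrow> fct n \<noteq> 0"
proof -
  assume n: "n < CHAR('k)"
  have "of_int (int CHAR('k) - 1 - int k) \<noteq> (0 :: 'k)" if "k < n" for k
    using that n by (intro of_int_neq_0) auto
  then show ?thesis unfolding fct_def prod_zero_iff[OF finite_lessThan] by blast
qed

text \<open>\<open>Inl\<close> indexes the submodule and \<open>Inr\<close> the quotient. Dividing by \<open>fct\<close> expresses the
  basis of the quotient through the vectors \<open>W n\<close>.\<close>

definition Eop :: "int \<Rightarrow> (int + int \<Rightarrow> 'k) \<Rightarrow> int + int \<Rightarrow> 'k" where
  "Eop j F = case_sum (\<lambda>n. vop sl j (\<lambda>i. F (Inl i)) n + (\<Sum>i<CHAR('k). F (Inr (int i)) * (gam (CHAR('k) - 1 - i) j n / fct (CHAR('k) - 1 - i))))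
     (vop sm j (\<lambda>i. F (Inr i)))"

definition E :: "int \<Rightarrow> (int + int, 'k) endo" where
  "E j = Endo (Eop j)"

lemma app_E: "app (E j) = Eop j"
  unfolding E_def
proof (rule app_Endo)
  fix x y :: "int + int \<Rightarrow> 'k"
  show "Eop j (x + y) = Eop j x + Eop j y"
  proof
    fix z show "Eop j (x + y) z = (Eop j x + Eop j y) z"
      by (cases z) (simp_all add: Eop_def vop_add_fun distrib_right sum.distrib add_divide_distrib)
  qed
  fix c
  show "Eop j (\<lambda>i. c * x i) = (\<lambda>i. c * Eop j x i)"
  proof
    fix z show "Eop j (\<lambda>i. c * x i) z = c * Eop j x z"
      by (cases z) (simp_all add: Eop_def vop_scale distrib_left sum_distrib_left mult.assoc)
  qed
qed

definition delta :: "int \<Rightarrow> int \<Rightarrow> 'k" where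
  "delta i n = (if n = i then 1 else 0)"

definition low :: "(int \<Rightarrow> 'k) \<Rightarrow> int + int \<Rightarrow> 'k" where
  "low f = case_sum f (\<lambda>_. 0)"

definition W :: "nat \<Rightarrow> int + int \<Rightarrow> 'k" where
  "W n = case_sum (\<lambda>_. 0) (\<lambda>i. fct n * delta (int CHAR('k) - 1 - int n) i)"

text \<open>Functions whose quotient part vanishes on \<open>0, \<dots>, p - 1\<close>. Besides the submodule this
  includes values outside the range, which all operators ignore.\<close>

definition upper_zero :: "(int + int \<Rightarrow> 'k) \<Rightarrow> bool" where
  "upper_zero F \<longleftrightarrow> (\<forall>i\<in>{0..<int CHAR('k)}. F (Inr i) = 0)"

lemma Eop_upper_zero: "upper_zero F \<Longrightarrow> Eop j F = low (vop sl j (\<lambda>i. F (Inl i)))"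
  by (auto simp: fun_eq_iff Eop_def low_def upper_zero_def vop_def split: sum.split)

lemma upper_zero_low: "upper_zero (low f)" and low_Inl: "(\<lambda>i. low f (Inl i)) = f"
  by (auto simp: upper_zero_def low_def)

lemma Eop_low: "Eop j (low f) = low (vop sl j f)"
  by (simp add: Eop_upper_zero upper_zero_low low_Inl)

lemma low_zero: "low 0 = 0"
  by (auto simp: low_def fun_eq_iff split: sum.split)

lemma Eop_W: "n < CHAR('k) \<Longrightarrow> Eop j (W n) = case_sum (gam n j) (\<lambda>i. fct n * vop sm j (delta (int CHAR('k) - 1 - int n)) i)"
proof -
  assume n: "n < CHAR('k)"
  have "(\<Sum>i<CHAR('k). W n (Inr (int i)) * (gam (CHAR('k) - 1 - i) j x / fct (CHAR('k) - 1 - i)))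
      = (\<Sum>i<CHAR('k). if i = CHAR('k) - 1 - n then gam n j x else 0)" for x
  proof (intro sum.cong refl)
    fix i assume "i \<in> {..<CHAR('k)}"
    then show "W n (Inr (int i)) * (gam (CHAR('k) - 1 - i) j x / fct (CHAR('k) - 1 - i)) = (if i = CHAR('k) - 1 - n then gam n j x else 0)"
      using n fct_nz[OF n] by (auto simp: W_def delta_def)
  qed
  also have "\<dots> x = gam n j x" for x using n by simp
  finally have "(\<Sum>i<CHAR('k). W n (Inr (int i)) * (gam (CHAR('k) - 1 - i) j x / fct (CHAR('k) - 1 - i))) = gam n j x" for x .
  moreover have "vop sl j (\<lambda>i. W n (Inl i)) = 0" using vop_zero[of sl j] by (simp add: W_def zero_fun_def)
  moreover have "vop sm j (\<lambda>i. W n (Inr i)) = (\<lambda>i. fct n * vop sm j (delta (int CHAR('k) - 1 - int n)) i)"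
    using vop_scale[of sm j "fct n"] by (simp add: W_def)
  ultimately show ?thesis by (simp add: Eop_def fun_eq_iff split: sum.split)
qed

lemma Eop_minus_one_W:
  assumes n: "n < CHAR('k)"
  shows "Eop (-1) (W n) = (if Suc n < CHAR('k) then W (Suc n) else 0)"
proof -
  have g: "gam n (-1) = (\<lambda>_. 0)" by (rule gam_neg) simp
  have v: "fct n * vop sm (-1) (delta (int CHAR('k) - 1 - int n)) i = (if Suc n < CHAR('k) then fct (Suc n) * delta (int CHAR('k) - 1 - int (Suc n)) i else 0)" for i
    using n by (auto simp: vop_def delta_def fct_def)
  show ?thesis unfolding Eop_W[OF n] g by (auto simp: v W_def fun_eq_iff split: sum.split)
qed

text \<open>The vectors \<open>W n\<close> span the quotient, so relations have to be checked only on them and on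
  the submodule.\<close>

lemma endo_zeroI:
  fixes a :: "(int + int, 'k) endo"
  assumes low: "\<And>F. upper_zero F \<Longrightarrow> app a F = 0" and W: "\<And>n. n < CHAR('k) \<Longrightarrow> app a (W n) = 0"
  shows "a = 0"
proof (rule endo_eqI)
  fix F :: "int + int \<Rightarrow> 'k"
  define c where "c n = F (Inr (int CHAR('k) - 1 - int n)) / fct n" for n
  have "app a (\<lambda>x. \<Sum>n\<in>S. c n * W n x) = 0" if "S \<subseteq> {..<CHAR('k)}" for S
    using finite_subset[OF that finite_lessThan] that
  proof (induction S rule: finite_induct)
    case empty
    then show ?case using app_zero[of a] by (simp add: zero_fun_def)
  next
    case (insert n S)
    have "(\<lambda>x. \<Sum>n\<in>insert n S. c n * W n x) = (\<lambda>x. c n * W n x) + (\<lambda>x. \<Sum>n\<in>S. c n * W n x)"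
      using insert by (simp add: fun_eq_iff)
    then show ?case using insert W[of n] by (simp only: app_add app_scale) (simp add: fun_eq_iff)
  qed
  then have 1: "app a (\<lambda>x. \<Sum>n<CHAR('k). c n * W n x) = 0" by simp
  have "upper_zero (F - (\<lambda>x. \<Sum>n<CHAR('k). c n * W n x))"
    unfolding upper_zero_def
  proof
    fix i assume i: "i \<in> {0..<int CHAR('k)}"
    have "(\<Sum>n<CHAR('k). c n * W n (Inr i)) = (\<Sum>n<CHAR('k). if n = nat (int CHAR('k) - 1 - i) then F (Inr i) else 0)"
    proof (intro sum.cong refl)
      fix n assume n: "n \<in> {..<CHAR('k)}"
      show "c n * W n (Inr i) = (if n = nat (int CHAR('k) - 1 - i) then F (Inr i) else 0)"
        using n i fct_nz[of n] by (auto simp: c_def W_def delta_def)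
    qed
    also have "\<dots> = F (Inr i)"
    proof -
      have "nat (int CHAR('k) - 1 - i) < CHAR('k)" using i char5 by auto
      then show ?thesis by simp
    qed
    finally show "(F - (\<lambda>x. \<Sum>n<CHAR('k). c n * W n x)) (Inr i) = 0" by simp
  qed
  then have "app a (F - (\<lambda>x. \<Sum>n<CHAR('k). c n * W n x)) = 0" by (rule low)
  then have "app a F - app a (\<lambda>x. \<Sum>n<CHAR('k). c n * W n x) = 0" by (simp only: app_minus_arg)
  with 1 show "app a F = app 0 F" by (simp add: app_simps)
qed

lemma E_large: "j \<ge> int CHAR('k) - 1 \<Longrightarrow> E j = 0"
  by (rule endo_eqI) (auto simp: app_E app_simps Eop_def vop_large gam_large fun_eq_iff split: sum.split)

lemma scalar_zero: "scalar 0 = (0 :: (int + int, 'k) endo)"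
  by (rule endo_eqI) (simp add: app_scalar app_simps fun_eq_iff)

lemma vop_comm:
  assumes "-1 \<le> i" "-1 \<le> j"
  shows "vop (s :: 'k) i (vop s j f) x - vop s j (vop s i f) x = of_int (j - i) * vop s (i + j) f x"
  using arg_cong[OF dens_comm[OF assms, of s], of "\<lambda>a. app a f x"] by (simp add: app_simps app_dens app_scalar)

definition defect :: "int \<Rightarrow> int \<Rightarrow> (int + int, 'k) endo" where
  "defect i j = E i * E j - E j * E i - scalar (of_int (j - i)) * E (i + j)"

lemma app_defect: "app (defect i j) F = Eop i (Eop j F) - Eop j (Eop i F) - (\<lambda>x. of_int (j - i) * Eop (i + j) F x)"
  by (simp add: defect_def app_simps app_E app_scalar)

lemma defect_upper_zero:
  assumes "-1 \<le> i" "-1 \<le> j" "upper_zero F"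
  shows "app (defect i j) F = 0"
  unfolding app_defect Eop_upper_zero[OF assms(3)] Eop_low
  using vop_comm[OF assms(1,2), of sl] by (auto simp: fun_eq_iff low_def split: sum.split)

text \<open>The definition of \<open>gam\<close> is precisely the relation with \<open>e\<^sub>-\<^sub>1\<close>.\<close>

lemma defect_minus_one:
  assumes j: "-1 \<le> j"
  shows "defect (-1) j = 0"
proof (rule endo_zeroI)
  fix F assume "upper_zero F"
  with j show "app (defect (-1) j) F = 0" by (intro defect_upper_zero) auto
next
  fix n assume n: "n < CHAR('k)"
  have up: "Eop j (Eop (-1) (W n)) (Inl x) = gam (Suc n) j x" for x
  proof (cases "Suc n < CHAR('k)")
    case True
    then show ?thesis by (simp add: Eop_minus_one_W[OF n] Eop_W)
  next
    case False
    then have "Suc n = CHAR('k)" using n by simp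
    then show ?thesis using gam_p app_zero[of "E j"] by (simp add: Eop_minus_one_W[OF n] app_E del: gam.simps)
  qed
  have sh: "(j - (-1)) = j + 1" "(-1 + j) = j - 1" by simp_all
  have lowpart: "Eop (-1) (Eop j (W n)) (Inl x) = vop sl (-1) (gam n j) x" for x
  proof -
    have "gam k (-1) = (\<lambda>_. 0)" for k by (rule gam_neg) simp
    then show ?thesis by (simp add: Eop_def[of "-1" "Eop j (W n)"]) (simp add: Eop_W[OF n])
  qed
  have "Eop (-1) (Eop j (W n)) (Inl x) - Eop j (Eop (-1) (W n)) (Inl x) - of_int (j - (-1)) * Eop (-1 + j) (W n) (Inl x) = 0" for x
    unfolding up lowpart by (simp add: Eop_W[OF n] sh)
  moreover have "Eop (-1) (Eop j (W n)) (Inr x) - Eop j (Eop (-1) (W n)) (Inr x) - of_int (j - (-1)) * Eop (-1 + j) (W n) (Inr x) = 0" for x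
    using vop_comm[of "-1" j sm "\<lambda>i. W n (Inr i)" x] j by (simp add: Eop_def)
  note calculation = calculation this
  show "app (defect (-1) j) (W n) = 0"
    unfolding app_defect
  proof (intro ext)
    fix y
    show "(Eop (-1) (Eop j (W n)) - Eop j (Eop (-1) (W n)) - (\<lambda>x. of_int (j - (-1)) * Eop (-1 + j) (W n) x)) y = 0 y"
      using calculation by (cases y) simp_all
  qed
qed

lemma app_endo_eq: "a = b \<Longrightarrow> app a x = app b x"
  by simp

lemma E_comm_minus_one:
  assumes "-1 \<le> j"
  shows "E (-1) * E j = E j * E (-1) + scalar (of_int (j + 1)) * E (j - 1)"
  using defect_minus_one[OF assms] by (simp add: defect_def algebra_simps)

lemma scalar_alg:
  "scalar (c + d) = (scalar c + scalar d :: (int + int, 'k) endo)"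
  "scalar (c * d) = (scalar c * scalar d :: (int + int, 'k) endo)"
  "scalar c * r = r * scalar c"
  using algebra_map.map_add[OF algebra_map_scalar] algebra_map.map_mult[OF algebra_map_scalar]
    algebra_map.central[OF algebra_map_scalar] by blast+

text \<open>The Jacobi identity: commuting \<open>e\<^sub>-\<^sub>1\<close> past the failure of one relation leaves failures of
  relations of lower degree. This is the induction step from \<open>W n\<close> to \<open>W (n + 1)\<close>.\<close>

lemma defect_shift:
  assumes "0 \<le> i" "0 \<le> j"
  shows "defect i j * E (-1) = E (-1) * defect i j
    - scalar (of_int (i + 1)) * defect (i - 1) j - scalar (of_int (j + 1)) * defect i (j - 1)"
proof (rule endo_eqI)
  fix F :: "int + int \<Rightarrow> 'k"
  have c: "Eop (-1) (Eop k G) = Eop k (Eop (-1) G) + (\<lambda>x. of_int (k + 1) * Eop (k - 1) G x)" if "-1 \<le> k" for k G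
    using app_endo_eq[OF E_comm_minus_one[OF that], of G] by (simp add: app_simps app_E app_scalar)
  have lin: "Eop k (x + y) = Eop k x + Eop k y" "Eop k (x - y) = Eop k x - Eop k y"
    "Eop k (\<lambda>i. a * x i) = (\<lambda>i. a * Eop k x i)" for k x y a
    using app_add[of "E k"] app_minus_arg[of "E k"] app_scale[of "E k"] by (simp_all add: app_E)
  have ij: "-1 \<le> i" "-1 \<le> j" "-1 \<le> i + j" using assms by auto
  have idx: "i - 1 + j = i + j - 1" "i + (j - 1) = i + j - 1" by auto
  show "app (defect i j * E (-1)) F = app (E (-1) * defect i j
    - scalar (of_int (i + 1)) * defect (i - 1) j - scalar (of_int (j + 1)) * defect i (j - 1)) F"
    unfolding app_simps app_E app_scalar app_defect lin c[OF ij(1)] c[OF ij(2)] c[OF ij(3)] idx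
    by (rule ext) (simp add: lin c[OF ij(2)] c[OF ij(1)] algebra_simps)
qed

lemma W0: "W 0 = case_sum (\<lambda>_. 0) (delta (int CHAR('k) - 1))"
  by (simp add: W_def fct_def)

lemma Eop_W0:
  assumes "0 \<le> j"
  shows "Eop j (W 0) = low (D j) + (\<lambda>x. (if j = 0 then sm - 1 else 0) * W 0 x)"
proof -
  have "vop sm j (delta (int CHAR('k) - 1)) i = (if j = 0 then sm - 1 else 0) * delta (int CHAR('k) - 1) i" for i
    using assms char5 by (auto simp: vop_def delta_def)
  moreover have "fct 0 = 1" by (simp add: fct_def)
  ultimately show ?thesis
    using Eop_W[of 0 j] char5 by (auto simp: fun_eq_iff low_def W0 split: sum.split)
qed

lemma defect_W0:
  assumes "0 \<le> i" "0 \<le> j"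
  shows "app (defect i j) (W 0) = 0"
proof -
  have lin: "Eop k (x + y) = Eop k x + Eop k y" "Eop k (\<lambda>i. a * x i) = (\<lambda>i. a * Eop k x i)" for k x y a
    using app_add[of "E k"] app_scale[of "E k"] by (simp_all add: app_E)
  have D0: "D 0 = 0" by (rule D_out) simp
  have wt: "vop sl 0 (D k) x = (sm - 1 + of_int k) * D k x" for k x using D_weight[of k] by simp
  have cc: "vop sl i (D j) x = vop sl j (D i) x + of_int (j - i) * D (i + j) x" if "i \<noteq> 0" "j \<noteq> 0" for x
  proof -
    have "(vop sl i (D j) - vop sl j (D i)) x = of_int (j - i) * D (i + j) x"
      using D_cocycle[of i j] that assms by simp
    then show ?thesis by (simp add: algebra_simps)
  qed
  have v0: "vop sl k (\<lambda>_. 0) x = 0" for k x by (simp add: vop_def)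
  show ?thesis
    unfolding app_defect Eop_W0[OF assms(1)] Eop_W0[OF assms(2)] lin Eop_low
    using Eop_W0[OF assms(1)] Eop_W0[OF assms(2)] Eop_W0[of "i + j"] assms
    by (cases "i = 0"; cases "j = 0")
      (auto simp: fun_eq_iff low_def D0 wt cc v0 zero_fun_def algebra_simps split: sum.split)
qed

lemma defect_zero:
  assumes "-1 \<le> i" "-1 \<le> j"
  shows "defect i j = 0"
proof (rule endo_zeroI)
  fix F assume "upper_zero F"
  with assms show "app (defect i j) F = 0" by (intro defect_upper_zero)
next
  have anti: "defect i j = - defect j i" for i j
  proof -
    have "scalar (of_int (i - j)) = - (scalar (of_int (j - i)) :: (int + int, 'k) endo)"
      by (rule endo_eqI) (simp add: app_scalar app_simps fun_eq_iff algebra_simps)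
    then show ?thesis by (simp add: defect_def add.commute algebra_simps)
  qed
  fix n assume "n < CHAR('k)"
  with assms show "app (defect i j) (W n) = 0"
  proof (induction n arbitrary: i j)
    case 0
    show ?case
    proof (cases "i = -1 \<or> j = -1")
      case True
      then show ?thesis using defect_minus_one[OF 0(1)] defect_minus_one[OF 0(2)] anti[of i j] by (auto simp: app_simps)
    next
      case False
      then show ?thesis using 0 by (intro defect_W0) auto
    qed
  next
    case (Suc n)
    show ?case
    proof (cases "i = -1 \<or> j = -1")
      case True
      then show ?thesis using defect_minus_one[OF Suc(2)] defect_minus_one[OF Suc(3)] anti[of i j] by (auto simp: app_simps)
    next
      case False
      then have ij: "0 \<le> i" "0 \<le> j" using Suc by auto
      have "app (defect i j) (W (Suc n)) = app (defect i j * E (-1)) (W n)"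
        using Suc.prems Eop_minus_one_W[of n] by (simp add: app_simps app_E)
      also have "\<dots> = 0"
        unfolding defect_shift[OF ij] app_simps app_scalar
        using Suc.IH[of i j] Suc.IH[of "i - 1" j] Suc.IH[of i "j - 1"] ij Suc.prems
        by (simp add: zero_fun_def)
      finally show ?thesis .
    qed
  qed
qed

lemma E_comm:
  assumes "-1 \<le> i" "-1 \<le> j"
  shows "E i * E j - E j * E i = scalar (of_int (j - i)) * E (i + j)"
  using defect_zero[OF assms] by (simp add: defect_def)

lemma of_nat_p_endo: "of_nat CHAR('k) = (0 :: (int + int, 'k) endo)"
  using algebra_map.of_nat_CHAR_zero[OF algebra_map_scalar] .

text \<open>An operator that commutes with \<open>e\<^sub>-\<^sub>1\<close> is determined on all \<open>W n\<close> by its value on \<open>W 0\<close>.\<close>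

lemma commuting_power_zero:
  fixes a :: "(int + int, 'k) endo"
  assumes comm: "a * E (-1) = E (-1) * a" and low: "\<And>F. upper_zero F \<Longrightarrow> app a F = 0" and W0: "app a (W 0) = 0"
  shows "a = 0"
proof (rule endo_zeroI[OF low])
  fix n assume "n < CHAR('k)"
  then show "app a (W n) = 0"
  proof (induction n)
    case 0
    show ?case by (rule W0)
  next
    case (Suc n)
    have "app a (W (Suc n)) = app (a * E (-1)) (W n)"
      using Suc.prems Eop_minus_one_W[of n] by (simp add: app_simps app_E)
    also have "\<dots> = app (E (-1)) (app a (W n))" by (simp add: comm app_simps)
    also have "\<dots> = 0" using Suc by (simp add: zero_fun_def)
    finally show ?case .
  qed
qed

lemma Eop_supp: "x \<notin> {0..<int CHAR('k)} \<Longrightarrow> Eop j F (Inl x) = 0"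
  using vop_support[of x sl j] gam_supp[of x] by (simp add: Eop_def)

lemma funpow_low: "(Eop j ^^ k) (low f) = low ((vop sl j ^^ k) f)"
  by (induction k) (simp_all add: Eop_low)

lemma funpow_upper_zero: "upper_zero F \<Longrightarrow> k > 0 \<Longrightarrow> (Eop j ^^ k) F = low ((vop sl j ^^ k) (\<lambda>i. F (Inl i)))"
proof -
  assume F: "upper_zero F" and "k > 0"
  then obtain k' where k: "k = Suc k'" using gr0_implies_Suc by blast
  show ?thesis unfolding k funpow_Suc_right by (simp add: Eop_upper_zero[OF F] funpow_low)
qed

text \<open>The difference \<open>e\<^sub>j\<^sup>p - e\<^sub>j\<^sup>[\<^sup>p\<^sup>]\<close> commutes with \<open>e\<^sub>-\<^sub>1\<close>, because \<open>p\<close>-th powers act by the \<open>p\<close>-fold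
  commutator, and it kills the submodule. Hence only its value on the highest weight vector matters,
  and that is where the last hypothesis on \<open>D\<close> enters.\<close>

lemma E_power:
  assumes j: "-1 \<le> j"
  shows "E j ^ CHAR('k) = (if j = 0 then E 0 else 0)"
proof -
  define a where "a = E j ^ CHAR('k) - (if j = 0 then E 0 else 0)"
  have p0: "CHAR('k) > 0" using char5 by simp
  have "a = 0"
  proof (rule commuting_power_zero)
    fix F assume F: "upper_zero F"
    have "(vop sl j ^^ CHAR('k)) f = (if j = 0 then vop sl 0 f else 0)" for f
      using arg_cong[OF dens_power[OF sl j], of "\<lambda>a. app a f"] by (auto simp: app_power app_dens app_simps)
    then show "app a F = 0"
      using F funpow_upper_zero[OF F p0, of j] by (auto simp: a_def app_simps app_power app_E Eop_upper_zero low_zero)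
  next
    show "app a (W 0) = 0"
    proof -
      consider "j = -1" | "j = 0" | "j \<ge> 1" using j by force
      then show ?thesis
      proof cases
        case 1
        have "(Eop (-1) ^^ k) (W 0) = (if k < CHAR('k) then W k else 0)" for k
        proof (induction k)
          case (Suc k)
          then show ?case using Eop_minus_one_W[of k] app_zero[of "E (-1)"] by (auto simp: app_E)
        qed (use p0 in simp)
        then show ?thesis using 1 by (simp add: a_def app_simps app_power app_E)
      next
        case 2
        have D0: "D 0 = 0" by (rule D_out) simp
        have e: "Eop 0 (W 0) = (\<lambda>x. (sm - 1) * W 0 x)" using Eop_W0[of 0] by (simp add: D0 low_zero fun_eq_iff)
        have sc: "Eop 0 (\<lambda>x. c * W 0 x) = (\<lambda>x. c * ((sm - 1) * W 0 x))" for c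
          using app_scale[of "E 0" c "W 0"] by (simp add: app_E e)
        have "(Eop 0 ^^ k) (W 0) = (\<lambda>x. (sm - 1) ^ k * W 0 x)" for k
        proof (induction k)
          case (Suc k)
          show ?case by (simp only: funpow.simps o_apply Suc sc) (simp add: fun_eq_iff mult_ac)
        qed simp
        moreover have "(sm - 1) ^ CHAR('k) = sm - 1"
        proof -
          have "(sm + (- 1)) ^ CHAR('k) = sm ^ CHAR('k) + (- 1) ^ CHAR('k)" by (rule freshmans_dream[OF prime_p refl])
          then show ?thesis using sm odd_p by simp
        qed
        ultimately show ?thesis using 2 by (simp add: a_def app_simps app_power app_E e)
      next
        case 3
        have "(Eop j ^^ CHAR('k)) (W 0) = (Eop j ^^ (CHAR('k) - 1)) (Eop j (W 0))"
          using p0 funpow_Suc_right[of "CHAR('k) - 1" "Eop j"] by simp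
        also have "Eop j (W 0) = low (D j)" using 3 Eop_W0[of j] by (simp add: fun_eq_iff)
        finally show ?thesis
          using 3 D_power[OF 3] by (simp add: a_def app_simps app_power app_E funpow_low low_zero zero_fun_def[symmetric])
      qed
    qed
  next
    \<comment> \<open>The \<open>k\<close>-fold commutator has degree \<open>k j - 1\<close>, which exceeds the range for \<open>k = p\<close>.\<close>
    have ad: "\<exists>c. ((\<lambda>z. E j * z - z * E j) ^^ k) (E (-1)) = scalar c * E (int k * j - 1)" if "j \<ge> 1" for k
    proof (induction k)
      case 0
      have "scalar 1 = (1 :: (int + int, 'k) endo)" by (rule endo_eqI) (simp add: app_scalar app_simps)
      then show ?case by (intro exI[of _ 1]) simp
    next
      case (Suc k)
      then obtain c where c: "((\<lambda>z. E j * z - z * E j) ^^ k) (E (-1)) = scalar c * E (int k * j - 1)" by blast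
      have nn: "int k * j \<ge> 0" using that by simp
      have "E j * (scalar c * E (int k * j - 1)) - (scalar c * E (int k * j - 1)) * E j
          = scalar c * (E j * E (int k * j - 1) - E (int k * j - 1) * E j)"
        by (simp add: right_diff_distrib mult.assoc) (simp only: mult.assoc[symmetric] scalar_alg(3)[of c "E j"])
      also have "\<dots> = scalar (c * of_int (int k * j - 1 - j)) * E (j + (int k * j - 1))"
        using that nn by (subst E_comm) (simp_all only: scalar_alg(2) mult.assoc)
      finally show ?case using c by (intro exI[of _ "c * of_int (int k * j - 1 - j)"]) (simp add: algebra_simps)
    qed
    note cp = commutator_power_prime[OF prime_p of_nat_p_endo, of "E j" "E (-1)"]
    consider "j = -1" | "j = 0" | "j \<ge> 1" using j by force
    then show "a * E (-1) = E (-1) * a"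
    proof cases
      case 1
      then show ?thesis by (simp add: a_def power_commutes)
    next
      case 2
      have one: "E 0 * E (-1) - E (-1) * E 0 = - E (-1)"
      proof -
        have "scalar (of_int (-1 - 0)) = (- 1 :: (int + int, 'k) endo)"
          by (rule endo_eqI) (simp add: app_scalar app_simps fun_eq_iff)
        then show ?thesis using E_comm[of 0 "-1"] by simp
      qed
      have "((\<lambda>z. E 0 * z - z * E 0) ^^ k) (E (-1)) = (- 1) ^ k * E (-1)" for k
      proof (induction k)
        case (Suc k)
        have "E 0 * ((- 1) ^ k * E (-1)) - (- 1) ^ k * E (-1) * E 0 = (- 1) ^ k * (E 0 * E (-1) - E (-1) * E 0)"
          by (cases "even k") (simp_all add: algebra_simps)
        then show ?case using Suc one by (simp add: power_commutes)
      qed simp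
      then have "E 0 ^ CHAR('k) * E (-1) - E (-1) * E 0 ^ CHAR('k) = E 0 * E (-1) - E (-1) * E 0"
        using cp 2 odd_p one by simp
      then show ?thesis using 2 by (simp add: a_def algebra_simps)
    next
      case 3
      obtain c where c: "((\<lambda>z. E j * z - z * E j) ^^ CHAR('k)) (E (-1)) = scalar c * E (int CHAR('k) * j - 1)" using ad[OF 3] by blast
      have "int CHAR('k) * 1 \<le> int CHAR('k) * j" using 3 by (intro mult_left_mono) auto
      then have "E (int CHAR('k) * j - 1) = 0" by (intro E_large) simp
      then show ?thesis using 3 cp c by (simp add: a_def)
    qed
  qed
  then show ?thesis by (simp add: a_def)
qed

lemma E_rep: "witt_rep scalar pm (witt_range TYPE('k)) E"
proof (intro witt_rep.intro algebra_map_scalar witt_rep_axioms.intro char5 pm)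
  show "witt_index TYPE('k) (witt_range TYPE('k))" by (simp add: witt_index_def)
next
  fix i j assume ij: "i \<in> witt_range TYPE('k)" "j \<in> witt_range TYPE('k)"
  then have b: "-1 \<le> i" "-1 \<le> j" by (auto simp: witt_range_def)
  show "E i * E j - E j * E i = (if i + j \<in> witt_range TYPE('k) then scalar (of_int (j - i)) * E (i + j) else 0)"
  proof (cases "i + j \<in> witt_range TYPE('k)")
    case False
    then have "i + j \<ge> int CHAR('k) - 1 \<or> j = i" using ij by (auto simp: witt_range_def)
    then show ?thesis using False E_comm[OF b] E_large[of "i + j"] scalar_zero by auto
  qed (simp add: E_comm[OF b])
next
  fix i assume "i \<in> witt_range TYPE('k)"
  then show "E i ^ CHAR('k) = (if i = 0 then E 0 else 0)"
    using E_power by (simp add: witt_range_def)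
qed

end

section \<open>Normal forms modulo a highest weight ideal\<close>

context witt_setup
begin

abbreviation "eps \<equiv> e (-1)"

lemma eps_in [simp]: "eps \<in> carrier A"
  using char5 by (intro e_in) (simp add: witt_range_def)

primrec pol :: "nat \<Rightarrow> (nat \<Rightarrow> 'k) \<Rightarrow> ((int \<Rightarrow>\<^sub>0 'k) list \<Rightarrow> 'k) set set" where
  "pol 0 c = \<zero>\<^bsub>A\<^esub>"
| "pol (Suc n) c = pol n c \<oplus>\<^bsub>A\<^esub> c n \<odot>\<^bsub>A\<^esub> (eps [^]\<^bsub>A\<^esub> n)"

lemma pow_in [simp]: "eps [^]\<^bsub>A\<^esub> (n::nat) \<in> carrier A"
  by (rule A.u.nat_pow_closed) simp

lemma pol_in [simp]: "pol n c \<in> carrier A"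
  by (induction n) (simp_all del: A.u.nat_pow_Suc)

lemma pol_add: "pol n c \<oplus>\<^bsub>A\<^esub> pol n d = pol n (\<lambda>i. c i + d i)"
proof (induction n)
  case (Suc n)
  have "pol (Suc n) c \<oplus>\<^bsub>A\<^esub> pol (Suc n) d
      = (pol n c \<oplus>\<^bsub>A\<^esub> pol n d) \<oplus>\<^bsub>A\<^esub> (c n \<odot>\<^bsub>A\<^esub> (eps [^]\<^bsub>A\<^esub> n) \<oplus>\<^bsub>A\<^esub> d n \<odot>\<^bsub>A\<^esub> (eps [^]\<^bsub>A\<^esub> n))"
    by (simp add: A.u.a_ac)
  then show ?case by (simp add: Suc A.u.smult_add_left)
qed simp

lemma smult_zero_A: "c \<odot>\<^bsub>A\<^esub> \<zero>\<^bsub>A\<^esub> = \<zero>\<^bsub>A\<^esub>"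
  using A.u.smult_eq_mult[of "\<zero>\<^bsub>A\<^esub>" c] by simp

lemma pol_smult: "t \<odot>\<^bsub>A\<^esub> pol n c = pol n (\<lambda>i. t * c i)"
  by (induction n) (simp_all add: smult_zero_A A.u.smult_add_right A.u.smult_smult)

lemma eps_pol: "eps \<otimes>\<^bsub>A\<^esub> pol n c = pol (Suc n) (\<lambda>i. case i of 0 \<Rightarrow> 0 | Suc i \<Rightarrow> c i)"
proof (induction n)
  case 0
  show ?case by simp
next
  case (Suc n)
  have "eps \<otimes>\<^bsub>A\<^esub> pol (Suc n) c = eps \<otimes>\<^bsub>A\<^esub> pol n c \<oplus>\<^bsub>A\<^esub> c n \<odot>\<^bsub>A\<^esub> (eps \<otimes>\<^bsub>A\<^esub> (eps [^]\<^bsub>A\<^esub> n))"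
    by (simp add: A.u.r_distr A.u.smult_mult_right del: A.u.nat_pow_Suc)
  also have "eps \<otimes>\<^bsub>A\<^esub> (eps [^]\<^bsub>A\<^esub> n) = eps [^]\<^bsub>A\<^esub> Suc n"
    by (rule A.u.nat_pow_Suc2[symmetric]) simp
  finally show ?case by (simp only: Suc pol.simps nat.case)
qed

lemma pol_zero_fun: "(\<And>i. i < n \<Longrightarrow> c i = 0) \<Longrightarrow> pol n c = \<zero>\<^bsub>A\<^esub>"
  by (induction n) (simp_all del: A.u.nat_pow_Suc)

lemma pol_one: "pol (Suc n) (\<lambda>i. if i = 0 then 1 else 0) = \<one>\<^bsub>A\<^esub>"
proof (induction n)
  case (Suc n)
  show ?case unfolding pol.simps(2)[of "Suc n"] Suc by simp
qed simp

text \<open>The sum of the left ideal and the polynomials in \<open>e\<^sub>-\<^sub>1\<close> is stable under left multiplication: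
  \<open>e\<^sub>j e\<^sub>-\<^sub>1\<^sup>n\<close> is reduced by induction on \<open>n\<close> until \<open>e\<^sub>j\<close> meets the unit, and \<open>e\<^sub>-\<^sub>1\<^sup>p = 0\<close> bounds the degree.\<close>

lemma span_modulo_left_ideal:
  assumes K: "K \<subseteq> carrier A" "\<zero>\<^bsub>A\<^esub> \<in> K" "\<And>a b. \<lbrakk>a \<in> K; b \<in> K\<rbrakk> \<Longrightarrow> a \<oplus>\<^bsub>A\<^esub> b \<in> K"
      "\<And>a b. \<lbrakk>a \<in> carrier A; b \<in> K\<rbrakk> \<Longrightarrow> a \<otimes>\<^bsub>A\<^esub> b \<in> K"
    and e0: "e 0 \<ominus>\<^bsub>A\<^esub> t \<odot>\<^bsub>A\<^esub> \<one>\<^bsub>A\<^esub> \<in> K"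
    and ej: "\<And>j. j \<in> {1..int CHAR('k) - 2} \<Longrightarrow> e j \<in> K"
    and a: "a \<in> carrier A"
  shows "\<exists>c. \<exists>b\<in>K. a = pol CHAR('k) c \<oplus>\<^bsub>A\<^esub> b"
proof -
  let ?p = "CHAR('k)"
  define G where "G = {a \<in> carrier A. \<exists>c. \<exists>b\<in>K. a = pol ?p c \<oplus>\<^bsub>A\<^esub> b}"
  have Kin: "b \<in> carrier A" if "b \<in> K" for b using K(1) that by blast
  have G_in: "a \<in> carrier A" if "a \<in> G" for a using that by (simp add: G_def)
  have GI: "pol ?p c \<oplus>\<^bsub>A\<^esub> b \<in> G" if "b \<in> K" for c b using that Kin by (auto simp: G_def)
  have GK: "b \<in> G" if "b \<in> K" for b
    using GI[OF that, of "\<lambda>_. 0"] Kin[OF that] pol_zero_fun[of ?p "\<lambda>_. 0"] by simp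
  have Gpol: "pol ?p c \<in> G" for c using GI[OF K(2)] by simp
  have G_add: "a \<oplus>\<^bsub>A\<^esub> a' \<in> G" if "a \<in> G" "a' \<in> G" for a a'
  proof -
    obtain c b where 1: "b \<in> K" "a = pol ?p c \<oplus>\<^bsub>A\<^esub> b" using \<open>a \<in> G\<close> by (auto simp: G_def)
    obtain c' b' where 2: "b' \<in> K" "a' = pol ?p c' \<oplus>\<^bsub>A\<^esub> b'" using \<open>a' \<in> G\<close> by (auto simp: G_def)
    have "a \<oplus>\<^bsub>A\<^esub> a' = (pol ?p c \<oplus>\<^bsub>A\<^esub> pol ?p c') \<oplus>\<^bsub>A\<^esub> (b \<oplus>\<^bsub>A\<^esub> b')"
      using Kin 1 2 by (simp add: A.u.a_ac)
    then show ?thesis using GI[OF K(3)[OF 1(1) 2(1)]] by (simp add: pol_add)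
  qed
  have G_smult: "s \<odot>\<^bsub>A\<^esub> a \<in> G" if "a \<in> G" for a s
  proof -
    obtain c b where 1: "b \<in> K" "a = pol ?p c \<oplus>\<^bsub>A\<^esub> b" using \<open>a \<in> G\<close> by (auto simp: G_def)
    have "s \<odot>\<^bsub>A\<^esub> b \<in> K" using K(4)[of "s \<odot>\<^bsub>A\<^esub> \<one>\<^bsub>A\<^esub>" b] 1(1) Kin[OF 1(1)] A.u.smult_eq_mult[of b s] by simp
    then show ?thesis using GI Kin[OF 1(1)] by (simp add: 1(2) A.u.smult_add_right pol_smult)
  qed
  have G_eps: "eps \<otimes>\<^bsub>A\<^esub> a \<in> G" if "a \<in> G" for a
  proof -
    obtain c b where 1: "b \<in> K" "a = pol ?p c \<oplus>\<^bsub>A\<^esub> b" using \<open>a \<in> G\<close> by (auto simp: G_def)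
    have "eps [^]\<^bsub>A\<^esub> ?p = \<zero>\<^bsub>A\<^esub>" using e_power[of "-1"] char5 by (simp add: witt_range_def)
    then have "eps \<otimes>\<^bsub>A\<^esub> pol ?p c = pol ?p (\<lambda>i. case i of 0 \<Rightarrow> 0 | Suc i \<Rightarrow> c i)"
      by (simp add: eps_pol smult_zero_A)
    then show ?thesis using GI[OF K(4)[OF eps_in 1(1)]] Kin[OF 1(1)] by (simp add: 1(2) A.u.r_distr)
  qed
  have one: "\<one>\<^bsub>A\<^esub> \<in> G"
    using Gpol[of "\<lambda>i. if i = 0 then 1 else 0"] pol_one[of "?p - 1"] char5 by simp
  have pow: "eps [^]\<^bsub>A\<^esub> n \<in> G" for n :: nat
  proof (induction n)
    case (Suc n)
    then show ?case using G_eps A.u.nat_pow_Suc2[OF eps_in, of n] by simp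
  qed (simp add: one)
  have ejn: "e j \<otimes>\<^bsub>A\<^esub> (eps [^]\<^bsub>A\<^esub> n) \<in> G" if "j \<in> {0..int ?p - 2}" for j and n :: nat
    using that
  proof (induction n arbitrary: j)
    case 0
    then have jR: "j \<in> witt_range TYPE('k)" by (simp add: witt_range_def)
    show ?case
    proof (cases "j = 0")
      case True
      have "e 0 = t \<odot>\<^bsub>A\<^esub> \<one>\<^bsub>A\<^esub> \<oplus>\<^bsub>A\<^esub> (e 0 \<ominus>\<^bsub>A\<^esub> t \<odot>\<^bsub>A\<^esub> \<one>\<^bsub>A\<^esub>)"
        using jR True by (simp add: A.u.minus_eq A.u.a_lcomm A.u.r_neg)
      then have "e 0 \<in> G" using G_add[OF G_smult[OF one, of t] GK[OF e0]] by simp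
      then show ?thesis using True jR by simp
    next
      case False
      then show ?thesis using 0 GK[OF ej[of j]] jR by simp
    qed
  next
    case (Suc n)
    have jR: "j \<in> witt_range TYPE('k)" "j + (-1) \<in> witt_range TYPE('k)" "-1 \<in> witt_range TYPE('k)"
      using Suc.prems char5 by (auto simp: witt_range_def)
    have "e j \<otimes>\<^bsub>A\<^esub> (eps [^]\<^bsub>A\<^esub> Suc n) = (e j \<otimes>\<^bsub>A\<^esub> eps) \<otimes>\<^bsub>A\<^esub> (eps [^]\<^bsub>A\<^esub> n)"
      unfolding A.u.nat_pow_Suc2[OF eps_in] using jR by (simp add: A.u.m_assoc)
    also have "\<dots> = of_int (-1 - j) \<odot>\<^bsub>A\<^esub> (e (j - 1) \<otimes>\<^bsub>A\<^esub> (eps [^]\<^bsub>A\<^esub> n)) \<oplus>\<^bsub>A\<^esub> eps \<otimes>\<^bsub>A\<^esub> (e j \<otimes>\<^bsub>A\<^esub> (eps [^]\<^bsub>A\<^esub> n))"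
      unfolding e_comm[OF jR(1,3)] using jR by (simp add: A.u.l_distr A.u.smult_mult_left A.u.m_assoc)
    also have "\<dots> \<in> G"
    proof (rule G_add[OF G_smult G_eps])
      show "e j \<otimes>\<^bsub>A\<^esub> (eps [^]\<^bsub>A\<^esub> n) \<in> G" by (rule Suc.IH[OF Suc.prems])
      show "e (j - 1) \<otimes>\<^bsub>A\<^esub> (eps [^]\<^bsub>A\<^esub> n) \<in> G"
      proof (cases "j = 0")
        case True
        then show ?thesis using G_eps[OF pow[of n]] by simp
      next
        case False
        then show ?thesis using Suc.prems by (intro Suc.IH) auto
      qed
    qed
    finally show ?case .
  qed
  have e_pol: "e j \<otimes>\<^bsub>A\<^esub> pol n c \<in> G" if j: "j \<in> {0..int ?p - 2}" for j n c
  proof (induction n)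
    case 0
    then show ?case using j GK[OF K(2)] by (simp add: witt_range_def)
  next
    case (Suc n)
    have "j \<in> witt_range TYPE('k)" using j by (simp add: witt_range_def)
    then show ?case
      using G_add[OF Suc G_smult[OF ejn[OF j, of n], of "c n"]]
      by (simp add: A.u.r_distr A.u.smult_mult_right del: A.u.nat_pow_Suc)
  qed
  have "a \<in> G"
    using a
  proof (induction a rule: A_induct)
    case (gen i a)
    show ?case
    proof (cases "i = -1")
      case True
      then show ?thesis using G_eps[OF gen(3)] by simp
    next
      case False
      then have i: "i \<in> {0..int ?p - 2}" using gen(1) by (auto simp: witt_range_def)
      obtain c b where 1: "b \<in> K" "a = pol ?p c \<oplus>\<^bsub>A\<^esub> b" using gen(3) by (auto simp: G_def)
      have "e i \<otimes>\<^bsub>A\<^esub> a = e i \<otimes>\<^bsub>A\<^esub> pol ?p c \<oplus>\<^bsub>A\<^esub> e i \<otimes>\<^bsub>A\<^esub> b"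
        using gen(1) Kin[OF 1(1)] by (simp add: 1(2) A.u.r_distr)
      then show ?thesis using G_add[OF e_pol[OF i] GK[OF K(4)[OF e_in[OF gen(1)] 1(1)]]] by simp
    qed
  qed (use GK[OF K(2)] one G_add G_smult in auto)
  then show ?thesis by (simp add: G_def)
qed

text \<open>The action of \<open>u(W)\<close> induced by operators for the basis of \<open>W(1,1)\<close>.\<close>

definition act :: "(int \<Rightarrow> ('i, 'k) endo) \<Rightarrow> ((int \<Rightarrow>\<^sub>0 'k) list \<Rightarrow> 'k) set set \<Rightarrow> ('i, 'k) endo" where
  "act r = envelope_map.u_lift scalar (witt_rep.rep scalar (witt_range TYPE('k)) r)"

context
  fixes r :: "int \<Rightarrow> ('i, 'k) endo"
  assumes r: "witt_rep scalar pm (witt_range TYPE('k)) r"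
begin

lemma act_env: "envelope_map (witt pm) scalar (witt_rep.rep scalar (witt_range TYPE('k)) r)"
proof -
  interpret W: witt_rep scalar pm "witt_range TYPE('k)" r by (rule r)
  show ?thesis using W.env.envelope_map_axioms by (simp only: witt_eq_witt_sub)
qed

lemma act_hom:
  assumes "a \<in> carrier A" "b \<in> carrier A"
  shows act_add: "act r (a \<oplus>\<^bsub>A\<^esub> b) = act r a + act r b"
    and act_mult: "act r (a \<otimes>\<^bsub>A\<^esub> b) = act r a * act r b"
    and act_smult: "act r (c \<odot>\<^bsub>A\<^esub> a) = scalar c * act r a"
  unfolding act_def
  using envelope_map.u_lift_add[OF act_env assms] envelope_map.u_lift_mult[OF act_env assms]
    envelope_map.u_lift_smult[OF act_env assms] by blast+

lemma act_one: "act r \<one>\<^bsub>A\<^esub> = 1" and act_zero: "act r \<zero>\<^bsub>A\<^esub> = 0"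
  unfolding act_def by (rule envelope_map.u_lift_one[OF act_env] envelope_map.u_lift_zero[OF act_env])+

lemma act_e: "i \<in> witt_range TYPE('k) \<Longrightarrow> act r (e i) = r i"
  unfolding act_def e_def
  using envelope_map.u_lift_gen[OF act_env witt_e_in] witt_rep.rep_e[OF r] by simp

lemma act_eps_pow: "act r (eps [^]\<^bsub>A\<^esub> (n::nat)) = r (-1) ^ n"
proof (induction n)
  case 0
  show ?case by (simp add: act_one)
next
  case (Suc n)
  have "-1 \<in> witt_range TYPE('k)" using char5 by (simp add: witt_range_def)
  then show ?case by (simp add: Suc act_mult act_e power_commutes)
qed

lemma act_pol: "app (act r (pol n c)) w = (\<lambda>x. \<Sum>i<n. c i * (app (r (-1)) ^^ i) w x)"
proof (induction n)
  case 0
  show ?case by (simp add: act_zero app_simps zero_fun_def)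
next
  case (Suc n)
  have "act r (pol (Suc n) c) = act r (pol n c) + scalar (c n) * r (-1) ^ n"
    by (simp only: pol.simps act_add[OF pol_in A.u.smult_closed[OF pow_in]] act_smult[OF pow_in pow_in] act_eps_pow)
  then show ?case by (simp add: Suc app_simps app_scalar app_power fun_eq_iff)
qed

end

section \<open>Verma modules as density modules\<close>

definition top :: "int \<Rightarrow> 'k" where
  "top n = (if n = int CHAR('k) - 1 then 1 else 0)"

definition unit_at :: "int \<Rightarrow> int \<Rightarrow> 'k" where
  "unit_at i n = (if n = i then 1 else 0)"

definition supported :: "(int \<Rightarrow> 'k) \<Rightarrow> bool" where
  "supported f \<longleftrightarrow> (\<forall>n. n \<notin> {0..<int CHAR('k)} \<longrightarrow> f n = 0)"

lemma top_eq: "top = unit_at (int CHAR('k) - 1)"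
  by (simp add: top_def unit_at_def fun_eq_iff)

lemma vop_unit_at:
  "vop s j (unit_at q) = (\<lambda>n. (if q \<in> {0..<int CHAR('k)} \<and> q + j \<in> {0..<int CHAR('k)}
     then of_int q + of_int (j + 1) * s else 0) * unit_at (q + j) n)"
  by (auto simp: vop_def unit_at_def fun_eq_iff)

text \<open>The coefficient of \<open>e\<^sub>-\<^sub>1\<close> at \<open>u\<^sub>n\<close> is \<open>n\<close>, independently of \<open>s\<close>, and nonzero for \<open>0 < n < p\<close>.\<close>

lemma lowering_top:
  "\<exists>F. F \<noteq> 0 \<and> (vop s (-1) ^^ n) top = (\<lambda>x. F * unit_at (int CHAR('k) - 1 - int n) x)" if "n < CHAR('k)"
  using that
proof (induction n)
  case 0
  show ?case by (rule exI[of _ 1]) (simp add: top_eq)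
next
  case (Suc n)
  then obtain F where F: "F \<noteq> 0" "(vop s (-1) ^^ n) top = (\<lambda>x. F * unit_at (int CHAR('k) - 1 - int n) x)" by auto
  let ?q = "int CHAR('k) - 1 - int n"
  have nz: "of_int ?q \<noteq> (0 :: 'k)" using Suc.prems by (intro of_int_neq_0) auto
  have "(vop s (-1) ^^ Suc n) top = (\<lambda>x. F * vop s (-1) (unit_at ?q) x)"
    by (simp add: F(2) vop_scale)
  also have "\<dots> = (\<lambda>x. (F * of_int ?q) * unit_at (?q - 1) x)"
    using Suc.prems by (simp add: vop_unit_at mult.assoc)
  also have "?q - 1 = int CHAR('k) - 1 - int (Suc n)" by simp
  finally show ?case using F(1) nz by (intro exI[of _ "F * of_int ?q"] conjI) (simp_all only: mult_eq_0_iff simp_thms not_False_eq_True)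
qed

lemma supported_vop: "supported (vop (s :: 'k) j f)"
  by (simp add: supported_def vop_support)

lemma supported_top: "supported top"
  using char5 by (auto simp: supported_def top_def)

context
  fixes s :: 'k
  assumes s: "s ^ CHAR('k) = s"
begin

lemma act_supported:
  assumes f: "supported f" and a: "a \<in> carrier A"
  shows "supported (app (act (dens s) a) f)"
  using a
proof (induction a rule: A_induct)
  case (gen i a)
  then show ?case using supported_vop by (simp add: act_mult[OF dens_rep[OF s]] act_e[OF dens_rep[OF s]] app_simps app_dens)
qed (use f in \<open>simp_all add: act_add[OF dens_rep[OF s]] act_smult[OF dens_rep[OF s]] act_one[OF dens_rep[OF s]]
  act_zero[OF dens_rep[OF s]] app_simps app_scalar supported_def\<close>)

lemma pol_top_zero:
  assumes "app (act (dens s) (pol CHAR('k) c)) top = 0"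
  shows "pol CHAR('k) c = \<zero>\<^bsub>A\<^esub>"
proof (rule pol_zero_fun)
  fix i assume i: "i < CHAR('k)"
  obtain F where F: "\<And>n. n < CHAR('k) \<Longrightarrow> F n \<noteq> 0 \<and> (vop s (-1) ^^ n) top = (\<lambda>x. F n * unit_at (int CHAR('k) - 1 - int n) x)"
    using lowering_top[of _ s] by metis
  have "0 = (\<Sum>n<CHAR('k). c n * (vop s (-1) ^^ n) top (int CHAR('k) - 1 - int i))"
    using fun_cong[OF assms, of "int CHAR('k) - 1 - int i"] by (simp add: act_pol[OF dens_rep[OF s]] app_dens)
  also have "\<dots> = (\<Sum>n<CHAR('k). if n = i then c i * F i else 0)"
    by (intro sum.cong refl) (use F in \<open>auto simp: unit_at_def\<close>)
  also have "\<dots> = c i * F i" using i by simp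
  finally show "c i = 0" using F[OF i] by simp
qed

lemma pol_top_surj:
  assumes f: "supported f"
  shows "\<exists>c. app (act (dens s) (pol CHAR('k) c)) top = f"
proof -
  obtain F where F: "\<And>n. n < CHAR('k) \<Longrightarrow> F n \<noteq> 0 \<and> (vop s (-1) ^^ n) top = (\<lambda>x. F n * unit_at (int CHAR('k) - 1 - int n) x)"
    using lowering_top[of _ s] by metis
  define c where "c n = f (int CHAR('k) - 1 - int n) / F n" for n
  have "app (act (dens s) (pol CHAR('k) c)) top x = f x" for x
  proof -
    have "app (act (dens s) (pol CHAR('k) c)) top x = (\<Sum>n<CHAR('k). c n * (vop s (-1) ^^ n) top x)"
      by (simp add: act_pol[OF dens_rep[OF s]] app_dens)
    also have "\<dots> = (\<Sum>n<CHAR('k). if int n = int CHAR('k) - 1 - x then f x else 0)"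
      by (intro sum.cong refl) (use F in \<open>auto simp: unit_at_def c_def\<close>)
    also have "\<dots> = f x"
    proof (cases "x \<in> {0..<int CHAR('k)}")
      case True
      then have "(int n = int CHAR('k) - 1 - x) = (n = nat (int CHAR('k) - 1 - x))" for n by auto
      moreover have "nat (int CHAR('k) - 1 - x) < CHAR('k)" using True char5 by auto
      ultimately show ?thesis by simp
    next
      case False
      then have "f x = 0" using f by (simp add: supported_def)
      then show ?thesis by (simp only: if_cancel sum.neutral_const)
    qed
    finally show ?thesis .
  qed
  then show ?thesis by blast
qed

end

end

context verma_setup
begin

lemma wt_shift: "(l + 1) ^ CHAR('k) = l + 1"
  using freshmans_dream[OF prime_p refl, of l 1] l by simp

text \<open>The isomorphism from the Verma module of weight \<open>l\<close> to the densities of degree \<open>l + 1\<close>; the shift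
  by one appears because \<open>e\<^sub>0\<close> has the eigenvalue \<open>p - 1 + s = s - 1\<close> on the top vector.\<close>

definition \<Theta> :: "(((int \<Rightarrow>\<^sub>0 'k) list \<Rightarrow> 'k) set set \<times> 'k \<Rightarrow>\<^sub>0 int) set \<Rightarrow> int \<Rightarrow> 'k" where
  "\<Theta> = (SOME \<Theta>. (\<forall>X\<in>carrier V. \<forall>Y\<in>carrier V. \<Theta> (X \<oplus>\<^bsub>V\<^esub> Y) = \<Theta> X + \<Theta> Y) \<and>
      (\<forall>a\<in>carrier A. \<forall>X\<in>carrier V. \<Theta> (a \<odot>\<^bsub>V\<^esub> X) = app (act (dens (l + 1)) a) (\<Theta> X)) \<and> \<Theta> hw = top)"

lemma \<Theta>:
  shows \<Theta>_add: "\<lbrakk>X \<in> carrier V; Y \<in> carrier V\<rbrakk> \<Longrightarrow> \<Theta> (X \<oplus>\<^bsub>V\<^esub> Y) = \<Theta> X + \<Theta> Y"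
    and \<Theta>_act: "\<lbrakk>a \<in> carrier A; X \<in> carrier V\<rbrakk> \<Longrightarrow> \<Theta> (a \<odot>\<^bsub>V\<^esub> X) = app (act (dens (l + 1)) a) (\<Theta> X)"
    and \<Theta>_hw: "\<Theta> hw = top"
proof -
  have w0: "app (dens (l + 1) 0) top = (\<lambda>i. l * top i)"
    using char5 by (auto simp: app_dens vop_def top_def)
  have w1: "app (dens (l + 1) j) top = 0" if "j \<in> {1..int CHAR('k) - 2}" for j
    using that by (auto simp: app_dens vop_def top_def fun_eq_iff)
  have "(\<forall>X\<in>carrier V. \<forall>Y\<in>carrier V. \<Theta> (X \<oplus>\<^bsub>V\<^esub> Y) = \<Theta> X + \<Theta> Y) \<and>
      (\<forall>a\<in>carrier A. \<forall>X\<in>carrier V. \<Theta> (a \<odot>\<^bsub>V\<^esub> X) = app (act (dens (l + 1)) a) (\<Theta> X)) \<and> \<Theta> hw = top"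
    unfolding \<Theta>_def act_def by (rule someI_ex[OF verma_map[OF dens_rep[OF wt_shift] w0 w1]])
  then show "\<lbrakk>X \<in> carrier V; Y \<in> carrier V\<rbrakk> \<Longrightarrow> \<Theta> (X \<oplus>\<^bsub>V\<^esub> Y) = \<Theta> X + \<Theta> Y"
    "\<lbrakk>a \<in> carrier A; X \<in> carrier V\<rbrakk> \<Longrightarrow> \<Theta> (a \<odot>\<^bsub>V\<^esub> X) = app (act (dens (l + 1)) a) (\<Theta> X)"
    "\<Theta> hw = top" by blast+
qed

lemma \<Theta>_zero: "\<Theta> \<zero>\<^bsub>V\<^esub> = 0"
  using \<Theta>_add[of "\<zero>\<^bsub>V\<^esub>" "\<zero>\<^bsub>V\<^esub>"] by simp

lemma \<Theta>_supported: "X \<in> carrier V \<Longrightarrow> supported (\<Theta> X)"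
  using V_cyclic[of X] act_supported[OF wt_shift supported_top] by (auto simp: \<Theta>_act \<Theta>_hw)

definition hw_ann :: "((int \<Rightarrow>\<^sub>0 'k) list \<Rightarrow> 'k) set set set" where
  "hw_ann = {a \<in> carrier A. a \<odot>\<^bsub>V\<^esub> hw = \<zero>\<^bsub>V\<^esub>}"

lemma e_in_ann: "j \<in> {1..int CHAR('k) - 2} \<Longrightarrow> e j \<in> hw_ann"
  using e_hw[of j] by (auto simp: hw_ann_def witt_range_def A.u.smult_zero)

lemma e0_in_ann: "e 0 \<ominus>\<^bsub>A\<^esub> l \<odot>\<^bsub>A\<^esub> \<one>\<^bsub>A\<^esub> \<in> hw_ann"
proof -
  have e0: "e 0 \<in> carrier A" using char5 by (intro e_in) (simp add: witt_range_def)
  have "e 0 \<odot>\<^bsub>V\<^esub> hw = (l \<odot>\<^bsub>A\<^esub> \<one>\<^bsub>A\<^esub>) \<odot>\<^bsub>V\<^esub> hw" using e_hw[of 0] char5 by simp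
  then have "(e 0 \<ominus>\<^bsub>A\<^esub> l \<odot>\<^bsub>A\<^esub> \<one>\<^bsub>A\<^esub>) \<odot>\<^bsub>V\<^esub> hw
      = ((l \<odot>\<^bsub>A\<^esub> \<one>\<^bsub>A\<^esub>) \<oplus>\<^bsub>A\<^esub> (\<ominus>\<^bsub>A\<^esub> (l \<odot>\<^bsub>A\<^esub> \<one>\<^bsub>A\<^esub>))) \<odot>\<^bsub>V\<^esub> hw"
    using e0 by (simp add: A.u.minus_eq V.act_add_left)
  also have "\<dots> = \<zero>\<^bsub>V\<^esub>" by (simp add: A.u.r_neg)
  finally show ?thesis using e0 by (simp add: hw_ann_def)
qed

lemma ann_left_ideal:
  shows "hw_ann \<subseteq> carrier A" "\<zero>\<^bsub>A\<^esub> \<in> hw_ann" "\<lbrakk>a \<in> hw_ann; b \<in> hw_ann\<rbrakk> \<Longrightarrow> a \<oplus>\<^bsub>A\<^esub> b \<in> hw_ann"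
    "\<lbrakk>c \<in> carrier A; b \<in> hw_ann\<rbrakk> \<Longrightarrow> c \<otimes>\<^bsub>A\<^esub> b \<in> hw_ann"
  by (auto simp: hw_ann_def V.act_add_left V.act_mult)

lemma \<Theta>_pol: "\<Theta> (pol n c \<odot>\<^bsub>V\<^esub> hw) = app (act (dens (l + 1)) (pol n c)) top"
  by (simp add: \<Theta>_act \<Theta>_hw)

text \<open>A general element is a polynomial in \<open>e\<^sub>-\<^sub>1\<close> applied to the highest weight vector, and
  the powers of \<open>e\<^sub>-\<^sub>1\<close> below the \<open>p\<close>-th are independent on the top density.\<close>

lemma \<Theta>_kernel:
  assumes X: "X \<in> carrier V" and 0: "\<Theta> X = 0"
  shows "X = \<zero>\<^bsub>V\<^esub>"
proof -
  obtain a where a: "a \<in> carrier A" "X = a \<odot>\<^bsub>V\<^esub> hw" using V_cyclic[OF X] by blast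
  obtain c b where cb: "b \<in> hw_ann" "a = pol CHAR('k) c \<oplus>\<^bsub>A\<^esub> b"
    using span_modulo_left_ideal[OF ann_left_ideal e0_in_ann e_in_ann a(1)] by blast
  have b: "b \<in> carrier A" "b \<odot>\<^bsub>V\<^esub> hw = \<zero>\<^bsub>V\<^esub>" using cb(1) by (auto simp: hw_ann_def)
  have X': "X = pol CHAR('k) c \<odot>\<^bsub>V\<^esub> hw" using a cb b by (simp add: V.act_add_left)
  have "pol CHAR('k) c = \<zero>\<^bsub>A\<^esub>"
    using 0 by (intro pol_top_zero[OF wt_shift]) (simp add: X' \<Theta>_pol)
  then show ?thesis by (simp add: X')
qed

lemma \<Theta>_inj:
  assumes X: "X \<in> carrier V" and Y: "Y \<in> carrier V" and eq: "\<Theta> X = \<Theta> Y"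
  shows "X = Y"
proof -
  have "\<Theta> (X \<ominus>\<^bsub>V\<^esub> Y) + \<Theta> Y = \<Theta> X"
    using \<Theta>_add[of "X \<ominus>\<^bsub>V\<^esub> Y" Y] X Y by (simp add: V.M.minus_eq V.M.a_assoc V.M.l_neg)
  then have "\<Theta> (X \<ominus>\<^bsub>V\<^esub> Y) = 0" using eq by simp
  then have "X \<ominus>\<^bsub>V\<^esub> Y = \<zero>\<^bsub>V\<^esub>" using X Y by (intro \<Theta>_kernel) auto
  moreover have "X = (X \<ominus>\<^bsub>V\<^esub> Y) \<oplus>\<^bsub>V\<^esub> Y"
    using X Y by (simp add: V.M.minus_eq V.M.a_assoc V.M.l_neg)
  ultimately show ?thesis using Y by simp
qed

lemma \<Theta>_surj: "supported f \<Longrightarrow> \<exists>X\<in>carrier V. \<Theta> X = f"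
  using pol_top_surj[OF wt_shift, of f] \<Theta>_pol by (metis V.act_closed hw_in pol_in)

lemma pol_ann: "pol CHAR('k) c \<in> hw_ann \<Longrightarrow> pol CHAR('k) c = \<zero>\<^bsub>A\<^esub>"
  using \<Theta>_pol[of "CHAR('k)" c] \<Theta>_zero by (intro pol_top_zero[OF wt_shift]) (simp add: hw_ann_def)

end

section \<open>Extensions of Verma modules and cocycles\<close>

context witt_setup
begin

text \<open>With \<open>m\<close> representing \<open>\<lambda> - \<mu>\<close>, this is the exponent \<open>n\<close> for which \<open>u\<^sub>n\<close> in the model of
  \<open>Z\<^sup>+(\<lambda>)\<close> has the weight \<open>\<mu> + j\<close>.\<close>

definition pos :: "nat \<Rightarrow> nat \<Rightarrow> int" where
  "pos m j = (int CHAR('k) - 1 - int m + int j) mod int CHAR('k)"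

text \<open>The coefficient with which \<open>e\<^sub>i\<close> maps the vector of weight \<open>\<mu> + j\<close> to that of weight
  \<open>\<mu> + i + j\<close>. It vanishes when the exponent would leave the range.\<close>

definition transfer :: "nat \<Rightarrow> 'k \<Rightarrow> nat \<Rightarrow> nat \<Rightarrow> 'k" where
  "transfer m s i j = (if pos m j + int i < int CHAR('k) then of_int (pos m j) + of_int (int i + 1) * s else 0)"

text \<open>The equations that \<open>[e\<^sub>i, e\<^sub>j] = (j - i) e\<^sub>i\<^sub>+\<^sub>j\<close> imposes on the coefficients \<open>c\<^sub>j\<close>, where
  \<open>c\<^sub>n = 0\<close> for \<open>n \<ge> p - 1\<close> expresses that there is no \<open>e\<^sub>n\<close>.\<close>

definition cocycle :: "nat \<Rightarrow> 'k \<Rightarrow> (nat \<Rightarrow> 'k) \<Rightarrow> bool" where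
  "cocycle m s c \<longleftrightarrow> (\<forall>j. j \<ge> CHAR('k) - 1 \<longrightarrow> c j = 0) \<and>
     (\<forall>i j. 1 \<le> i \<longrightarrow> i < j \<longrightarrow> j \<le> CHAR('k) - 2 \<longrightarrow>
        transfer m s i j * c j - transfer m s j i * c i = of_int (int j - int i) * c (i + j))"

lemma pos_range: "pos m j \<in> {0..<int CHAR('k)}"
  using char5 by (simp add: pos_def)

lemma pos_add: "pos m j + int i < int CHAR('k) \<Longrightarrow> pos m (i + j) = pos m j + int i"
proof -
  assume "pos m j + int i < int CHAR('k)"
  moreover have "pos m (i + j) = (pos m j + int i) mod int CHAR('k)"
  proof -
    have "(pos m j + int i) mod int CHAR('k) = (int CHAR('k) - 1 - int m + int j + int i) mod int CHAR('k)"
      unfolding pos_def by (rule mod_add_left_eq)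
    also have "\<dots> = pos m (i + j)"
      unfolding pos_def by (rule arg_cong2[where f = "(mod)"]) simp_all
    finally show ?thesis by (rule sym)
  qed
  ultimately show ?thesis using pos_range[of m j] by simp
qed

lemma pos_eq_iff: "x \<in> {0..<int CHAR('k)} \<Longrightarrow> of_int x = (of_int (pos m j) :: 'k) \<longleftrightarrow> x = pos m j"
proof -
  assume x: "x \<in> {0..<int CHAR('k)}"
  have "of_int (x - pos m j) \<noteq> (0 :: 'k)" if "x \<noteq> pos m j"
    using that x pos_range[of m j] by (intro of_int_neq_0) auto
  then show ?thesis by auto
qed

lemma of_int_pos: "of_int (pos m j) = (of_nat j - 1 - of_nat m :: 'k)"
proof -
  have "of_nat (nat ((int CHAR('k) - 1 - int m + int j) mod int CHAR('k))) = (of_int (int CHAR('k) - 1 - int m + int j) :: 'k)"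
    by (rule of_int_mod_p)
  then show ?thesis using char5 by (simp add: pos_def of_nat_nat)
qed

lemma vop_at_pos:
  fixes s :: 'k
  shows "vop s (int i) f (pos m (i + j)) = transfer m s i j * f (pos m j)"
proof (cases "pos m j + int i < int CHAR('k)")
  case True
  then show ?thesis using pos_add[OF True] pos_range[of m j] by (simp add: vop_def transfer_def)
next
  case False
  have "\<not> pos m (i + j) - int i \<ge> 0"
  proof
    assume nn: "pos m (i + j) - int i \<ge> 0"
    have "(pos m (i + j) - int i) mod int CHAR('k) = pos m j"
    proof -
      have "(pos m (i + j) - int i) mod int CHAR('k) = (int CHAR('k) - 1 - int m + int (i + j) - int i) mod int CHAR('k)"
        unfolding pos_def by (rule mod_diff_left_eq)
      also have "\<dots> = pos m j" unfolding pos_def by (rule arg_cong2[where f = "(mod)"]) simp_all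
      finally show ?thesis .
    qed
    moreover have "(pos m (i + j) - int i) mod int CHAR('k) = pos m (i + j) - int i"
      using nn pos_range[of m "i + j"] by simp
    ultimately show False using False pos_range[of m "i + j"] by simp
  qed
  then show ?thesis using False by (simp add: vop_def transfer_def)
qed

lemma e_in_range: "1 \<le> j \<Longrightarrow> j \<le> CHAR('k) - 2 \<Longrightarrow> int j \<in> witt_range TYPE('k)"
  using char5 by (simp add: witt_range_def)

end

locale verma_pair = witt_setup pm for pm :: "(int \<Rightarrow>\<^sub>0 'k::field) \<Rightarrow> (int \<Rightarrow>\<^sub>0 'k)" +
  fixes mu lam :: 'k and m :: nat
  assumes mu: "mu \<in> \<int>" and lam: "lam \<in> \<int>" and m: "of_nat m = lam - mu" and m_less: "m < CHAR('k)"
begin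

sublocale VM: verma_setup pm mu
  by unfold_locales (rule ints_power_p[OF mu])

sublocale VL: verma_setup pm lam
  by unfold_locales (rule ints_power_p[OF lam])

sublocale C: cyclic_ext A VM.V VL.V VM.hw
  by (intro cyclic_ext.intro A.u.kalgebra_axioms VM.V_module VL.V_module cyclic_ext_axioms.intro)
    (simp_all add: VM.V_cyclic)

definition s :: 'k where
  "s = lam + 1"

abbreviation "rl \<equiv> dens s"

lemma s_power: "s ^ CHAR('k) = s"
  unfolding s_def by (rule VL.wt_shift)

lemma \<Theta>_act: "\<lbrakk>a \<in> carrier A; X \<in> carrier VL.V\<rbrakk> \<Longrightarrow> VL.\<Theta> (a \<odot>\<^bsub>VL.V\<^esub> X) = app (act rl a) (VL.\<Theta> X)"
  unfolding s_def by (rule VL.\<Theta>_act)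

lemma ann_eq: "C.ann = VM.hw_ann"
  by (simp add: C.ann_def VM.hw_ann_def)

lemma ann_in: "a \<in> C.ann \<Longrightarrow> a \<in> carrier A"
  by (simp add: C.ann_def)

lemma rl_rep: "witt_rep scalar pm (witt_range TYPE('k)) rl"
  by (rule dens_rep[OF s_power])

abbreviation "h0 \<equiv> e 0 \<ominus>\<^bsub>A\<^esub> mu \<odot>\<^bsub>A\<^esub> \<one>\<^bsub>A\<^esub>"

lemma zero_range: "0 \<in> witt_range TYPE('k)"
  using char5 by (simp add: witt_range_def)

lemma e_ann: "\<lbrakk>1 \<le> j; j \<le> CHAR('k) - 2\<rbrakk> \<Longrightarrow> e (int j) \<in> C.ann"
  unfolding ann_eq using char5 by (intro VM.e_in_ann) auto

lemma h0_ann: "h0 \<in> C.ann"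
  unfolding ann_eq by (rule VM.e0_in_ann)

lemma act_h0: "app (act rl h0) f = vop s 0 f - (\<lambda>x. mu * f x)"
proof -
  have "act rl h0 + act rl (mu \<odot>\<^bsub>A\<^esub> \<one>\<^bsub>A\<^esub>) = act rl (e 0)"
    using act_add[OF rl_rep, of h0 "mu \<odot>\<^bsub>A\<^esub> \<one>\<^bsub>A\<^esub>"] zero_range by (simp add: A.u.minus_eq A.u.a_assoc A.u.l_neg)
  then have "act rl h0 = rl 0 - scalar mu"
    by (simp add: act_e[OF rl_rep zero_range] act_smult[OF rl_rep A.u.one_closed A.u.one_closed] act_one[OF rl_rep] algebra_simps)
  then show ?thesis by (simp add: app_simps app_dens app_scalar)
qed

text \<open>Homomorphisms from the annihilator of the highest weight vector of \<open>Z\<^sup>+(\<mu>)\<close> to \<open>Z\<^sup>+(\<lambda>)\<close>, the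
  latter replaced by its model.\<close>

definition fun_hom :: "(((int \<Rightarrow>\<^sub>0 'k) list \<Rightarrow> 'k) set set \<Rightarrow> int \<Rightarrow> 'k) \<Rightarrow> bool" where
  "fun_hom F \<longleftrightarrow> (\<forall>a\<in>C.ann. supported (F a)) \<and> (\<forall>a\<in>C.ann. \<forall>b\<in>C.ann. F (a \<oplus>\<^bsub>A\<^esub> b) = F a + F b) \<and>
     (\<forall>a\<in>carrier A. \<forall>b\<in>C.ann. F (a \<otimes>\<^bsub>A\<^esub> b) = app (act rl a) (F b))"

lemma fun_hom_of_ann_hom: "C.ann_hom f \<Longrightarrow> fun_hom (\<lambda>a. VL.\<Theta> (f a))"
  unfolding C.ann_hom_def fun_hom_def by (simp add: VL.\<Theta>_supported VL.\<Theta>_add \<Theta>_act)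

lemma ann_closed:
  shows ann_add: "\<lbrakk>a \<in> C.ann; b \<in> C.ann\<rbrakk> \<Longrightarrow> a \<oplus>\<^bsub>A\<^esub> b \<in> C.ann"
    and ann_mult: "\<lbrakk>a \<in> carrier A; b \<in> C.ann\<rbrakk> \<Longrightarrow> a \<otimes>\<^bsub>A\<^esub> b \<in> C.ann"
    and ann_zero: "\<zero>\<^bsub>A\<^esub> \<in> C.ann"
    and ann_smult: "b \<in> C.ann \<Longrightarrow> c \<odot>\<^bsub>A\<^esub> b \<in> C.ann"
proof -
  show *: "\<lbrakk>a \<in> C.ann; b \<in> C.ann\<rbrakk> \<Longrightarrow> a \<oplus>\<^bsub>A\<^esub> b \<in> C.ann" "\<zero>\<^bsub>A\<^esub> \<in> C.ann" for a b
    unfolding ann_eq using VM.ann_left_ideal by blast+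
  show mult: "\<lbrakk>a \<in> carrier A; b \<in> C.ann\<rbrakk> \<Longrightarrow> a \<otimes>\<^bsub>A\<^esub> b \<in> C.ann" for a b
    unfolding ann_eq using VM.ann_left_ideal by blast
  show "b \<in> C.ann \<Longrightarrow> c \<odot>\<^bsub>A\<^esub> b \<in> C.ann"
    using mult[of "c \<odot>\<^bsub>A\<^esub> \<one>\<^bsub>A\<^esub>" b] ann_in[of b] A.u.smult_eq_mult[of b c] by simp
qed

text \<open>The component of the value at \<open>e\<^sub>j\<close> in the only weight that is compatible with
  homogeneity.\<close>

definition coord :: "(((int \<Rightarrow>\<^sub>0 'k) list \<Rightarrow> 'k) set set \<Rightarrow> int \<Rightarrow> 'k) \<Rightarrow> nat \<Rightarrow> 'k" where
  "coord F j = (if 1 \<le> j \<and> j \<le> CHAR('k) - 2 then F (e (int j)) (pos m j) else 0)"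

context
  fixes F
  assumes F: "fun_hom F"
begin

lemma F_add: "\<lbrakk>a \<in> C.ann; b \<in> C.ann\<rbrakk> \<Longrightarrow> F (a \<oplus>\<^bsub>A\<^esub> b) = F a + F b"
  and F_mult: "\<lbrakk>a \<in> carrier A; b \<in> C.ann\<rbrakk> \<Longrightarrow> F (a \<otimes>\<^bsub>A\<^esub> b) = app (act rl a) (F b)"
  and F_supp: "a \<in> C.ann \<Longrightarrow> supported (F a)"
  using F by (auto simp: fun_hom_def)

lemma F_zero: "F \<zero>\<^bsub>A\<^esub> = 0"
  using F_add[OF ann_zero ann_zero] by simp

lemma F_smult: "b \<in> C.ann \<Longrightarrow> F (c \<odot>\<^bsub>A\<^esub> b) = (\<lambda>x. c * F b x)"
proof -
  assume b: "b \<in> C.ann"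
  have "F (c \<odot>\<^bsub>A\<^esub> b) = F ((c \<odot>\<^bsub>A\<^esub> \<one>\<^bsub>A\<^esub>) \<otimes>\<^bsub>A\<^esub> b)"
    using A.u.smult_eq_mult[OF ann_in[OF b], of c] by simp
  also have "\<dots> = app (act rl (c \<odot>\<^bsub>A\<^esub> \<one>\<^bsub>A\<^esub>)) (F b)" by (rule F_mult[OF _ b]) simp
  finally show ?thesis
    by (simp add: act_smult[OF rl_rep A.u.one_closed A.u.one_closed] act_one[OF rl_rep] app_simps app_scalar)
qed

lemma F_e: "i \<in> witt_range TYPE('k) \<Longrightarrow> b \<in> C.ann \<Longrightarrow> F (e i \<otimes>\<^bsub>A\<^esub> b) = vop s i (F b)"
  by (simp add: F_mult act_e[OF rl_rep] app_dens)

lemma F_bracket: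
  assumes i: "1 \<le> i" "i \<le> CHAR('k) - 2" and j: "1 \<le> j" "j \<le> CHAR('k) - 2"
  shows "vop s (int i) (F (e (int j))) - vop s (int j) (F (e (int i)))
    = (if i + j \<le> CHAR('k) - 2 then (\<lambda>x. of_int (int j - int i) * F (e (int (i + j))) x) else 0)"
proof -
  note ir = e_in_range[OF i] and jr = e_in_range[OF j]
  have ij: "int i + int j \<in> witt_range TYPE('k) \<longleftrightarrow> i + j \<le> CHAR('k) - 2"
    using char5 by (auto simp: witt_range_def)
  let ?b = "if i + j \<le> CHAR('k) - 2 then of_int (int j - int i) \<odot>\<^bsub>A\<^esub> e (int (i + j)) else \<zero>\<^bsub>A\<^esub>"
  have b: "?b \<in> C.ann" using e_ann[of "i + j"] i by (auto intro!: ann_smult ann_zero)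
  have "e (int i) \<otimes>\<^bsub>A\<^esub> e (int j) = ?b \<oplus>\<^bsub>A\<^esub> e (int j) \<otimes>\<^bsub>A\<^esub> e (int i)"
    using e_comm[OF ir jr] by (simp add: ij)
  then have "F (e (int i) \<otimes>\<^bsub>A\<^esub> e (int j)) = F ?b + F (e (int j) \<otimes>\<^bsub>A\<^esub> e (int i))"
    using F_add[OF b ann_mult[OF e_in[OF jr] e_ann[OF i]]] by simp
  then have "vop s (int i) (F (e (int j))) = F ?b + vop s (int j) (F (e (int i)))"
    by (simp only: F_e[OF ir e_ann[OF j]] F_e[OF jr e_ann[OF i]])
  moreover have "F ?b = (if i + j \<le> CHAR('k) - 2 then (\<lambda>x. of_int (int j - int i) * F (e (int (i + j))) x) else 0)"
    using F_smult[OF e_ann[of "i + j"], of "of_int (int j - int i)"] i by (simp add: F_zero)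
  ultimately show ?thesis by simp
qed

lemma coord_cocycle: "cocycle m s (coord F)"
  unfolding cocycle_def
proof (intro conjI allI impI)
  fix j assume "CHAR('k) - 1 \<le> j"
  then show "coord F j = 0" using char5 by (auto simp: coord_def)
next
  fix i j assume ij: "1 \<le> i" "i < j" "j \<le> CHAR('k) - 2"
  have c: "coord F i = F (e (int i)) (pos m i)" "coord F j = F (e (int j)) (pos m j)"
    using ij by (simp_all add: coord_def)
  have "i \<le> CHAR('k) - 2" "1 \<le> j" using ij by auto
  note fb = F_bracket[OF ij(1) this ij(3)]
  have "vop s (int i) (F (e (int j))) (pos m (i + j)) - vop s (int j) (F (e (int i))) (pos m (j + i))
      = of_int (int j - int i) * coord F (i + j)"
    using fun_cong[OF fb, of "pos m (i + j)"] ij by (simp add: coord_def add.commute)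
  then show "transfer m s i j * coord F j - transfer m s j i * coord F i = of_int (int j - int i) * coord F (i + j)"
    by (simp only: vop_at_pos c)
qed

text \<open>The obstruction to making a homomorphism vanish on \<open>e\<^sub>0 - \<mu>\<close> is the component of weight \<open>\<mu>\<close> of its
  value there. On \<open>e\<^sub>0\<^sup>n - \<mu>\<^sup>n\<close> this component is multiplied by the derivative \<open>n \<mu>\<^sup>n\<^sup>-\<^sup>1\<close>. For \<open>n = p\<close> the
  element is \<open>e\<^sub>0 - \<mu>\<close> again while the derivative is zero, so the component vanishes.\<close>

lemma y0_zero: "F h0 (pos m 0) = 0"
proof -
  let ?q = "pos m 0"
  have q: "of_int ?q + s = mu" using m by (simp add: of_int_pos s_def)
  have v: "vop s 0 f ?q = mu * f ?q" for f
    using pos_range[of m 0] q by (simp add: vop_def)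
  have e0: "e 0 \<in> carrier A" by (simp add: zero_range)
  \<comment> \<open>The elements \<open>e\<^sub>0\<^sup>n - \<mu>\<^sup>n\<close>.\<close>
  define g where "g n = e 0 [^]\<^bsub>A\<^esub> n \<ominus>\<^bsub>A\<^esub> mu ^ n \<odot>\<^bsub>A\<^esub> \<one>\<^bsub>A\<^esub>" for n :: nat
  have g_in: "g n \<in> carrier A" for n using e0 by (simp add: g_def)
  have g_Suc: "g (Suc n) = e 0 \<otimes>\<^bsub>A\<^esub> g n \<oplus>\<^bsub>A\<^esub> mu ^ n \<odot>\<^bsub>A\<^esub> h0" for n
  proof -
    have x: "e 0 \<otimes>\<^bsub>A\<^esub> (\<ominus>\<^bsub>A\<^esub> (mu ^ n \<odot>\<^bsub>A\<^esub> \<one>\<^bsub>A\<^esub>)) = \<ominus>\<^bsub>A\<^esub> (mu ^ n \<odot>\<^bsub>A\<^esub> e 0)"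
      using e0 by (simp add: A.u.r_minus A.u.smult_mult_right)
    have y: "mu ^ n \<odot>\<^bsub>A\<^esub> (\<ominus>\<^bsub>A\<^esub> (mu \<odot>\<^bsub>A\<^esub> \<one>\<^bsub>A\<^esub>)) = \<ominus>\<^bsub>A\<^esub> (mu ^ Suc n \<odot>\<^bsub>A\<^esub> \<one>\<^bsub>A\<^esub>)"
    proof -
      have "mu ^ n \<odot>\<^bsub>A\<^esub> (\<ominus>\<^bsub>A\<^esub> (mu \<odot>\<^bsub>A\<^esub> \<one>\<^bsub>A\<^esub>)) \<oplus>\<^bsub>A\<^esub> mu ^ n \<odot>\<^bsub>A\<^esub> (mu \<odot>\<^bsub>A\<^esub> \<one>\<^bsub>A\<^esub>) = \<zero>\<^bsub>A\<^esub>"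
        by (simp add: A.u.l_neg smult_zero_A flip: A.u.smult_add_right)
      then show ?thesis
        by (metis A.u.minus_equality A.u.a_inv_closed A.u.one_closed A.u.smult_closed A.u.smult_smult power_Suc2)
    qed
    have "e 0 \<otimes>\<^bsub>A\<^esub> g n \<oplus>\<^bsub>A\<^esub> mu ^ n \<odot>\<^bsub>A\<^esub> h0
        = (e 0 \<otimes>\<^bsub>A\<^esub> (e 0 [^]\<^bsub>A\<^esub> n) \<oplus>\<^bsub>A\<^esub> \<ominus>\<^bsub>A\<^esub> (mu ^ n \<odot>\<^bsub>A\<^esub> e 0)) \<oplus>\<^bsub>A\<^esub> (mu ^ n \<odot>\<^bsub>A\<^esub> e 0 \<oplus>\<^bsub>A\<^esub> \<ominus>\<^bsub>A\<^esub> (mu ^ Suc n \<odot>\<^bsub>A\<^esub> \<one>\<^bsub>A\<^esub>))"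
      using e0 unfolding g_def A.u.minus_eq by (simp add: A.u.r_distr A.u.smult_add_right x y del: A.u.nat_pow_Suc power_Suc)
    also have "\<dots> = e 0 \<otimes>\<^bsub>A\<^esub> (e 0 [^]\<^bsub>A\<^esub> n) \<oplus>\<^bsub>A\<^esub> \<ominus>\<^bsub>A\<^esub> (mu ^ Suc n \<odot>\<^bsub>A\<^esub> \<one>\<^bsub>A\<^esub>)"
      using e0 by (simp add: A.u.a_assoc A.u.r_neg1 A.u.r_neg2 del: A.u.nat_pow_Suc power_Suc)
    also have "e 0 \<otimes>\<^bsub>A\<^esub> (e 0 [^]\<^bsub>A\<^esub> n) = e 0 [^]\<^bsub>A\<^esub> Suc n" by (rule A.u.nat_pow_Suc2[OF e0, symmetric])
    finally show ?thesis by (simp only: g_def A.u.minus_eq)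
  qed
  have g0: "g 0 = \<zero>\<^bsub>A\<^esub>" by (simp add: g_def A.u.minus_eq A.u.r_neg)
  have g_ann: "g n \<in> C.ann" for n
    by (induction n) (simp_all only: g0 g_Suc ann_zero ann_add ann_mult ann_smult h0_ann e0)
  have val: "F (g (Suc n)) ?q = of_nat (Suc n) * mu ^ n * F h0 ?q" for n
  proof (induction n)
    case 0
    then show ?case
      using F_add[OF ann_mult[OF e0 ann_zero] ann_smult[OF h0_ann, of 1]]
      by (simp add: g_Suc g0 F_mult[OF e0 ann_zero] F_zero app_zero F_smult[OF h0_ann] zero_fun_def[symmetric] A.u.r_null e0)
  next
    case (Suc n)
    have "F (g (Suc (Suc n))) = vop s 0 (F (g (Suc n))) + (\<lambda>x. mu ^ Suc n * F h0 x)"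
      unfolding g_Suc[of "Suc n"]
      by (simp only: F_add[OF ann_mult[OF e0 g_ann] ann_smult[OF h0_ann]] F_e[OF zero_range g_ann] F_smult[OF h0_ann])
    then show ?case by (simp add: v Suc algebra_simps)
  qed
  have "g CHAR('k) = h0"
    using e_power[OF zero_range] ints_power_p[OF mu] by (simp add: g_def)
  moreover obtain n where n: "CHAR('k) = Suc n" using char5 by (cases "CHAR('k)") auto
  ultimately have "F h0 ?q = of_nat CHAR('k) * mu ^ n * F h0 ?q" using val[of n] by metis
  then show ?thesis by simp
qed

text \<open>As \<open>e\<^sub>1\<close> and \<open>e\<^sub>2\<close> generate all \<open>e\<^sub>j\<close> with \<open>j \<ge> 1\<close>, the elements on which the homomorphism vanishes form
  a left ideal with the same normal form as the whole annihilator, hence equal to it.\<close>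

lemma F_vanish:
  assumes 0: "F h0 = 0" and 1: "F (e 1) = 0" and 2: "F (e 2) = 0" and a: "a \<in> C.ann"
  shows "F a = 0"
proof -
  have e: "F (e (int j)) = 0" if "1 \<le> j" "j \<le> CHAR('k) - 2" for j
    using that
  proof (induction j rule: less_induct)
    case (less j)
    show ?case
    proof (cases "j \<le> 2")
      case True
      then have "j = 1 \<or> j = 2" using less.prems by auto
      then show ?thesis using 1 2 by auto
    next
      case False
      have IH: "F (e (int 1)) = 0" "F (e (int (j - 1))) = 0" using less.IH[of 1] less.IH[of "j - 1"] less.prems False by auto
      have "1 \<le> CHAR('k) - 2" "1 \<le> j - 1" "j - 1 \<le> CHAR('k) - 2" "1 + (j - 1) = j" using less.prems False by auto
      then have "(0 :: int \<Rightarrow> 'k) = (\<lambda>x. of_int (int (j - 1) - int 1) * F (e (int j)) x)"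
        using F_bracket[of 1 "j - 1"] less.prems IH by (simp add: vop_zero)
      moreover have "of_int (int (j - 1) - int 1) \<noteq> (0 :: 'k)"
        using less.prems False by (intro of_int_neq_0) auto
      ultimately show ?thesis by (auto simp: fun_eq_iff)
    qed
  qed
  define K where "K = {a \<in> C.ann. F a = 0}"
  have "\<exists>c. \<exists>b\<in>K. a = pol CHAR('k) c \<oplus>\<^bsub>A\<^esub> b"
  proof (rule span_modulo_left_ideal[where t = mu])
    show "h0 \<in> K" using 0 h0_ann by (simp add: K_def)
    show "e j \<in> K" if "j \<in> {1..int CHAR('k) - 2}" for j
    proof -
      have i: "j = int (nat j)" "1 \<le> nat j" "nat j \<le> CHAR('k) - 2" using that char5 by auto
      have "e (int (nat j)) \<in> K" using e[OF i(2,3)] e_ann[OF i(2,3)] by (simp only: K_def mem_Collect_eq)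
      then show ?thesis by (simp only: i(1)[symmetric])
    qed
    show "a \<in> carrier A" by (rule ann_in[OF a])
    show "K \<subseteq> carrier A" using ann_in by (auto simp: K_def)
    show "\<zero>\<^bsub>A\<^esub> \<in> K" by (simp add: K_def ann_zero F_zero)
    show "\<And>a b. \<lbrakk>a \<in> K; b \<in> K\<rbrakk> \<Longrightarrow> a \<oplus>\<^bsub>A\<^esub> b \<in> K" by (simp add: K_def ann_add F_add)
    show "\<And>a b. \<lbrakk>a \<in> carrier A; b \<in> K\<rbrakk> \<Longrightarrow> a \<otimes>\<^bsub>A\<^esub> b \<in> K" by (simp add: K_def ann_mult F_mult app_zero)
  qed
  then obtain c b where cb: "b \<in> K" "a = pol CHAR('k) c \<oplus>\<^bsub>A\<^esub> b" by blast
  have b: "b \<in> C.ann" using cb(1) by (simp add: K_def)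
  have "pol CHAR('k) c \<odot>\<^bsub>VM.V\<^esub> VM.hw = \<zero>\<^bsub>VM.V\<^esub>"
    using a b ann_in[OF b] by (simp add: cb(2) C.ann_def VM.V.act_add_left)
  then have "pol CHAR('k) c = \<zero>\<^bsub>A\<^esub>" by (intro VM.pol_ann) (simp add: VM.hw_ann_def)
  then have "a = b" using cb ann_in[OF b] by simp
  then show ?thesis using cb by (simp add: K_def)
qed

end

definition inner_coef :: "nat \<Rightarrow> 'k" where
  "inner_coef j = transfer m s j 0"

lemma one_two: "1 \<le> (1::nat)" "1 \<le> CHAR('k) - 2" "1 \<le> (2::nat)" "2 \<le> CHAR('k) - 2"
  using char5 by auto

lemma inner_coord:
  assumes f: "\<And>a. a \<in> C.ann \<Longrightarrow> F a = app (act rl a) g" and j: "1 \<le> j" "j \<le> CHAR('k) - 2"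
  shows "coord F j = g (pos m 0) * inner_coef j"
proof -
  have "coord F j = vop s (int j) g (pos m (j + 0))"
    using j by (simp add: coord_def f[OF e_ann[OF j]] act_e[OF rl_rep e_in_range[OF j]] app_dens)
  also have "\<dots> = transfer m s j 0 * g (pos m 0)" by (rule vop_at_pos)
  finally show ?thesis by (simp add: inner_coef_def)
qed

text \<open>Given matching first coordinates, the vector \<open>g\<close> is built weight by weight: away from the weight
  \<open>\<mu>\<close> the value at \<open>e\<^sub>0 - \<mu>\<close> can be divided by the nonzero eigenvalue, and in weight \<open>\<mu>\<close> the factor \<open>t\<close>
  is used. The difference \<open>G\<close> then vanishes on \<open>e\<^sub>0 - \<mu>\<close>, so its values on \<open>e\<^sub>1\<close> and \<open>e\<^sub>2\<close> are
  homogeneous and vanish by the choice of \<open>t\<close>.\<close>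

lemma inner_iff:
  assumes f: "C.ann_hom f"
  shows "C.inner f \<longleftrightarrow> (\<exists>t. coord (\<lambda>a. VL.\<Theta> (f a)) 1 = t * inner_coef 1 \<and> coord (\<lambda>a. VL.\<Theta> (f a)) 2 = t * inner_coef 2)"
proof
  assume "C.inner f"
  then obtain n where n: "n \<in> carrier VL.V" "\<And>a. a \<in> C.ann \<Longrightarrow> f a = a \<odot>\<^bsub>VL.V\<^esub> n" by (auto simp: C.inner_def)
  have "VL.\<Theta> (f a) = app (act rl a) (VL.\<Theta> n)" if "a \<in> C.ann" for a
    using n that ann_in[OF that] by (simp add: \<Theta>_act)
  from inner_coord[of "\<lambda>a. VL.\<Theta> (f a)", OF this] one_two
  show "\<exists>t. coord (\<lambda>a. VL.\<Theta> (f a)) 1 = t * inner_coef 1 \<and> coord (\<lambda>a. VL.\<Theta> (f a)) 2 = t * inner_coef 2" by blast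
next
  define F where "F a = VL.\<Theta> (f a)" for a
  have F: "fun_hom F" using fun_hom_of_ann_hom[OF f] by (simp add: F_def[abs_def])
  assume "\<exists>t. coord (\<lambda>a. VL.\<Theta> (f a)) 1 = t * inner_coef 1 \<and> coord (\<lambda>a. VL.\<Theta> (f a)) 2 = t * inner_coef 2"
  then obtain t where t: "coord F 1 = t * inner_coef 1" "coord F 2 = t * inner_coef 2"
    by (auto simp: F_def[abs_def])
  let ?q = "pos m 0"
  define g where "g x = (if x = ?q then t else if x \<in> {0..<int CHAR('k)} then F h0 x / (of_int x + s - mu) else 0)" for x
  have g_supp: "supported g" using pos_range[of m 0] by (auto simp: supported_def g_def)
  define G where "G a = F a - app (act rl a) g" for a
  have G: "fun_hom G"
    unfolding fun_hom_def
  proof (intro conjI ballI)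
    fix a assume a: "a \<in> C.ann"
    show "supported (G a)"
      using F_supp[OF F a] act_supported[OF s_power g_supp ann_in[OF a]] by (simp add: G_def supported_def)
  next
    fix a b assume ab: "a \<in> C.ann" "b \<in> C.ann"
    show "G (a \<oplus>\<^bsub>A\<^esub> b) = G a + G b"
      using F_add[OF F ab] act_add[OF rl_rep ann_in[OF ab(1)] ann_in[OF ab(2)]] by (simp add: G_def app_simps fun_eq_iff)
  next
    fix a b assume ab: "a \<in> carrier A" "b \<in> C.ann"
    show "G (a \<otimes>\<^bsub>A\<^esub> b) = app (act rl a) (G b)"
      unfolding G_def F_mult[OF F ab] act_mult[OF rl_rep ab(1) ann_in[OF ab(2)]] app_minus_arg app_simps ..
  qed
  have q: "of_int ?q + s = mu" using m by (simp add: of_int_pos s_def)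
  have nz: "of_int x + s - mu \<noteq> 0" if "x \<in> {0..<int CHAR('k)}" "x \<noteq> ?q" for x
    using pos_eq_iff[OF that(1), of m 0] that(2) q by (auto simp: algebra_simps)
  have G0: "G h0 = 0"
  proof
    fix x
    show "G h0 x = 0 x"
    proof (cases "x \<in> {0..<int CHAR('k)}")
      case False
      then show ?thesis using F_supp[OF G h0_ann] by (simp add: supported_def)
    next
      case True
      have "G h0 x = F h0 x - ((of_int x + s) * g x - mu * g x)"
        using True by (simp add: G_def act_h0 vop_def)
      also have "(of_int x + s) * g x - mu * g x = (of_int x + s - mu) * g x"
        by (simp add: algebra_simps)
      also have "\<dots> = F h0 x"
      proof (cases "x = ?q")
        case True
        then show ?thesis using y0_zero[OF F] q by simp
      next
        case False
        then show ?thesis using True nz[OF True False] by (simp add: g_def)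
      qed
      finally show ?thesis by simp
    qed
  qed
  have wt: "G (e (int j)) x = 0" if j: "1 \<le> j" "j \<le> CHAR('k) - 2" and x: "x \<noteq> pos m j" for j x
  proof (cases "x \<in> {0..<int CHAR('k)}")
    case False
    then show ?thesis using F_supp[OF G e_ann[OF j]] by (simp add: supported_def)
  next
    case True
    note jr = e_in_range[OF j]
    have eq: "e 0 \<otimes>\<^bsub>A\<^esub> e (int j) = of_int (int j) \<odot>\<^bsub>A\<^esub> e (int j) \<oplus>\<^bsub>A\<^esub> e (int j) \<otimes>\<^bsub>A\<^esub> e 0"
      using e_comm[OF zero_range jr] jr by simp
    have e0: "e (int j) \<otimes>\<^bsub>A\<^esub> e 0 = e (int j) \<otimes>\<^bsub>A\<^esub> h0 \<oplus>\<^bsub>A\<^esub> mu \<odot>\<^bsub>A\<^esub> e (int j)"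
    proof -
      have "e 0 = h0 \<oplus>\<^bsub>A\<^esub> mu \<odot>\<^bsub>A\<^esub> \<one>\<^bsub>A\<^esub>" using zero_range by (simp add: A.u.minus_eq A.u.a_assoc A.u.l_neg)
      then have "e (int j) \<otimes>\<^bsub>A\<^esub> e 0 = e (int j) \<otimes>\<^bsub>A\<^esub> (h0 \<oplus>\<^bsub>A\<^esub> mu \<odot>\<^bsub>A\<^esub> \<one>\<^bsub>A\<^esub>)" by simp
      then show ?thesis using jr zero_range by (simp add: A.u.r_distr A.u.smult_mult_right)
    qed
    have ej: "e (int j) \<in> C.ann" by (rule e_ann[OF j])
    have "vop s 0 (G (e (int j))) = (\<lambda>x. of_int (int j) * G (e (int j)) x) + (vop s (int j) (G h0) + (\<lambda>x. mu * G (e (int j)) x))"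
      using arg_cong[OF eq[unfolded e0], of G]
      by (simp only: F_e[OF G zero_range ej] F_add[OF G ann_smult[OF ej] ann_add[OF ann_mult[OF e_in[OF jr] h0_ann] ann_smult[OF ej]]]
        F_add[OF G ann_mult[OF e_in[OF jr] h0_ann] ann_smult[OF ej]] F_smult[OF G ej] F_e[OF G jr h0_ann])
    then have "vop s 0 (G (e (int j))) x = of_int (int j) * G (e (int j)) x + mu * G (e (int j)) x"
      by (simp add: G0 vop_zero)
    then have "(of_int x + s - mu - of_nat j) * G (e (int j)) x = 0"
      using True by (simp add: vop_def algebra_simps)
    moreover have "of_int x + s - mu - of_nat j \<noteq> 0"
      using pos_eq_iff[OF True, of m j] x m by (simp add: of_int_pos s_def algebra_simps)
    ultimately show ?thesis by simp
  qed
  have diag: "G (e (int j)) = 0" if "j = 1 \<or> j = 2" for j :: nat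
  proof
    fix x
    have j: "1 \<le> j" "j \<le> CHAR('k) - 2" using that char5 by auto
    show "G (e (int j)) x = 0 x"
    proof (cases "x = pos m j")
      case False
      then show ?thesis using wt[OF j] by simp
    next
      case True
      have "app (act rl (e (int j))) g x = coord (\<lambda>a. app (act rl a) g) j"
        using True j by (simp add: coord_def)
      also have "\<dots> = t * inner_coef j"
        using inner_coord[of "\<lambda>a. app (act rl a) g" g j] j by (simp add: g_def)
      also have "\<dots> = F (e (int j)) x" using t that True j by (auto simp: coord_def)
      finally show ?thesis by (simp add: G_def)
    qed
  qed
  have "G a = 0" if "a \<in> C.ann" for a
  proof (rule F_vanish[OF G G0 _ _ that])
    have "G (e (int 1)) = 0" by (rule diag) simp
    then show "G (e 1) = 0" by (simp only: of_nat_1)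
    have "G (e (int 2)) = 0" by (rule diag) simp
    then show "G (e 2) = 0" by (simp only: of_nat_numeral)
  qed
  then have Fg: "F a = app (act rl a) g" if "a \<in> C.ann" for a using that by (simp add: G_def)
  obtain n where n: "n \<in> carrier VL.V" "VL.\<Theta> n = g" using VL.\<Theta>_surj[OF g_supp] by blast
  have "f a = a \<odot>\<^bsub>VL.V\<^esub> n" if a: "a \<in> C.ann" for a
  proof (rule VL.\<Theta>_inj)
    show "f a \<in> carrier VL.V" using f a by (simp add: C.ann_hom_def)
    show "a \<odot>\<^bsub>VL.V\<^esub> n \<in> carrier VL.V" using ann_in[OF a] n by simp
    show "VL.\<Theta> (f a) = VL.\<Theta> (a \<odot>\<^bsub>VL.V\<^esub> n)"
      using Fg[OF a] ann_in[OF a] n by (simp add: F_def \<Theta>_act)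
  qed
  then show "C.inner f" using n(1) by (auto simp: C.inner_def)
qed

end

section \<open>Realizing cocycles\<close>

context witt_setup
begin

lemma vop_unit_at_pos:
  "vop s (int i) (unit_at (pos m j)) = (\<lambda>n. transfer m s i j * unit_at (pos m (i + j)) n)"
proof (cases "pos m j + int i < int CHAR('k)")
  case True
  then show ?thesis using pos_add[OF True] pos_range[of m j] by (simp add: vop_unit_at transfer_def)
qed (simp add: vop_unit_at transfer_def)

lemma transfer_large: "i \<ge> CHAR('k) - 1 \<Longrightarrow> transfer m s i j = (0 :: 'k)"
proof -
  assume i: "i \<ge> CHAR('k) - 1"
  show ?thesis
  proof (cases "pos m j + int i < int CHAR('k)")
    case True
    then have "pos m j = 0" "int i + 1 = int CHAR('k)" using i pos_range[of m j] by auto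
    then have "transfer m s i j = of_int 0 + of_int (int CHAR('k)) * s"
      using True unfolding transfer_def by (simp only: if_True)
    then show ?thesis by simp
  qed (simp add: transfer_def)
qed

lemma cocycle_relation:
  assumes c: "cocycle m s c" and i: "1 \<le> i" and j: "1 \<le> j"
  shows "transfer m s i j * c j - transfer m s j i * c i = of_int (int j - int i) * c (i + j)"
proof -
  have out: "c j = 0" if "j \<ge> CHAR('k) - 1" for j using c that by (simp add: cocycle_def)
  have *: "transfer m s i j * c j - transfer m s j i * c i = of_int (int j - int i) * c (i + j)" if ij: "1 \<le> i" "i < j" for i j
  proof (cases "j \<le> CHAR('k) - 2")
    case True
    then show ?thesis using c ij by (simp add: cocycle_def)
  next
    case False
    then have "CHAR('k) - 1 \<le> j" by simp
    then show ?thesis using out[of j] out[of "i + j"] transfer_large[of j m s i] by simp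
  qed
  have "i < j \<or> i = j \<or> j < i" by linarith
  then show ?thesis
  proof (elim disjE)
    assume "j < i"
    have "transfer m s i j * c j - transfer m s j i * c i = - (transfer m s j i * c i - transfer m s i j * c j)" by simp
    also have "\<dots> = - (of_int (int i - int j) * c (j + i))" by (simp only: *[OF j \<open>j < i\<close>])
    also have "\<dots> = of_int (int j - int i) * c (i + j)" by (simp add: algebra_simps)
    finally show ?thesis .
  qed (use * i in simp_all)
qed

lemma funpow_vop_unit_at:
  "(vop s (int j) ^^ k) (unit_at (pos m i)) = (\<lambda>n. (\<Prod>x<k. transfer m s j (i + x * j)) * unit_at (pos m (i + k * j)) n)"
proof (induction k)
  case (Suc k)
  show ?case
    unfolding funpow.simps o_apply Suc vop_scale vop_unit_at_pos by (simp add: mult.assoc add.commute add.left_commute)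
qed simp

text \<open>A raising chain of length \<open>p - 1\<close> with steps \<open>j\<close> needs \<open>(p - 1) j\<close> positions above its start, so it
  can be nonzero only for \<open>j = 1\<close> and when it starts at the bottom, which means \<open>m = 0\<close>. In that
  case the factors are \<open>x + 2 s\<close>.\<close>

lemma raising_product_zero:
  assumes j: "1 \<le> j" and m: "m < CHAR('k)" and r: "m = 0 \<Longrightarrow> \<exists>x<CHAR('k) - 1. of_nat x + 2 * s = (0 :: 'k)"
  shows "(\<Prod>x<CHAR('k) - 1. transfer m s j (j + x * j)) = 0"
proof (rule ccontr)
  assume nz: "(\<Prod>x<CHAR('k) - 1. transfer m s j (j + x * j)) \<noteq> 0"
  have nz: "transfer m s j (j + x * j) \<noteq> 0" if "x < CHAR('k) - 1" for x
    using nz that unfolding prod_zero_iff[OF finite_lessThan] by blast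
  have up: "pos m (j + x * j) = pos m j + int (x * j)" if "x \<le> CHAR('k) - 1" for x
    using that
  proof (induction x)
    case (Suc x)
    then have "pos m (j + x * j) + int j < int CHAR('k)"
      using nz[of x] by (auto simp: transfer_def split: if_splits)
    from pos_add[OF this] Suc show ?case by (simp add: add.commute)
  qed simp
  have "int ((CHAR('k) - 1) * j) + pos m j < int CHAR('k)"
    using pos_range[of m "j + (CHAR('k) - 1) * j"]
    unfolding up[OF order_refl] by (simp only: atLeastLessThan_iff add.commute)
  then have lt: "int ((CHAR('k) - 1) * j) + pos m j \<le> int (CHAR('k) - 1)" using char5 by simp
  have j1: "j = 1"
  proof (rule ccontr)
    assume "j \<noteq> 1"
    then have "(CHAR('k) - 1) * 2 \<le> (CHAR('k) - 1) * j" using j by (intro mult_le_mono2) simp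
    moreover have "int ((CHAR('k) - 1) * j) \<le> int (CHAR('k) - 1)" using lt pos_range[of m j] by simp
    then have "(CHAR('k) - 1) * j \<le> CHAR('k) - 1" by (simp only: of_nat_le_iff)
    ultimately show False using char5 by simp
  qed
  have p1: "pos m 1 = 0" using lt pos_range[of m 1] by (simp add: j1)
  have m0: "m = 0"
  proof (rule ccontr)
    assume "m \<noteq> 0"
    have "pos m 1 = (int CHAR('k) - int m) mod int CHAR('k)" by (simp add: pos_def algebra_simps del: minus_mod_self1)
    also have "\<dots> = int CHAR('k) - int m" using m \<open>m \<noteq> 0\<close> by (intro mod_pos_pos_trivial) auto
    finally have "pos m 1 = int CHAR('k) - int m" .
    then show False using p1 m by simp
  qed
  obtain x where x: "x < CHAR('k) - 1" "of_nat x + 2 * s = 0" using r[OF m0] by blast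
  have "transfer m s j (j + x * j) = 0"
    using up[of x] x p1 by (simp add: transfer_def j1)
  then show False using nz[OF x(1)] by simp
qed

end

context extension_setup
begin

lemma act_E_upper: "a \<in> carrier A \<Longrightarrow> app (act E a) F (Inr i) = app (act (dens sm) a) (\<lambda>i. F (Inr i)) i"
proof (induction a arbitrary: i rule: A_induct)
  case (gen k a)
  then show ?case
    by (simp add: act_mult[OF E_rep] act_e[OF E_rep] act_mult[OF dens_rep[OF sm]] act_e[OF dens_rep[OF sm]]
      app_simps app_E app_dens Eop_def)
qed (simp_all add: act_add[OF E_rep] act_add[OF dens_rep[OF sm]] act_smult[OF E_rep] act_smult[OF dens_rep[OF sm]]
  act_one[OF E_rep] act_one[OF dens_rep[OF sm]] act_zero[OF E_rep] act_zero[OF dens_rep[OF sm]] app_simps app_scalar)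

lemma act_E_low: "a \<in> carrier A \<Longrightarrow> app (act E a) (low f) = low (app (act (dens sl) a) f)"
proof (induction a rule: A_induct)
  case (gen k a)
  then show ?case
    by (simp add: act_mult[OF E_rep] act_e[OF E_rep] act_mult[OF dens_rep[OF sl]] act_e[OF dens_rep[OF sl]]
      app_simps app_E app_dens Eop_low)
qed (auto simp: act_add[OF E_rep] act_add[OF dens_rep[OF sl]] act_smult[OF E_rep] act_smult[OF dens_rep[OF sl]]
  act_one[OF E_rep] act_one[OF dens_rep[OF sl]] act_zero[OF E_rep] act_zero[OF dens_rep[OF sl]] app_simps app_scalar
  low_zero low_def fun_eq_iff split: sum.split)

lemma act_E_supported: "a \<in> carrier A \<Longrightarrow> supported (\<lambda>x. app (act E a) (W 0) (Inl x))"
proof (induction a rule: A_induct)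
  case (gen k a)
  then show ?case
    by (simp add: act_mult[OF E_rep] act_e[OF E_rep] app_simps app_E Eop_supp supported_def)
qed (simp_all add: act_add[OF E_rep] act_smult[OF E_rep] act_one[OF E_rep] act_zero[OF E_rep] app_simps app_scalar
  supported_def W0)

lemma low_Inl_eq: "(\<And>i. F (Inr i) = 0) \<Longrightarrow> F = low (\<lambda>x. F (Inl x))"
  by (auto simp: low_def fun_eq_iff split: sum.split)

lemma low_eq_iff: "low f = low g \<longleftrightarrow> f = g"
  using low_Inl by metis

lemma W0_top: "(\<lambda>i. W 0 (Inr i)) = top"
  by (simp add: W0 delta_def top_def fun_eq_iff)

end

context verma_pair
begin

text \<open>In the extension built from \<open>D j = c\<^sub>j u\<^sub>n\<close>, the element \<open>a\<close> acts on the lift \<open>W 0\<close> of the highest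
  weight vector. If \<open>a\<close> annihilates that vector in the quotient, the result lies in the submodule,
  and this defines the homomorphism.\<close>

lemma cocycle_realized:
  assumes c: "cocycle m s c" and r: "m = 0 \<Longrightarrow> \<exists>x<CHAR('k) - 1. of_nat x + 2 * s = 0"
  shows "\<exists>f. C.ann_hom f \<and> (\<forall>j. 1 \<le> j \<longrightarrow> j \<le> CHAR('k) - 2 \<longrightarrow> coord (\<lambda>a. VL.\<Theta> (f a)) j = c j)"
proof -
  define D :: "int \<Rightarrow> int \<Rightarrow> 'k" where
    "D j = (if 1 \<le> j then (\<lambda>n. c (nat j) * unit_at (pos m (nat j)) n) else 0)" for j
  have c_out: "c j = 0" if "j \<ge> CHAR('k) - 1" for j using c that by (simp add: cocycle_def)
  have D_nat: "D (int j) = (\<lambda>n. c j * unit_at (pos m j) n)" if "1 \<le> j" for j using that by (simp add: D_def)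
  have vop_D: "vop s (int i) (D (int j)) = (\<lambda>n. c j * (transfer m s i j * unit_at (pos m (i + j)) n))" if "1 \<le> j" for i j
    by (simp only: D_nat[OF that] vop_scale vop_unit_at_pos)
  have nat_of_pos: "\<exists>i. j = int i \<and> 1 \<le> i" if "1 \<le> j" for j
    using that by (intro exI[of _ "nat j"]) simp
  have mu_power: "(mu + 1) ^ CHAR('k) = mu + 1" by (rule VM.wt_shift)
  interpret X: extension_setup pm s "mu + 1" D
  proof unfold_locales
    show "s ^ CHAR('k) = s" by (rule s_power)
    show "(mu + 1) ^ CHAR('k) = mu + 1" by (rule mu_power)
  next
    fix j :: int
    assume "j \<notin> {1..int CHAR('k) - 2}"
    then have "j < 1 \<or> 1 \<le> j \<and> CHAR('k) - 1 \<le> nat j" using char5 by auto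
    then show "D j = 0" using c_out[of "nat j"] by (auto simp: D_def fun_eq_iff)
  next
    fix n :: int and j :: int
    assume "n \<notin> {0..<int CHAR('k)}"
    then show "D j n = 0" using pos_range[of m "nat j"] by (auto simp: D_def unit_at_def)
  next
    fix j :: int
    show "vop s 0 (D j) = (\<lambda>n. (mu + 1 - 1 + of_int j) * D j n)"
    proof (cases "1 \<le> j")
      case True
      then obtain i where i: "j = int i" "1 \<le> i" using nat_of_pos by blast
      have t: "transfer m s 0 i = mu + of_nat i"
        using m pos_range[of m i] by (simp add: transfer_def of_int_pos s_def)
      show ?thesis
        using vop_D[OF i(2), of 0] by (simp add: i(1) D_nat[OF i(2)] t mult_ac)
    next
      case False
      then show ?thesis by (simp add: D_def zero_fun_def)
    qed
  next
    fix i j :: int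
    assume "1 \<le> i" "1 \<le> j"
    then obtain k l where k: "i = int k" "1 \<le> k" and l: "j = int l" "1 \<le> l"
      using nat_of_pos by meson
    show "vop s i (D j) - vop s j (D i) = (\<lambda>n. of_int (j - i) * D (i + j) n)"
    proof
      fix n
      have "(vop s i (D j) - vop s j (D i)) n = (transfer m s k l * c l - transfer m s l k * c k) * unit_at (pos m (k + l)) n"
        using vop_D[OF l(2), of k] vop_D[OF k(2), of l] by (simp add: k(1) l(1) algebra_simps)
      also have "\<dots> = of_int (j - i) * D (i + j) n"
        using D_nat[of "k + l"] k(2) by (simp only: cocycle_relation[OF c k(2) l(2)] k(1) l(1) of_nat_add) simp
      finally show "(vop s i (D j) - vop s j (D i)) n = of_int (j - i) * D (i + j) n" .
    qed
  next
    fix j :: int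
    assume "1 \<le> j"
    then obtain i where i: "j = int i" "1 \<le> i" using nat_of_pos by blast
    have lin: "(vop s j ^^ k) (\<lambda>n. t * f n) = (\<lambda>n. t * (vop s j ^^ k) f n)" for k t f
      by (induction k) (simp_all add: vop_scale)
    have z: "(\<Prod>x<CHAR('k) - 1. transfer m s i (i + x * i)) = 0"
      by (rule raising_product_zero[OF i(2) m_less]) (rule r)
    show "(vop s j ^^ (CHAR('k) - 1)) (D j) = 0"
      unfolding i(1) D_nat[OF i(2)] lin[unfolded i(1)] funpow_vop_unit_at z
      by (simp add: zero_fun_def)
  qed
  define H where "H a = app (act X.E a) (X.W 0)" for a
  define h where "h a = (\<lambda>x. H a (Inl x))" for a
  have H_low: "H a = X.low (h a)" if a: "a \<in> C.ann" for a
    unfolding h_def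
  proof (rule X.low_Inl_eq)
    fix i
    have "H a (Inr i) = app (act (dens (mu + 1)) a) top i"
      using X.act_E_upper[OF ann_in[OF a], of "X.W 0" i] by (simp only: H_def X.W0_top)
    also have "app (act (dens (mu + 1)) a) top = VM.\<Theta> (a \<odot>\<^bsub>VM.V\<^esub> VM.hw)"
      by (simp only: VM.\<Theta>_act[OF ann_in[OF a] VM.hw_in] VM.\<Theta>_hw)
    also have "\<dots> = 0" using a by (simp add: C.ann_def VM.\<Theta>_zero)
    finally show "H a (Inr i) = 0" by simp
  qed
  have h_supp: "supported (h a)" if "a \<in> C.ann" for a
    unfolding h_def H_def by (rule X.act_E_supported[OF ann_in[OF that]])
  have H_add: "H (a \<oplus>\<^bsub>A\<^esub> b) = H a + H b" if "a \<in> C.ann" "b \<in> C.ann" for a b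
    unfolding H_def using act_add[OF X.E_rep ann_in[OF that(1)] ann_in[OF that(2)]] by (simp add: app_simps)
  have h_add: "h (a \<oplus>\<^bsub>A\<^esub> b) = h a + h b" if "a \<in> C.ann" "b \<in> C.ann" for a b
    using H_add[OF that] by (simp add: h_def fun_eq_iff)
  have h_mult: "h (a \<otimes>\<^bsub>A\<^esub> b) = app (act rl a) (h b)" if ab: "a \<in> carrier A" "b \<in> C.ann" for a b
  proof -
    have "X.low (h (a \<otimes>\<^bsub>A\<^esub> b)) = H (a \<otimes>\<^bsub>A\<^esub> b)" by (rule H_low[OF ann_mult[OF ab], symmetric])
    also have "\<dots> = app (act X.E a) (H b)"
      unfolding H_def using act_mult[OF X.E_rep ab(1) ann_in[OF ab(2)]] by (simp add: app_simps)
    also have "\<dots> = X.low (app (act rl a) (h b))" by (simp only: H_low[OF ab(2)] X.act_E_low[OF ab(1)])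
    finally show ?thesis by (simp only: X.low_eq_iff)
  qed
  define f where "f a = (SOME Y. Y \<in> carrier VL.V \<and> VL.\<Theta> Y = h a)" for a
  have f: "f a \<in> carrier VL.V" "VL.\<Theta> (f a) = h a" if "a \<in> C.ann" for a
  proof -
    have "\<exists>Y. Y \<in> carrier VL.V \<and> VL.\<Theta> Y = h a" using VL.\<Theta>_surj[OF h_supp[OF that]] by blast
    from someI_ex[OF this] show "f a \<in> carrier VL.V" "VL.\<Theta> (f a) = h a" by (simp_all only: f_def)
  qed
  have "C.ann_hom f"
    unfolding C.ann_hom_def
  proof (intro conjI ballI)
    fix a assume "a \<in> C.ann" then show "f a \<in> carrier VL.V" by (rule f)
  next
    fix a b assume ab: "a \<in> C.ann" "b \<in> C.ann"
    show "f (a \<oplus>\<^bsub>A\<^esub> b) = f a \<oplus>\<^bsub>VL.V\<^esub> f b"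
    proof (rule VL.\<Theta>_inj)
      show "VL.\<Theta> (f (a \<oplus>\<^bsub>A\<^esub> b)) = VL.\<Theta> (f a \<oplus>\<^bsub>VL.V\<^esub> f b)"
        by (simp only: f[OF ann_add[OF ab]] VL.\<Theta>_add[OF f(1)[OF ab(1)] f(1)[OF ab(2)]] f(2)[OF ab(1)] f(2)[OF ab(2)] h_add[OF ab])
    qed (use f(1)[OF ann_add[OF ab]] f(1)[OF ab(1)] f(1)[OF ab(2)] in simp_all)
  next
    fix a b assume ab: "a \<in> carrier A" "b \<in> C.ann"
    show "f (a \<otimes>\<^bsub>A\<^esub> b) = a \<odot>\<^bsub>VL.V\<^esub> f b"
    proof (rule VL.\<Theta>_inj)
      show "VL.\<Theta> (f (a \<otimes>\<^bsub>A\<^esub> b)) = VL.\<Theta> (a \<odot>\<^bsub>VL.V\<^esub> f b)"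
        by (simp only: f[OF ann_mult[OF ab]] \<Theta>_act[OF ab(1) f(1)[OF ab(2)]] f(2)[OF ab(2)] h_mult[OF ab])
    qed (use f(1)[OF ann_mult[OF ab]] f(1)[OF ab(2)] ab in simp_all)
  qed
  moreover have "coord (\<lambda>a. VL.\<Theta> (f a)) j = c j" if j: "1 \<le> j" "j \<le> CHAR('k) - 2" for j
  proof -
    have "H (e (int j)) = X.low (D (int j))"
      using X.Eop_W0[of "int j"] j by (simp add: H_def act_e[OF X.E_rep e_in_range[OF j]] X.app_E fun_eq_iff)
    then have "h (e (int j)) = D (int j)" by (simp add: H_low[OF e_ann[OF j]] X.low_eq_iff)
    then show ?thesis using j by (simp add: coord_def f(2)[OF e_ann[OF j]] D_nat[OF j(1)] unit_at_def)
  qed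
  ultimately show ?thesis by blast
qed

theorem Ext1_verma_trivial:
  assumes "\<And>c. cocycle m s c \<Longrightarrow> \<exists>t. c 1 = t * inner_coef 1 \<and> c 2 = t * inner_coef 2"
  shows "carrier (Ext1 A VM.V VL.V) = {\<zero>\<^bsub>Ext1 A VM.V VL.V\<^esub>}"
proof (rule C.Ext1_trivial)
  fix f assume f: "C.ann_hom f"
  show "C.inner f"
    unfolding inner_iff[OF f] by (rule assms[OF coord_cocycle[OF fun_hom_of_ann_hom[OF f]]])
qed

text \<open>A linear form in \<open>c\<^sub>1\<close> and \<open>c\<^sub>2\<close> that vanishes exactly on the inner solutions induces an isomorphism
  with the field.\<close>

theorem Ext1_verma_one_dimensional:
  assumes c: "cocycle m s c" and r: "m = 0 \<Longrightarrow> \<exists>x<CHAR('k) - 1. of_nat x + 2 * s = 0"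
    and inner: "\<alpha> * inner_coef 1 + \<beta> * inner_coef 2 = 0" and nz: "\<alpha> * c 1 + \<beta> * c 2 \<noteq> 0"
    and ker: "\<And>c. \<lbrakk>cocycle m s c; \<alpha> * c 1 + \<beta> * c 2 = 0\<rbrakk> \<Longrightarrow> \<exists>t. c 1 = t * inner_coef 1 \<and> c 2 = t * inner_coef 2"
  shows "linear_iso (Ext1 A VM.V VL.V) base_field"
proof -
  define \<theta> where "\<theta> f = \<alpha> * coord (\<lambda>a. VL.\<Theta> (f a)) 1 + \<beta> * coord (\<lambda>a. VL.\<Theta> (f a)) 2" for f
  have coord: "coord F 1 = F (e 1) (pos m 1)" "coord F 2 = F (e 2) (pos m 2)" for F
    using one_two by (simp_all add: coord_def)
  have e12: "e 1 \<in> C.ann" "e 2 \<in> C.ann" using e_ann[OF one_two(1,2)] e_ann[OF one_two(3,4)] by simp_all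
  have N: "f a \<in> carrier VL.V" if "C.ann_hom f" "a \<in> C.ann" for f a using that by (simp add: C.ann_hom_def)
  show ?thesis
  proof (rule C.Ext1_one_dimensional[where \<theta> = \<theta>])
    fix f g :: "((int \<Rightarrow>\<^sub>0 'k) list \<Rightarrow> 'k) set set \<Rightarrow> (((int \<Rightarrow>\<^sub>0 'k) list \<Rightarrow> 'k) set set \<times> 'k \<Rightarrow>\<^sub>0 int) set"
    assume "\<And>a. a \<in> C.ann \<Longrightarrow> f a = g a"
    then show "\<theta> f = \<theta> g" using e12 unfolding \<theta>_def coord by simp
  next
    fix f g assume fg: "C.ann_hom f" "C.ann_hom g"
    show "\<theta> (\<lambda>a. f a \<oplus>\<^bsub>VL.V\<^esub> g a) = \<theta> f + \<theta> g"
      using N[OF fg(1) e12(1)] N[OF fg(1) e12(2)] N[OF fg(2) e12(1)] N[OF fg(2) e12(2)]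
      unfolding \<theta>_def coord by (simp add: VL.\<Theta>_add algebra_simps)
  next
    fix t f assume f: "C.ann_hom f"
    have "VL.\<Theta> ((t \<odot>\<^bsub>A\<^esub> \<one>\<^bsub>A\<^esub>) \<odot>\<^bsub>VL.V\<^esub> f a) x = t * VL.\<Theta> (f a) x" if "a \<in> C.ann" for a x
      using \<Theta>_act[OF _ N[OF f that], of "t \<odot>\<^bsub>A\<^esub> \<one>\<^bsub>A\<^esub>"]
      by (simp add: act_smult[OF rl_rep A.u.one_closed A.u.one_closed] act_one[OF rl_rep] app_simps app_scalar)
    then show "\<theta> (\<lambda>a. (t \<odot>\<^bsub>A\<^esub> \<one>\<^bsub>A\<^esub>) \<odot>\<^bsub>VL.V\<^esub> f a) = t * \<theta> f"
      using e12 unfolding \<theta>_def coord by (simp add: algebra_simps)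
  next
    fix f assume f: "C.ann_hom f"
    show "\<theta> f = 0 \<longleftrightarrow> C.inner f"
    proof
      assume "\<theta> f = 0"
      then show "C.inner f"
        unfolding inner_iff[OF f] \<theta>_def by (rule ker[OF coord_cocycle[OF fun_hom_of_ann_hom[OF f]]])
    next
      assume "C.inner f"
      then obtain t where t: "coord (\<lambda>a. VL.\<Theta> (f a)) 1 = t * inner_coef 1" "coord (\<lambda>a. VL.\<Theta> (f a)) 2 = t * inner_coef 2"
        unfolding inner_iff[OF f] by blast
      have "\<theta> f = t * (\<alpha> * inner_coef 1 + \<beta> * inner_coef 2)" unfolding \<theta>_def t by (simp add: algebra_simps)
      then show "\<theta> f = 0" by (simp only: inner mult_zero_right)
    qed
  next
    obtain f where f: "C.ann_hom f" "\<And>j. 1 \<le> j \<Longrightarrow> j \<le> CHAR('k) - 2 \<Longrightarrow> coord (\<lambda>a. VL.\<Theta> (f a)) j = c j"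
      using cocycle_realized[OF c r] by blast
    have "\<theta> f \<noteq> 0" unfolding \<theta>_def f(2)[OF one_two(1,2)] f(2)[OF one_two(3,4)] by (rule nz)
    then show "\<exists>f. C.ann_hom f \<and> \<theta> f \<noteq> 0" using f(1) by blast
  qed
qed

end

section \<open>Solving the cocycle equations\<close>

text \<open>Eliminating \<open>c\<^sub>3\<close>, \<open>c\<^sub>4\<close> and \<open>c\<^sub>5\<close> from the equations of degree at most five. The last factor
  is the determinant of \<open>(c\<^sub>1, c\<^sub>2)\<close> and the inner solution, which must split off because inner
  solutions satisfy all equations.\<close>

lemma degree_five_identity:
  fixes M s :: "'a :: idom"
  assumes 12: "(1 - M + 2 * s) * c\<^sub>2 - (3 * s - M) * c\<^sub>1 = c\<^sub>3"
    and 13: "(2 - M + 2 * s) * c\<^sub>3 - (4 * s - M) * c\<^sub>1 = 2 * c\<^sub>4"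
    and 14: "(3 - M + 2 * s) * c\<^sub>4 - (5 * s - M) * c\<^sub>1 = 3 * c\<^sub>5"
    and 23: "(2 - M + 3 * s) * c\<^sub>3 - (1 - M + 4 * s) * c\<^sub>2 = c\<^sub>5"
  shows "2 * ((M ^ 2 - 4 * M * s - M + 4 * s ^ 2 - 4 * s) * ((3 * s - M - 1) * c\<^sub>1 - (2 * s - M - 1) * c\<^sub>2)) = 0"
proof -
  \<comment> \<open>With each equation written as a vanishing error term, the elimination is one polynomial identity.\<close>
  define E12 where "E12 = (1 - M + 2 * s) * c\<^sub>2 - (3 * s - M) * c\<^sub>1 - c\<^sub>3"
  define E13 where "E13 = (2 - M + 2 * s) * c\<^sub>3 - (4 * s - M) * c\<^sub>1 - 2 * c\<^sub>4"
  define E14 where "E14 = (3 - M + 2 * s) * c\<^sub>4 - (5 * s - M) * c\<^sub>1 - 3 * c\<^sub>5"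
  define E23 where "E23 = (2 - M + 3 * s) * c\<^sub>3 - (1 - M + 4 * s) * c\<^sub>2 - c\<^sub>5"
  have "2 * ((M ^ 2 - 4 * M * s - M + 4 * s ^ 2 - 4 * s) * ((3 * s - M - 1) * c\<^sub>1 - (2 * s - M - 1) * c\<^sub>2))
      = 12 * (E23 + (2 - M + 3 * s) * E12) - 4 * E14 - 2 * (3 - M + 2 * s) * (E13 + (2 - M + 2 * s) * E12)"
    unfolding E12_def E13_def E14_def E23_def by (simp add: algebra_simps power2_eq_square)
  also have "\<dots> = 0" using assms by (simp add: E12_def E13_def E14_def E23_def)
  finally show ?thesis .
qed

lemma degree_seven_identity:
  fixes M s :: "'a :: idom"
  assumes 12: "(1 - M + 2 * s) * c\<^sub>2 - (3 * s - M) * c\<^sub>1 = c\<^sub>3"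
    and 13: "(2 - M + 2 * s) * c\<^sub>3 - (4 * s - M) * c\<^sub>1 = 2 * c\<^sub>4"
    and 23: "(2 - M + 3 * s) * c\<^sub>3 - (1 - M + 4 * s) * c\<^sub>2 = c\<^sub>5"
    and 25: "(4 - M + 3 * s) * c\<^sub>5 - (1 - M + 6 * s) * c\<^sub>2 = 3 * c\<^sub>7"
    and 34: "(3 - M + 4 * s) * c\<^sub>4 - (2 - M + 5 * s) * c\<^sub>3 = c\<^sub>7"
    and 5: "(M ^ 2 - 4 * M * s - M + 4 * s ^ 2 - 4 * s) * ((3 * s - M - 1) * c\<^sub>1 - (2 * s - M - 1) * c\<^sub>2) = 0"
  shows "2 * (s * (M - s + 1) * ((3 * s - M - 1) * c\<^sub>1 - (2 * s - M - 1) * c\<^sub>2)) = 0"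
proof -
  define E12 where "E12 = (1 - M + 2 * s) * c\<^sub>2 - (3 * s - M) * c\<^sub>1 - c\<^sub>3"
  define E13 where "E13 = (2 - M + 2 * s) * c\<^sub>3 - (4 * s - M) * c\<^sub>1 - 2 * c\<^sub>4"
  define E23 where "E23 = (2 - M + 3 * s) * c\<^sub>3 - (1 - M + 4 * s) * c\<^sub>2 - c\<^sub>5"
  define E25 where "E25 = (4 - M + 3 * s) * c\<^sub>5 - (1 - M + 6 * s) * c\<^sub>2 - 3 * c\<^sub>7"
  define E34 where "E34 = (3 - M + 4 * s) * c\<^sub>4 - (2 - M + 5 * s) * c\<^sub>3 - c\<^sub>7"
  have "2 * (s * (M - s + 1) * ((3 * s - M - 1) * c\<^sub>1 - (2 * s - M - 1) * c\<^sub>2))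
      = (M ^ 2 - 4 * M * s - M + 4 * s ^ 2 - 4 * s) * ((3 * s - M - 1) * c\<^sub>1 - (2 * s - M - 1) * c\<^sub>2)
        - 2 * (E25 + (4 - M + 3 * s) * (E23 + (2 - M + 3 * s) * E12))
        + 6 * (E34 - (2 - M + 5 * s) * E12) + 3 * (3 - M + 4 * s) * (E13 + (2 - M + 2 * s) * E12)"
    unfolding E12_def E13_def E23_def E25_def E34_def by (simp add: algebra_simps power2_eq_square)
  also have "\<dots> = 0" unfolding 5 using 12 13 23 25 34 by (simp add: E12_def E13_def E23_def E25_def E34_def)
  finally show ?thesis .
qed

context witt_setup
begin

lemma of_nat_neq_0: "\<lbrakk>0 < n; n < CHAR('k)\<rbrakk> \<Longrightarrow> of_nat n \<noteq> (0 :: 'k)"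
  using dvd_imp_le[of "CHAR('k)" n] by (auto simp: of_nat_eq_0_iff_char_dvd)

lemma of_nat_eq_iff_less: "\<lbrakk>n < CHAR('k); i < CHAR('k)\<rbrakk> \<Longrightarrow> of_nat n = (of_nat i :: 'k) \<longleftrightarrow> n = i"
proof -
  assume *: "n < CHAR('k)" "i < CHAR('k)"
  have "of_int (int n - int i) \<noteq> (0 :: 'k)" if "n \<noteq> i" using * that by (intro of_int_neq_0) auto
  then show ?thesis by auto
qed

lemma numeral_neq_0: "numeral n < CHAR('k) \<Longrightarrow> numeral n \<noteq> (0 :: 'k)"
  using of_nat_neq_0[of "numeral n"] by simp

lemma small_neq_0: "(2 :: 'k) \<noteq> 0" "(3 :: 'k) \<noteq> 0" "(4 :: 'k) \<noteq> 0"
  using char5 by (intro numeral_neq_0; simp)+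

lemma of_nat_char_minus: "i \<le> CHAR('k) \<Longrightarrow> of_nat (CHAR('k) - i) = (- of_nat i :: 'k)"
  by (simp add: of_nat_diff)

text \<open>The value of \<open>transfer\<close> as long as the exponent stays in the range.\<close>

definition weight :: "nat \<Rightarrow> 'k \<Rightarrow> nat \<Rightarrow> nat \<Rightarrow> 'k" where
  "weight m s i j = of_nat j - 1 - of_nat m + (of_nat i + 1) * s"

lemma transfer_weight:
  assumes m: "m < CHAR('k)" and j: "j < CHAR('k)"
  shows "transfer m s i j = (if (if j \<le> m then i + j \<le> m else i + j \<le> CHAR('k) + m) then weight m s i j else (0 :: 'k))"
proof -
  have "pos m j = (if j \<le> m then int CHAR('k) - 1 - int m + int j else int j - int m - 1)"
  proof (cases "j \<le> m")
    case True
    then show ?thesis using m unfolding pos_def by (simp add: mod_pos_pos_trivial)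
  next
    case False
    have "pos m j = (int j - int m - 1 + int CHAR('k)) mod int CHAR('k)"
      unfolding pos_def by (rule arg_cong2[where f = "(mod)"]) simp_all
    also have "\<dots> = int j - int m - 1" using False j by (simp add: mod_pos_pos_trivial)
    finally show ?thesis using False by simp
  qed
  moreover have "of_int (pos m j) + of_int (int i + 1) * s = weight m s i j"
    by (simp add: of_int_pos weight_def)
  ultimately show ?thesis unfolding transfer_def by auto
qed

lemma cocycle_out: "cocycle m s c \<Longrightarrow> n \<ge> CHAR('k) - 1 \<Longrightarrow> c n = (0 :: 'k)"
  by (simp add: cocycle_def)

text \<open>The exponents wrap around between \<open>m\<close> and \<open>m + 1\<close>, so \<open>e\<^sub>1\<close> kills the vector in degree \<open>m\<close>, and the
  equations for the pairs \<open>(1, n - 1)\<close> propagate the vanishing upwards.\<close>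

lemma cocycle_high_zero:
  assumes c: "cocycle m s c" and m: "2 \<le> m" "m < CHAR('k)" and n: "m < n"
  shows "c n = (0 :: 'k)"
  using n
proof (induction n rule: less_induct)
  case (less n)
  show ?case
  proof (cases "n \<ge> CHAR('k) - 1")
    case True
    then show ?thesis by (rule cocycle_out[OF c])
  next
    case False
    have zero: "transfer m s 1 (n - 1) * c (n - 1) = 0"
    proof (cases "n - 1 = m")
      case True
      then show ?thesis using m by (simp add: transfer_weight)
    next
      case F: False
      then show ?thesis using less.IH[of "n - 1"] less.prems by simp
    qed
    have "transfer m s 1 (n - 1) * c (n - 1) - transfer m s (n - 1) 1 * c 1 = of_int (int (n - 1) - int 1) * c (1 + (n - 1))"
      using m less.prems False by (intro cocycle_relation[OF c]) auto
    moreover have "transfer m s (n - 1) 1 = 0" using m less.prems by (simp add: transfer_weight)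
    moreover have "of_int (int (n - 1) - int 1) \<noteq> (0 :: 'k)"
      using m less.prems False by (intro of_int_neq_0) auto
    moreover have "1 + (n - 1) = n" using less.prems by simp
    ultimately show ?thesis using zero by (simp only: mult_zero_left diff_self) auto
  qed
qed

definition low_relations :: "nat \<Rightarrow> nat \<Rightarrow> 'k \<Rightarrow> (nat \<Rightarrow> 'k) \<Rightarrow> bool" where
  "low_relations N m s c \<longleftrightarrow> (\<forall>i j. 1 \<le> i \<longrightarrow> i < j \<longrightarrow> i + j \<le> N \<longrightarrow>
     weight m s i j * c j - weight m s j i * c i = of_int (int j - int i) * c (i + j))"

lemma low_relation:
  "\<lbrakk>low_relations N m s c; 1 \<le> i; i < j; i + j = n; n \<le> N\<rbrakk> \<Longrightarrow>
    (of_nat j - 1 - of_nat m + (of_nat i + 1) * s) * c j - (of_nat i - 1 - of_nat m + (of_nat j + 1) * s) * c i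
      = of_int (int j - int i) * c n"
  by (auto simp: low_relations_def weight_def)

lemma cocycle_iff_low:
  assumes m: "2 \<le> m" "m < CHAR('k)"
  shows "cocycle m s c \<longleftrightarrow> (\<forall>n. m < n \<or> CHAR('k) - 1 \<le> n \<longrightarrow> c n = (0 :: 'k)) \<and> low_relations m m s c"
    (is "_ \<longleftrightarrow> ?Z \<and> ?R")
proof
  assume c: "cocycle m s c"
  have ?R
    unfolding low_relations_def
  proof (intro allI impI)
    fix i j assume ij: "1 \<le> i" "i < j" "i + j \<le> m"
    then show "weight m s i j * c j - weight m s j i * c i = of_int (int j - int i) * c (i + j)"
      using cocycle_relation[OF c, of i j] m transfer_weight[of m j s i] transfer_weight[of m i s j] by (simp add: add.commute)
  qed
  then show "?Z \<and> ?R" using cocycle_high_zero[OF c m] cocycle_out[OF c] by blast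
next
  assume zr: "?Z \<and> ?R"
  show "cocycle m s c"
    unfolding cocycle_def
  proof (intro conjI allI impI)
    fix j assume "CHAR('k) - 1 \<le> j" then show "c j = 0" using zr by blast
  next
    fix i j assume ij: "1 \<le> i" "i < j" "j \<le> CHAR('k) - 2"
    have jl: "j < CHAR('k)" "i < CHAR('k)" using ij char5 by auto
    show "transfer m s i j * c j - transfer m s j i * c i = of_int (int j - int i) * c (i + j)"
    proof (cases "i + j \<le> m")
      case True
      then show ?thesis using zr ij jl m by (simp add: transfer_weight add.commute low_relations_def)
    next
      case False
      have "transfer m s i j * c j = 0" if "\<not> i + j \<le> m" "j < CHAR('k)" for i j
        using zr that m by (cases "j \<le> m") (simp_all add: transfer_weight)
      from this[of i j] this[of j i] False jl have "transfer m s i j * c j = 0" "transfer m s j i * c i = 0" by simp_all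
      moreover have "c (i + j) = 0" using zr False by auto
      ultimately show ?thesis by (simp only: diff_self mult_zero_right)
    qed
  qed
qed

text \<open>The determinant of \<open>(c\<^sub>1, c\<^sub>2)\<close> and the first two coordinates of the inner solution, which are
  \<open>weight m s 1 0\<close> and \<open>weight m s 2 0\<close> if \<open>m \<ge> 2\<close>.\<close>

definition wedge :: "nat \<Rightarrow> 'k \<Rightarrow> (nat \<Rightarrow> 'k) \<Rightarrow> 'k" where
  "wedge m s c = weight m s 2 0 * c 1 - weight m s 1 0 * c 2"

lemma wedge_zero_iff:
  assumes nz: "weight m s 1 0 \<noteq> 0 \<or> weight m s 2 0 \<noteq> 0"
  shows "wedge m s c = 0 \<longleftrightarrow> (\<exists>t. c 1 = t * weight m s 1 0 \<and> c 2 = t * weight m s 2 0)"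
proof
  assume w: "wedge m s c = 0"
  show "\<exists>t. c 1 = t * weight m s 1 0 \<and> c 2 = t * weight m s 2 0"
  proof (cases "weight m s 1 0 = 0")
    case True
    then show ?thesis using nz w by (intro exI[of _ "c 2 / weight m s 2 0"]) (simp add: wedge_def)
  next
    case False
    then show ?thesis using w by (intro exI[of _ "c 1 / weight m s 1 0"]) (simp add: wedge_def field_simps)
  qed
qed (auto simp: wedge_def)

lemma ex_wedge:
  assumes nz: "weight m s 1 0 \<noteq> 0 \<or> weight m s 2 0 \<noteq> 0"
  obtains a b where "weight m s 2 0 * a - weight m s 1 0 * b \<noteq> 0"
proof (cases "weight m s 1 0 = 0")
  case True
  then show ?thesis using nz by (intro that[of 1 0]) simp
next
  case False
  then show ?thesis by (intro that[of 0 1]) simp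
qed

lemma weight_nz:
  assumes m: "m < CHAR('k)" and not: "\<not> (m = CHAR('k) - 1 \<and> s = 0)"
  shows "weight m s 1 0 \<noteq> (0 :: 'k) \<or> weight m s 2 0 \<noteq> 0"
proof (rule ccontr)
  assume "\<not> ?thesis"
  then have 1: "2 * s = 1 + of_nat m" and 2: "3 * s = 1 + of_nat m" by (simp_all add: weight_def algebra_simps)
  have "s = 3 * s - 2 * s" by simp
  also have "\<dots> = 0" by (simp only: 1 2 diff_self)
  finally have s: "s = 0" .
  then have "of_nat (Suc m) = (0 :: 'k)" using 1 by simp
  then have "Suc m \<ge> CHAR('k)" using of_nat_neq_0[of "Suc m"] by (meson linorder_not_less zero_less_Suc)
  then show False using m not s by simp
qed

definition defect5 :: "nat \<Rightarrow> 'k \<Rightarrow> 'k" where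
  "defect5 m s = of_nat m ^ 2 - 4 * of_nat m * s - of_nat m + 4 * s ^ 2 - 4 * s"

lemma wedge_eq: "wedge m s c = (3 * s - of_nat m - 1) * c 1 - (2 * s - of_nat m - 1) * c 2"
  by (simp add: wedge_def weight_def algebra_simps)

context
  fixes N m :: nat and s :: 'k and c
  assumes R: "low_relations N m s c"
begin

lemma relations_to_five:
  assumes N: "5 \<le> N"
  shows "(1 - of_nat m + 2 * s) * c 2 - (3 * s - of_nat m) * c 1 = c 3"
    and "(2 - of_nat m + 2 * s) * c 3 - (4 * s - of_nat m) * c 1 = 2 * c 4"
    and "(3 - of_nat m + 2 * s) * c 4 - (5 * s - of_nat m) * c 1 = 3 * c 5"
    and "(2 - of_nat m + 3 * s) * c 3 - (1 - of_nat m + 4 * s) * c 2 = c 5"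
  using low_relation[OF R, of 1 2 3] low_relation[OF R, of 1 3 4] low_relation[OF R, of 1 4 5] low_relation[OF R, of 2 3 5] N
  by (simp_all add: algebra_simps)

lemma degree_five:
  assumes N: "5 \<le> N"
  shows "defect5 m s * wedge m s c = 0"
  using degree_five_identity[OF relations_to_five[OF N]] small_neq_0(1)
  unfolding defect5_def wedge_eq by (simp only: mult_eq_0_iff) simp

lemma degree_seven:
  assumes N: "7 \<le> N"
  shows "s * (of_nat m - s + 1) * wedge m s c = 0"
proof -
  have N5: "5 \<le> N" using N by simp
  have 25: "(4 - of_nat m + 3 * s) * c 5 - (1 - of_nat m + 6 * s) * c 2 = 3 * c 7"
    and 34: "(3 - of_nat m + 4 * s) * c 4 - (2 - of_nat m + 5 * s) * c 3 = c 7"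
    using low_relation[OF R, of 2 5 7] low_relation[OF R, of 3 4 7] N by (simp_all add: algebra_simps)
  show ?thesis
    using degree_seven_identity[OF relations_to_five(1,2,4)[OF N5] 25 34 degree_five[OF N5, unfolded defect5_def wedge_eq]]
      small_neq_0(1)
    unfolding wedge_eq by (simp only: mult_eq_0_iff) simp
qed

end

text \<open>If \<open>wedge\<close> did not vanish, degree five and degree seven would give two equations for \<open>m\<close> and \<open>s\<close>,
  whose only common solutions have \<open>m = 0\<close> or \<open>m = 1\<close>.\<close>

lemma wedge_zero_of_large:
  fixes s :: 'k
  assumes R: "low_relations N m s c" and N: "7 \<le> N"
    and m: "2 \<le> m" "m < CHAR('k)"
  shows "wedge m s c = 0"
proof (rule ccontr)
  assume "wedge m s c \<noteq> 0"
  then have 5: "defect5 m s = 0" and 7: "s * (of_nat m - s + 1) = 0"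
    using degree_five[OF R] degree_seven[OF R] N by auto
  have "of_nat m * (of_nat m - 1) = (0 :: 'k)"
  proof (cases "s = 0")
    case True
    then show ?thesis using 5 by (simp add: defect5_def power2_eq_square algebra_simps)
  next
    case False
    then have "of_nat m - s + 1 = 0" using 7 by (simp only: mult_eq_0_iff) simp
    then have M: "of_nat m = s - 1" by (simp add: algebra_simps)
    have "defect5 m s = (s - 1) * (s - 1 - 1)" unfolding defect5_def M by (simp add: power2_eq_square algebra_simps)
    then show ?thesis using 5 M by simp
  qed
  moreover have "of_nat m \<noteq> (0 :: 'k)" using m by (intro of_nat_neq_0) auto
  moreover have "of_nat m \<noteq> (of_nat 1 :: 'k)" using m char5 of_nat_eq_iff_less[of m 1] by auto
  ultimately show False by simp
qed

end

context witt_setup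
begin

lemma cocycle_zero_iff:
  "cocycle 0 s c \<longleftrightarrow> (\<forall>n\<ge>CHAR('k) - 1. c n = (0 :: 'k)) \<and> low_relations CHAR('k) 0 s c"
proof
  assume c: "cocycle 0 s c"
  have "low_relations CHAR('k) 0 s c"
    unfolding low_relations_def
  proof (intro allI impI)
    fix i j assume ij: "1 \<le> i" "i < j" "i + j \<le> CHAR('k)"
    then have "transfer 0 s i j = weight 0 s i j" "transfer 0 s j i = weight 0 s j i"
      using char5 by (simp_all add: transfer_weight)
    then show "weight 0 s i j * c j - weight 0 s j i * c i = of_int (int j - int i) * c (i + j)"
      using cocycle_relation[OF c, of i j] ij by simp
  qed
  then show "(\<forall>n\<ge>CHAR('k) - 1. c n = 0) \<and> low_relations CHAR('k) 0 s c" using cocycle_out[OF c] by blast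
next
  assume zr: "(\<forall>n\<ge>CHAR('k) - 1. c n = 0) \<and> low_relations CHAR('k) 0 s c"
  show "cocycle 0 s c"
    unfolding cocycle_def
  proof (intro conjI allI impI)
    fix j assume "CHAR('k) - 1 \<le> j" then show "c j = 0" using zr by blast
  next
    fix i j assume ij: "1 \<le> i" "i < j" "j \<le> CHAR('k) - 2"
    then have t: "transfer 0 s i j = (if i + j \<le> CHAR('k) then weight 0 s i j else 0)"
      "transfer 0 s j i = (if i + j \<le> CHAR('k) then weight 0 s j i else 0)"
      using char5 by (simp_all add: transfer_weight add.commute)
    show "transfer 0 s i j * c j - transfer 0 s j i * c i = of_int (int j - int i) * c (i + j)"
    proof (cases "i + j \<le> CHAR('k)")
      case True
      then show ?thesis using zr ij unfolding t low_relations_def by (simp only: if_True)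
    next
      case False
      then have "c (i + j) = 0" using zr by simp
      then show ?thesis using False by (simp add: t)
    qed
  qed
qed

lemma truncate:
  assumes "f (CHAR('k) - 1) = 0" "f CHAR('k) = 0" "n \<le> CHAR('k)"
  shows "(if n \<le> CHAR('k) - 2 then f n else 0) = (f n :: 'k)"
proof -
  have "n \<le> CHAR('k) - 2 \<or> n = CHAR('k) - 1 \<or> n = CHAR('k)" using assms(3) by linarith
  then show ?thesis using assms(1,2) by auto
qed

lemma of_nat_pred: "of_nat (CHAR('k) - 1) = (- 1 :: 'k)" "of_nat (CHAR('k) - 2) = (- 2 :: 'k)"
  using of_nat_char_minus[of 1] of_nat_char_minus[of 2] char5 by simp_all

lemma pred_nz: "\<lbrakk>2 \<le> j; j < CHAR('k)\<rbrakk> \<Longrightarrow> of_nat j - 1 \<noteq> (0 :: 'k)"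
  using of_nat_eq_iff_less[of j 1] char5 by simp

text \<open>The recursion gives \<open>c\<^sub>n = (n - 1) c\<^sub>2\<close>, and the factor is \<open>-2\<close> at \<open>n = p - 1\<close>.\<close>

lemma linear_recursion_zero:
  assumes rel: "\<And>j. \<lbrakk>2 \<le> j; j \<le> CHAR('k) - 2\<rbrakk> \<Longrightarrow> of_nat j * c j = (of_nat j - 1) * c (Suc j)"
    and end0: "c (CHAR('k) - 1) = (0 :: 'k)"
  shows "c 2 = 0"
proof -
  have "2 \<le> n \<Longrightarrow> n \<le> CHAR('k) - 1 \<Longrightarrow> c n = (of_nat n - 1) * c 2" for n
  proof (induction n rule: nat_induct_at_least)
    case base
    show ?case by simp
  next
    case (Suc n)
    then have IH: "c n = (of_nat n - 1) * c 2" and "n \<le> CHAR('k) - 2" by simp_all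
    have "(of_nat n - 1) * c (Suc n) = (of_nat n - 1) * (of_nat n * c 2)"
      using rel[of n] Suc.hyps Suc.prems IH \<open>n \<le> CHAR('k) - 2\<close> by (auto simp: mult_ac)
    moreover have "of_nat n - 1 \<noteq> (0 :: 'k)" using Suc.hyps Suc.prems by (intro pred_nz) auto
    ultimately show ?case by simp
  qed
  from this[of "CHAR('k) - 1"] show ?thesis using end0 char5 small_neq_0 by (simp add: of_nat_pred)
qed

text \<open>The solution with \<open>(c\<^sub>1, c\<^sub>2) = 4 (a, b)\<close>; the factor four avoids denominators. The equations for
  the pairs \<open>(1,2)\<close>, \<open>(1,3)\<close>, \<open>(2,3)\<close>, \<open>(2,4)\<close> serve as definitions, \<open>(1,5)\<close> then holds identically, and
  \<open>(1,4)\<close> is the condition of degree five.\<close>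

definition low_sol :: "nat \<Rightarrow> 'k \<Rightarrow> 'k \<Rightarrow> 'k \<Rightarrow> nat \<Rightarrow> 'k" where
  "low_sol m s a b =
    (let c\<^sub>3 = weight m s 1 2 * b - weight m s 2 1 * a; c\<^sub>4 = weight m s 1 3 * c\<^sub>3 - weight m s 3 1 * a
     in (\<lambda>_. 0)(1 := 4 * a, 2 := 4 * b, 3 := 4 * c\<^sub>3, 4 := 2 * c\<^sub>4,
       5 := 4 * (weight m s 2 3 * c\<^sub>3 - weight m s 3 2 * b), 6 := weight m s 2 4 * c\<^sub>4 - 2 * weight m s 4 2 * b))"

lemma low_sol_relations:
  assumes m: "m \<le> 6" and 5: "5 \<le> m \<Longrightarrow> defect5 m s = 0"
  shows "low_relations m m s (\<lambda>n. if n \<le> m then low_sol m s a b n else 0)"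
  unfolding low_relations_def
proof (intro allI impI)
  fix i j assume ij: "1 \<le> i" "i < j" "i + j \<le> m"
  have s14: "weight m s 1 4 * low_sol m s a b 4 - weight m s 4 1 * low_sol m s a b 1 - 3 * low_sol m s a b 5
      = - 2 * (defect5 m s * (weight m s 2 0 * a - weight m s 1 0 * b))"
    unfolding low_sol_def Let_def weight_def defect5_def by (simp add: algebra_simps power2_eq_square)
  have s15: "weight m s 1 5 * low_sol m s a b 5 - weight m s 5 1 * low_sol m s a b 1 - 4 * low_sol m s a b 6 = 0"
    unfolding low_sol_def Let_def weight_def by (simp add: algebra_simps)
  have "i = 1 \<and> j = 2 \<or> i = 1 \<and> j = 3 \<or> i = 2 \<and> j = 3 \<or> i = 2 \<and> j = 4 \<or> i = 1 \<and> j = 4 \<or> i = 1 \<and> j = 5"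
    using ij m by presburger
  then show "weight m s i j * (if j \<le> m then low_sol m s a b j else 0) - weight m s j i * (if i \<le> m then low_sol m s a b i else 0)
      = of_int (int j - int i) * (if i + j \<le> m then low_sol m s a b (i + j) else 0)"
  proof (elim disjE conjE)
    assume *: "i = 1" "j = 4"
    then have "defect5 m s = 0" using 5 ij by simp
    then show ?thesis using s14 ij(3) * by (simp add: algebra_simps)
  next
    assume *: "i = 1" "j = 5"
    then show ?thesis using s15 ij(3) by (simp add: algebra_simps)
  qed (use ij(3) in \<open>simp_all add: low_sol_def Let_def algebra_simps\<close>)
qed

end

context verma_pair
begin

abbreviation "ext_zero \<equiv> carrier (Ext1 A VM.V VL.V) = {\<zero>\<^bsub>Ext1 A VM.V VL.V\<^esub>}"
abbreviation "ext_one \<equiv> linear_iso (Ext1 A VM.V VL.V) base_field"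

lemma inner_coef_eq: "inner_coef j = (if j \<le> m then weight m s j 0 else 0)"
  using m_less by (simp add: inner_coef_def transfer_weight)

subsection \<open>Weight difference at least two\<close>

lemma ext_zero_of_wedge:
  assumes m: "2 \<le> m" and not: "\<not> (m = CHAR('k) - 1 \<and> s = 0)"
    and w: "\<And>c. cocycle m s c \<Longrightarrow> wedge m s c = 0"
  shows ext_zero
proof (rule Ext1_verma_trivial)
  fix c assume "cocycle m s c"
  then show "\<exists>t. c 1 = t * inner_coef 1 \<and> c 2 = t * inner_coef 2"
    using w wedge_zero_iff[OF weight_nz[OF m_less not]] m by (simp add: inner_coef_eq)
qed

lemma ext_one_of_wedge:
  assumes m: "2 \<le> m" and not: "\<not> (m = CHAR('k) - 1 \<and> s = 0)"
    and c: "cocycle m s c" and w: "wedge m s c \<noteq> 0"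
  shows ext_one
proof (rule Ext1_verma_one_dimensional[OF c, where \<alpha> = "weight m s 2 0" and \<beta> = "- weight m s 1 0"])
  show "\<exists>x<CHAR('k) - 1. of_nat x + 2 * s = 0" if "m = 0" using m that by simp
  show "weight m s 2 0 * inner_coef 1 + - weight m s 1 0 * inner_coef 2 = 0" using m by (simp add: inner_coef_eq)
  show "weight m s 2 0 * c 1 + - weight m s 1 0 * c 2 \<noteq> 0" using w by (simp add: wedge_def)
next
  fix c :: "nat \<Rightarrow> 'k" assume "weight m s 2 0 * c 1 + - weight m s 1 0 * c 2 = 0"
  then have "wedge m s c = 0" by (simp add: wedge_def)
  then show "\<exists>t. c 1 = t * inner_coef 1 \<and> c 2 = t * inner_coef 2"
    using wedge_zero_iff[OF weight_nz[OF m_less not]] m by (simp add: inner_coef_eq)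
qed

lemma ext_one_low_sol:
  assumes m: "2 \<le> m" "m \<le> 6" and not: "\<not> (m = CHAR('k) - 1 \<and> s = 0)"
    and 5: "5 \<le> m \<Longrightarrow> defect5 m s = 0" and end0: "\<And>a b. m = CHAR('k) - 1 \<Longrightarrow> low_sol m s a b m = 0"
  shows ext_one
proof -
  obtain a b where ab: "weight m s 2 0 * a - weight m s 1 0 * b \<noteq> 0"
    using ex_wedge[OF weight_nz[OF m_less not]] by blast
  let ?c = "\<lambda>n. if n \<le> m then low_sol m s a b n else 0"
  have "?c n = 0" if "m < n \<or> CHAR('k) - 1 \<le> n" for n
  proof (cases "m < n")
    case False
    then have "n = m" "m = CHAR('k) - 1" using that m_less by auto
    then show ?thesis using end0 by simp
  qed simp
  then have "cocycle m s ?c"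
    unfolding cocycle_iff_low[OF m(1) m_less] using low_sol_relations[OF m(2) 5] by blast
  moreover have "wedge m s ?c = 4 * (weight m s 2 0 * a - weight m s 1 0 * b)"
    using m(1) by (simp add: wedge_def low_sol_def Let_def algebra_simps)
  then have "wedge m s ?c \<noteq> 0" using ab small_neq_0(3) by (simp only: mult_eq_0_iff simp_thms)
  ultimately show ?thesis by (rule ext_one_of_wedge[OF m(1) not])
qed

lemma low_relations_of_cocycle:
  assumes c: "cocycle m s c" and m: "2 \<le> m"
  shows "low_relations m m s c"
  using c unfolding cocycle_iff_low[OF m m_less] by blast

lemma ext_zero_defect5:
  assumes m: "5 \<le> m" and not: "\<not> (m = CHAR('k) - 1 \<and> s = 0)" and 5: "defect5 m s \<noteq> 0"
  shows ext_zero
proof (rule ext_zero_of_wedge[OF _ not])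
  show m2: "2 \<le> m" using m by simp
  fix c assume c: "cocycle m s c"
  show "wedge m s c = 0" using degree_five[OF low_relations_of_cocycle[OF c m2] m] 5 by simp
qed

lemma ext_zero_large:
  assumes m: "7 \<le> m" and not: "\<not> (m = CHAR('k) - 1 \<and> s = 0)"
  shows ext_zero
proof (rule ext_zero_of_wedge[OF _ not])
  show m2: "2 \<le> m" using m by simp
  fix c assume c: "cocycle m s c"
  show "wedge m s c = 0" by (rule wedge_zero_of_large[OF low_relations_of_cocycle[OF c m2] m m2 m_less])
qed

text \<open>This is the only case with \<open>m \<ge> 2\<close> in which all inner solutions vanish. The equations
  \<open>j c\<^sub>j - i c\<^sub>i = (j - i) c\<^sub>i\<^sub>+\<^sub>j\<close> are solved by affine functions of \<open>j\<close>, and \<open>c\<^sub>p\<^sub>-\<^sub>1 = 0\<close> leaves the multiples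
  of \<open>j + 1\<close>.\<close>

lemma ext_one_top:
  assumes m: "m = CHAR('k) - 1" and s: "s = 0"
  shows ext_one
proof -
  have m2: "2 \<le> m" using m char5 by simp
  have M: "of_nat m = (- 1 :: 'k)" by (simp only: m of_nat_pred)
  have w: "weight m s i j = of_nat j" for i j by (simp add: weight_def M s)
  have inner0: "inner_coef j = 0" for j by (simp add: inner_coef_eq w)
  let ?c = "\<lambda>n. if n \<le> CHAR('k) - 2 then of_nat n + 1 else 0 :: 'k"
  have c: "?c n = of_nat n + 1" if "n \<le> m" for n
  proof -
    have "n \<le> CHAR('k) - 2 \<or> n = m" using that m by linarith
    then show ?thesis using M by auto
  qed
  have "cocycle m s ?c"
    unfolding cocycle_iff_low[OF m2 m_less]
  proof
    show "\<forall>n. m < n \<or> CHAR('k) - 1 \<le> n \<longrightarrow> ?c n = 0" using m char5 by auto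
    show "low_relations m m s ?c"
      unfolding low_relations_def
    proof (intro allI impI)
      fix i j assume ij: "1 \<le> i" "i < j" "i + j \<le> m"
      have le: "i \<le> m" "j \<le> m" using ij by auto
      show "weight m s i j * ?c j - weight m s j i * ?c i = of_int (int j - int i) * ?c (i + j)"
        unfolding c[OF le(1)] c[OF le(2)] c[OF ij(3)] w by (simp add: algebra_simps)
    qed
  qed
  then show ?thesis
  proof (rule Ext1_verma_one_dimensional[where \<alpha> = 1 and \<beta> = 0])
    show "\<exists>x<CHAR('k) - 1. of_nat x + 2 * s = 0" if "m = 0" using m2 that by simp
    show "1 * inner_coef 1 + 0 * inner_coef 2 = 0" by (simp add: inner0)
    show "1 * ?c 1 + 0 * ?c 2 \<noteq> 0" using char5 small_neq_0 by simp
  next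
    fix c assume c: "cocycle m s c" and "1 * c 1 + 0 * c 2 = 0"
    then have c1: "c 1 = 0" by simp
    have "c 2 = 0"
    proof (rule linear_recursion_zero)
      show "c (CHAR('k) - 1) = 0" by (rule cocycle_out[OF c]) simp
      fix j assume j: "2 \<le> j" "j \<le> CHAR('k) - 2"
      then show "of_nat j * c j = (of_nat j - 1) * c (Suc j)"
        using low_relation[OF low_relations_of_cocycle[OF c m2], of 1 j "Suc j"] c1 m by (simp add: M s)
    qed
    then show "\<exists>t. c 1 = t * inner_coef 1 \<and> c 2 = t * inner_coef 2" using c1 by (simp add: inner0)
  qed
qed

text \<open>For \<open>p = 5\<close> and \<open>m = 4\<close> the truncation \<open>c\<^sub>4 = 0\<close> is an additional equation; modulo the inner solution
  it reads \<open>1 - s\<^sup>2 = 0\<close>.\<close>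

lemma five_cases:
  assumes p: "CHAR('k) = 5" and m: "m = 4" and s0: "s \<noteq> 0"
  shows "s = 1 \<or> s = - 1 \<Longrightarrow> ext_one" and "\<lbrakk>s \<noteq> 1; s \<noteq> - 1\<rbrakk> \<Longrightarrow> ext_zero"
proof -
  have five: "(5 :: 'k) = 0" using of_nat_CHAR[where 'a = 'k] p by simp
  have mult5: "numeral n * (5 :: 'k) = 0" for n by (simp only: five mult_zero_right)
  have not: "\<not> (m = CHAR('k) - 1 \<and> s = 0)" using s0 by simp
  show ext_one if "s = 1 \<or> s = - 1"
  proof (rule ext_one_low_sol[OF _ _ not])
    fix a b
    have "low_sol m s a b m = 2 * (weight m s 1 3 * (weight m s 1 2 * b - weight m s 2 1 * a) - weight m s 3 1 * a)"
      by (simp add: low_sol_def Let_def m)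
    moreover have "weight m s 1 3 * (weight m s 1 2 * b - weight m s 2 1 * a) - weight m s 3 1 * a = 0"
      using that
    proof
      assume s: "s = 1"
      have "weight m s 1 3 = 0" "weight m s 3 1 = 0" by (simp_all add: weight_def m s)
      then show ?thesis by simp
    next
      assume s: "s = - 1"
      have "weight m s 1 2 = - 5" "weight m s 1 3 = - 4" "weight m s 2 1 = - 7" "weight m s 3 1 = - 8"
        by (simp_all add: weight_def m s)
      then have "weight m s 1 3 * (weight m s 1 2 * b - weight m s 2 1 * a) - weight m s 3 1 * a = 5 * (4 * b - 4 * a)"
        by (simp add: algebra_simps)
      then show ?thesis by (simp only: five mult_zero_left)
    qed
    ultimately show "low_sol m s a b m = 0" by simp
  qed (use m in simp_all)
  show ext_zero if s: "s \<noteq> 1" "s \<noteq> - 1"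
  proof (rule ext_zero_of_wedge[OF _ not])
    show m2: "2 \<le> m" using m by simp
    fix c assume c: "cocycle m s c"
    note R = low_relations_of_cocycle[OF c m2]
    have 12: "c 3 = (2 * s - 3) * c 2 - (3 * s - 4) * c 1" and 13: "(2 * s - 2) * c 3 - (4 * s - 4) * c 1 = 2 * c 4"
      using low_relation[OF R, of 1 2 3] low_relation[OF R, of 1 3 4] m by (simp_all add: algebra_simps)
    have c4: "c 4 = 0" using cocycle_out[OF c, of 4] p by simp
    have "(1 - s) * (1 + s) * (c 1 + c 2) = (2 * s - 2) * c 3 - (4 * s - 4) * c 1
        - 5 * ((s\<^sup>2 - 2 * s + 1) * c 2 - (s\<^sup>2 - 2 * s + 1) * c 1)"
      unfolding 12 by (simp add: algebra_simps power2_eq_square) 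
    moreover have "(2 * s - 2) * c 3 - (4 * s - 4) * c 1 = 0" by (simp only: 13 c4 mult_zero_right)
    ultimately have "(1 - s) * (1 + s) * (c 1 + c 2) = 0" by (simp only: five mult_zero_left diff_self)
    moreover have "1 - s \<noteq> 0" "1 + s \<noteq> 0" using s by (auto simp: eq_neg_iff_add_eq_0 add.commute)
    ultimately have "c 1 + c 2 = 0" by simp
    then have c2: "c 2 = - c 1" by (simp add: eq_neg_iff_add_eq_0 add.commute)
    have "wedge m s c = 5 * ((s - 2) * c 1)" unfolding wedge_def c2 by (simp add: weight_def m algebra_simps)
    then show "wedge m s c = 0" by (simp only: five mult_zero_left)
  qed
qed

end

context verma_pair
begin

subsection \<open>Weight difference one\<close>

lemma ext_zero_difference_one:
  assumes m: "m = 1" and s: "s \<noteq> 1" and c2: "\<And>c. cocycle m s c \<Longrightarrow> c 2 = 0"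
  shows ext_zero
proof (rule Ext1_verma_trivial)
  fix c assume c: "cocycle m s c"
  have "inner_coef 1 = 2 * (s - 1)" "inner_coef 2 = 0"
    unfolding inner_coef_eq by (simp_all add: m weight_def algebra_simps)
  moreover have "2 * (s - 1) \<noteq> 0" using s small_neq_0 by simp
  ultimately show "\<exists>t. c 1 = t * inner_coef 1 \<and> c 2 = t * inner_coef 2"
    using c2[OF c] by (intro exI[of _ "c 1 / (2 * (s - 1))"]) simp
qed

lemma ext_one_difference_one:
  assumes m: "m = 1" and s: "s \<noteq> 1" and c: "cocycle m s c" "c 2 \<noteq> 0"
  shows ext_one
proof -
  have inner: "inner_coef 1 = 2 * (s - 1)" "inner_coef 2 = 0"
    unfolding inner_coef_eq by (simp_all add: m weight_def algebra_simps)
  moreover have "2 * (s - 1) \<noteq> 0" using s small_neq_0 by simp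
  moreover have "\<exists>x<CHAR('k) - 1. of_nat x + 2 * s = 0" if "m = 0" using m that by simp
  ultimately show ?thesis
  proof (intro Ext1_verma_one_dimensional[OF c(1), where \<alpha> = 0 and \<beta> = 1])
    fix d :: "nat \<Rightarrow> 'k" assume "0 * d 1 + 1 * d 2 = 0"
    then show "\<exists>t. d 1 = t * inner_coef 1 \<and> d 2 = t * inner_coef 2"
      using inner \<open>2 * (s - 1) \<noteq> 0\<close> by (intro exI[of _ "d 1 / (2 * (s - 1))"]) simp
  qed (use c(2) in simp_all)
qed

lemma difference_one_relation:
  assumes c: "cocycle m s c" and m: "m = 1" and j: "2 \<le> j" "j \<le> CHAR('k) - 2"
  shows "(of_nat j - 2 + 2 * s) * c j = (of_nat j - 1) * c (Suc j)"
proof -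
  have "transfer m s 1 j = weight m s 1 j" "transfer m s j 1 = 0"
    using j char5 m by (simp_all add: transfer_weight)
  then show ?thesis using cocycle_relation[OF c, of 1 j] j by (simp add: weight_def m)
qed

text \<open>For \<open>p \<ge> 7\<close> eliminating \<open>c\<^sub>3\<close>, \<open>c\<^sub>4\<close>, \<open>c\<^sub>5\<close> gives \<open>s (s - 1) (s - 2) c\<^sub>2 = 0\<close>; for \<open>p = 5\<close> the same
  follows from \<open>c\<^sub>4 = 0\<close>.\<close>

lemma difference_one_generic:
  assumes m: "m = 1" and s: "s \<noteq> 0" "s \<noteq> 1" "s \<noteq> 2"
  shows ext_zero
proof (rule ext_zero_difference_one[OF m s(2)])
  fix c assume c: "cocycle m s c"
  have r2: "2 * s * c 2 = c 3" and r3: "(1 + 2 * s) * c 3 = 2 * c 4"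
    using difference_one_relation[OF c m, of 2] difference_one_relation[OF c m, of 3] char5 by (simp_all add: eval_nat_numeral)
  show "c 2 = 0"
  proof (cases "CHAR('k) = 5")
    case True
    have five: "(5 :: 'k) = 0" using of_nat_CHAR[where 'a = 'k] True by simp
    have "c 4 = 0" using cocycle_out[OF c, of 4] True by simp
    then have "(1 + 2 * s) * (2 * s * c 2) = 0" using r2 r3 by simp
    moreover have "1 + 2 * s = 2 * (s - 2) + 5" by simp
    then have "1 + 2 * s = 2 * (s - 2)" by (simp only: five add_0_right)
    then have "1 + 2 * s \<noteq> 0" using s small_neq_0(1) by (simp only: mult_eq_0_iff) simp
    ultimately show ?thesis using s small_neq_0(1) by (simp only: mult_eq_0_iff simp_thms)
  next
    case False
    have p: "7 \<le> CHAR('k)"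
    proof -
      have "CHAR('k) \<noteq> 6" using prime_p by auto
      then show ?thesis using False char5 by simp
    qed
    have r4: "(2 + 2 * s) * c 4 = 3 * c 5"
      using difference_one_relation[OF c m, of 4] p by (simp add: eval_nat_numeral)
    have "transfer m s 2 3 = weight m s 2 3" "transfer m s 3 2 = weight m s 3 2"
      using p m by (simp_all add: transfer_weight)
    then have r23: "(1 + 3 * s) * c 3 - 4 * s * c 2 = c 5"
      using cocycle_relation[OF c, of 2 3] by (simp add: weight_def m eval_nat_numeral)
    have "8 * (s * (s - 1) * (s - 2) * c 2) = (2 + 2 * s) * ((1 + 2 * s) * (2 * s * c 2)) - 6 * ((1 + 3 * s) * (2 * s * c 2) - 4 * s * c 2)"
      by (simp add: algebra_simps)
    also have "\<dots> = 2 * ((2 + 2 * s) * c 4) - 6 * c 5"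
      unfolding r2 r3 r23 by (simp add: algebra_simps)
    also have "\<dots> = 0" unfolding r4 by simp
    finally have "2 * (4 * (s * (s - 1) * (s - 2) * c 2)) = 0" by simp
    then show ?thesis using s small_neq_0 by (simp only: mult_eq_0_iff) simp
  qed
qed

text \<open>A single coefficient in degree \<open>q\<close> is a cocycle if \<open>e\<^sub>i\<close> kills the corresponding vector for all
  \<open>i \<noteq> q\<close> and \<open>q\<close> is not a sum of two different positive degrees.\<close>

lemma cocycle_delta:
  assumes q: "1 \<le> q" "q \<le> CHAR('k) - 2" and t: "\<And>i. 1 \<le> i \<Longrightarrow> i \<noteq> q \<Longrightarrow> transfer m s i q = 0"
    and q': "\<And>i j. \<lbrakk>1 \<le> i; i < j; i + j = q\<rbrakk> \<Longrightarrow> False"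
  shows "cocycle m s (\<lambda>n. if n = q then 1 else 0)"
  unfolding cocycle_def
proof (intro conjI allI impI)
  fix j assume "CHAR('k) - 1 \<le> j"
  then show "(if j = q then 1 else 0) = (0 :: 'k)" using q char5 by auto
next
  fix i j assume ij: "1 \<le> i" "i < j" "j \<le> CHAR('k) - 2"
  have "transfer m s i j * (if j = q then 1 else 0) = 0" "transfer m s j i * (if i = q then 1 else 0) = 0"
    using t[of i] t[of j] ij by auto
  moreover have "i + j \<noteq> q" using q'[OF ij(1,2)] by blast
  ultimately show "transfer m s i j * (if j = q then 1 else 0) - transfer m s j i * (if i = q then 1 else 0)
      = of_int (int j - int i) * (if i + j = q then 1 else 0)"
    by (simp only: if_False mult_zero_right diff_self)
qed

lemma difference_one_zero:
  assumes m: "m = 1" and s: "s = 0"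
  shows ext_one
proof (rule ext_one_difference_one[OF m])
  show "cocycle m s (\<lambda>n. if n = 2 then 1 else 0)"
    using char5 by (intro cocycle_delta) (auto simp: transfer_weight m s weight_def)
qed (simp_all add: s)

text \<open>The solution is \<open>c\<^sub>j = j (j\<^sup>2 - 1)\<close>, which vanishes in the degrees \<open>p - 1\<close>, \<open>p\<close> and \<open>p + 1\<close>, so that
  the truncation does not disturb it.\<close>

lemma difference_one_two:
  assumes m: "m = 1" and s: "s = 2"
  shows ext_one
proof (rule ext_one_difference_one[OF m, where c = "\<lambda>n. if n \<le> CHAR('k) - 2 then of_nat n * (of_nat n ^ 2 - 1) else 0"])
  let ?f = "\<lambda>n. of_nat n * (of_nat n ^ 2 - 1) :: 'k"
  let ?c = "\<lambda>n. if n \<le> CHAR('k) - 2 then ?f n else 0"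
  have c: "?c n = ?f n" if n: "n \<le> CHAR('k) + 1" for n
  proof (cases "n = CHAR('k) + 1")
    case False
    then show ?thesis using n of_nat_pred by (intro truncate) auto
  qed simp
  have "(2 :: 'k) * 3 \<noteq> 0" using small_neq_0 by (simp only: mult_eq_0_iff simp_thms)
  moreover have "2 \<le> CHAR('k) - 2" using char5 by simp
  ultimately show "?c 2 \<noteq> 0" by simp
  show "cocycle m s ?c"
    unfolding cocycle_def
  proof (intro conjI allI impI)
    fix j assume "CHAR('k) - 1 \<le> j"
    then show "?c j = 0" using char5 by auto
  next
    fix i j assume ij: "1 \<le> i" "i < j" "j \<le> CHAR('k) - 2"
    have t: "transfer m s i j = (if i + j \<le> CHAR('k) + 1 then of_nat j + 2 * of_nat i else 0)"
      "transfer m s j i * ?f i = (if i + j \<le> CHAR('k) + 1 then of_nat i + 2 * of_nat j else 0) * ?f i"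
      using ij char5 by (auto simp: transfer_weight m s weight_def algebra_simps)
    have le: "i \<le> CHAR('k) + 1" "j \<le> CHAR('k) + 1" using ij by auto
    show "transfer m s i j * ?c j - transfer m s j i * ?c i = of_int (int j - int i) * ?c (i + j)"
    proof (cases "i + j \<le> CHAR('k) + 1")
      case True
      show ?thesis
        unfolding c[OF le(1)] c[OF le(2)] c[OF True] t using True
        by (simp add: algebra_simps power2_eq_square power3_eq_cube)
    next
      case False
      moreover have "\<not> i + j \<le> CHAR('k) - 2" using False by simp
      ultimately show ?thesis unfolding c[OF le(1)] c[OF le(2)] t by simp
    qed
  qed
  show "s \<noteq> 1"
  proof
    assume "s = 1"
    then have "(1 :: 'k) + 1 = 1" by (simp only: s one_add_one)
    then show False by (metis add_cancel_right_right one_neq_zero)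
  qed
qed

lemma difference_one_one:
  assumes m: "m = 1" and s: "s = 1"
  shows ext_one
proof -
  have inner: "inner_coef 1 = 0" "inner_coef 2 = 0" unfolding inner_coef_eq by (simp_all add: m s weight_def)
  have c: "cocycle m s (\<lambda>n. if n = 1 then 1 else 0)"
    using char5 by (intro cocycle_delta) (auto simp: transfer_weight m s weight_def)
  show ?thesis
  proof (rule Ext1_verma_one_dimensional[OF c, where \<alpha> = 1 and \<beta> = 0])
    show "\<exists>x<CHAR('k) - 1. of_nat x + 2 * s = 0" if "m = 0" using m that by simp
  next
    fix d assume d: "cocycle m s d" "1 * d 1 + 0 * d 2 = 0"
    have "d 2 = 0"
    proof (rule linear_recursion_zero)
      show "d (CHAR('k) - 1) = 0" by (rule cocycle_out[OF d(1)]) simp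
      fix j assume "2 \<le> j" "j \<le> CHAR('k) - 2"
      then show "of_nat j * d j = (of_nat j - 1) * d (Suc j)"
        using difference_one_relation[OF d(1) m, of j] by (simp add: s)
    qed
    then show "\<exists>t. d 1 = t * inner_coef 1 \<and> d 2 = t * inner_coef 2" using d(2) by (simp add: inner)
  qed (use inner in simp_all)
qed

subsection \<open>Equal weights\<close>

lemma inner_zero_equal: "m = 0 \<Longrightarrow> 1 \<le> j \<Longrightarrow> inner_coef j = 0"
  unfolding inner_coef_eq by simp

lemma equal_relation:
  assumes c: "cocycle m s c" and m: "m = 0" and j: "2 \<le> j" "j \<le> CHAR('k) - 2"
  shows "(of_nat j - 1 + 2 * s) * c j - (of_nat j + 1) * s * c 1 = (of_nat j - 1) * c (Suc j)"
proof -
  have "low_relations CHAR('k) 0 s c" using c unfolding m cocycle_zero_iff by blast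
  from low_relation[OF this, of 1 j "Suc j"] show ?thesis using j by (simp add: algebra_simps)
qed

lemma ext_one_equal:
  assumes m: "m = 0" and r: "\<exists>x<CHAR('k) - 1. of_nat x + 2 * s = 0" and c: "cocycle m s c" "c 1 \<noteq> 0"
    and ker: "\<And>d. \<lbrakk>cocycle m s d; d 1 = 0\<rbrakk> \<Longrightarrow> d 2 = 0"
  shows ext_one
proof (rule Ext1_verma_one_dimensional[OF c(1) r, where \<alpha> = 1 and \<beta> = 0])
  fix d assume "cocycle m s d" "1 * d 1 + 0 * d 2 = 0"
  then show "\<exists>t. d 1 = t * inner_coef 1 \<and> d 2 = t * inner_coef 2" using ker[of d] by (intro exI[of _ 0]) simp
qed (use c(2) inner_zero_equal[OF m] in simp_all)

lemma equal_zero: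
  assumes m: "m = 0" and s: "s = 0"
  shows ext_one
proof (rule ext_one_equal[OF m])
  show "\<exists>x<CHAR('k) - 1. of_nat x + 2 * s = 0" using char5 by (intro exI[of _ 0]) (simp add: s)
  show "cocycle m s (\<lambda>n. if n = 1 then 1 else 0)"
    using char5 by (intro cocycle_delta) (auto simp: transfer_weight m s weight_def)
next
  fix d assume d: "cocycle m s d"
  have "2 \<le> n \<Longrightarrow> n \<le> CHAR('k) - 1 \<Longrightarrow> d n = d 2" for n
  proof (induction n rule: nat_induct_at_least)
    case (Suc n)
    then have "(of_nat n - 1) * d n = (of_nat n - 1) * d (Suc n)"
      using equal_relation[OF d m, of n] by (simp add: s)
    moreover have "of_nat n - 1 \<noteq> (0 :: 'k)" using Suc.hyps Suc.prems by (intro pred_nz) auto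
    ultimately show ?case using Suc by simp
  qed simp
  from this[of "CHAR('k) - 1"] show "d 2 = 0" using cocycle_out[OF d, of "CHAR('k) - 1"] char5 by simp
qed simp

text \<open>The solution is \<open>c\<^sub>j = j (j + 1)\<close>, which vanishes in the degrees \<open>p - 1\<close> and \<open>p\<close>. The extra condition for
  \<open>m = 0\<close> holds because \<open>x + 2 = 0\<close> for \<open>x = p - 2\<close>.\<close>

lemma equal_one:
  assumes m: "m = 0" and s: "s = 1"
  shows ext_one
proof (rule ext_one_equal[OF m])
  show "\<exists>x<CHAR('k) - 1. of_nat x + 2 * s = 0"
    using char5 by (intro exI[of _ "CHAR('k) - 2"]) (simp add: s of_nat_pred)
  let ?f = "\<lambda>n. of_nat n * (of_nat n + 1) :: 'k"
  let ?c = "\<lambda>n. if n \<le> CHAR('k) - 2 then ?f n else 0"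
  have c: "?c n = ?f n" if n: "n \<le> CHAR('k)" for n
    using n of_nat_pred by (intro truncate) auto
  show "?c 1 \<noteq> 0" using char5 small_neq_0 by simp
  show "cocycle m s ?c"
    unfolding m cocycle_zero_iff
  proof
    show "\<forall>n\<ge>CHAR('k) - 1. ?c n = 0" using char5 by auto
    show "low_relations CHAR('k) 0 s ?c"
      unfolding low_relations_def
    proof (intro allI impI)
      fix i j assume ij: "1 \<le> i" "i < j" "i + j \<le> CHAR('k)"
      have le: "i \<le> CHAR('k)" "j \<le> CHAR('k)" using ij by auto
      show "weight 0 s i j * ?c j - weight 0 s j i * ?c i = of_int (int j - int i) * ?c (i + j)"
        unfolding c[OF le(1)] c[OF le(2)] c[OF ij(3)] by (simp add: weight_def s algebra_simps)
    qed
  qed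
next
  fix d assume d: "cocycle m s d" "d 1 = 0"
  have "2 \<le> n \<Longrightarrow> n \<le> CHAR('k) - 1 \<Longrightarrow> 2 * d n = of_nat n * (of_nat n - 1) * d 2" for n
  proof (induction n rule: nat_induct_at_least)
    case (Suc n)
    then have IH: "2 * d n = of_nat n * (of_nat n - 1) * d 2" and n: "n \<le> CHAR('k) - 2" by simp_all
    have "(of_nat n + 1) * d n = (of_nat n - 1) * d (Suc n)"
      using equal_relation[OF d(1) m Suc.hyps(1) n] d(2) by (simp add: s algebra_simps)
    then have "(of_nat n - 1) * (2 * d (Suc n)) = (of_nat n + 1) * (2 * d n)"
      by (simp only: mult.left_commute[of _ 2])
    also have "\<dots> = (of_nat n - 1) * ((of_nat n + 1) * of_nat n * d 2)" unfolding IH by (simp only: mult_ac)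
    finally have "(of_nat n - 1) * (2 * d (Suc n)) = (of_nat n - 1) * ((of_nat n + 1) * of_nat n * d 2)" .
    moreover have "of_nat n - 1 \<noteq> (0 :: 'k)" using Suc.hyps Suc.prems by (intro pred_nz) auto
    ultimately have "2 * d (Suc n) = (of_nat n + 1) * of_nat n * d 2" by (simp only: mult_cancel_left simp_thms)
    then show ?case by (simp add: add.commute)
  qed simp
  from this[of "CHAR('k) - 1"] show "d 2 = 0"
    using cocycle_out[OF d(1), of "CHAR('k) - 1"] char5 small_neq_0 by (simp add: of_nat_pred)
qed

text \<open>For \<open>p \<ge> 7\<close> the condition of degree five forces \<open>c\<close> to be a multiple of the formal coboundary
  \<open>-1 + (j + 1) s\<close>, whose value at \<open>j = p - 1\<close> is \<open>-1\<close>; so the truncation kills it. For \<open>p = 5\<close> the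
  equations with \<open>c\<^sub>4 = c\<^sub>5 = 0\<close> have the determinant \<open>2 s (1 + 9 s)\<close>.\<close>

lemma equal_generic:
  assumes m: "m = 0" and s: "s \<noteq> 0" "s \<noteq> 1"
  shows ext_zero
proof (rule Ext1_verma_trivial)
  fix c assume c: "cocycle m s c"
  have R: "low_relations CHAR('k) 0 s c" using c unfolding m cocycle_zero_iff by blast
  have "c 1 = 0 \<and> c 2 = 0"
  proof (cases "CHAR('k) = 5")
    case True
    have five: "(5 :: 'k) = 0" using of_nat_CHAR[where 'a = 'k] True by simp
    have out: "c 4 = 0" "c 5 = 0" using cocycle_out[OF c, of 4] cocycle_out[OF c, of 5] True by simp_all
    have r: "c 3 = (1 + 2 * s) * c 2 - 3 * s * c 1" "(2 + 2 * s) * c 3 - 4 * s * c 1 = 0"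
        "(2 + 3 * s) * c 3 - (1 + 4 * s) * c 2 = 0"
      using relations_to_five(1,2,4)[OF R] True out by simp_all
    \<comment> \<open>The equations for the pairs \<open>(1,3)\<close> and \<open>(2,3)\<close> after substituting \<open>c\<^sub>3\<close>.\<close>
    define X where "X = (2 + 2 * s) * ((1 + 2 * s) * c 2 - 3 * s * c 1) - 4 * s * c 1"
    define Y where "Y = (2 + 3 * s) * ((1 + 2 * s) * c 2 - 3 * s * c 1) - (1 + 4 * s) * c 2"
    have XY: "X = 0" "Y = 0" using r by (simp_all add: X_def Y_def)
    have "(2 * s * (1 + 9 * s)) * c 1 = (1 + 3 * s + 6 * s\<^sup>2) * X - (2 + 6 * s + 4 * s\<^sup>2) * Y"
      "(2 * s * (1 + 9 * s)) * c 2 = (6 * s + 9 * s\<^sup>2) * X - (10 * s + 6 * s\<^sup>2) * Y"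
      unfolding X_def Y_def by (simp_all add: algebra_simps power2_eq_square)
    then have zero: "(2 * s * (1 + 9 * s)) * c 1 = 0" "(2 * s * (1 + 9 * s)) * c 2 = 0"
      by (simp_all only: XY mult_zero_right diff_self)
    have "1 + 9 * s = 5 * (2 * s) - (s - 1)" by simp
    then have nine: "1 + 9 * s = - (s - 1)" by (simp only: five mult_zero_left diff_0)
    have "1 + 9 * s \<noteq> 0" unfolding nine using s by simp
    then have "2 * s * (1 + 9 * s) \<noteq> 0" using s small_neq_0(1) by (simp only: mult_eq_0_iff simp_thms)
    then show ?thesis using zero by simp
  next
    case False
    have p: "5 \<le> CHAR('k)" "CHAR('k) \<noteq> 6" using prime_p char5 by auto
    have not: "\<not> (0 = CHAR('k) - 1 \<and> s = 0)" using s by simp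
    have "defect5 0 s = 4 * (s * (s - 1))" by (simp add: defect5_def power2_eq_square algebra_simps)
    moreover have "4 * (s * (s - 1)) \<noteq> 0" using s small_neq_0(3) by (simp only: mult_eq_0_iff) simp
    ultimately have "wedge 0 s c = 0" using degree_five[OF R p(1)] by simp
    then obtain t where t: "c 1 = t * weight 0 s 1 0" "c 2 = t * weight 0 s 2 0"
      using wedge_zero_iff[OF weight_nz[OF _ not]] char5 by auto
    have "2 \<le> n \<Longrightarrow> n \<le> CHAR('k) - 1 \<Longrightarrow> c n = t * weight 0 s n 0" for n
    proof (induction n rule: nat_induct_at_least)
      case base
      show ?case by (rule t(2))
    next
      case (Suc n)
      then have IH: "c n = t * weight 0 s n 0" and n: "n \<le> CHAR('k) - 2" by simp_all
      have "(of_nat n - 1) * c (Suc n) = (of_nat n - 1) * (t * weight 0 s (Suc n) 0)"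
        using equal_relation[OF c m Suc.hyps(1) n] unfolding IH t(1) by (simp add: weight_def algebra_simps)
      moreover have "of_nat n - 1 \<noteq> (0 :: 'k)" using Suc.hyps Suc.prems by (intro pred_nz) auto
      ultimately show ?case by (simp only: mult_cancel_left simp_thms)
    qed
    from this[of "CHAR('k) - 1"] have "0 = t * weight 0 s (CHAR('k) - 1) 0"
      using cocycle_out[OF c, of "CHAR('k) - 1"] char5 by simp
    moreover have "weight 0 s (CHAR('k) - 1) 0 = - 1" unfolding weight_def of_nat_pred by simp
    ultimately have "t = 0" by simp
    then show ?thesis unfolding t by simp
  qed
  then show "\<exists>t. c 1 = t * inner_coef 1 \<and> c 2 = t * inner_coef 2" by (intro exI[of _ 0]) simp
qed

subsection \<open>Classification\<close>

lemma s_int: "s \<in> \<int>"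
  using lam by (simp add: s_def)

lemma char_not_six: "CHAR('k) \<noteq> 6"
  using prime_p by auto

text \<open>For \<open>p = 7\<close> the condition for \<open>m = 6\<close> becomes \<open>2 s\<^sup>2 + 1 = 0\<close>, that is, \<open>s\<^sup>2 = 3\<close>, and \<open>3\<close> is not a square
  modulo \<open>7\<close>.\<close>

lemma no_root_mod_seven:
  assumes p: "CHAR('k) = 7"
  shows "2 * s ^ 2 - 14 * s + 15 \<noteq> 0"
proof -
  obtain x where x: "s = of_int x" using s_int by (auto elim: Ints_cases)
  have sx: "2 * s ^ 2 - 14 * s + 15 = of_int (2 * x ^ 2 - 14 * x + 15)" by (simp add: x)
  have "\<not> 7 dvd 2 * x ^ 2 - 14 * x + 15"
  proof
    define d r where "d = x div 7" and "r = x mod 7"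
    have xdr: "x = 7 * d + r" by (simp add: d_def r_def)
    assume "7 dvd 2 * x ^ 2 - 14 * x + 15"
    then obtain q where "2 * x ^ 2 - 14 * x + 15 = 7 * q" ..
    then have "2 * r ^ 2 + 1 = 7 * (q - 14 * d ^ 2 - 4 * d * r + 2 * x - 2)"
      unfolding xdr by (simp add: power2_eq_square algebra_simps)
    then have "7 dvd 2 * r ^ 2 + 1" by (rule dvdI)
    moreover have "r = 0 \<or> r = 1 \<or> r = 2 \<or> r = 3 \<or> r = 4 \<or> r = 5 \<or> r = 6"
      unfolding r_def by presburger
    ultimately show False by (elim disjE) simp_all
  qed
  then show ?thesis unfolding sx of_int_eq_0 p by simp
qed

theorem classification:
  defines "P \<equiv> m = 0 \<and> (s = 0 \<or> s = 1) \<or> m = 1 \<and> (s = 0 \<or> s = 1 \<or> s = 2) \<or> m = 2 \<or> m = 3 \<or>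
    m = 4 \<and> (CHAR('k) \<noteq> 5 \<or> s = 1 \<or> s = - 1) \<or> m = 5 \<and> (s = 1 \<or> s = 5) \<or>
    m = 6 \<and> 2 * s ^ 2 - 14 * s + 15 = 0 \<or> m = CHAR('k) - 1 \<and> s = 0"
  shows "if P then ext_one else ext_zero"
proof -
  have "m = 0 \<or> m = 1 \<or> m = 2 \<or> m = 3 \<or> m = 4 \<or> m = 5 \<or> m = 6 \<or> 7 \<le> m" by linarith
  then show ?thesis
  proof (elim disjE)
    assume m: "m = 0"
    then have "P \<longleftrightarrow> s = 0 \<or> s = 1" using char5 by (auto simp: P_def)
    then show ?thesis
      using equal_zero[OF m] equal_one[OF m] equal_generic[OF m] by (cases "s = 0"; cases "s = 1") simp_all
  next
    assume m: "m = 1"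
    then have "P \<longleftrightarrow> s = 0 \<or> s = 1 \<or> s = 2" using char5 by (auto simp: P_def)
    then show ?thesis
      using difference_one_zero[OF m] difference_one_one[OF m] difference_one_two[OF m] difference_one_generic[OF m]
      by (cases "s = 0"; cases "s = 1"; cases "s = 2") simp_all
  next
    assume m: "m = 2"
    then have ext_one using char5 by (intro ext_one_low_sol) auto
    moreover have P using m by (simp add: P_def)
    ultimately show ?thesis by simp
  next
    assume m: "m = 3"
    then have ext_one using char5 by (intro ext_one_low_sol) auto
    moreover have P using m by (simp add: P_def)
    ultimately show ?thesis by simp
  next
    assume m: "m = 4"
    show ?thesis
    proof (cases "CHAR('k) = 5")
      case True
      then have "P \<longleftrightarrow> s = 0 \<or> s = 1 \<or> s = - 1" using m by (auto simp: P_def)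
      moreover have ext_one if "s = 0" using that True m by (intro ext_one_top) auto
      ultimately show ?thesis using five_cases[OF True m]
        by (cases "s = 0"; cases "s = 1"; cases "s = - 1") simp_all
    next
      case False
      then have ext_one using m char5 by (intro ext_one_low_sol) auto
      moreover have P using m False by (simp add: P_def)
      ultimately show ?thesis by simp
    qed
  next
    assume m: "m = 5"
    then have top: "m \<noteq> CHAR('k) - 1" using char_not_six by auto
    have "defect5 m s = 4 * ((s - 1) * (s - 5))"
      by (simp add: defect5_def m power2_eq_square algebra_simps)
    then have d: "defect5 m s = 0 \<longleftrightarrow> s = 1 \<or> s = 5" using small_neq_0(3) by simp
    then have "P \<longleftrightarrow> defect5 m s = 0" using m top by (simp add: P_def)
    moreover have ext_one if "defect5 m s = 0" using that m top by (intro ext_one_low_sol) auto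
    moreover have ext_zero if "defect5 m s \<noteq> 0" using that m top by (intro ext_zero_defect5) auto
    ultimately show ?thesis by simp
  next
    assume m: "m = 6"
    have "defect5 m s = 2 * (2 * s ^ 2 - 14 * s + 15)"
      by (simp add: defect5_def m power2_eq_square algebra_simps)
    then have d: "defect5 m s = 0 \<longleftrightarrow> 2 * s ^ 2 - 14 * s + 15 = 0" using small_neq_0(1) by (simp only: mult_eq_0_iff simp_thms)
    show ?thesis
    proof (cases "CHAR('k) = 7")
      case True
      then have "P \<longleftrightarrow> s = 0" using m no_root_mod_seven by (auto simp: P_def)
      moreover have ext_one if "s = 0" using that True m by (intro ext_one_top) auto
      moreover have ext_zero if "s \<noteq> 0" using that m d no_root_mod_seven[OF True] by (intro ext_zero_defect5) auto
      ultimately show ?thesis by simp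
    next
      case False
      then have top: "m \<noteq> CHAR('k) - 1" using m by auto
      then have "P \<longleftrightarrow> defect5 m s = 0" using m d by (simp add: P_def)
      moreover have ext_one if "defect5 m s = 0" using that m top by (intro ext_one_low_sol) auto
      moreover have ext_zero if "defect5 m s \<noteq> 0" using that m top by (intro ext_zero_defect5) auto
      ultimately show ?thesis by simp
    qed
  next
    assume m: "7 \<le> m"
    then have P: "P \<longleftrightarrow> m = CHAR('k) - 1 \<and> s = 0" by (auto simp: P_def)
    show ?thesis
    proof (cases "m = CHAR('k) - 1 \<and> s = 0")
      case True
      then have P by (simp only: P)
      moreover have ext_one using True by (intro ext_one_top) simp_all
      ultimately show ?thesis by (simp only: if_True)
    next
      case False
      then have "\<not> P" by (simp only: P not_False_eq_True)
      moreover have ext_zero by (rule ext_zero_large[OF m False])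
      ultimately show ?thesis by (simp only: if_False)
    qed
  qed
qed

lemma pair_iff: "(mu, lam) = (a, b) \<longleftrightarrow> of_nat m = b - a \<and> s = b + 1"
  using m by (auto simp: s_def)

lemma difference_numeral: "numeral i < CHAR('k) \<Longrightarrow> of_nat m = (numeral i :: 'k) \<longleftrightarrow> m = numeral i"
  using of_nat_eq_iff_less[OF m_less, of "numeral i"] by simp

lemma difference_small:
  "of_nat m = (0 :: 'k) \<longleftrightarrow> m = 0" "of_nat m = (1 :: 'k) \<longleftrightarrow> m = 1" "of_nat m = (- 1 :: 'k) \<longleftrightarrow> m = CHAR('k) - 1"
  using of_nat_eq_iff_less[OF m_less, of 0] of_nat_eq_iff_less[OF m_less, of 1]
    of_nat_eq_iff_less[OF m_less, of "CHAR('k) - 1"] char5 by (simp_all add: of_nat_pred)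

end

section \<open>Extensions between Verma modules\<close>

theorem theorem2p2:
  fixes pm :: "(int \<Rightarrow>\<^sub>0 'k::alg_closed_field) \<Rightarrow> (int \<Rightarrow>\<^sub>0 'k)"
    and lam mu :: 'k
  assumes p: "CHAR('k) \<ge> 5"
    and pm: "is_witt_p_map pm"
    and lam: "lam \<in> \<int>" and mu: "mu \<in> \<int>"
  shows "let E = Ext1 (u_alg (witt pm)) (verma pm mu) (verma pm lam) in
     (CHAR('k) = 5 \<longrightarrow>
       (if lam - mu = 2 \<or> lam - mu = 3 \<or>
           {mu, lam} = {0} \<or> {mu, lam} = {4} \<or> {mu, lam} = {0, 1} \<or>
           {mu, lam} = {0, 4} \<or> {mu, lam} = {3, 4}
        then linear_iso E base_field
        else carrier E = {\<zero>\<^bsub>E\<^esub>})) \<and>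
     (CHAR('k) \<ge> 7 \<longrightarrow>
       (if lam - mu = 2 \<or> lam - mu = 3 \<or> lam - mu = 4 \<or>
           (mu, lam) \<in> {(0, 0), (-1, -1), (-1, 0), (0, -1), (0, 1), (-2, -1), (-5, 0), (-1, 4)} \<or>
           (2 * lam^2 - 10 * lam + 3 = 0 \<and> lam - mu = 6)
        then linear_iso E base_field
        else carrier E = {\<zero>\<^bsub>E\<^esub>}))"
proof -
  have witt: "witt_setup pm" by (rule witt_setup.intro[OF p pm])
  obtain n where n: "lam - mu = of_int n" using lam mu by (meson Ints_cases Ints_diff)
  define m where "m = nat (n mod int CHAR('k))"
  have mless: "m < CHAR('k)" using p by (simp add: m_def nat_less_iff)
  have m: "of_nat m = lam - mu" using witt_setup.of_int_mod_p[OF witt, of n] by (simp add: n m_def)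
  interpret verma_pair pm mu lam m
    by (intro verma_pair.intro witt verma_pair_axioms.intro mu lam m mless)
  define P where "P \<longleftrightarrow> m = 0 \<and> (s = 0 \<or> s = 1) \<or> m = 1 \<and> (s = 0 \<or> s = 1 \<or> s = 2) \<or> m = 2 \<or> m = 3 \<or>
    m = 4 \<and> (CHAR('k) \<noteq> 5 \<or> s = 1 \<or> s = - 1) \<or> m = 5 \<and> (s = 1 \<or> s = 5) \<or>
    m = 6 \<and> 2 * s ^ 2 - 14 * s + 15 = 0 \<or> m = CHAR('k) - 1 \<and> s = 0"
  have main: "if P then ext_one else ext_zero" unfolding P_def by (rule classification)
  have P5: "P \<longleftrightarrow> lam - mu = 2 \<or> lam - mu = 3 \<or> {mu, lam} = {0} \<or> {mu, lam} = {4} \<or> {mu, lam} = {0, 1} \<or>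
      {mu, lam} = {0, 4} \<or> {mu, lam} = {3, 4}" if p: "CHAR('k) = 5"
  proof -
    have five: "(5 :: 'k) = 0" using of_nat_CHAR[where 'a = 'k] p by simp
    have sets: "{mu, lam} = {a, b} \<longleftrightarrow> (mu, lam) = (a, b) \<or> (mu, lam) = (b, a)" for a b
      by (auto simp: doubleton_eq_iff)
    have single: "{mu, lam} = {a} \<longleftrightarrow> (mu, lam) = (a, a)" for a by auto
    have four: "(4 :: 'k) = - 1" "(- 4 :: 'k) = 1"
    proof -
      have "(4 :: 'k) = 5 - 1" "(- 4 :: 'k) = 1 - 5" by simp_all
      then show "(4 :: 'k) = - 1" "(- 4 :: 'k) = 1" by (simp_all only: five diff_0 diff_0_right)
    qed
    have numbers: "lam - mu = 2 \<longleftrightarrow> m = 2" "lam - mu = 3 \<longleftrightarrow> m = 3"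
      unfolding m[symmetric] using p by (intro difference_numeral; simp)+
    have pairs: "(mu, lam) = (0, 0) \<longleftrightarrow> m = 0 \<and> s = 1" "(mu, lam) = (4, 4) \<longleftrightarrow> m = 0 \<and> s = 0"
      "(mu, lam) = (0, 1) \<longleftrightarrow> m = 1 \<and> s = 2" "(mu, lam) = (1, 0) \<longleftrightarrow> m = 4 \<and> s = 1"
      "(mu, lam) = (0, 4) \<longleftrightarrow> m = 4 \<and> s = 0" "(mu, lam) = (4, 0) \<longleftrightarrow> m = 1 \<and> s = 1"
      "(mu, lam) = (3, 4) \<longleftrightarrow> m = 1 \<and> s = 0" "(mu, lam) = (4, 3) \<longleftrightarrow> m = 4 \<and> s = - 1"
      unfolding pair_iff using difference_small p by (simp_all add: four five)
    have "m = 0 \<or> m = 1 \<or> m = 2 \<or> m = 3 \<or> m = 4" using m_less p by linarith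
    then show ?thesis
      unfolding P_def numbers single sets pairs
      using p by (elim disjE) auto
  qed
  have P7: "P \<longleftrightarrow> lam - mu = 2 \<or> lam - mu = 3 \<or> lam - mu = 4 \<or>
      (mu, lam) \<in> {(0, 0), (-1, -1), (-1, 0), (0, -1), (0, 1), (-2, -1), (-5, 0), (-1, 4)} \<or>
      (2 * lam^2 - 10 * lam + 3 = 0 \<and> lam - mu = 6)" if p: "7 \<le> CHAR('k)"
  proof -
    have quad: "2 * lam^2 - 10 * lam + 3 = 2 * s ^ 2 - 14 * s + 15"
      by (simp add: s_def power2_eq_square algebra_simps)
    have n4: "numeral i < CHAR('k)" if "numeral i \<le> (6 :: nat)" for i using p that by linarith
    have numbers: "lam - mu = 2 \<longleftrightarrow> m = 2" "lam - mu = 3 \<longleftrightarrow> m = 3" "lam - mu = 4 \<longleftrightarrow> m = 4" "lam - mu = 6 \<longleftrightarrow> m = 6"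
      unfolding m[symmetric] using p by (intro difference_numeral n4; simp)+
    have five: "of_nat m = (5 :: 'k) \<longleftrightarrow> m = 5" by (intro difference_numeral n4) simp
    have pairs: "(mu, lam) = (0, 0) \<longleftrightarrow> m = 0 \<and> s = 1" "(mu, lam) = (- 1, - 1) \<longleftrightarrow> m = 0 \<and> s = 0"
      "(mu, lam) = (- 1, 0) \<longleftrightarrow> m = 1 \<and> s = 1" "(mu, lam) = (0, - 1) \<longleftrightarrow> m = CHAR('k) - 1 \<and> s = 0"
      "(mu, lam) = (0, 1) \<longleftrightarrow> m = 1 \<and> s = 2" "(mu, lam) = (- 2, - 1) \<longleftrightarrow> m = 1 \<and> s = 0"
      "(mu, lam) = (- 5, 0) \<longleftrightarrow> m = 5 \<and> s = 1" "(mu, lam) = (- 1, 4) \<longleftrightarrow> m = 5 \<and> s = 5"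
      unfolding pair_iff using difference_small five by simp_all
    have "CHAR('k) \<noteq> 5" using p by simp
    then show ?thesis
      unfolding P_def numbers insert_iff empty_iff pairs quad by blast
  qed
  show ?thesis
    unfolding Let_def
  proof (intro conjI impI)
    assume p: "CHAR('k) = 5"
    show "if lam - mu = 2 \<or> lam - mu = 3 \<or> {mu, lam} = {0} \<or> {mu, lam} = {4} \<or> {mu, lam} = {0, 1} \<or>
        {mu, lam} = {0, 4} \<or> {mu, lam} = {3, 4} then ext_one else ext_zero"
      using main unfolding P5[OF p] .
  next
    assume p: "7 \<le> CHAR('k)"
    show "if lam - mu = 2 \<or> lam - mu = 3 \<or> lam - mu = 4 \<or>
        (mu, lam) \<in> {(0, 0), (-1, -1), (-1, 0), (0, -1), (0, 1), (-2, -1), (-5, 0), (-1, 4)} \<or>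
        (2 * lam^2 - 10 * lam + 3 = 0 \<and> lam - mu = 6) then ext_one else ext_zero"
      using main unfolding P7[OF p] .
  qed
qed

end
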